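(* Let $m\geq 3$, $s=0,\ldots,m$ and $k\in\mathbb{N}_0$. Denote by $N^{s,m}_k$ the set of pairs $(t,j)\in\{0,\ldots,m-1\}\times\{0,\ldots,k\}$ such that $t\in\{s-1,s\}$ and, if $t\in\{0,m-1\}$, then $j=0$. Then, under the $H$-action of $Pin(m-1)$, we have the following multiplicity free irreducible decomposition $$\mathcal{H}^s_k(\mathbb{R}^m)=\bigoplus_{(t,j)\in N^{s,m}_k} X^{s,t,m}_{k,j}\,\mathcal{H}^t_j(\mathbb{R}^{m-1}).$$ Here the embedding factors $X^{s,t,m}_{k,j}$ are defined as $$X^{s,t,m}_{k,j}(x)=X^{(k-j)}_{m,j}(x)\,e_m^{s-t}+\alpha\,X^{(k-1-j)}_{m,j+1}(x)\,\bigl(\beta^{t-s}(\underline{x}\,\wedge)+\beta^{t-s+1}(\underline{x}\,\bullet)\bigr)\,e_m^{s-t+1},$$ where $x=(\underline{x},x_m)\in\mathbb{R}^m$, $X^{(-1)}_{m,k+1}=0$, $\beta=-(j+m-1-t)/(j+t)$, and $\alpha=-(j+1)/(m+2j-1)$ unless $t\in\{0,m-1\}$, while $\alpha=0$ if $t\in\{0,m-1\}$ (in which case the second summand is understood to be $0$). In particular, this decomposition is orthogonal with respect to any invariant inner product, including the $L^2$-inner product $(f,g)=\int_{\mathbb{B}_m}[\bar f g]_0\,d\lambda^m$.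
   Context: Clifford algebra. $e_1,\ldots,e_m$ is an orthonormal basis of $\mathbb{R}^m$; $\mathcal{C}\ell_m$ denotes either the real Clifford algebra $\mathbb{R}_{0,m}$ with $e_ie_j+e_je_i=-2\delta_{ij}$ or the corresponding complex Clifford algebra $\mathbb{C}_m$ (the same choice throughout). $\mathcal{C}\ell_m^s$ is the space of $s$-vectors, i.e. the span of the products $e_{i_1}\cdots e_{i_s}$ with $i_1<\cdots<i_s$. $\mathcal{C}\ell_{m-1}\subset\mathcal{C}\ell_m$ is generated by $e_1,\ldots,e_{m-1}$. $\bar a$ is the Clifford conjugate of $a$ (the anti-automorphism with $\bar e_i=-e_i$, antilinear in the complex case), and $[a]_0$ is the scalar part. $\mathbb{B}_m$ is the unit ball of $\mathbb{R}^m$ and $\lambda^m$ is Lebesgue measure. A vector $(x_1,\ldots,x_m)$ is identified with $x_1e_1+\cdots+x_me_m$, and $\underline{x}=x_1e_1+\cdots+x_{m-1}e_{m-1}$. For a 1-vector $u$ and an $s$-vector $v$: $u\bullet v=\frac12(uv-(-1)^svu)$ (an $(s-1)$-vector) and $u\wedge v=\frac12(uv+(-1)^svu)$ (an $(s+1)$-vector), extended linearly to all $v\in\mathcal{C}\ell_m$; $(u\,\wedge)$ and $(u\,\bullet)$ are the operators $v\mapsto u\wedge v$, $v\mapsto u\bullet v$. All other products are left Clifford multiplications, and operators are composed from right to left; $X^{s,t,m}_{k,j}$ is applied in this sense to elements of $\mathcal{H}^t_j(\mathbb{R}^{m-1})$. For $n\ge 2$, $\mathcal{H}^t_j(\mathbb{R}^n)$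 is the space of $j$-homogeneous polynomials $P:\mathbb{R}^n\to\mathcal{C}\ell_n^t$ with $\partial P=0$, where $\partial=e_1\partial_{x_1}+\cdots+e_n\partial_{x_n}$. $H$-action. $Pin(m)$ is the set of finite products of unit vectors of $\mathbb{R}^m$ inside $\mathcal{C}\ell_m$ with Clifford multiplication, a double cover of $O(m)$. The $H$-action is $[H(r)(f)](x)=r\,f(r^{-1}x\,r)\,r^{-1}$ for $r\in Pin(m)$, $x\in\mathbb{R}^m$. $Pin(m-1)$ is realized as the subgroup of $Pin(m)$ describing orthogonal transformations of $\mathbb{R}^m$ fixing the last basis vector $e_m$. Embedding factors for monogenics. For integers $j\ge0$, $n\ge 0$ put $$F^{(n)}_{m,j}(x)=\frac{(j+1)_{n}}{(m-2+2j)_{n}}\,|x|^{n}\,C^{m/2+j-1}_{n}(x_m/|x|),\qquad F^{(-1)}_{m,j}=0,$$ where $(\nu)_n=\nu(\nu+1)\cdots(\nu+n-1)$ and $C^\nu_n(z)=\sum_{i=0}^{[n/2]}\frac{(-1)^i(\nu)_{n-i}}{i!(n-2i)!}(2z)^{n-2i}$ is the Gegenbauer polynomial. For $n\geq 0$ put $$X^{(n)}_{m,j}(x)=F^{(n)}_{m,j}(x)+\frac{j+1}{m+2j-1}F^{(n-1)}_{m,j+1}(x)\,\underline{x}\,e_m .$$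
   Formalization: For s = 0 or s = m with k ≥ 1 the printed equation fails: the space of s-vector valued monogenics of degree k is {0}, while the set of pairs (t,j) has one element with nonzero image; in these cases the empty index set is used instead. *)

theory Defs
  imports "HOL-Analysis.Analysis" "HOL-Library.Function_Algebras"
begin

section \<open>Scalars\<close>

text \<open>
  The scalars are the real or the complex numbers; a statement about a type variable of
  this class makes the same choice throughout. The lemma \<open>real_or_complex_cases\<close> shows that the
  axioms leave no other possibility.
\<close>

class real_or_complex = real_normed_field + banach + second_countable_topology +
  fixes sconj :: "'a \<Rightarrow> 'a"
  assumes sconj_add: "sconj (x + y) = sconj x + sconj y"
    and sconj_mult: "sconj (x * y) = sconj x * sconj y"
    and sconj_sconj [simp]: "sconj (sconj x) = x"
    and mult_sconj_scaleR: "x * sconj x = (norm x)\<^sup>2 *\<^sub>R 1"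

instantiation real :: real_or_complex
begin
definition "sconj_real = (\<lambda>x::real. x)"
instance by standard (auto simp: sconj_real_def power2_eq_square)
end

instantiation complex :: real_or_complex
begin
definition "sconj_complex = cnj"
instance by standard (simp_all add: sconj_complex_def complex_norm_square[symmetric] scaleR_conv_of_real)
end

lemma mult_sconj: "x * sconj x = of_real ((norm (x :: 'a::real_or_complex))\<^sup>2)"
  by (simp add: mult_sconj_scaleR of_real_def)

lemma sconj_of_real [simp]: "sconj (of_real r :: 'a::real_or_complex) = of_real r"
proof (cases "r = 0")
  case False
  have "of_real r * sconj (of_real r) = of_real r * (of_real r :: 'a)"
    by (simp add: mult_sconj power2_eq_square)
  with False show ?thesis by simp
next
  case True
  have "sconj (0::'a) = sconj 0 + sconj 0"
    using sconj_add[of "0::'a" 0] by simp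
  then show ?thesis by (simp add: True)
qed

lemma sconj_0 [simp]: "sconj (0 :: 'a::real_or_complex) = 0"
  and sconj_1 [simp]: "sconj (1 :: 'a::real_or_complex) = 1"
  using sconj_of_real[of 0] sconj_of_real[of 1] by simp_all

lemma sconj_minus: "sconj (- x) = - sconj (x :: 'a::real_or_complex)"
  using sconj_add[of x "- x"] by (simp add: eq_neg_iff_add_eq_0 add.commute)

lemma add_sconj_real: "(x :: 'a::real_or_complex) + sconj x \<in> \<real>"
proof -
  have "of_real ((norm (1 + x))\<^sup>2) = (1 + x) * sconj (1 + x)"
    by (simp add: mult_sconj)
  also have "\<dots> = 1 + (x + sconj x) + of_real ((norm x)\<^sup>2)"
    unfolding mult_sconj[symmetric] by (simp add: sconj_add algebra_simps)
  finally have "x + sconj x = of_real ((norm (1 + x))\<^sup>2 - 1 - (norm x)\<^sup>2)"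
    by (simp add: algebra_simps)
  then show ?thesis by (metis Reals_of_real)
qed

lemma real_or_complex_cases:
  "(\<forall>x::'a::real_or_complex. x \<in> \<real>) \<or>
   (\<exists>u::'a. u * u = - 1 \<and> sconj u = - u \<and> (\<forall>x. \<exists>!p. x = of_real (fst p) + of_real (snd p) * u))"
proof (cases "\<forall>x::'a. x \<in> \<real>")
  case False
  have split: "\<exists>a y. x = of_real a + y \<and> sconj y = - y" for x :: 'a
  proof -
    obtain c where c: "x + sconj x = of_real c"
      using add_sconj_real[of x] by (auto elim: Reals_cases)
    have "sconj (x - of_real (c/2)) = sconj x - of_real (c/2)"
      using sconj_add[of x "- of_real (c/2)"] by (simp add: sconj_minus del: of_real_divide)
    also have "\<dots> = - (x - of_real (c/2))"
      using c by (simp add: algebra_simps)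
    finally show ?thesis
      by (intro exI[of _ "c/2"] exI[of _ "x - of_real (c/2)"]) auto
  qed
  from False obtain x :: 'a where x: "x \<notin> \<real>" by blast
  obtain a y where y: "x = of_real a + y" "sconj y = - y"
    using split by blast
  with x have y0: "y \<noteq> 0" by auto
  define e where "e = y * of_real (inverse (norm y))"
  have sq: "y * y = - of_real ((norm y)\<^sup>2)"
    using mult_sconj[of y] y(2) by (metis minus_minus mult_minus_right)
  have e: "e * e = - 1"
  proof -
    have "e * e = (y * y) * of_real ((inverse (norm y))\<^sup>2)"
      unfolding e_def by (simp add: power2_eq_square)
    also have "\<dots> = - of_real ((norm y)\<^sup>2 * (inverse (norm y))\<^sup>2)"
      unfolding sq by simp
    finally show ?thesis using y0 by (simp add: power_mult_distrib[symmetric])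
  qed
  have e': "sconj e = - e"
    unfolding e_def by (simp add: sconj_mult y(2) del: of_real_inverse)
  have real_if: "z \<in> \<real>" if "sconj z = z" for z :: 'a
  proof -
    obtain d where "z + sconj z = of_real d"
      using add_sconj_real[of z] by (auto elim: Reals_cases)
    then have "z = of_real (d/2)" using that by (simp add: mult.commute)
    then show ?thesis by (metis Reals_of_real)
  qed
  have "\<exists>!p. z = of_real (fst p) + of_real (snd p) * e" for z
  proof -
    obtain c w where w: "z = of_real c + w" "sconj w = - w"
      using split by blast
    have "w * e \<in> \<real>" using w(2) e' by (intro real_if) (simp add: sconj_mult)
    then obtain b where "w * e = of_real b" by (auto elim: Reals_cases)
    then have "w * (e * e) = of_real b * e" by (metis mult.assoc)
    then have we: "w = of_real (- b) * e" using e by (metis minus_minus mult_minus1_right mult_minus_left of_real_minus)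
    have uniq: "c1 = c2 \<and> b1 = b2"
      if "of_real c1 + of_real b1 * e = (of_real c2 + of_real b2 * e :: 'a)" for c1 c2 b1 b2
    proof -
      from that have *: "of_real (c1 - c2) = (of_real (b2 - b1) * e :: 'a)"
        by (simp add: algebra_simps)
      then have "of_real (c1 - c2) = - (of_real (c1 - c2) :: 'a)"
        using sconj_of_real[of "c1 - c2", where 'a='a] e' by (metis sconj_mult sconj_of_real mult_minus_right)
      then have "c1 - c2 = 0"
        by (metis of_real_minus of_real_eq_iff equal_neg_zero)
      moreover have "e \<noteq> 0" using e by auto
      ultimately show ?thesis using * by auto
    qed
    have ex: "z = of_real c + of_real (- b) * e" using w(1) we by simp
    have uniq': "p = (c, - b)" if "z = of_real (fst p) + of_real (snd p) * e" for p
      using uniq[of "fst p" "snd p" c "- b"] that ex by (simp add: prod_eq_iff)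
    show ?thesis
      by (rule ex1I[of _ "(c, - b)"]) (use ex uniq' in auto)
  qed
  with e e' show ?thesis by blast
qed auto

section \<open>The Clifford algebra\<close>

text \<open>
  One type holds the Clifford algebra on generators \<open>e\<^sub>0, e\<^sub>1, e\<^sub>2, \<dots>\<close> with
  \<open>e\<^sub>i e\<^sub>j + e\<^sub>j e\<^sub>i = - 2 \<delta>\<^sub>i\<^sub>j\<close>: an element is given by its coefficients with respect to the basis
  \<open>e\<^sub>A = e\<^bsub>i1\<^esub> \<cdots> e\<^bsub>is\<^esub>\<close> for finite \<open>A = {i1 < \<dots> < is}\<close>. The Clifford algebra of \<open>\<real>\<^sup>m\<close> is the
  part spanned by the \<open>e\<^sub>A\<close> with \<open>A \<subseteq> {1..m}\<close>, so that the algebra of \<open>\<real>\<^sup>m\<^sup>-\<^sup>1\<close> is contained in that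
  of \<open>\<real>\<^sup>m\<close>.
\<close>

typedef (overloaded) 'a clifford =
  "{f :: nat set \<Rightarrow> 'a::zero. finite {A. f A \<noteq> 0} \<and> (\<forall>A. f A \<noteq> 0 \<longrightarrow> finite A)}"
  morphisms coeff Abs_clifford
  by (rule exI[of _ "\<lambda>_. 0"]) simp

setup_lifting type_definition_clifford

lemma support_pointwise:
  assumes "finite {A. f A \<noteq> 0} \<and> (\<forall>A. f A \<noteq> 0 \<longrightarrow> finite A)" "\<And>A. f A = 0 \<Longrightarrow> g A = 0"
  shows "finite {A. g A \<noteq> 0} \<and> (\<forall>A. g A \<noteq> 0 \<longrightarrow> finite A)"
proof -
  have "{A. g A \<noteq> 0} \<subseteq> {A. f A \<noteq> 0}" using assms(2) by auto
  then show ?thesis using assms(1) finite_subset by blast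
qed

lemma finite_support [simp]: "finite {A. coeff a A \<noteq> 0}"
  and coeff_infinite: "infinite A \<Longrightarrow> coeff a A = 0"
  using coeff[of a] by auto

lemma clifford_eqI: "(\<And>A. coeff a A = coeff b A) \<Longrightarrow> a = b"
  using coeff_inject by blast

text \<open>
  \<open>e\<^sub>A e\<^sub>B = bsign A B e\<^sub>A\<^sub>\<triangle>\<^sub>B\<close>: moving the factors of \<open>e\<^sub>B\<close> into place changes the sign once for every
  pair \<open>b < a\<close>, and every index common to \<open>A\<close> and \<open>B\<close> contributes \<open>e\<^sub>a e\<^sub>a = - 1\<close>.
\<close>

definition bsign :: "nat set \<Rightarrow> nat set \<Rightarrow> 'a::comm_ring_1"
  where "bsign A B = (\<Prod>a\<in>A. \<Prod>b\<in>B. if b \<le> a then - 1 else 1)"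

lemma prod_sym_diff:
  fixes f :: "'b \<Rightarrow> 'a::comm_ring_1"
  assumes "finite A" "finite B" "\<And>x. f x * f x = 1"
  shows "prod f (sym_diff A B) = prod f A * prod f B"
proof -
  have A: "prod f A = prod f (A - B) * prod f (A \<inter> B)"
    using assms(1) by (metis Diff_disjoint Int_Diff_Un Un_commute finite_Diff finite_Int prod.union_disjoint
        Int_Diff_disjoint inf_commute)
  have B: "prod f B = prod f (B - A) * prod f (A \<inter> B)"
    using assms(2) by (metis Int_Diff_Un Un_commute finite_Diff finite_Int prod.union_disjoint
        Int_Diff_disjoint inf_commute)
  have "prod f (A \<inter> B) * prod f (A \<inter> B) = 1"
    by (simp add: prod.distrib[symmetric] assms(3))
  moreover have "prod f (sym_diff A B) = prod f (A - B) * prod f (B - A)"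
    by (rule prod.union_disjoint) (use assms in auto)
  ultimately show ?thesis
    unfolding A B by (metis (no_types, lifting) mult.assoc mult.commute mult.right_neutral)
qed

lemma bsign_sq_aux: "(\<Prod>b\<in>B. if b \<le> a then - 1 else 1) * (\<Prod>b\<in>B. if b \<le> a then - 1 else 1) = (1::'a::comm_ring_1)"
  by (simp add: prod.distrib[symmetric] if_distrib if_distribR cong: if_cong)

lemma bsign_sym_diff_left:
  "finite A \<Longrightarrow> finite B \<Longrightarrow> bsign (sym_diff A B) C = bsign A C * bsign B C"
  unfolding bsign_def by (rule prod_sym_diff) (auto simp: bsign_sq_aux)

lemma bsign_sym_diff_right:
  assumes "finite B" "finite C"
  shows "bsign A (sym_diff B C) = bsign A B * bsign A C"
  unfolding bsign_def
  by (subst prod_sym_diff) (use assms in \<open>auto simp: prod.distrib\<close>)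

lemma bsign_empty [simp]: "bsign {} A = 1" "bsign A {} = 1"
  by (simp_all add: bsign_def)

lemma bsign_assoc:
  assumes "finite A" "finite B" "finite C"
  shows "bsign A B * bsign (sym_diff A B) C = bsign A (sym_diff B C) * bsign B C"
  using assms by (simp add: bsign_sym_diff_left bsign_sym_diff_right mult.assoc)

lemma sym_diff_cancel [simp]:
  "sym_diff A (sym_diff A B) = B" "sym_diff (sym_diff A B) A = B" "sym_diff B (sym_diff A B) = A"
  by blast+

instantiation clifford :: (ab_group_add) ab_group_add
begin
lift_definition zero_clifford :: "'a clifford" is "\<lambda>_. 0" by simp
lift_definition plus_clifford :: "'a clifford \<Rightarrow> 'a clifford \<Rightarrow> 'a clifford"
  is "\<lambda>f g A. f A + g A"
proof -
  fix f g :: "nat set \<Rightarrow> 'a"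
  assume f: "finite {A. f A \<noteq> 0} \<and> (\<forall>A. f A \<noteq> 0 \<longrightarrow> finite A)"
    and g: "finite {A. g A \<noteq> 0} \<and> (\<forall>A. g A \<noteq> 0 \<longrightarrow> finite A)"
  have "{A. f A + g A \<noteq> 0} \<subseteq> {A. f A \<noteq> 0} \<union> {A. g A \<noteq> 0}" by auto
  then show "finite {A. f A + g A \<noteq> 0} \<and> (\<forall>A. f A + g A \<noteq> 0 \<longrightarrow> finite A)"
    using f g finite_subset by blast
qed
lift_definition uminus_clifford :: "'a clifford \<Rightarrow> 'a clifford" is "\<lambda>f A. - f A"
  by auto
definition minus_clifford :: "'a clifford \<Rightarrow> 'a clifford \<Rightarrow> 'a clifford"
  where "minus_clifford a b = a + - b"
instance
proof
  fix a b c :: "'a clifford"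
  note r = plus_clifford.rep_eq uminus_clifford.rep_eq zero_clifford.rep_eq
  show "a + b + c = a + (b + c)" by (rule clifford_eqI) (simp add: r add.assoc)
  show "a + b = b + a" by (rule clifford_eqI) (simp add: r add.commute)
  show "0 + a = a" by (rule clifford_eqI) (simp add: r)
  show "- a + a = 0" by (rule clifford_eqI) (simp add: r)
  show "a - b = a + - b" by (rule minus_clifford_def)
qed
end

lemma coeff_0 [simp]: "coeff 0 A = 0"
  and coeff_add [simp]: "coeff (a + b) A = coeff a A + coeff b A"
  and coeff_minus [simp]: "coeff (- a) A = - coeff a A"
  by (simp_all add: zero_clifford.rep_eq plus_clifford.rep_eq uminus_clifford.rep_eq)

lemma coeff_diff [simp]: "coeff (a - b) A = coeff a A - coeff b A"
  by (simp only: diff_conv_add_uminus coeff_add coeff_minus)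

lemma coeff_sum [simp]: "coeff (sum f S) A = (\<Sum>x\<in>S. coeff (f x) A)"
  by (induction S rule: infinite_finite_induct) auto

text \<open>The basis element \<open>e\<^sub>A\<close>, zero for infinite \<open>A\<close>.\<close>

lift_definition blade :: "nat set \<Rightarrow> 'a::comm_ring_1 clifford"
  is "\<lambda>A B. if B = A \<and> finite A then 1 else 0"
  by auto

lemma coeff_blade: "finite A \<Longrightarrow> coeff (blade A) B = (if B = A then 1 else 0)"
  by (simp add: blade.rep_eq)

instantiation clifford :: (comm_ring_1) ring_1
begin

definition one_clifford :: "'a clifford" where "one_clifford = blade {}"

lift_definition times_clifford :: "'a clifford \<Rightarrow> 'a clifford \<Rightarrow> 'a clifford"
  is "\<lambda>f g C. \<Sum>A | f A \<noteq> 0. bsign A (sym_diff A C) * f A * g (sym_diff A C)"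
proof (intro conjI allI impI)
  fix f g :: "nat set \<Rightarrow> 'a"
  assume f: "finite {A. f A \<noteq> 0} \<and> (\<forall>A. f A \<noteq> 0 \<longrightarrow> finite A)"
    and g: "finite {A. g A \<noteq> 0} \<and> (\<forall>A. g A \<noteq> 0 \<longrightarrow> finite A)"
  let ?h = "\<lambda>C. \<Sum>A | f A \<noteq> 0. bsign A (sym_diff A C) * f A * g (sym_diff A C)"
  let ?S = "(\<lambda>(A, B). sym_diff A B) ` ({A. f A \<noteq> 0} \<times> {A. g A \<noteq> 0})"
  have *: "C \<in> ?S" if nz: "?h C \<noteq> 0" for C
  proof -
    from nz obtain A where "A \<in> {A. f A \<noteq> 0}"
        "bsign A (sym_diff A C) * f A * g (sym_diff A C) \<noteq> 0"
      by (rule sum.not_neutral_contains_not_neutral)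
    then have "f A \<noteq> 0" "g (sym_diff A C) \<noteq> 0" by auto
    then have "C = (\<lambda>(A, B). sym_diff A B) (A, sym_diff A C)"
        "(A, sym_diff A C) \<in> {A. f A \<noteq> 0} \<times> {A. g A \<noteq> 0}" by simp_all
    then show ?thesis by (rule image_eqI)
  qed
  show "finite {C. ?h C \<noteq> 0}"
    by (rule finite_subset[of _ ?S]) (use * f g in \<open>auto intro!: finite_imageI\<close>)
  show "finite C" if "?h C \<noteq> 0" for C
    using *[OF that] f g by auto
qed

lemma coeff_mult:
  fixes a b :: "'a clifford"
  assumes "finite S" "{A. coeff a A \<noteq> 0} \<subseteq> S"
  shows "coeff (a * b) C = (\<Sum>A\<in>S. bsign A (sym_diff A C) * coeff a A * coeff b (sym_diff A C))"
  unfolding times_clifford.rep_eq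
  by (rule sum.mono_neutral_left) (use assms in auto)

instance
proof
  fix a b c :: "'a clifford"
  let ?A = "{A. coeff a A \<noteq> 0}" and ?B = "{A. coeff b A \<noteq> 0}"
  show "(a * b) * c = a * (b * c)"
  proof (rule clifford_eqI)
    fix D
    let ?T = "(\<lambda>(A, B). sym_diff A B) ` (?A \<times> ?B)"
    have sub: "{E. coeff (a * b) E \<noteq> 0} \<subseteq> ?T"
    proof
      fix E assume "E \<in> {E. coeff (a * b) E \<noteq> 0}"
      then have nz: "(\<Sum>A\<in>?A. bsign A (sym_diff A E) * coeff a A * coeff b (sym_diff A E)) \<noteq> 0"
        by (simp add: times_clifford.rep_eq)
      from nz obtain A where "A \<in> ?A"
          "bsign A (sym_diff A E) * coeff a A * coeff b (sym_diff A E) \<noteq> 0"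
        by (rule sum.not_neutral_contains_not_neutral)
      then have "coeff a A \<noteq> 0" "coeff b (sym_diff A E) \<noteq> 0" by auto
      then have "E = (\<lambda>(A, B). sym_diff A B) (A, sym_diff A E)"
        "(A, sym_diff A E) \<in> ?A \<times> ?B" by simp_all
      then show "E \<in> ?T" by (rule image_eqI)
    qed
    have "coeff (a * b * c) D =
        (\<Sum>E\<in>?T. bsign E (sym_diff E D) * coeff (a * b) E * coeff c (sym_diff E D))"
      by (rule coeff_mult) (use sub in auto)
    also have "\<dots> = (\<Sum>E\<in>?T. \<Sum>A\<in>?A. bsign E (sym_diff E D) *
        (bsign A (sym_diff A E) * coeff a A * coeff b (sym_diff A E)) * coeff c (sym_diff E D))"
      unfolding times_clifford.rep_eq by (simp add: sum_distrib_left sum_distrib_right)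
    also have "\<dots> = (\<Sum>A\<in>?A. \<Sum>E\<in>?T. bsign E (sym_diff E D) *
        (bsign A (sym_diff A E) * coeff a A * coeff b (sym_diff A E)) * coeff c (sym_diff E D))"
      by (rule sum.swap)
    also have "\<dots> = (\<Sum>A\<in>?A. \<Sum>B\<in>?B. bsign (sym_diff A B) (sym_diff (sym_diff A B) D) *
        (bsign A B * coeff a A * coeff b B) * coeff c (sym_diff (sym_diff A B) D))"
    proof (rule sum.cong[OF refl])
      fix A assume A: "A \<in> ?A"
      let ?g = "\<lambda>E. bsign E (sym_diff E D) *
        (bsign A (sym_diff A E) * coeff a A * coeff b (sym_diff A E)) * coeff c (sym_diff E D)"
      have inj: "inj_on (sym_diff A) ?B"
        by (rule inj_on_inverseI[where g = "sym_diff A"]) simp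
      have "sum ?g ?T = sum ?g (sym_diff A ` ?B)"
      proof (rule sum.mono_neutral_right)
        show "finite ?T" by simp
        show "sym_diff A ` ?B \<subseteq> ?T" using A by force
        show "\<forall>E\<in>?T - sym_diff A ` ?B. ?g E = 0"
        proof
          fix E assume E: "E \<in> ?T - sym_diff A ` ?B"
          have "E = sym_diff A (sym_diff A E)" by simp
          with E have "sym_diff A E \<notin> ?B" by blast
          then show "?g E = 0" by simp
        qed
      qed
      also have "\<dots> = (\<Sum>B\<in>?B. ?g (sym_diff A B))"
        using sum.reindex[OF inj, of ?g] by (simp only: o_def)
      finally show "sum ?g ?T = (\<Sum>B\<in>?B. bsign (sym_diff A B) (sym_diff (sym_diff A B) D) *
        (bsign A B * coeff a A * coeff b B) * coeff c (sym_diff (sym_diff A B) D))"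
        by simp
    qed
    also have "\<dots> = (\<Sum>A\<in>?A. \<Sum>B\<in>?B. bsign A (sym_diff A D) * coeff a A *
        (bsign B (sym_diff B (sym_diff A D)) * coeff b B * coeff c (sym_diff B (sym_diff A D))))"
    proof (intro sum.cong refl)
      fix A B assume "A \<in> ?A" "B \<in> ?B"
      then have fin: "finite A" "finite B" by (auto intro: ccontr simp: coeff_infinite)
      define C where "C = sym_diff B (sym_diff A D)"
      have eqs: "sym_diff (sym_diff A B) D = C" "sym_diff A D = sym_diff B C"
        by (auto simp: C_def)
      show "bsign (sym_diff A B) (sym_diff (sym_diff A B) D) *
          (bsign A B * coeff a A * coeff b B) * coeff c (sym_diff (sym_diff A B) D) =
          bsign A (sym_diff A D) * coeff a A *
          (bsign B (sym_diff B (sym_diff A D)) * coeff b B * coeff c (sym_diff B (sym_diff A D)))"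
      proof (cases "finite C")
        case True
        have "bsign (sym_diff A B) C * (bsign A B * coeff a A * coeff b B) * coeff c C
          = (bsign A B * bsign (sym_diff A B) C) * (coeff a A * coeff b B * coeff c C)"
          by (simp only: mult_ac)
        also have "\<dots> = bsign A (sym_diff B C) * coeff a A * (bsign B C * coeff b B * coeff c C)"
          unfolding bsign_assoc[OF fin True] by (simp only: mult_ac)
        finally show ?thesis unfolding eqs sym_diff_cancel .
      next
        case False
        then show ?thesis unfolding eqs sym_diff_cancel by (simp add: coeff_infinite)
      qed
    qed
    also have "\<dots> = coeff (a * (b * c)) D"
      unfolding times_clifford.rep_eq by (simp add: sum_distrib_left)
    finally show "coeff (a * b * c) D = coeff (a * (b * c)) D" .
  qed
  show "(a + b) * c = a * c + b * c"
  proof (rule clifford_eqI)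
    fix D
    have "finite (?A \<union> ?B)" by simp
    note m = coeff_mult[OF this]
    show "coeff ((a + b) * c) D = coeff (a * c + b * c) D"
      by (subst m, force) (simp add: m sum.distrib[symmetric] algebra_simps)
  qed
  show "a * (b + c) = a * b + a * c"
    by (rule clifford_eqI) (simp add: times_clifford.rep_eq sum.distrib[symmetric] algebra_simps)
  show "1 * a = a"
  proof (rule clifford_eqI)
    fix D
    show "coeff (1 * a) D = coeff a D"
      by (subst coeff_mult[of "{{}}"]) (auto simp: one_clifford_def coeff_blade)
  qed
  show "a * 1 = a"
  proof (rule clifford_eqI)
    fix D
    have "coeff (a * 1) D = (\<Sum>A\<in>insert D ?A. bsign A (sym_diff A D) * coeff a A * coeff 1 (sym_diff A D))"
      by (rule coeff_mult) auto
    also have "\<dots> = (\<Sum>A\<in>insert D ?A. if A = D then coeff a D else 0)"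
    proof (rule sum.cong[OF refl])
      fix A
      have "sym_diff A D = {} \<longleftrightarrow> A = D" by blast
      then show "bsign A (sym_diff A D) * coeff a A * coeff 1 (sym_diff A D) = (if A = D then coeff a D else 0)"
        by (auto simp: one_clifford_def coeff_blade)
    qed
    also have "\<dots> = coeff a D" by simp
    finally show "coeff (a * 1) D = coeff a D" .
  qed
  have "coeff (0::'a clifford) {} \<noteq> coeff 1 {}" by (simp add: one_clifford_def coeff_blade)
  then show "(0::'a clifford) \<noteq> 1" by metis
qed

end

abbreviation gen :: "nat \<Rightarrow> 'a::comm_ring_1 clifford"
  where "gen i \<equiv> blade {i}"

text \<open>A vector space over the scalars: coefficientwise multiplication.\<close>

lift_definition cscale :: "'a::comm_ring_1 \<Rightarrow> 'a clifford \<Rightarrow> 'a clifford" (infixr \<open>*\<^sub>C\<close> 75)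
  is "\<lambda>c f A. c * f A"
  by (erule support_pointwise) simp

lemma coeff_cscale [simp]: "coeff (c *\<^sub>C a) A = c * coeff a A"
  by (simp add: cscale.rep_eq)

interpretation cliff: vector_space "cscale :: 'a::field \<Rightarrow> 'a clifford \<Rightarrow> 'a clifford"
  by standard (auto intro!: clifford_eqI simp: algebra_simps)

lemma cscale_mult_left: "(c *\<^sub>C a) * b = c *\<^sub>C (a * b)"
proof (rule clifford_eqI)
  fix A
  have m: "coeff (d * b) A = (\<Sum>B | coeff a B \<noteq> 0. bsign B (sym_diff B A) * coeff d B * coeff b (sym_diff B A))"
    if "{B. coeff d B \<noteq> 0} \<subseteq> {B. coeff a B \<noteq> 0}" for d
    using that by (intro coeff_mult) auto
  show "coeff ((c *\<^sub>C a) * b) A = coeff (c *\<^sub>C (a * b)) A"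
    by (subst m, force) (simp add: m sum_distrib_left mult_ac)
qed

lemma cscale_mult_right: "a * (c *\<^sub>C b) = c *\<^sub>C (a * b)"
  by (rule clifford_eqI) (simp add: times_clifford.rep_eq sum_distrib_left mult_ac)

lemma blade_mult:
  assumes "finite A" "finite B"
  shows "blade A * blade B = bsign A B *\<^sub>C blade (sym_diff A B)"
proof (rule clifford_eqI)
  fix C
  have "sym_diff A C = B \<longleftrightarrow> C = sym_diff A B" by (metis sym_diff_cancel(1))
  then show "coeff (blade A * blade B) C = coeff (bsign A B *\<^sub>C blade (sym_diff A B)) C"
    by (subst coeff_mult[of "{A}"]) (use assms in \<open>auto simp: coeff_blade\<close>)
qed

lemma gen_anticommute:
  "gen i * gen j + gen j * gen i = (if i = j then - 2 else 0 :: 'a::comm_ring_1 clifford)"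
proof (cases "i = j")
  case True
  have "gen i * gen i = (- 1 :: 'a clifford)"
    by (intro clifford_eqI) (simp add: blade_mult bsign_def one_clifford_def coeff_blade)
  with True show ?thesis by simp
next
  case False
  have "sym_diff {i} {j} = sym_diff {j} {i}" by (rule Un_commute)
  with False show ?thesis
    by (intro clifford_eqI) (auto simp: blade_mult bsign_def)
qed

lemma blade_eq_prod_list:
  assumes "sorted_wrt (<) is"
  shows "prod_list (map gen is) = (blade (set is) :: 'a::comm_ring_1 clifford)"
  using assms
proof (induction "is")
  case Nil
  then show ?case by (simp add: one_clifford_def)
next
  case (Cons i js)
  then have "sym_diff {i} (set js) = insert i (set js)" by auto
  moreover have "bsign {i} (set js) = (1 :: 'a)"
    unfolding bsign_def using Cons.prems by (auto intro!: prod.neutral)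
  ultimately show ?case
    using Cons by (simp add: blade_mult) (auto intro!: clifford_eqI)
qed

text \<open>The Euclidean norm of the coefficients, used for the derivatives of functions with values in
  the Clifford algebra.\<close>

lemma norm_clifford_aux:
  fixes a :: "'a::real_normed_vector clifford"
  assumes "finite S" "{A. coeff a A \<noteq> 0} \<subseteq> S"
  shows "L2_set (\<lambda>A. norm (coeff a A)) {A. coeff a A \<noteq> 0} = L2_set (\<lambda>A. norm (coeff a A)) S"
  unfolding L2_set_def
  by (intro arg_cong[where f = sqrt] sum.mono_neutral_left) (use assms in auto)

instantiation clifford :: (real_normed_field) real_vector
begin
definition scaleR_clifford :: "real \<Rightarrow> 'a clifford \<Rightarrow> 'a clifford"
  where "scaleR_clifford r a = of_real r *\<^sub>C a"
instance
  by standard (auto simp: scaleR_clifford_def algebra_simps intro!: clifford_eqI)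
end

instantiation clifford :: (real_normed_field) real_normed_vector
begin

definition norm_clifford :: "'a clifford \<Rightarrow> real"
  where "norm_clifford a = L2_set (\<lambda>A. norm (coeff a A)) {A. coeff a A \<noteq> 0}"
definition sgn_clifford :: "'a clifford \<Rightarrow> 'a clifford"
  where "sgn_clifford a = a /\<^sub>R norm a"
definition dist_clifford :: "'a clifford \<Rightarrow> 'a clifford \<Rightarrow> real"
  where "dist_clifford a b = norm (a - b)"
definition uniformity_clifford :: "('a clifford \<times> 'a clifford) filter"
  where "uniformity_clifford = (INF e\<in>{0 <..}. principal {(x, y). dist x y < e})"
definition open_clifford :: "'a clifford set \<Rightarrow> bool"
  where "open_clifford U \<longleftrightarrow> (\<forall>x\<in>U. eventually (\<lambda>(x', y). x' = x \<longrightarrow> y \<in> U) uniformity)"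

instance
proof
  fix a b :: "'a clifford" and r :: real
  show "(norm a = 0) = (a = 0)"
    by (auto simp: norm_clifford_def L2_set_eq_0_iff intro!: clifford_eqI)
  let ?S = "{A. coeff a A \<noteq> 0} \<union> {A. coeff b A \<noteq> 0}"
  have S: "finite ?S" by simp
  have "norm (a + b) = L2_set (\<lambda>A. norm (coeff (a + b) A)) ?S"
    unfolding norm_clifford_def by (rule norm_clifford_aux) auto
  also have "\<dots> \<le> L2_set (\<lambda>A. norm (coeff a A) + norm (coeff b A)) ?S"
    by (rule L2_set_mono) (auto intro: norm_triangle_ineq)
  also have "\<dots> \<le> L2_set (\<lambda>A. norm (coeff a A)) ?S + L2_set (\<lambda>A. norm (coeff b A)) ?S"
    by (rule L2_set_triangle_ineq)
  also have "\<dots> = norm a + norm b"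
    unfolding norm_clifford_def
    using norm_clifford_aux[OF S, of a] norm_clifford_aux[OF S, of b] by auto
  finally show "norm (a + b) \<le> norm a + norm b" .
  have "norm (r *\<^sub>R a) = L2_set (\<lambda>A. norm (coeff (r *\<^sub>R a) A)) {A. coeff a A \<noteq> 0}"
    unfolding norm_clifford_def
    by (rule norm_clifford_aux) (auto simp: scaleR_clifford_def)
  also have "\<dots> = \<bar>r\<bar> * norm a"
    by (simp add: norm_clifford_def scaleR_clifford_def norm_mult L2_set_right_distrib)
  finally show "norm (r *\<^sub>R a) = \<bar>r\<bar> * norm a" .
qed (rule sgn_clifford_def dist_clifford_def uniformity_clifford_def open_clifford_def)+

end

lemma coeff_scaleR [simp]: "coeff (r *\<^sub>R a) A = r *\<^sub>R coeff a A"
  by (simp add: scaleR_clifford_def scaleR_conv_of_real)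

instance clifford :: (real_normed_field) real_algebra_1
  by standard (simp_all add: scaleR_clifford_def cscale_mult_left cscale_mult_right)

text \<open>The \<open>s\<close>-vectors of the Clifford algebra of \<open>\<real>\<^sup>m\<close>.\<close>

definition multivectors :: "nat \<Rightarrow> nat \<Rightarrow> 'a::field clifford set"
  where "multivectors m s =
    cliff.span {prod_list (map gen is) | is. sorted_wrt (<) is \<and> set is \<subseteq> {1..m} \<and> length is = s}"

lemma multivectors_iff:
  "a \<in> multivectors m s \<longleftrightarrow> (\<forall>A. coeff a A \<noteq> 0 \<longrightarrow> A \<subseteq> {1..m} \<and> card A = s)"
  for a :: "'a::field clifford"
proof -
  let ?P = "{prod_list (map gen is) | is. sorted_wrt (<) is \<and> set is \<subseteq> {1..m} \<and> length is = s}
    :: 'a clifford set"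
  let ?Q = "{a :: 'a clifford. \<forall>A. coeff a A \<noteq> 0 \<longrightarrow> A \<subseteq> {1..m} \<and> card A = s}"
  have sub: "cliff.span ?P \<subseteq> ?Q"
  proof (rule cliff.span_minimal)
    show "?P \<subseteq> ?Q"
      by (auto simp: blade_eq_prod_list coeff_blade strict_sorted_iff distinct_card split: if_splits)
    show "cliff.subspace ?Q"
    proof (rule cliff.subspaceI)
      fix x y :: "'a clifford" assume "x \<in> ?Q" "y \<in> ?Q"
      then show "x + y \<in> ?Q" by simp (metis add.right_neutral)
    qed simp_all
  qed
  have "a \<in> cliff.span ?P" if a: "a \<in> ?Q" for a
  proof -
    have expand: "a = (\<Sum>A | coeff a A \<noteq> 0. coeff a A *\<^sub>C blade A)"
    proof (rule clifford_eqI)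
      fix B
      have "coeff (\<Sum>A | coeff a A \<noteq> 0. coeff a A *\<^sub>C blade A) B =
          (\<Sum>A | coeff a A \<noteq> 0. if A = B then coeff a B else 0)"
        unfolding coeff_sum
      proof (rule sum.cong[OF refl])
        fix A assume "A \<in> {A. coeff a A \<noteq> 0}"
        then have "finite A" by (auto intro: ccontr simp: coeff_infinite)
        then show "coeff (coeff a A *\<^sub>C blade A) B = (if A = B then coeff a B else 0)"
          by (simp add: coeff_blade)
      qed
      then show "coeff a B = coeff (\<Sum>A | coeff a A \<noteq> 0. coeff a A *\<^sub>C blade A) B" by simp
    qed
    have "coeff a A *\<^sub>C blade A \<in> cliff.span ?P" if "A \<in> {A. coeff a A \<noteq> 0}" for A
    proof -
      have A: "A \<subseteq> {1..m}" "card A = s" using a that by auto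
      then have fin: "finite A" using finite_subset by blast
      have eq: "blade A = (prod_list (map gen (sorted_list_of_set A)) :: 'a clifford)"
        using fin by (simp add: blade_eq_prod_list)
      have "prod_list (map gen (sorted_list_of_set A)) \<in> ?P"
        using A fin by (intro CollectI exI[of _ "sorted_list_of_set A"]) simp
      then show ?thesis
        unfolding eq by (intro cliff.span_scale cliff.span_base)
    qed
    then have "(\<Sum>A | coeff a A \<noteq> 0. coeff a A *\<^sub>C blade A) \<in> cliff.span ?P"
      by (rule cliff.span_sum)
    then show ?thesis by (simp only: expand[symmetric])
  qed
  then have "?Q \<subseteq> cliff.span ?P" by (rule subsetI)
  with sub have "cliff.span ?P = ?Q" by (rule subset_antisym)
  then show ?thesis unfolding multivectors_def by simp
qed

text \<open>The main involution, i.e. the linear extension of \<open>v \<mapsto> (- 1)\<^sup>s v\<close> from \<open>s\<close>-vectors to all \<open>v\<close>;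
  it extends the two products of a 1-vector and an \<open>s\<close>-vector below linearly in the second argument.\<close>

lift_definition involute :: "'a::comm_ring_1 clifford \<Rightarrow> 'a clifford"
  is "\<lambda>f A. (- 1) ^ card A * f A"
  by (erule support_pointwise) simp

text \<open>The Clifford conjugation: the conjugate of \<open>e\<^bsub>i1\<^esub> \<cdots> e\<^bsub>is\<^esub>\<close> is
  \<open>(- 1)\<^sup>s e\<^bsub>is\<^esub> \<cdots> e\<^bsub>i1\<^esub>\<close>, and reversing the product gives a further \<open>(- 1)\<close> to the power
  \<open>s (s - 1) / 2\<close>.\<close>

lift_definition cconj :: "'a::real_or_complex clifford \<Rightarrow> 'a clifford"
  is "\<lambda>f A. (- 1) ^ (card A * (card A + 1) div 2) * sconj (f A)"
  by (erule support_pointwise) simp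

definition scalar_part :: "'a::zero clifford \<Rightarrow> 'a"
  where "scalar_part a = coeff a {}"

definition cinverse :: "'a::comm_ring_1 clifford \<Rightarrow> 'a clifford"
  where "cinverse r = (THE q. r * q = 1 \<and> q * r = 1)"

definition wedge :: "'a::real_normed_field clifford \<Rightarrow> 'a clifford \<Rightarrow> 'a clifford"
  where "wedge u v = (1/2) *\<^sub>R (u * v + involute v * u)"

definition bullet :: "'a::real_normed_field clifford \<Rightarrow> 'a clifford \<Rightarrow> 'a clifford"
  where "bullet u v = (1/2) *\<^sub>R (u * v - involute v * u)"

section \<open>Homogeneous monogenic polynomials\<close>

text \<open>
  A point of \<open>\<real>\<^sup>m\<close> is given by the values \<open>x 1, \<dots>, x m\<close> of some \<open>x :: nat \<Rightarrow> real\<close>. All functions on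
  \<open>\<real>\<^sup>m\<close> below depend on these coordinates only, so equality of functions on \<open>\<real>\<^sup>m\<close> is equality in HOL,
  and composing with the projection \<open>\<real>\<^sup>m \<rightarrow> \<real>\<^sup>m\<^sup>-\<^sup>1\<close> that forgets \<open>x m\<close> leaves a function unchanged.
\<close>

definition cvec :: "nat \<Rightarrow> (nat \<Rightarrow> real) \<Rightarrow> 'a::real_normed_field clifford"
  where "cvec m x = (\<Sum>i=1..m. x i *\<^sub>R gen i)"

definition coords :: "nat \<Rightarrow> 'a::real_normed_field clifford \<Rightarrow> nat \<Rightarrow> real"
  where "coords m = the_inv_into {x. \<forall>i. i \<notin> {1..m} \<longrightarrow> x i = 0} (cvec m)"

definition partial :: "nat \<Rightarrow> ((nat \<Rightarrow> real) \<Rightarrow> 'b::real_normed_vector) \<Rightarrow> (nat \<Rightarrow> real) \<Rightarrow> 'b"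
  where "partial i f x = vector_derivative (\<lambda>t. f (x(i := t))) (at (x i))"

definition dirac ::
    "nat \<Rightarrow> ((nat \<Rightarrow> real) \<Rightarrow> 'a::real_normed_field clifford) \<Rightarrow> (nat \<Rightarrow> real) \<Rightarrow> 'a clifford"
  where "dirac n f x = (\<Sum>i=1..n. gen i * partial i f x)"

definition multi_indices :: "nat \<Rightarrow> nat \<Rightarrow> (nat \<Rightarrow> nat) set"
  where "multi_indices n j = {a. (\<forall>i. i \<notin> {1..n} \<longrightarrow> a i = 0) \<and> (\<Sum>i=1..n. a i) = j}"

definition homogeneous_polys ::
    "nat \<Rightarrow> nat \<Rightarrow> 'b::real_vector set \<Rightarrow> ((nat \<Rightarrow> real) \<Rightarrow> 'b) set"
  where "homogeneous_polys n j V =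
    {\<lambda>x. \<Sum>a\<in>multi_indices n j. (\<Prod>i=1..n. x i ^ a i) *\<^sub>R c a | c. \<forall>a. c a \<in> V}"

text \<open>\<open>monogenics n t j\<close> is \<open>\<H>\<^sup>t\<^sub>j(\<real>\<^sup>n)\<close>.\<close>

definition monogenics ::
    "nat \<Rightarrow> nat \<Rightarrow> nat \<Rightarrow> ((nat \<Rightarrow> real) \<Rightarrow> 'a::real_normed_field clifford) set"
  where "monogenics n t j =
    {P \<in> homogeneous_polys n j (multivectors n t). \<forall>x. dirac n P x = 0}"

definition fscale :: "'a::comm_ring_1 \<Rightarrow> ('b \<Rightarrow> 'a clifford) \<Rightarrow> 'b \<Rightarrow> 'a clifford"
  where "fscale c f = (\<lambda>x. c *\<^sub>C f x)"

interpretation fun_space: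
  vector_space "fscale :: 'a::field \<Rightarrow> ('b \<Rightarrow> 'a clifford) \<Rightarrow> 'b \<Rightarrow> 'a clifford"
  by standard (auto simp: fscale_def fun_eq_iff cliff.scale_right_distrib cliff.scale_left_distrib)

section \<open>The action of the Pin group\<close>

definition Pin :: "nat \<Rightarrow> 'a::real_normed_field clifford set"
  where "Pin m = {prod_list us | us. set us \<subseteq> cvec m ` {x. (\<Sum>i=1..m. (x i)\<^sup>2) = 1}}"

text \<open>
  In the double cover of \<open>O(m)\<close> the element \<open>r\<close> describes the transformation
  \<open>x \<mapsto> involute r * x * cinverse r\<close>; for a unit vector \<open>r\<close> this is the reflection in the hyperplane
  orthogonal to \<open>r\<close>. Without the involution one obtains its negative, and for odd \<open>m\<close> the image
  would be \<open>SO(m)\<close> only. \<open>Pin_fix m\<close> is \<open>Pin(m - 1)\<close>, the stabilizer of \<open>e\<^sub>m\<close>; it contains the unit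
  vectors of \<open>\<real>\<^sup>m\<^sup>-\<^sup>1\<close>. The action on functions is the one without the involution.
\<close>

definition Pin_fix :: "nat \<Rightarrow> 'a::real_normed_field clifford set"
  where "Pin_fix m = {r \<in> Pin m. involute r * gen m * cinverse r = gen m}"

definition H_action :: "nat \<Rightarrow> 'a::real_normed_field clifford \<Rightarrow>
    ((nat \<Rightarrow> real) \<Rightarrow> 'a clifford) \<Rightarrow> (nat \<Rightarrow> real) \<Rightarrow> 'a clifford"
  where "H_action m r f = (\<lambda>x. r * f (coords m (cinverse r * cvec m x * r)) * cinverse r)"

section \<open>Representations\<close>

definition invariant_subspace ::
    "('a::field \<Rightarrow> 'v::ab_group_add \<Rightarrow> 'v) \<Rightarrow> 'g set \<Rightarrow> ('g \<Rightarrow> 'v \<Rightarrow> 'v) \<Rightarrow> 'v set \<Rightarrow> bool"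
  where "invariant_subspace scl G \<rho> U \<longleftrightarrow>
    module.subspace scl U \<and> (\<forall>r\<in>G. \<forall>u\<in>U. \<rho> r u \<in> U)"

definition irreducible_rep ::
    "('a::field \<Rightarrow> 'v::ab_group_add \<Rightarrow> 'v) \<Rightarrow> 'g set \<Rightarrow> ('g \<Rightarrow> 'v \<Rightarrow> 'v) \<Rightarrow> 'v set \<Rightarrow> bool"
  where "irreducible_rep scl G \<rho> W \<longleftrightarrow>
    invariant_subspace scl G \<rho> W \<and> W \<noteq> {0} \<and>
    (\<forall>U\<subseteq>W. invariant_subspace scl G \<rho> U \<longrightarrow> U = {0} \<or> U = W)"

definition equivalent_reps :: "('a::field \<Rightarrow> 'v::ab_group_add \<Rightarrow> 'v) \<Rightarrow> 'g set \<Rightarrow>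
    ('g \<Rightarrow> 'v \<Rightarrow> 'v) \<Rightarrow> 'v set \<Rightarrow> 'v set \<Rightarrow> bool"
  where "equivalent_reps scl G \<rho> U W \<longleftrightarrow> (\<exists>\<phi>. bij_betw \<phi> U W \<and>
    (\<forall>u\<in>U. \<forall>v\<in>U. \<phi> (u + v) = \<phi> u + \<phi> v) \<and>
    (\<forall>c. \<forall>u\<in>U. \<phi> (scl c u) = scl c (\<phi> u)) \<and>
    (\<forall>r\<in>G. \<forall>u\<in>U. \<phi> (\<rho> r u) = \<rho> r (\<phi> u)))"

definition internal_direct_sum :: "'v::comm_monoid_add set \<Rightarrow> 'i set \<Rightarrow> ('i \<Rightarrow> 'v set) \<Rightarrow> bool"
  where "internal_direct_sum V I W \<longleftrightarrow> bij_betw (\<lambda>w. \<Sum>i\<in>I. w i) (Pi\<^sub>E I W) V"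

definition multiplicity_free_decomposition ::
    "('a::field \<Rightarrow> 'v::ab_group_add \<Rightarrow> 'v) \<Rightarrow> 'g set \<Rightarrow> ('g \<Rightarrow> 'v \<Rightarrow> 'v) \<Rightarrow>
     'v set \<Rightarrow> 'i set \<Rightarrow> ('i \<Rightarrow> 'v set) \<Rightarrow> bool"
  where "multiplicity_free_decomposition scl G \<rho> V I W \<longleftrightarrow>
    internal_direct_sum V I W \<and>
    (\<forall>i\<in>I. irreducible_rep scl G \<rho> (W i)) \<and>
    (\<forall>i\<in>I. \<forall>j\<in>I. i \<noteq> j \<longrightarrow> \<not> equivalent_reps scl G \<rho> (W i) (W j))"

definition inner_product_on :: "('a::real_or_complex \<Rightarrow> 'v::ab_group_add \<Rightarrow> 'v) \<Rightarrow> 'v set \<Rightarrow>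
    ('v \<Rightarrow> 'v \<Rightarrow> 'a) \<Rightarrow> bool"
  where "inner_product_on scl V ip \<longleftrightarrow>
    (\<forall>f\<in>V. \<forall>g\<in>V. \<forall>h\<in>V. ip f (g + h) = ip f g + ip f h) \<and>
    (\<forall>f\<in>V. \<forall>g\<in>V. \<forall>c. ip f (scl c g) = c * ip f g) \<and>
    (\<forall>f\<in>V. \<forall>g\<in>V. ip g f = sconj (ip f g)) \<and>
    (\<forall>f\<in>V. f \<noteq> 0 \<longrightarrow> (\<exists>p>0. ip f f = of_real p))"

definition invariant_inner_product :: "('a::real_or_complex \<Rightarrow> 'v::ab_group_add \<Rightarrow> 'v) \<Rightarrow> 'g set \<Rightarrow>
    ('g \<Rightarrow> 'v \<Rightarrow> 'v) \<Rightarrow> 'v set \<Rightarrow> ('v \<Rightarrow> 'v \<Rightarrow> 'a) \<Rightarrow> bool"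
  where "invariant_inner_product scl G \<rho> V ip \<longleftrightarrow>
    inner_product_on scl V ip \<and> (\<forall>r\<in>G. \<forall>f\<in>V. \<forall>g\<in>V. ip (\<rho> r f) (\<rho> r g) = ip f g)"

definition orthogonal_family :: "('v \<Rightarrow> 'v \<Rightarrow> 'a::zero) \<Rightarrow> 'i set \<Rightarrow> ('i \<Rightarrow> 'v set) \<Rightarrow> bool"
  where "orthogonal_family ip I W \<longleftrightarrow>
    (\<forall>i\<in>I. \<forall>j\<in>I. i \<noteq> j \<longrightarrow> (\<forall>f\<in>W i. \<forall>g\<in>W j. ip f g = 0))"

definition L2_inner :: "nat \<Rightarrow> ((nat \<Rightarrow> real) \<Rightarrow> 'a::real_or_complex clifford) \<Rightarrow>
    ((nat \<Rightarrow> real) \<Rightarrow> 'a clifford) \<Rightarrow> 'a"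
  where "L2_inner m f g =
    set_lebesgue_integral (\<Pi>\<^sub>M i\<in>{1..m}. lborel) {x \<in> {1..m} \<rightarrow>\<^sub>E UNIV. (\<Sum>i=1..m. (x i)\<^sup>2) < 1}
      (\<lambda>x. scalar_part (cconj (f x) * g x))"

section \<open>Embedding factors\<close>

definition gegenbauer :: "real \<Rightarrow> nat \<Rightarrow> real \<Rightarrow> real"
  where "gegenbauer \<nu> n z =
    (\<Sum>i=0..n div 2. (- 1) ^ i * pochhammer \<nu> (n - i) / (fact i * fact (n - 2 * i)) * (2 * z) ^ (n - 2 * i))"

text \<open>
  The upper index is an integer because \<open>n = - 1\<close> occurs. At the origin \<open>x m / 0 = 0\<close>; the value of the
  product is that of the polynomial extension, since \<open>0 ^ n = 0\<close> for \<open>n > 0\<close> and the Gegenbauer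
  polynomial of degree \<open>0\<close> is \<open>1\<close>.
\<close>

definition F_factor :: "nat \<Rightarrow> nat \<Rightarrow> int \<Rightarrow> (nat \<Rightarrow> real) \<Rightarrow> real"
  where "F_factor m j n x = (if n < 0 then 0 else
    pochhammer (real j + 1) (nat n) / pochhammer (real m - 2 + 2 * real j) (nat n) *
    L2_set x {1..m} ^ nat n *
    gegenbauer (real m / 2 + real j - 1) (nat n) (x m / L2_set x {1..m}))"

definition X_factor :: "nat \<Rightarrow> nat \<Rightarrow> int \<Rightarrow> (nat \<Rightarrow> real) \<Rightarrow> 'a::real_normed_field clifford"
  where "X_factor m j n x = (if n < 0 then 0 else
    F_factor m j n x *\<^sub>R 1 +
    ((real j + 1) / (real m + 2 * real j - 1) * F_factor m (j + 1) (n - 1) x) *\<^sub>R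
      (cvec (m - 1) x * gen m))"

text \<open>For \<open>t = 0\<close> or \<open>t = m - 1\<close> the number \<open>\<beta>\<close> or \<open>\<beta>\<^sup>-\<^sup>1\<close> is meaningless, but \<open>\<alpha> = 0\<close> there.\<close>

definition embedding :: "nat \<Rightarrow> nat \<Rightarrow> nat \<Rightarrow> nat \<Rightarrow> nat \<Rightarrow>
    ((nat \<Rightarrow> real) \<Rightarrow> 'a::real_normed_field clifford) \<Rightarrow> (nat \<Rightarrow> real) \<Rightarrow> 'a clifford"
  where "embedding m s t k j P = (\<lambda>x.
    let u = cvec (m - 1) x;
        \<beta> = - (real j + real m - 1 - real t) / (real j + real t);
        \<alpha> = (if t = 0 \<or> t = m - 1 then 0 else - (real j + 1) / (real m + 2 * real j - 1));
        v = gen m ^ (s + 1 - t) * P x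
    in X_factor m j (int k - int j) x * (gen m ^ (s - t) * P x) +
       \<alpha> *\<^sub>R (X_factor m (j + 1) (int k - 1 - int j) x *
         (\<beta> powi (int t - int s) *\<^sub>R wedge u v + \<beta> powi (int t - int s + 1) *\<^sub>R bullet u v)))"

text \<open>
  For \<open>s \<in> {0, m}\<close> and \<open>k > 0\<close> every homogeneous monogenic \<open>s\<close>-vector-valued polynomial of degree \<open>k\<close>
  vanishes, although \<open>(0, 0)\<close> or \<open>(m - 1, 0)\<close> is an index pair: the image of the embedding is then not
  \<open>s\<close>-vector-valued. In these cases the decomposition has to be indexed by the empty set.
\<close>

definition index_pairs :: "nat \<Rightarrow> nat \<Rightarrow> nat \<Rightarrow> (nat \<times> nat) set"
  where "index_pairs m s k = {(t, j). t \<in> {0..m - 1} \<and> j \<in> {0..k} \<and> (t + 1 = s \<or> t = s) \<and>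
    (t \<in> {0, m - 1} \<longrightarrow> j = 0)}"

end

theory Submission
  imports Defs
begin

text \<open>
  Put \<open>n = m - 1\<close>. The embedding factors form an Appell system: \<open>\<partial>\<^sub>m\<close> maps the image of \<open>\<H>\<^sup>t\<^sub>j(\<real>\<^sup>n)\<close> in
  degree \<open>k\<close> to its image in degree \<open>k - 1\<close>, up to a nonzero factor if \<open>j < k\<close>. Hence the decomposition follows
  by induction on \<open>k\<close>: the components of \<open>\<partial>\<^sub>m f\<close> are integrated, and what remains does not depend on \<open>x\<^sub>m\<close>,
  so it is \<open>P + e\<^sub>m Q\<close> with monogenic \<open>P\<close> and \<open>Q\<close> on \<open>\<real>\<^sup>n\<close>.

  Irreducibility, inequivalence and orthogonality all follow from Schur's lemma for linear maps \<open>T\<close>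
  between the spaces \<open>\<H>\<^sup>t\<^sub>j(\<real>\<^sup>n)\<close> that commute with reflections. It is proved by induction on \<open>n\<close>, using
  the decomposition: the map \<open>f \<mapsto> (T f)(e\<^sub>n)\<close> commutes with the stabilizer of \<open>e\<^sub>n\<close>, so by induction it only
  sees the components of \<open>f\<close> over constants, that is, the value \<open>f(e\<^sub>n)\<close>. If source and target have the
  same \<open>t\<close>, this gives \<open>x \<and> T f(x) = c x \<and> f(x)\<close> on the unit sphere, and apart from the case \<open>t = n\<close>, where
  \<open>\<bullet>\<close> is used, a monogenic \<open>g\<close> with \<open>x \<and> g(x) = 0\<close> vanishes.
\<close>

section \<open>Calculations in the Clifford algebra\<close>

text \<open>Schur's lemma is obtained in a form that also holds over the reals: the scalar is read
  off from values at one point, so no eigenvalue has to exist. Its induction descends to dimension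
  one, hence the decomposition is needed for all \<open>n \<ge> 1\<close>. For \<open>m = 2\<close>,
  \<open>j = 0\<close> the quotient in \<open>F_factor\<close> is meaningless; therefore the
  embeddings are rebuilt from a power series (\<open>ck_factor\<close>) and compared with the
  Gegenbauer form for \<open>m \<ge> 3\<close>.

  That \<open>x \<and> f\<close> determines \<open>f\<close> comes from the Dirac operator, which
  sends \<open>x \<and> f\<close> to a multiple of \<open>f\<close>. If the degrees \<open>j\<close>
  differ, harmonicity decides: \<open>f\<close> is closed and coclosed, so \<open>x \<and> f\<close>
  is harmonic, and homogeneous harmonic polynomials of different degrees agree on the sphere only if
  they vanish.

  Passing from Schur's lemma to irreducibility takes one invariant inner product. The
  \<open>L2\<close> product serves, so the product measure has to be invariant under reflections.
  Reflections suffice for Schur's lemma, but the components must be stable under all of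
  \<open>Pin_fix\<close>, whose elements are given as products of unit vectors of
  \<open>R^m\<close>.\<close>

lemma coeff_gen_mult:
  "coeff (gen i * a) C = bsign {i} (sym_diff {i} C) * coeff a (sym_diff {i} C)"
  by (subst coeff_mult[of "{{i}}"]) (auto simp: coeff_blade)

lemma coeff_mult_gen:
  "coeff (a * gen i) C = bsign (sym_diff {i} C) {i} * coeff a (sym_diff {i} C)"
proof -
  let ?D = "sym_diff {i} C"
  have "coeff (a * gen i) C = (\<Sum>A\<in>insert ?D {A. coeff a A \<noteq> 0}.
      bsign A (sym_diff A C) * coeff a A * coeff (gen i) (sym_diff A C))"
    by (rule coeff_mult) auto
  also have "\<dots> = (\<Sum>A\<in>insert ?D {A. coeff a A \<noteq> 0}. if A = ?D then bsign ?D {i} * coeff a ?D else 0)"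
  proof (rule sum.cong[OF refl])
    fix A
    have *: "sym_diff A C = {i} \<longleftrightarrow> A = ?D" by blast
    show "bsign A (sym_diff A C) * coeff a A * coeff (gen i) (sym_diff A C) =
        (if A = ?D then bsign ?D {i} * coeff a ?D else 0)"
    proof (cases "A = ?D")
      case True
      then have "sym_diff A C = {i}" by blast
      then show ?thesis using True by (simp add: coeff_blade)
    next
      case False
      then have "sym_diff A C \<noteq> {i}" using * by blast
      then show ?thesis using False by (simp add: coeff_blade)
    qed
  qed
  also have "\<dots> = bsign ?D {i} * coeff a ?D" by simp
  finally show ?thesis .
qed

text \<open>For \<open>d \<noteq> i\<close> exactly one of the orders \<open>e_d e_i\<close> and
  \<open>e_i e_d\<close> costs a sign, whence \<open>(- 1) ^ card D\<close>. For
  \<open>d = i\<close> both do, which the middle factor corrects.\<close>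

lemma bsign_singleton_swap:
  assumes "finite D"
  shows "bsign D {i} = (- 1) ^ card D * (if i \<in> D then - 1 else 1) * (bsign {i} D :: 'a::comm_ring_1)"
proof -
  have "bsign D {i} = (\<Prod>d\<in>D. (- 1) * (if d = i then - 1 else 1) * (if d \<le> i then - 1 else 1) :: 'a)"
    unfolding bsign_def by (intro prod.cong) auto
  also have "\<dots> = (- 1) ^ card D * (if i \<in> D then - 1 else 1) * bsign {i} D"
    unfolding prod.distrib using assms by (simp add: bsign_def prod.delta)
  finally show ?thesis .
qed

section \<open>The main involution as an algebra automorphism\<close>

lemma coeff_involute [simp]: "coeff (involute a) A = (- 1) ^ card A * coeff a A"
  by (simp add: involute.rep_eq)

lemma involute_add: "involute (a + b) = involute a + involute b"
  and involute_diff: "involute (a - b) = involute a - involute b"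
  and involute_minus: "involute (- a) = - involute a"
  and involute_zero [simp]: "involute 0 = 0"
  and involute_cscale: "involute (c *\<^sub>C a) = c *\<^sub>C involute a"
  and involute_involute [simp]: "involute (involute a) = a"
  by (rule clifford_eqI; simp add: algebra_simps flip: power_add mult.assoc)+

lemma involute_scaleR:
  fixes a :: "'a::real_normed_field clifford"
  shows "involute (r *\<^sub>R a) = r *\<^sub>R involute a"
  by (rule clifford_eqI) (simp add: algebra_simps)

lemma involute_sum: "involute (sum f S) = (\<Sum>x\<in>S. involute (f x))"
  by (induction S rule: infinite_finite_induct) (auto simp: involute_add)

lemma minus_one_power_card_sym_diff:
  assumes "finite A" "finite B"
  shows "(- 1) ^ card (sym_diff A B) = (- 1) ^ card A * ((- 1) ^ card B :: 'a::comm_ring_1)"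
  using prod_sym_diff[OF assms, of "\<lambda>_. - 1 :: 'a"] by simp

text \<open>\<open>e_A e_B\<close> is a multiple of \<open>e_C\<close> with \<open>C\<close> the
  symmetric difference, and \<open>card C\<close> has the parity of
  \<open>card A + card B\<close>.\<close>

lemma involute_mult: "involute (a * b) = involute a * involute b"
proof (rule clifford_eqI)
  fix C
  have "coeff (involute a * involute b) C = (\<Sum>A | coeff a A \<noteq> 0. bsign A (sym_diff A C) *
      coeff (involute a) A * coeff (involute b) (sym_diff A C))"
    by (rule coeff_mult) auto
  also have "\<dots> = (\<Sum>A | coeff a A \<noteq> 0. (- 1) ^ card C * (bsign A (sym_diff A C) * coeff a A * coeff b (sym_diff A C)))"
  proof (rule sum.cong[OF refl])
    fix A assume "A \<in> {A. coeff a A \<noteq> 0}"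
    then have A: "finite A" using coeff_infinite by blast
    show "bsign A (sym_diff A C) * coeff (involute a) A * coeff (involute b) (sym_diff A C) =
        (- 1) ^ card C * (bsign A (sym_diff A C) * coeff a A * coeff b (sym_diff A C))"
    proof (cases "finite C")
      case True
      then have "(- 1) ^ card A * ((- 1) ^ card (sym_diff A C) :: 'a) = (- 1) ^ card C"
        using A minus_one_power_card_sym_diff[of A "sym_diff A C", where 'a='a] by simp
      moreover have "bsign A (sym_diff A C) * coeff (involute a) A * coeff (involute b) (sym_diff A C) =
          (- 1) ^ card A * (- 1) ^ card (sym_diff A C) * (bsign A (sym_diff A C) * coeff a A * coeff b (sym_diff A C))"
        by (simp only: coeff_involute mult_ac)
      ultimately show ?thesis by simp
    next
      case False
      then have "infinite (sym_diff A C)"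
        using A by (metis finite_Diff finite_UnI sym_diff_cancel(1))
      then show ?thesis by (simp add: coeff_infinite)
    qed
  qed
  also have "\<dots> = coeff (involute (a * b)) C"
    by (simp add: times_clifford.rep_eq sum_distrib_left)
  finally show "coeff (involute (a * b)) C = coeff (involute a * involute b) C" by simp
qed

lemma involute_one [simp]: "involute 1 = 1"
  and involute_gen [simp]: "involute (gen i) = - gen i"
  by (rule clifford_eqI; simp add: one_clifford_def coeff_blade)+

lemma involute_multivectors: "a \<in> multivectors m s \<Longrightarrow> involute a = (- 1) ^ s *\<^sub>R a"
  for a :: "'a::real_normed_field clifford"
  by (rule clifford_eqI) (auto simp: multivectors_iff scaleR_conv_of_real[where 'a='a])

section \<open>Outer and inner product with a vector\<close>

lemma wedge_add_left: "wedge (u + v) a = wedge u a + wedge v a"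
  and wedge_add_right: "wedge u (a + b) = wedge u a + wedge u b"
  and bullet_add_left: "bullet (u + v) a = bullet u a + bullet v a"
  and bullet_add_right: "bullet u (a + b) = bullet u a + bullet u b"
  by (simp_all add: wedge_def bullet_def distrib_left distrib_right involute_add scaleR_add_right
      scaleR_diff_right add_ac diff_add_eq diff_diff_eq2 diff_diff_add)

lemma wedge_scaleR_left: "wedge (r *\<^sub>R u) a = r *\<^sub>R wedge u a"
  and wedge_scaleR_right: "wedge u (r *\<^sub>R a) = r *\<^sub>R wedge u a"
  and bullet_scaleR_left: "bullet (r *\<^sub>R u) a = r *\<^sub>R bullet u a"
  and bullet_scaleR_right: "bullet u (r *\<^sub>R a) = r *\<^sub>R bullet u a"
  by (simp_all add: wedge_def bullet_def involute_scaleR scaleR_add_right scaleR_diff_right)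

lemma wedge_zero [simp]: "wedge 0 a = 0" "wedge u 0 = 0"
  and bullet_zero [simp]: "bullet 0 a = 0" "bullet u 0 = 0"
  by (simp_all add: wedge_def bullet_def)

lemma wedge_minus_right: "wedge u (- a) = - wedge u a"
  and bullet_minus_right: "bullet u (- a) = - bullet u a"
  using wedge_scaleR_right[of u "- 1" a] bullet_scaleR_right[of u "- 1" a] by simp_all

lemma wedge_diff_right: "wedge u (a - b) = wedge u a - wedge u b"
  and bullet_diff_right: "bullet u (a - b) = bullet u a - bullet u b"
  using wedge_add_right[of u a "- b"] bullet_add_right[of u a "- b"]
  by (simp_all add: wedge_minus_right bullet_minus_right)

lemma cscale_scaleR: "c *\<^sub>C (r *\<^sub>R a) = r *\<^sub>R (c *\<^sub>C a)"
  for a :: "'a::real_normed_field clifford"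
  by (rule clifford_eqI) simp

lemma wedge_cscale: "wedge u (c *\<^sub>C a) = c *\<^sub>C wedge u a"
  and bullet_cscale: "bullet u (c *\<^sub>C a) = c *\<^sub>C bullet u a"
  by (simp_all add: wedge_def bullet_def involute_cscale cscale_mult_left cscale_mult_right
      cscale_scaleR cliff.scale_right_distrib cliff.scale_right_diff_distrib)

lemma wedge_sum_left: "wedge (sum f S) a = (\<Sum>i\<in>S. wedge (f i) a)"
  and wedge_sum_right: "wedge u (sum g S) = (\<Sum>i\<in>S. wedge u (g i))"
  by (induction S rule: infinite_finite_induct) (auto simp: wedge_add_left wedge_add_right)

lemma bullet_sum_left: "bullet (sum f S) a = (\<Sum>i\<in>S. bullet (f i) a)"
  and bullet_sum_right: "bullet u (sum g S) = (\<Sum>i\<in>S. bullet u (g i))"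
  by (induction S rule: infinite_finite_induct) (auto simp: bullet_add_left bullet_add_right)

lemma wedge_plus_bullet: "wedge u a + bullet u a = u * a"
proof -
  have "wedge u a + bullet u a = (1/2) *\<^sub>R (u * a + u * a)"
    by (simp add: wedge_def bullet_def flip: scaleR_add_right)
  then show ?thesis by (simp flip: scaleR_add_left add: scaleR_add_right)
qed

text \<open>Moving \<open>e_i\<close> from the right of the involuted blade \<open>e_D\<close> to
  its left leaves the sign \<open>1\<close> if \<open>i \<notin> D\<close> and \<open>- 1\<close> if
  \<open>i \<in> D\<close>. So the half sum keeps exactly the terms in which \<open>e_i\<close>
  creates the index \<open>i\<close>, the half difference those in which it removes
  \<open>i\<close>.\<close>

lemma coeff_wedge_gen: "coeff (wedge (gen i) a) C = (if i \<in> C then coeff (gen i * a) C else 0)"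
  and coeff_bullet_gen: "coeff (bullet (gen i) a) C = (if i \<in> C then 0 else coeff (gen i * a) C)"
proof -
  let ?D = "sym_diff {i} C"
  have "coeff (involute a * gen i) C = (if i \<in> C then 1 else - 1) * coeff (gen i * a) C"
  proof (cases "finite ?D")
    case True
    have [simp]: "(- 1) ^ n * ((- 1) ^ n * x) = x" for n and x :: 'a
      by (simp flip: mult.assoc power_add)
    have "i \<in> ?D \<longleftrightarrow> i \<notin> C" by blast
    then show ?thesis
      using bsign_singleton_swap[OF True, of i, where 'a='a]
      by (auto simp: coeff_mult_gen coeff_gen_mult mult_ac)
  next
    case False
    then show ?thesis by (simp add: coeff_mult_gen coeff_gen_mult coeff_infinite)
  qed
  then show "coeff (wedge (gen i) a) C = (if i \<in> C then coeff (gen i * a) C else 0)"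
    "coeff (bullet (gen i) a) C = (if i \<in> C then 0 else coeff (gen i * a) C)"
    by (auto simp: wedge_def bullet_def scaleR_conv_of_real[where 'a='a])
qed

lemma wedge_cvec: "wedge (cvec n x) a = (\<Sum>i=1..n. x i *\<^sub>R wedge (gen i) a)"
  by (simp add: cvec_def wedge_sum_left wedge_scaleR_left)

lemma bullet_cvec: "bullet (cvec n x) a = (\<Sum>i=1..n. x i *\<^sub>R bullet (gen i) a)"
  by (simp add: cvec_def bullet_sum_left bullet_scaleR_left)

section \<open>The grading by degree\<close>

lemma multivectors_subspace: "cliff.subspace (multivectors n s :: 'a::field clifford set)"
  unfolding multivectors_def by (rule cliff.subspace_span)

lemmas multivectors_zero [simp] = cliff.subspace_0[OF multivectors_subspace]
  and multivectors_add = cliff.subspace_add[OF multivectors_subspace]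
  and multivectors_minus = cliff.subspace_neg[OF multivectors_subspace]
  and multivectors_diff = cliff.subspace_diff[OF multivectors_subspace]
  and multivectors_cscale = cliff.subspace_scale[OF multivectors_subspace]

lemma multivectors_scaleR: "a \<in> multivectors n s \<Longrightarrow> r *\<^sub>R a \<in> multivectors n s"
  for a :: "'a::real_normed_field clifford"
  by (simp add: scaleR_clifford_def multivectors_cscale)

lemma multivectors_sum:
  "(\<And>i. i \<in> S \<Longrightarrow> f i \<in> multivectors n s) \<Longrightarrow> sum f S \<in> multivectors n s"
  by (induction S rule: infinite_finite_induct) (auto simp: multivectors_add)

lemma multivectors_mono: "m \<le> n \<Longrightarrow> a \<in> multivectors m s \<Longrightarrow> a \<in> multivectors n s"
  for a :: "'a::field clifford"
  by (force simp: multivectors_iff)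

lemma wedge_gen_multivectors:
  assumes "a \<in> multivectors n s" "i \<in> {1..n}"
  shows "wedge (gen i) a \<in> multivectors n (Suc s)"
  unfolding multivectors_iff
proof (intro allI impI)
  fix C assume "coeff (wedge (gen i) a) C \<noteq> 0"
  then have i: "i \<in> C" and "coeff a (sym_diff {i} C) \<noteq> 0"
    by (auto simp: coeff_wedge_gen coeff_gen_mult split: if_splits)
  moreover from i have "sym_diff {i} C = C - {i}" by auto
  ultimately have "C - {i} \<subseteq> {1..n}" "card (C - {i}) = s"
    using assms(1) by (auto simp: multivectors_iff)
  then show "C \<subseteq> {1..n} \<and> card C = Suc s"
    using i assms(2) finite_subset[of "C - {i}" "{1..n}"] card_Suc_Diff1[of C i] by auto
qed

lemma bullet_gen_multivectors:
  assumes "a \<in> multivectors n s" "i \<in> {1..n}"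
  shows "bullet (gen i) a \<in> multivectors n (s - 1)"
  unfolding multivectors_iff
proof (intro allI impI)
  fix C assume "coeff (bullet (gen i) a) C \<noteq> 0"
  then have i: "i \<notin> C" and "coeff a (sym_diff {i} C) \<noteq> 0"
    by (auto simp: coeff_bullet_gen coeff_gen_mult split: if_splits)
  moreover from i have "sym_diff {i} C = insert i C" by auto
  ultimately have "insert i C \<subseteq> {1..n}" "card (insert i C) = s"
    using assms(1) by (auto simp: multivectors_iff)
  then show "C \<subseteq> {1..n} \<and> card C = s - 1"
    using i finite_subset[of "insert i C" "{1..n}"] by auto
qed

text \<open>Complements \<open>bullet_gen_multivectors\<close>: for \<open>s = 0\<close> the
  truncated \<open>s - 1\<close> would only say that the product is again a scalar.\<close>

lemma bullet_gen_scalar: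
  assumes "a \<in> multivectors n 0"
  shows "bullet (gen i) a = 0"
proof (rule clifford_eqI)
  fix C
  have "coeff a (insert i C) = 0"
    using assms finite_subset[of _ "{1..n}"] by (fastforce simp: multivectors_iff)
  then show "coeff (bullet (gen i) a) C = coeff 0 C"
    by (simp add: coeff_bullet_gen coeff_gen_mult)
qed

lemma wedge_gen_pseudoscalar:
  assumes "a \<in> multivectors n n" "i \<in> {1..n}"
  shows "wedge (gen i) a = 0"
proof (rule clifford_eqI)
  fix C
  have "coeff a (C - {i}) = 0" if "i \<in> C"
  proof (rule ccontr)
    assume "coeff a (C - {i}) \<noteq> 0"
    then have "C - {i} \<subseteq> {1..n}" "card (C - {i}) = card {1..n}"
      using assms(1) by (auto simp: multivectors_iff)
    then have "C - {i} = {1..n}" by (metis card_subset_eq finite_atLeastAtMost)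
    then show False using assms(2) by blast
  qed
  moreover have "sym_diff {i} C = C - {i}" if "i \<in> C" using that by blast
  ultimately show "coeff (wedge (gen i) a) C = coeff 0 C"
    by (simp add: coeff_wedge_gen coeff_gen_mult)
qed

lemma wedge_cvec_multivectors:
  "a \<in> multivectors n s \<Longrightarrow> wedge (cvec n x) a \<in> multivectors n (Suc s)"
  unfolding wedge_cvec by (intro multivectors_sum multivectors_scaleR wedge_gen_multivectors)

lemma bullet_cvec_multivectors:
  "a \<in> multivectors n s \<Longrightarrow> bullet (cvec n x) a \<in> multivectors n (s - 1)"
  unfolding bullet_cvec by (intro multivectors_sum multivectors_scaleR bullet_gen_multivectors)

lemma bullet_cvec_scalar: "a \<in> multivectors n 0 \<Longrightarrow> bullet (cvec m x) a = 0"
  by (simp add: bullet_cvec bullet_gen_scalar)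

lemma wedge_cvec_pseudoscalar: "a \<in> multivectors n n \<Longrightarrow> wedge (cvec n x) a = 0"
  by (simp add: wedge_cvec wedge_gen_pseudoscalar)

lemma multivectors_disjoint:
  "a \<in> multivectors n s \<Longrightarrow> a \<in> multivectors n t \<Longrightarrow> s \<noteq> t \<Longrightarrow> a = 0"
  for a :: "'a::field clifford"
  by (rule clifford_eqI) (auto simp: multivectors_iff)

lemma gen_involute_gen:
  "coeff (gen i * involute a * gen i) C = (if i \<in> C then 1 else - 1) * coeff a C"
proof (cases "finite C")
  case True
  let ?D = "sym_diff {i} C"
  have D: "finite ?D" using True by simp
  have *: "bsign {i} ?D * bsign {i} C = (- 1 :: 'a)"
  proof -
    have "bsign {i} ?D = bsign {i} {i} * (bsign {i} C :: 'a)"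
      using True by (simp add: bsign_sym_diff_right)
    moreover have "bsign {i} C * bsign {i} C = (1 :: 'a)" by (simp add: bsign_def bsign_sq_aux)
    ultimately show ?thesis by (simp add: mult.assoc bsign_def)
  qed
  have "coeff (gen i * involute a * gen i) C =
      bsign ?D {i} * (bsign {i} C * ((- 1) ^ card C * coeff a C))"
    by (simp add: coeff_mult_gen coeff_gen_mult)
  also have "bsign ?D {i} = (- 1) ^ card ?D * (if i \<in> C then 1 else - 1) * (bsign {i} ?D :: 'a)"
    using bsign_singleton_swap[OF D, of i, where 'a='a] by auto
  also have "(- 1) ^ card ?D = (- 1 :: 'a) * (- 1) ^ card C"
    using minus_one_power_card_sym_diff[of "{i}" C, where 'a='a] True by simp
  also have "(- 1 :: 'a) * (- 1) ^ card C * (if i \<in> C then 1 else - 1) * bsign {i} ?D *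
      (bsign {i} C * ((- 1) ^ card C * coeff a C)) =
      ((- 1) ^ card C * (- 1) ^ card C) * (if i \<in> C then 1 else - 1) * - (bsign {i} ?D * bsign {i} C) * coeff a C"
    by (simp add: mult_ac)
  also have "\<dots> = (if i \<in> C then 1 else - 1) * coeff a C"
    unfolding * by (simp flip: power_add)
  finally show ?thesis .
qed (simp add: coeff_infinite)

text \<open>On a blade \<open>e_A\<close> of degree \<open>s\<close> the \<open>s\<close> indices in
  \<open>A\<close> contribute \<open>1\<close> each and the \<open>n - s\<close> others
  \<open>- 1\<close>. Through this eigenvalue the degree \<open>s\<close> enters the formulas for
  the Dirac operator.\<close>

lemma sum_gen_involute_gen:
  fixes a :: "'a::real_normed_field clifford"
  assumes "a \<in> multivectors n s"
  shows "(\<Sum>i=1..n. gen i * involute a * gen i) = (2 * real s - real n) *\<^sub>R a"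
proof (rule clifford_eqI)
  fix C
  show "coeff (\<Sum>i=1..n. gen i * involute a * gen i) C = coeff ((2 * real s - real n) *\<^sub>R a) C"
  proof (cases "coeff a C = 0")
    case False
    then have C: "C \<subseteq> {1..n}" "card C = s" using assms by (auto simp: multivectors_iff)
    have "(\<Sum>i=1..n. (if i \<in> C then 1 else - 1 :: real)) = (\<Sum>i\<in>C. 1) + (\<Sum>i\<in>{1..n}-C. - 1)"
      using C(1) by (subst sum.subset_diff[OF C(1)]) (auto simp: add.commute)
    also have "\<dots> = 2 * real s - real n"
      using C finite_subset[OF C(1)] card_mono[OF _ C(1)] by (simp add: card_Diff_subset of_nat_diff)
    finally have *: "(\<Sum>i=1..n. (if i \<in> C then 1 else - 1 :: real)) = 2 * real s - real n" .
    have "coeff (\<Sum>i=1..n. gen i * involute a * gen i) C = (\<Sum>i=1..n. of_real (if i \<in> C then 1 else - 1)) * coeff a C"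
      unfolding coeff_sum gen_involute_gen sum_distrib_right by (intro sum.cong) auto
    also have "\<dots> = of_real (2 * real s - real n) * coeff a C"
      unfolding *[symmetric] by simp
    finally show ?thesis by (simp add: scaleR_conv_of_real[where 'a='a])
  qed (simp add: gen_involute_gen)
qed

lemma cvec_anticommute:
  "cvec n x * cvec n y + cvec n y * cvec n x =
    (- 2 * (\<Sum>i=1..n. x i * y i)) *\<^sub>R (1 :: 'a::real_normed_field clifford)"
proof -
  have "cvec n x * cvec n y + cvec n y * (cvec n x :: 'a clifford) =
      (\<Sum>i=1..n. \<Sum>j=1..n. (x i * y j) *\<^sub>R (gen i * gen j)) + (\<Sum>j=1..n. \<Sum>i=1..n. (x i * y j) *\<^sub>R (gen j * gen i))"
    unfolding cvec_def sum_product by (simp add: mult_ac)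
  also have "\<dots> = (\<Sum>i=1..n. \<Sum>j=1..n. (x i * y j) *\<^sub>R (gen i * gen j + gen j * gen i))"
    by (subst sum.swap[of _ "{1..n}" "{1..n}"], simp add: sum.distrib scaleR_add_right,
      subst sum.swap, simp)
  also have "\<dots> = (\<Sum>i=1..n. \<Sum>j=1..n. if i = j then (- 2 * (x i * y i)) *\<^sub>R 1 else 0)"
  proof -
    have two: "r *\<^sub>R 2 = (2 * r) *\<^sub>R (1 :: 'a clifford)" for r
    proof -
      have "(2 :: 'a clifford) = of_real 2" by simp
      then show ?thesis by (simp only: of_real_def scaleR_scaleR mult.commute)
    qed
    show ?thesis
      unfolding gen_anticommute by (intro sum.cong refl) (auto simp: two)
  qed
  also have "\<dots> = (- 2 * (\<Sum>i=1..n. x i * y i)) *\<^sub>R 1"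
    by (simp add: sum_distrib_left scaleR_sum_left sum_negf)
  finally show ?thesis .
qed

lemma cvec_square:
  "cvec n x * cvec n x = - (\<Sum>i=1..n. (x i)\<^sup>2) *\<^sub>R (1 :: 'a::real_normed_field clifford)"
proof -
  have "2 *\<^sub>R (cvec n x * cvec n x) = 2 *\<^sub>R (- (\<Sum>i=1..n. (x i)\<^sup>2) *\<^sub>R 1 :: 'a clifford)"
    using cvec_anticommute[of n x x, where 'a='a] by (simp add: scaleR_2 power2_eq_square)
  then show ?thesis by (simp only: scaleR_cancel_left) simp
qed

lemma involute_cvec [simp]: "involute (cvec n x) = - cvec n x"
  by (simp add: cvec_def involute_sum involute_scaleR sum_negf)

text \<open>The Koszul relations. They follow from \<open>u * u = - |x|^2\<close> and
  \<open>involute u = - u\<close>, because the mixed terms \<open>u * b * u\<close> cancel.\<close>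

lemma wedge_wedge_cvec [simp]: "wedge (cvec n x) (wedge (cvec n x) a) = 0"
  and bullet_bullet_cvec [simp]: "bullet (cvec n x) (bullet (cvec n x) a) = 0"
  and wedge_bullet_cvec: "wedge (cvec n x) (bullet (cvec n x) a) + bullet (cvec n x) (wedge (cvec n x) a) =
    - (\<Sum>i=1..n. (x i)\<^sup>2) *\<^sub>R a"
  for a :: "'a::real_normed_field clifford"
proof -
  let ?u = "cvec n x"
  have 1: "?u * (?u * b) = - (\<Sum>i=1..n. (x i)\<^sup>2) *\<^sub>R b" for b :: "'a clifford"
    by (simp add: cvec_square flip: mult.assoc)
  have 2: "b * ?u * ?u = - (\<Sum>i=1..n. (x i)\<^sup>2) *\<^sub>R b" for b :: "'a clifford"
    by (simp add: cvec_square mult.assoc)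
  show "wedge ?u (wedge ?u a) = 0" "bullet ?u (bullet ?u a) = 0"
    by (simp_all add: wedge_def bullet_def involute_scaleR involute_add involute_diff involute_mult
       distrib_left distrib_right left_diff_distrib right_diff_distrib 1 2)
      (simp_all add: algebra_simps)
  show "wedge ?u (bullet ?u a) + bullet ?u (wedge ?u a) = - (\<Sum>i=1..n. (x i)\<^sup>2) *\<^sub>R a"
    by (simp add: wedge_def bullet_def involute_scaleR involute_add involute_diff involute_mult
       distrib_left distrib_right left_diff_distrib right_diff_distrib 1 2)
      (simp add: algebra_simps flip: scaleR_add_left)
qed

section \<open>Homogeneous polynomials\<close>

lemma finite_multi_indices [simp]: "finite (multi_indices n j)"
proof (rule finite_subset)
  show "multi_indices n j \<subseteq> {a. \<forall>i. (i \<in> {1..n} \<longrightarrow> a i \<in> {0..j}) \<and> (i \<notin> {1..n} \<longrightarrow> a i = 0)}"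
    unfolding multi_indices_def using member_le_sum[of _ "{1..n}"] by fastforce
  show "finite {a. \<forall>i. (i \<in> {1..n} \<longrightarrow> a i \<in> {0..j}) \<and> (i \<notin> {1..n} \<longrightarrow> a i = (0::nat))}"
    by (rule finite_set_of_finite_funs) auto
qed

lemma multi_indices_Suc_iff:
  assumes "i \<in> {1..n}"
  shows "a(i := Suc (a i)) \<in> multi_indices n (Suc j) \<longleftrightarrow> a \<in> multi_indices n j"
proof -
  have "(\<Sum>l=1..n. (a(i := Suc (a i))) l) = Suc (\<Sum>l=1..n. a l)"
  proof -
    have "(\<Sum>l=1..n. (a(i := Suc (a i))) l) = (\<Sum>l=1..n. a l + (if l = i then 1 else 0))"
      by (rule sum.cong) auto
    then show ?thesis using assms by (simp add: sum.distrib)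
  qed
  then show ?thesis using assms unfolding multi_indices_def by auto
qed

lemma monomial_Suc:
  fixes x :: "nat \<Rightarrow> real"
  assumes "i \<in> {1..n}"
  shows "(\<Prod>l=1..n. x l ^ (a(i := Suc (a i))) l) = x i * (\<Prod>l=1..n. x l ^ a l)"
proof -
  have "(\<Prod>l=1..n. x l ^ (a(i := Suc (a i))) l) = (\<Prod>l=1..n. (if l = i then x l else 1) * x l ^ a l)"
    by (rule prod.cong) auto
  then show ?thesis using assms by (simp add: prod.distrib)
qed

lemma inj_increment: "inj (\<lambda>a::nat \<Rightarrow> nat. a(i := Suc (a i)))"
proof (rule injI)
  fix a b :: "nat \<Rightarrow> nat"
  assume eq: "a(i := Suc (a i)) = b(i := Suc (b i))"
  show "a = b"
  proof
    fix l show "a l = b l" using fun_cong[OF eq, of l] by (cases "l = i") auto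
  qed
qed

lemma increment_decrement: "0 < a i \<Longrightarrow> (a(i := a i - 1))(i := Suc ((a(i := a i - 1)) i)) = (a :: nat \<Rightarrow> nat)"
  by auto

lemma homogeneous_polys_0: "homogeneous_polys n 0 V = {\<lambda>_. v | v. v \<in> V}"
proof -
  have *: "multi_indices n 0 = {\<lambda>_. 0}" by (force simp: multi_indices_def)
  show ?thesis unfolding homogeneous_polys_def * by auto
qed

lemma homogeneous_polys_const: "v \<in> V \<Longrightarrow> (\<lambda>_. v) \<in> homogeneous_polys n 0 V"
  by (auto simp: homogeneous_polys_0)

lemma homogeneous_polys_zero: "0 \<in> V \<Longrightarrow> (\<lambda>_. 0) \<in> homogeneous_polys n j V"
  unfolding homogeneous_polys_def by (intro CollectI exI[of _ "\<lambda>_. 0"]) simp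

lemma homogeneous_polys_add:
  assumes "subspace V" "f \<in> homogeneous_polys n j V" "g \<in> homogeneous_polys n j V"
  shows "(\<lambda>x. f x + g x) \<in> homogeneous_polys n j V"
proof -
  obtain c d where "\<forall>a. c a \<in> V" "f = (\<lambda>x. \<Sum>a\<in>multi_indices n j. (\<Prod>i=1..n. x i ^ a i) *\<^sub>R c a)"
    "\<forall>a. d a \<in> V" "g = (\<lambda>x. \<Sum>a\<in>multi_indices n j. (\<Prod>i=1..n. x i ^ a i) *\<^sub>R d a)"
    using assms unfolding homogeneous_polys_def by blast
  then show ?thesis
    unfolding homogeneous_polys_def using subspace_add[OF assms(1)]
    by (intro CollectI exI[of _ "\<lambda>a. c a + d a"]) (simp add: scaleR_add_right sum.distrib)
qed

lemma homogeneous_polys_scaleR: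
  assumes "subspace V" "f \<in> homogeneous_polys n j V"
  shows "(\<lambda>x. r *\<^sub>R f x) \<in> homogeneous_polys n j V"
proof -
  obtain c where "\<forall>a. c a \<in> V" "f = (\<lambda>x. \<Sum>a\<in>multi_indices n j. (\<Prod>i=1..n. x i ^ a i) *\<^sub>R c a)"
    using assms unfolding homogeneous_polys_def by blast
  then show ?thesis
    unfolding homogeneous_polys_def using subspace_scale[OF assms(1)]
    by (intro CollectI exI[of _ "\<lambda>a. r *\<^sub>R c a"]) (simp add: scaleR_sum_right mult.commute)
qed

lemma homogeneous_polys_sum:
  assumes "subspace V" "\<And>i. i \<in> S \<Longrightarrow> f i \<in> homogeneous_polys n j V"
  shows "(\<lambda>x. \<Sum>i\<in>S. f i x) \<in> homogeneous_polys n j V"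
  using assms(2)
  by (induction S rule: infinite_finite_induct)
    (auto intro: homogeneous_polys_zero homogeneous_polys_add subspace_0 assms(1))

lemma homogeneous_polys_var:
  assumes "0 \<in> V" "i \<in> {1..n}" "f \<in> homogeneous_polys n j V"
  shows "(\<lambda>x. x i *\<^sub>R f x) \<in> homogeneous_polys n (Suc j) V"
proof -
  obtain c where c: "\<forall>a. c a \<in> V"
    and f: "f = (\<lambda>x. \<Sum>a\<in>multi_indices n j. (\<Prod>i=1..n. x i ^ a i) *\<^sub>R c a)"
    using assms(3) unfolding homogeneous_polys_def by blast
  let ?inc = "\<lambda>a::nat \<Rightarrow> nat. a(i := Suc (a i))"
  \<comment> \<open>Multi-indices without the variable \<open>x i\<close> are not reached by raising
    its exponent; they get the coefficient \<open>0\<close>, which has to lie in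
    \<open>V\<close>.\<close>
  define d where "d a = (if 0 < a i then c (a(i := a i - 1)) else 0)" for a :: "nat \<Rightarrow> nat"
  have d_inc: "d (?inc a) = c a" for a by (simp add: d_def)
  have "x i *\<^sub>R f x = (\<Sum>a\<in>multi_indices n (Suc j). (\<Prod>l=1..n. x l ^ a l) *\<^sub>R d a)" for x
  proof -
    have "x i *\<^sub>R f x = (\<Sum>a\<in>multi_indices n j. (\<Prod>l=1..n. x l ^ ?inc a l) *\<^sub>R d (?inc a))"
      unfolding d_inc monomial_Suc[OF assms(2)] f scaleR_sum_right by simp
    also have "\<dots> = (\<Sum>a\<in>?inc ` multi_indices n j. (\<Prod>l=1..n. x l ^ a l) *\<^sub>R d a)"
      by (subst sum.reindex) (auto intro: inj_on_subset[OF inj_increment])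
    also have "\<dots> = (\<Sum>a\<in>multi_indices n (Suc j). (\<Prod>l=1..n. x l ^ a l) *\<^sub>R d a)"
    proof (rule sum.mono_neutral_left)
      show "?inc ` multi_indices n j \<subseteq> multi_indices n (Suc j)"
        using multi_indices_Suc_iff[OF assms(2)] by blast
      show "\<forall>a\<in>multi_indices n (Suc j) - ?inc ` multi_indices n j. (\<Prod>l=1..n. x l ^ a l) *\<^sub>R d a = 0"
      proof
        fix a assume a: "a \<in> multi_indices n (Suc j) - ?inc ` multi_indices n j"
        have "a i = 0"
        proof (rule ccontr)
          assume "a i \<noteq> 0"
          then have *: "?inc (a(i := a i - 1)) = a" by (intro increment_decrement) simp
          with a have "a(i := a i - 1) \<in> multi_indices n j"
            using multi_indices_Suc_iff[OF assms(2), of "a(i := a i - 1)" j] by auto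
          with * a show False by (metis (no_types, lifting) DiffD2 image_eqI)
        qed
        then show "(\<Prod>l=1..n. x l ^ a l) *\<^sub>R d a = 0" by (simp add: d_def)
      qed
    qed simp
    finally show ?thesis .
  qed
  moreover have "\<forall>a. d a \<in> V" using c assms(1) by (simp add: d_def)
  ultimately show ?thesis unfolding homogeneous_polys_def by blast
qed

lemma homogeneous_polys_Suc_cases:
  assumes "0 \<in> V" "f \<in> homogeneous_polys n (Suc j) V"
  obtains g where "\<And>i. g i \<in> homogeneous_polys n j V" "f = (\<lambda>x. \<Sum>i=1..n. x i *\<^sub>R g i x)"
proof -
  obtain c where c: "\<forall>a. c a \<in> V"
    and f: "f = (\<lambda>x. \<Sum>a\<in>multi_indices n (Suc j). (\<Prod>i=1..n. x i ^ a i) *\<^sub>R c a)"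
    using assms(2) unfolding homogeneous_polys_def by blast
  define inc where "inc = (\<lambda>i a. (a :: nat \<Rightarrow> nat)(i := Suc (a i)))"
  \<comment> \<open>A monomial can be divided by each of its variables. It is attributed to the
    least one, \<open>l a\<close>, so that the multi-indices of degree \<open>Suc j\<close> are
    partitioned and nothing is counted twice.\<close>
  define l where "l a = (LEAST i. 0 < (a :: nat \<Rightarrow> nat) i)" for a
  define d where "d i a = (if l (inc i a) = i then c (inc i a) else 0)" for i a
  define g where "g i = (\<lambda>x::nat \<Rightarrow> real. \<Sum>a\<in>multi_indices n j. (\<Prod>p=1..n. x p ^ a p) *\<^sub>R d i a)" for i
  have l: "l a \<in> {1..n}" "0 < a (l a)" if "a \<in> multi_indices n (Suc j)" for a
  proof -
    have "(\<Sum>i=1..n. a i) \<noteq> 0" using that by (simp add: multi_indices_def)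
    then have "\<exists>i. 0 < a i" by (metis sum.neutral neq0_conv)
    then show "0 < a (l a)" unfolding l_def by (rule LeastI_ex)
    then show "l a \<in> {1..n}" using that unfolding multi_indices_def by fastforce
  qed
  have "f x = (\<Sum>i=1..n. x i *\<^sub>R g i x)" for x
  proof -
    have "f x = (\<Sum>i=1..n. \<Sum>a | a \<in> multi_indices n (Suc j) \<and> l a = i. (\<Prod>p=1..n. x p ^ a p) *\<^sub>R c a)"
      unfolding f by (rule sum.group[symmetric]) (use l in auto)
    also have "\<dots> = (\<Sum>i=1..n. x i *\<^sub>R g i x)"
    proof (rule sum.cong[OF refl])
      fix i assume i: "i \<in> {1..n}"
      have *: "inc i ` {a \<in> multi_indices n j. l (inc i a) = i} = {a \<in> multi_indices n (Suc j). l a = i}"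
      proof (intro equalityI subsetI)
        fix a assume "a \<in> inc i ` {a \<in> multi_indices n j. l (inc i a) = i}"
        then show "a \<in> {a \<in> multi_indices n (Suc j). l a = i}"
          using multi_indices_Suc_iff[OF i] by (auto simp: inc_def)
      next
        fix a assume a: "a \<in> {a \<in> multi_indices n (Suc j). l a = i}"
        then have "0 < a i" using l(2) by blast
        then have eq: "inc i (a(i := a i - 1)) = a" unfolding inc_def by (rule increment_decrement)
        then have "a(i := a i - 1) \<in> multi_indices n j"
          using multi_indices_Suc_iff[OF i, of "a(i := a i - 1)" j] a by (simp add: inc_def)
        with eq a show "a \<in> inc i ` {a \<in> multi_indices n j. l (inc i a) = i}"
          by (intro image_eqI[of _ _ "a(i := a i - 1)"]) auto
      qed
      have "(\<Sum>a | a \<in> multi_indices n (Suc j) \<and> l a = i. (\<Prod>p=1..n. x p ^ a p) *\<^sub>R c a) =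
          (\<Sum>a | a \<in> multi_indices n j \<and> l (inc i a) = i. (\<Prod>p=1..n. x p ^ inc i a p) *\<^sub>R c (inc i a))"
        unfolding *[symmetric]
        by (subst sum.reindex) (auto simp: inc_def intro: inj_on_subset[OF inj_increment])
      also have "\<dots> = (\<Sum>a\<in>multi_indices n j. (\<Prod>p=1..n. x p ^ inc i a p) *\<^sub>R d i a)"
        by (rule sum.mono_neutral_cong_left) (auto simp: d_def)
      also have "\<dots> = x i *\<^sub>R g i x"
        unfolding g_def inc_def monomial_Suc[OF i] scaleR_sum_right by simp
      finally show "(\<Sum>a | a \<in> multi_indices n (Suc j) \<and> l a = i. (\<Prod>p=1..n. x p ^ a p) *\<^sub>R c a) =
          x i *\<^sub>R g i x" .
    qed
    finally show ?thesis .
  qed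
  moreover have "g i \<in> homogeneous_polys n j V" for i
    unfolding homogeneous_polys_def g_def using c assms(1) by (auto simp: d_def intro!: exI[of _ "d i"])
  ultimately show ?thesis using that[of g] by blast
qed

text \<open>Hides the multi-indices: a claim is checked for constants and carried over to sums
  \<open>x_1 g_1 + ... + x_n g_n\<close>. Since \<open>Q\<close> may depend on the degree,
  statements such as Euler's identity fit this scheme.\<close>

lemma homogeneous_polys_induct [consumes 2, case_names const Suc]:
  assumes "f \<in> homogeneous_polys n j V" "subspace V"
    and "\<And>v. v \<in> V \<Longrightarrow> Q 0 (\<lambda>_. v)"
    and "\<And>j g. (\<And>i. g i \<in> homogeneous_polys n j V) \<Longrightarrow> (\<And>i. Q j (g i)) \<Longrightarrow>
      (\<lambda>x. \<Sum>i=1..n. x i *\<^sub>R g i x) \<in> homogeneous_polys n (Suc j) V \<Longrightarrow>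
      Q (Suc j) (\<lambda>x. \<Sum>i=1..n. x i *\<^sub>R g i x)"
  shows "Q j f"
  using assms(1)
proof (induction j arbitrary: f)
  case 0
  then show ?case using assms(3) by (auto simp: homogeneous_polys_0)
next
  case (Suc j)
  obtain g where g: "\<And>i. g i \<in> homogeneous_polys n j V" "f = (\<lambda>x. \<Sum>i=1..n. x i *\<^sub>R g i x)"
    using homogeneous_polys_Suc_cases[OF subspace_0[OF assms(2)] Suc.prems] by blast
  then show ?case using assms(4)[OF g(1)] Suc.IH[OF g(1)] Suc.prems by simp
qed

lemma homogeneous_polys_Suc:
  assumes "subspace V" "\<And>i. i \<in> {1..n} \<Longrightarrow> g i \<in> homogeneous_polys n j V"
  shows "(\<lambda>x. \<Sum>i=1..n. x i *\<^sub>R g i x) \<in> homogeneous_polys n (Suc j) V"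
  using assms by (intro homogeneous_polys_sum homogeneous_polys_var subspace_0)

lemma homogeneous_polys_cong:
  assumes "f \<in> homogeneous_polys n j V" "\<And>i. i \<in> {1..n} \<Longrightarrow> x i = y i"
  shows "f x = f y"
  using assms unfolding homogeneous_polys_def by (auto intro!: sum.cong prod.cong)

lemma homogeneous_polys_range:
  assumes "f \<in> homogeneous_polys n j V" "subspace V"
  shows "f x \<in> V"
  using assms unfolding homogeneous_polys_def by (auto intro!: subspace_sum subspace_scale)

lemma homogeneous_polys_map:
  assumes "f \<in> homogeneous_polys n j V" "linear h" "\<And>v. v \<in> V \<Longrightarrow> h v \<in> W"
  shows "(\<lambda>x. h (f x)) \<in> homogeneous_polys n j W"
proof -
  obtain c where "\<forall>a. c a \<in> V" "f = (\<lambda>x. \<Sum>a\<in>multi_indices n j. (\<Prod>i=1..n. x i ^ a i) *\<^sub>R c a)"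
    using assms unfolding homogeneous_polys_def by blast
  then show ?thesis
    unfolding homogeneous_polys_def
    by (intro CollectI exI[of _ "\<lambda>a. h (c a)"]) (simp add: assms linear_sum linear_scale)
qed

lemma homogeneous_polys_mono:
  "f \<in> homogeneous_polys n j V \<Longrightarrow> V \<subseteq> W \<Longrightarrow> f \<in> homogeneous_polys n j W"
  using homogeneous_polys_map[OF _ linear_id, of f n j V W] by auto

lemma homogeneous_polys_mult:
  assumes p: "p \<in> homogeneous_polys n i (UNIV :: real set)"
    and V: "subspace V" and f: "f \<in> homogeneous_polys n j V"
  shows "(\<lambda>x. p x *\<^sub>R f x) \<in> homogeneous_polys n (i + j) V"
  using p subspace_UNIV
proof (induction rule: homogeneous_polys_induct)
  case (const v)
  then show ?case using homogeneous_polys_scaleR[OF V f] by simp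
next
  case (Suc i g)
  have "(\<lambda>x. (\<Sum>l=1..n. x l *\<^sub>R g l x) *\<^sub>R f x) = (\<lambda>x. \<Sum>l=1..n. x l *\<^sub>R (g l x *\<^sub>R f x))"
    by (simp add: scaleR_sum_left)
  then show ?case using homogeneous_polys_Suc[OF V Suc.IH] by simp
qed

lemma homogeneous_polys_homogeneous:
  assumes "f \<in> homogeneous_polys n j V" "subspace V"
  shows "f (\<lambda>i. c * x i) = c ^ j *\<^sub>R f x"
  using assms
  by (induction rule: homogeneous_polys_induct) (auto simp: scaleR_sum_right mult_ac)

lemma homogeneous_polys_subst:
  assumes "f \<in> homogeneous_polys n j V" "subspace V"
    and L: "\<And>x i. i \<in> {1..n} \<Longrightarrow> L x i = (\<Sum>l=1..m. M i l * x l)"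
  shows "(\<lambda>x. f (L x)) \<in> homogeneous_polys m j V"
  using assms(1,2)
proof (induction rule: homogeneous_polys_induct)
  case (const v)
  then show ?case by (rule homogeneous_polys_const)
next
  case (Suc j g)
  have "(\<lambda>x. \<Sum>i=1..n. L x i *\<^sub>R g i (L x)) = (\<lambda>x. \<Sum>l=1..m. x l *\<^sub>R (\<Sum>i=1..n. M i l *\<^sub>R g i (L x)))"
  proof
    fix x
    have "(\<Sum>i=1..n. L x i *\<^sub>R g i (L x)) = (\<Sum>i=1..n. \<Sum>l=1..m. x l *\<^sub>R M i l *\<^sub>R g i (L x))"
      by (intro sum.cong refl) (simp add: L scaleR_sum_left mult.commute)
    also have "\<dots> = (\<Sum>l=1..m. x l *\<^sub>R (\<Sum>i=1..n. M i l *\<^sub>R g i (L x)))"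
      by (subst sum.swap) (simp add: scaleR_sum_right)
    finally show "(\<Sum>i=1..n. L x i *\<^sub>R g i (L x)) = \<dots>" .
  qed
  then show ?case
    using Suc.IH assms(2)
    by (simp only:) (intro homogeneous_polys_Suc homogeneous_polys_sum homogeneous_polys_scaleR; simp)
qed

subsection \<open>Partial derivatives\<close>

text \<open>\<open>partial\<close> is defined by \<open>vector_derivative\<close>, which says
  something only if a derivative exists. The relational form carries existence along, so the rules
  below can be composed.\<close>

definition has_partial :: "nat \<Rightarrow> ((nat \<Rightarrow> real) \<Rightarrow> 'b::real_normed_vector) \<Rightarrow> (nat \<Rightarrow> real) \<Rightarrow> 'b \<Rightarrow> bool"
  where "has_partial i f x d \<longleftrightarrow> ((\<lambda>t. f (x(i := t))) has_vector_derivative d) (at (x i))"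

lemma partialI: "has_partial i f x d \<Longrightarrow> partial i f x = d"
  unfolding has_partial_def partial_def by (rule vector_derivative_at)

lemma has_partial_const: "has_partial i (\<lambda>_. v) x 0"
  unfolding has_partial_def by simp

lemma has_partial_coord: "has_partial i (\<lambda>x. x l) x (if l = i then 1 else 0)"
  unfolding has_partial_def by (auto intro!: derivative_eq_intros)

lemma has_partial_add:
  "has_partial i f x d \<Longrightarrow> has_partial i g x e \<Longrightarrow> has_partial i (\<lambda>x. f x + g x) x (d + e)"
  unfolding has_partial_def by (rule has_vector_derivative_add)

lemma has_partial_sum:
  "(\<And>l. l \<in> S \<Longrightarrow> has_partial i (f l) x (d l)) \<Longrightarrow> has_partial i (\<lambda>x. \<Sum>l\<in>S. f l x) x (\<Sum>l\<in>S. d l)"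
  unfolding has_partial_def by (rule has_vector_derivative_sum)

lemma has_partial_scaleR:
  assumes "has_partial i p x (q :: real)" "has_partial i f x d"
  shows "has_partial i (\<lambda>x. p x *\<^sub>R f x) x (p x *\<^sub>R d + q *\<^sub>R f x)"
  using has_vector_derivative_scaleR[of "\<lambda>t. p (x(i := t))" q "x i" UNIV "\<lambda>t. f (x(i := t))" d] assms
  unfolding has_partial_def by (simp add: has_real_derivative_iff_has_vector_derivative)

lemma has_partial_coord_scaleR:
  "has_partial i f x d \<Longrightarrow> has_partial i (\<lambda>x. x l *\<^sub>R f x) x ((if l = i then f x else 0) + x l *\<^sub>R d)"
  using has_partial_scaleR[OF has_partial_coord, of i f x d l] by (auto simp: add.commute)

lemma has_partial_cmult:
  "has_partial i f x d \<Longrightarrow> has_partial i (\<lambda>x. r *\<^sub>R f x) x (r *\<^sub>R d)"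
  using has_partial_scaleR[OF has_partial_const, of i f x d r] by simp

text \<open>The last conjunct compensates for \<open>j - 1 = 0\<close> at \<open>j = 0\<close>:
  without it the inductive step would meet \<open>x l *\<^sub>R g' l x\<close> as a polynomial of
  degree \<open>1\<close> where degree \<open>0\<close> is claimed.\<close>

lemma homogeneous_polys_has_partial_ex:
  assumes "f \<in> homogeneous_polys n j V" "subspace V"
  shows "\<exists>f'\<in>homogeneous_polys n (j - 1) V. (\<forall>x. has_partial i f x (f' x)) \<and> (j = 0 \<longrightarrow> f' = (\<lambda>_. 0))"
  using assms
proof (induction rule: homogeneous_polys_induct)
  case (const v)
  then show ?case
    using homogeneous_polys_zero[OF subspace_0[OF assms(2)]] by (intro bexI[of _ "\<lambda>_. 0"]) (auto simp: has_partial_const)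
next
  case (Suc j g)
  then obtain g' where g': "\<And>l. g' l \<in> homogeneous_polys n (j - 1) V" "\<And>l x. has_partial i (g l) x (g' l x)"
    "\<And>l. j = 0 \<Longrightarrow> g' l = (\<lambda>_. 0)"
    by metis
  have "(\<lambda>x. x l *\<^sub>R g' l x) \<in> homogeneous_polys n j V" if "l \<in> {1..n}" for l
  proof (cases j)
    case 0
    then show ?thesis using g'(3) homogeneous_polys_zero[OF subspace_0[OF assms(2)]] by simp
  next
    case (Suc p)
    then show ?thesis using homogeneous_polys_var[OF subspace_0[OF assms(2)] that g'(1)] by simp
  qed
  moreover have "(\<lambda>x. if l = i then g l x else 0) \<in> homogeneous_polys n j V" for l
    using Suc.hyps(1) homogeneous_polys_zero[OF subspace_0[OF assms(2)]] by (cases "l = i") simp_all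
  ultimately have "(\<lambda>x. \<Sum>l=1..n. (if l = i then g l x else 0) + x l *\<^sub>R g' l x) \<in> homogeneous_polys n j V"
    by (intro homogeneous_polys_sum homogeneous_polys_add assms(2))
  moreover have "has_partial i (\<lambda>x. \<Sum>l=1..n. x l *\<^sub>R g l x) x (\<Sum>l=1..n. (if l = i then g l x else 0) + x l *\<^sub>R g' l x)" for x
    by (intro has_partial_sum has_partial_coord_scaleR g'(2))
  ultimately show ?case by (intro bexI) auto
qed

lemma homogeneous_polys_partial:
  assumes "f \<in> homogeneous_polys n j V" "subspace V"
  shows "partial i f \<in> homogeneous_polys n (j - 1) V"
    and homogeneous_polys_has_partial: "has_partial i f x (partial i f x)"
    and homogeneous_polys_partial_0: "j = 0 \<Longrightarrow> partial i f x = 0"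
proof -
  obtain f' where f': "f' \<in> homogeneous_polys n (j - 1) V" "\<And>x. has_partial i f x (f' x)" "j = 0 \<Longrightarrow> f' = (\<lambda>_. 0)"
    using homogeneous_polys_has_partial_ex[OF assms] by blast
  have "partial i f = f'" using partialI[OF f'(2)] by (rule ext)
  with f' show "partial i f \<in> homogeneous_polys n (j - 1) V" "has_partial i f x (partial i f x)"
    "j = 0 \<Longrightarrow> partial i f x = 0" by auto
qed

lemma partial_outside:
  assumes "f \<in> homogeneous_polys n j V" "i \<notin> {1..n}"
  shows "partial i f x = 0"
proof -
  have "(\<lambda>t. f (x(i := t))) = (\<lambda>t. f x)"
    using assms(2) by (intro ext homogeneous_polys_cong[OF assms(1)]) auto
  then show ?thesis by (intro partialI) (simp add: has_partial_def)
qed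

lemma partial_coord_sum:
  assumes "\<And>l. l \<in> {1..n} \<Longrightarrow> g l \<in> homogeneous_polys n j V" "subspace V"
  shows "partial i (\<lambda>x. \<Sum>l=1..n. x l *\<^sub>R g l x) x = (\<Sum>l=1..n. (if l = i then g l x else 0) + x l *\<^sub>R partial i (g l) x)"
  by (intro partialI has_partial_sum has_partial_coord_scaleR homogeneous_polys_has_partial[OF assms])

text \<open>The Clifford algebra on all generators has infinite dimension, and \<open>h\<close> is
  merely linear, perhaps not continuous. The finite polynomial form of \<open>f\<close> takes the
  place of continuity.\<close>

lemma has_partial_map:
  assumes "f \<in> homogeneous_polys n j V" "subspace V" "linear h"
  shows "has_partial i (\<lambda>x. h (f x)) x (h (partial i f x))"
  using assms(1,2)
proof (induction arbitrary: x rule: homogeneous_polys_induct)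
  case (const v)
  have "partial i (\<lambda>_. v) x = 0" by (intro partialI has_partial_const)
  then show ?case using has_partial_const by (simp add: linear_0[OF assms(3)])
next
  case (Suc j g)
  have "h (partial i (\<lambda>x. \<Sum>l=1..n. x l *\<^sub>R g l x) x) =
      (\<Sum>l=1..n. (if l = i then h (g l x) else 0) + x l *\<^sub>R h (partial i (g l) x))"
    unfolding partial_coord_sum[OF Suc.hyps(1) assms(2)] linear_sum[OF assms(3)]
    by (intro sum.cong refl) (simp add: linear_add[OF assms(3)] linear_scale[OF assms(3)] linear_0[OF assms(3)])
  moreover have "(\<lambda>x. h (\<Sum>l=1..n. x l *\<^sub>R g l x)) = (\<lambda>x. \<Sum>l=1..n. x l *\<^sub>R h (g l x))"
    by (simp add: linear_sum[OF assms(3)] linear_scale[OF assms(3)])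
  ultimately show ?case
    by (simp only:) (intro has_partial_sum has_partial_coord_scaleR Suc.IH)
qed

lemmas partial_map = partialI[OF has_partial_map]

lemma partial_commute:
  assumes "f \<in> homogeneous_polys n j V" "subspace V"
  shows "partial i (partial l f) x = partial l (partial i f) x"
  using assms
proof (induction arbitrary: x rule: homogeneous_polys_induct)
  case (const v)
  have *: "partial i (\<lambda>_. w) = (\<lambda>_. 0 :: 'a)" for i w by (intro ext partialI has_partial_const)
  show ?case unfolding * ..
next
  case (Suc j g)
  have *: "partial a (partial b (\<lambda>x. \<Sum>p=1..n. x p *\<^sub>R g p x)) x =
      (\<Sum>p=1..n. (if p = b then partial a (g p) x else 0) +
        ((if p = a then partial b (g p) x else 0) + x p *\<^sub>R partial a (partial b (g p)) x))" for a b
  proof (rule partialI)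
    have "has_partial a (\<lambda>x. if p = b then g p x else 0) x (if p = b then partial a (g p) x else 0)" for p
      using homogeneous_polys_has_partial[OF Suc.hyps(1) assms(2)] by (auto simp: has_partial_const)
    moreover have "partial b (\<lambda>x. \<Sum>p=1..n. x p *\<^sub>R g p x) =
        (\<lambda>x. \<Sum>p=1..n. (if p = b then g p x else 0) + x p *\<^sub>R partial b (g p) x)"
      by (intro ext partial_coord_sum[OF Suc.hyps(1) assms(2)])
    ultimately show "has_partial a (partial b (\<lambda>x. \<Sum>p=1..n. x p *\<^sub>R g p x)) x
      (\<Sum>p=1..n. (if p = b then partial a (g p) x else 0) +
        ((if p = a then partial b (g p) x else 0) + x p *\<^sub>R partial a (partial b (g p)) x))"
      by (simp only:) (intro has_partial_sum has_partial_add has_partial_coord_scaleR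
        homogeneous_polys_has_partial[OF homogeneous_polys_partial(1)[OF Suc.hyps(1) assms(2)] assms(2)])
  qed
  show ?case unfolding * Suc.IH by (intro sum.cong refl) (simp add: add_ac)
qed

lemma euler_identity:
  assumes "f \<in> homogeneous_polys n j V" "subspace V"
  shows "(\<Sum>i=1..n. x i *\<^sub>R partial i f x) = real j *\<^sub>R f x"
  using assms
proof (induction rule: homogeneous_polys_induct)
  case (const v)
  have "partial i (\<lambda>_. v) x = 0" for i by (intro partialI has_partial_const)
  then show ?case by simp
next
  case (Suc j g)
  have "(\<Sum>i=1..n. x i *\<^sub>R partial i (\<lambda>x. \<Sum>l=1..n. x l *\<^sub>R g l x) x) =
      (\<Sum>i=1..n. \<Sum>l=1..n. (if l = i then x i *\<^sub>R g l x else 0) + x l *\<^sub>R x i *\<^sub>R partial i (g l) x)"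
    unfolding partial_coord_sum[OF Suc.hyps(1) assms(2)] scaleR_sum_right
    by (intro sum.cong refl) (simp add: scaleR_add_right mult.commute)
  also have "\<dots> = (\<Sum>l=1..n. x l *\<^sub>R g l x) + (\<Sum>l=1..n. x l *\<^sub>R (\<Sum>i=1..n. x i *\<^sub>R partial i (g l) x))"
    unfolding sum.distrib by (intro arg_cong2[of _ _ _ _ "(+)"])
      (simp, subst sum.swap, simp add: scaleR_sum_right)
  also have "\<dots> = real (Suc j) *\<^sub>R (\<Sum>l=1..n. x l *\<^sub>R g l x)"
    unfolding Suc.IH by (simp add: scaleR_sum_right flip: sum.distrib, simp add: distrib_left scaleR_add_left mult.commute)
  finally show ?case .
qed

lemma has_partial_subst:
  assumes "f \<in> homogeneous_polys n j V" "subspace V"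
    and L: "\<And>x i. i \<in> {1..n} \<Longrightarrow> L x i = (\<Sum>l=1..m. M i l * x l)"
    and p: "p \<in> {1..m}"
  shows "has_partial p (\<lambda>x. f (L x)) x (\<Sum>i=1..n. M i p *\<^sub>R partial i f (L x))"
  using assms(1,2)
proof (induction arbitrary: x rule: homogeneous_polys_induct)
  case (const v)
  have "partial i (\<lambda>_. v) y = 0" for i y by (intro partialI has_partial_const)
  then show ?case using has_partial_const by simp
next
  case (Suc j g)
  have coord: "has_partial p (\<lambda>x. L x i) x (M i p)" if "i \<in> {1..n}" for i
  proof -
    have "has_partial p (\<lambda>x. \<Sum>l=1..m. M i l *\<^sub>R x l) x (\<Sum>l=1..m. M i l *\<^sub>R (if l = p then 1 else 0))"
      by (intro has_partial_sum has_partial_cmult has_partial_coord)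
    moreover have "(\<Sum>l=1..m. M i l *\<^sub>R (if l = p then 1 else 0)) = M i p"
      using p by (simp add: if_distrib cong: if_cong)
    ultimately show ?thesis using L[OF that] by simp
  qed
  have "has_partial p (\<lambda>x. \<Sum>i=1..n. L x i *\<^sub>R g i (L x)) x
      (\<Sum>i=1..n. L x i *\<^sub>R (\<Sum>l=1..n. M l p *\<^sub>R partial l (g i) (L x)) + M i p *\<^sub>R g i (L x))"
    by (intro has_partial_sum has_partial_scaleR coord Suc.IH)
  moreover have "(\<Sum>i=1..n. M i p *\<^sub>R partial i (\<lambda>x. \<Sum>l=1..n. x l *\<^sub>R g l x) (L x)) =
      (\<Sum>i=1..n. \<Sum>l=1..n. (if l = i then M i p *\<^sub>R g l (L x) else 0) + L x l *\<^sub>R M i p *\<^sub>R partial i (g l) (L x))"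
    unfolding partial_coord_sum[OF Suc.hyps(1) assms(2)] scaleR_sum_right
    by (intro sum.cong refl) (simp add: scaleR_add_right mult.commute)
  moreover have "\<dots> = (\<Sum>i=1..n. L x i *\<^sub>R (\<Sum>l=1..n. M l p *\<^sub>R partial l (g i) (L x)) + M i p *\<^sub>R g i (L x))"
    unfolding sum.distrib by (subst add.commute, intro arg_cong2[of _ _ _ _ "(+)"])
      (subst sum.swap, simp add: scaleR_sum_right, simp)
  ultimately show ?case by simp
qed

lemmas partial_subst = partialI[OF has_partial_subst]

section \<open>The Dirac operator\<close>

lemma multivectors_real_subspace: "subspace (multivectors n t :: 'a::real_normed_field clifford set)"
  unfolding subspace_def by (auto intro: multivectors_add multivectors_scaleR)

lemmas hp_UNIV = homogeneous_polys_mono[OF _ subset_UNIV]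
lemmas has_partial_poly = homogeneous_polys_has_partial[OF hp_UNIV subspace_UNIV]
lemmas euler_poly = euler_identity[OF hp_UNIV subspace_UNIV]
lemmas partial_commute_poly = partial_commute[OF hp_UNIV subspace_UNIV]
lemmas has_partial_map_poly = has_partial_map[OF hp_UNIV subspace_UNIV]
lemmas partial_map_poly = partial_map[OF hp_UNIV subspace_UNIV]
lemmas partial_subst_poly = partial_subst[OF hp_UNIV subspace_UNIV]

lemma partial_in_poly: "f \<in> homogeneous_polys n j V \<Longrightarrow> partial i f \<in> homogeneous_polys n (j - 1) UNIV"
  by (rule homogeneous_polys_partial(1)[OF hp_UNIV subspace_UNIV])

lemma partial_const [simp]: "partial i (\<lambda>_. v) = (\<lambda>_. 0)"
  by (intro ext partialI has_partial_const)

lemma has_partial_partial: "has_partial i f x d \<Longrightarrow> has_partial i f x (partial i f x)"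
  by (simp add: partialI)

lemma dirac_zero [simp]: "dirac n (\<lambda>_. 0) x = 0"
  by (simp add: dirac_def)

lemma linear_mult_left: "linear (\<lambda>b. a * b)"
  and linear_mult_right: "linear (\<lambda>b. b * a)"
  for a :: "'a::real_algebra"
  by (intro linearI; simp add: algebra_simps)+

lemma linear_wedge: "linear (wedge u)" "linear (\<lambda>u. wedge u a)"
  and linear_bullet: "linear (bullet u)" "linear (\<lambda>u. bullet u a)"
  by (intro linearI;
    simp add: wedge_add_right wedge_scaleR_right bullet_add_right bullet_scaleR_right
      wedge_add_left wedge_scaleR_left bullet_add_left bullet_scaleR_left)+

lemma linear_coeff: "linear (\<lambda>a::'a::real_normed_field clifford. coeff a A)"
  by (intro linearI) simp_all

lemma linear_cscale: "linear (\<lambda>a::'a::real_normed_field clifford. c *\<^sub>C a)"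
  by (intro linearI) (simp_all add: cliff.scale_right_distrib cscale_scaleR)

text \<open>The products \<open>x f(x)\<close>, \<open>x \<and> f(x)\<close>, \<open>x \<bullet> f(x)\<close> and \<open>f(x) x\<close> are treated uniformly as \<open>\<B> x f(x)\<close>.\<close>

locale left_product =
  fixes \<B> :: "'a::real_normed_field clifford \<Rightarrow> 'a clifford \<Rightarrow> 'a clifford"
  assumes linear_left: "linear (\<lambda>u. \<B> u a)" and linear_right: "linear (\<B> u)"
begin

lemma cvec_expand: "\<B> (cvec n x) a = (\<Sum>l=1..n. x l *\<^sub>R \<B> (gen l) a)"
  unfolding cvec_def by (simp add: linear_sum[OF linear_left] linear_scale[OF linear_left])

lemma poly:
  assumes f: "f \<in> homogeneous_polys n j V" and W: "subspace W" and le: "p \<le> n"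
    and *: "\<And>i v. i \<in> {1..p} \<Longrightarrow> v \<in> V \<Longrightarrow> \<B> (gen i) v \<in> W"
  shows "(\<lambda>x. \<B> (cvec p x) (f x)) \<in> homogeneous_polys n (Suc j) W"
  unfolding cvec_expand
proof (intro homogeneous_polys_sum W homogeneous_polys_var subspace_0)
  fix i assume i: "i \<in> {1..p}"
  then show "i \<in> {1..n}" using le by auto
  show "(\<lambda>x. \<B> (gen i) (f x)) \<in> homogeneous_polys n j W"
    by (rule homogeneous_polys_map[OF f linear_right *[OF i]])
qed

lemma has_partial:
  assumes f: "f \<in> homogeneous_polys n j V"
  shows "has_partial i (\<lambda>x. \<B> (cvec p x) (f x)) x
    ((if i \<in> {1..p} then \<B> (gen i) (f x) else 0) + \<B> (cvec p x) (partial i f x))"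
proof -
  have "has_partial i (\<lambda>x. \<Sum>l=1..p. x l *\<^sub>R \<B> (gen l) (f x)) x
      (\<Sum>l=1..p. (if l = i then \<B> (gen l) (f x) else 0) + x l *\<^sub>R \<B> (gen l) (partial i f x))"
    by (intro has_partial_sum has_partial_coord_scaleR has_partial_map_poly[OF f] linear_right)
  moreover have "(\<Sum>l=1..p. if l = i then \<B> (gen l) (f x) else 0) = (if i \<in> {1..p} then \<B> (gen i) (f x) else 0)"
    by (subst sum.delta) auto
  ultimately show ?thesis by (simp add: cvec_expand sum.distrib)
qed

end

interpretation mult: left_product "(*)"
  by standard (simp_all add: algebra_simps)

interpretation wedge: left_product wedge
  by standard (simp_all add: wedge_add_left wedge_add_right wedge_scaleR_left wedge_scaleR_right)

interpretation bullet: left_product bullet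
  by standard (simp_all add: bullet_add_left bullet_add_right bullet_scaleR_left bullet_scaleR_right)

interpretation involute_mult: left_product "\<lambda>u a. involute a * u"
  by standard (simp_all add: involute_add involute_scaleR algebra_simps)

lemma gen_eq_cvec: "i \<in> {1..n} \<Longrightarrow> gen i = (cvec n (\<lambda>l. if l = i then 1 else 0) :: 'a::real_normed_field clifford)"
  unfolding cvec_def by (simp add: if_distrib if_distribR cong: if_cong)

lemma gen_cvec:
  "i \<in> {1..n} \<Longrightarrow> gen i * cvec n x = - (cvec n x * gen i) - (2 * x i) *\<^sub>R (1 :: 'a::real_normed_field clifford)"
proof -
  assume i: "i \<in> {1..n}"
  have "gen i * cvec n x + cvec n x * gen i = (- 2 * x i) *\<^sub>R (1 :: 'a clifford)"
    unfolding gen_eq_cvec[OF i] cvec_anticommute using i by (simp add: if_distrib if_distribR cong: if_cong)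
  then have "gen i * cvec n x = (- 2 * x i) *\<^sub>R (1 :: 'a clifford) - cvec n x * gen i"
    by (simp only: eq_diff_eq)
  then show ?thesis by simp
qed

lemma gen_square: "gen i * gen i = (- 1 :: 'a::real_normed_field clifford)"
proof -
  have "2 *\<^sub>R (gen i * gen i) = (2 *\<^sub>R (- 1) :: 'a clifford)"
    using gen_anticommute[of i i, where 'a='a] by (simp add: scaleR_2)
  then show ?thesis by (simp only: scaleR_cancel_left) simp
qed

lemma gen_gen_mult: "gen i * (gen i * a) = - (a :: 'a::real_normed_field clifford)"
  by (simp add: gen_square flip: mult.assoc)

text \<open>The summand \<open>n\<close> comes from \<open>e_i e_i = - 1\<close>, the summand
  \<open>2 j\<close> from the rest term of \<open>e_i x = - x e_i - 2 x_i\<close>, which Euler's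
  identity sums up.\<close>

lemma dirac_cvec_mult:
  fixes f :: "(nat \<Rightarrow> real) \<Rightarrow> 'a::real_normed_field clifford"
  assumes f: "f \<in> homogeneous_polys n j V"
  shows "dirac n (\<lambda>x. cvec n x * f x) x = - (real n + 2 * real j) *\<^sub>R f x - cvec n x * dirac n f x"
proof -
  have "dirac n (\<lambda>x. cvec n x * f x) x = (\<Sum>i=1..n. gen i * (gen i * f x + cvec n x * partial i f x))"
    unfolding dirac_def by (intro sum.cong refl) (simp add: partialI[OF mult.has_partial[OF f]])
  also have "\<dots> = (\<Sum>i=1..n. - f x - cvec n x * (gen i * partial i f x) - 2 *\<^sub>R x i *\<^sub>R partial i f x)"
  proof (intro sum.cong refl)
    fix i assume i: "i \<in> {1..n}"
    have "gen i * (cvec n x * partial i f x) = (gen i * cvec n x) * partial i f x"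
      by (simp only: mult.assoc)
    also have "\<dots> = - (cvec n x * (gen i * partial i f x)) - 2 *\<^sub>R x i *\<^sub>R partial i f x"
      unfolding gen_cvec[OF i] by (simp add: left_diff_distrib mult.assoc)
    finally show "gen i * (gen i * f x + cvec n x * partial i f x) =
        - f x - cvec n x * (gen i * partial i f x) - 2 *\<^sub>R x i *\<^sub>R partial i f x"
      by (simp add: distrib_left gen_gen_mult)
  qed
  also have "\<dots> = - real n *\<^sub>R f x - cvec n x * dirac n f x - 2 *\<^sub>R (\<Sum>i=1..n. x i *\<^sub>R partial i f x)"
    unfolding dirac_def by (simp add: sum_subtractf sum_distrib_left scaleR_sum_right scaleR_conv_of_real)
  also have "\<dots> = - (real n + 2 * real j) *\<^sub>R f x - cvec n x * dirac n f x"
    unfolding euler_poly[OF f] by (simp add: algebra_simps)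
  finally show ?thesis .
qed

lemma dirac_involute_mult:
  assumes f: "f \<in> homogeneous_polys n j (multivectors n t :: 'a::real_normed_field clifford set)"
  shows "dirac n (\<lambda>x. involute (f x) * cvec n x) x =
    (2 * real t - real n) *\<^sub>R f x - involute (dirac n f x) * cvec n x"
proof -
  have "dirac n (\<lambda>x. involute (f x) * cvec n x) x =
      (\<Sum>i=1..n. gen i * (involute (f x) * gen i + involute (partial i f x) * cvec n x))"
    unfolding dirac_def by (intro sum.cong refl) (simp add: partialI[OF involute_mult.has_partial[OF f]])
  also have "\<dots> = (\<Sum>i=1..n. gen i * involute (f x) * gen i) + (\<Sum>i=1..n. gen i * involute (partial i f x)) * cvec n x"
    by (simp add: distrib_left sum.distrib sum_distrib_right mult.assoc)
  also have "(\<Sum>i=1..n. gen i * involute (partial i f x)) = - involute (dirac n f x)"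
    by (simp add: dirac_def involute_sum involute_mult sum_negf)
  finally show ?thesis
    using sum_gen_involute_gen[OF homogeneous_polys_range[OF f multivectors_real_subspace]] by simp
qed

lemma monogenicsD:
  assumes "f \<in> monogenics n t j"
  shows "f \<in> homogeneous_polys n j (multivectors n t)" "dirac n f x = 0"
  using assms by (auto simp: monogenics_def)

lemma dirac_scaleR_add:
  assumes "\<And>i. has_partial i f x (partial i f x)" "\<And>i. has_partial i g x (partial i g x)"
  shows "dirac n (\<lambda>x. a *\<^sub>R f x + b *\<^sub>R g x) x = a *\<^sub>R dirac n f x + b *\<^sub>R dirac n g x"
proof -
  have "partial i (\<lambda>x. a *\<^sub>R f x + b *\<^sub>R g x) x = a *\<^sub>R partial i f x + b *\<^sub>R partial i g x" for i
    by (intro partialI has_partial_add has_partial_cmult assms)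
  then show ?thesis unfolding dirac_def by (simp add: distrib_left sum.distrib scaleR_sum_right)
qed

text \<open>Both products are half sums of \<open>x f\<close> and plus or minus
  \<open>involute f * x\<close>. On a monogenic \<open>f\<close> the Dirac operator multiplies these
  two by \<open>- (n + 2 j)\<close> and \<open>2 t - n\<close>, so the eigenvalues are the half sum
  and half difference of these numbers.\<close>

lemma dirac_wedge_bullet:
  assumes f: "f \<in> monogenics n t j"
  shows "dirac n (\<lambda>x. wedge (cvec n x) (f x)) x = (real t - real n - real j) *\<^sub>R f x"
    and "dirac n (\<lambda>x. bullet (cvec n x) (f x)) x = - (real t + real j) *\<^sub>R f x"
proof -
  note f' = monogenicsD(1)[OF f] monogenicsD(2)[OF f]
  have p1: "has_partial i (\<lambda>x. cvec n x * f x) x (partial i (\<lambda>x. cvec n x * f x) x)" for i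
    by (rule has_partial_partial[OF mult.has_partial[OF f'(1)]])
  have p2: "has_partial i (\<lambda>x. involute (f x) * cvec n x) x (partial i (\<lambda>x. involute (f x) * cvec n x) x)" for i
    by (rule has_partial_partial[OF involute_mult.has_partial[OF f'(1)]])
  have *: "dirac n (\<lambda>x. a *\<^sub>R (cvec n x * f x) + b *\<^sub>R (involute (f x) * cvec n x)) x =
      (b * (2 * real t - real n) - a * (real n + 2 * real j)) *\<^sub>R f x" for a b
    unfolding dirac_scaleR_add[OF p1 p2] dirac_cvec_mult[OF f'(1)] dirac_involute_mult[OF f'(1)] f'(2)
    by (simp add: algebra_simps)
  show "dirac n (\<lambda>x. wedge (cvec n x) (f x)) x = (real t - real n - real j) *\<^sub>R f x"
    unfolding wedge_def scaleR_add_right * by (intro arg_cong2[of _ _ _ _ scaleR]) (simp_all add: field_simps)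
  show "dirac n (\<lambda>x. bullet (cvec n x) (f x)) x = - (real t + real j) *\<^sub>R f x"
  proof -
    have "dirac n (\<lambda>x. bullet (cvec n x) (f x)) x =
        dirac n (\<lambda>x. (1/2) *\<^sub>R (cvec n x * f x) + (- 1/2) *\<^sub>R (involute (f x) * cvec n x)) x"
      by (simp add: bullet_def scaleR_diff_right)
    then show ?thesis
      unfolding * by (simp only:) (intro arg_cong2[of _ _ _ _ scaleR]; simp add: field_simps)
  qed
qed

text \<open>Applying the Dirac operator to \<open>x \<and> f = 0\<close> returns
  \<open>t - n - j\<close> times \<open>f\<close>. The excluded case contains the constant
  pseudoscalars, for which \<open>x \<and> f = 0\<close> always holds.\<close>

lemma monogenic_wedge_zero:
  assumes f: "f \<in> monogenics n t j" and "\<And>x. wedge (cvec n x) (f x) = 0" "t \<noteq> n + j"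
  shows "f x = 0"
proof -
  have "(real t - real n - real j) *\<^sub>R f x = 0"
    using dirac_wedge_bullet(1)[OF f, of x] assms(2) by simp
  moreover have "real t - real n - real j \<noteq> 0" using assms(3) by linarith
  ultimately show ?thesis by simp
qed

lemma monogenic_bullet_zero:
  assumes f: "f \<in> monogenics n t j" and "\<And>x. bullet (cvec n x) (f x) = 0" "t + j \<noteq> 0"
  shows "f x = 0"
proof -
  have "- (real t + real j) *\<^sub>R f x = 0"
    using dirac_wedge_bullet(2)[OF f, of x] assms(2) by simp
  moreover have "- (real t + real j) \<noteq> 0" using assms(3) by linarith
  ultimately show ?thesis by (metis scaleR_eq_0_iff)
qed

text \<open>A monogenic \<open>t\<close>-vector-valued function is closed and coclosed, since the two parts of
  \<open>\<partial>f\<close> have degrees \<open>t + 1\<close> and \<open>t - 1\<close>.\<close>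

lemma monogenic_closed:
  assumes f: "f \<in> monogenics n t j"
  shows "(\<Sum>i=1..n. wedge (gen i) (partial i f x)) = 0" "(\<Sum>i=1..n. bullet (gen i) (partial i f x)) = 0"
proof -
  let ?W = "\<Sum>i=1..n. wedge (gen i) (partial i f x)" and ?B = "\<Sum>i=1..n. bullet (gen i) (partial i f x)"
  have p: "partial i f x \<in> multivectors n t" for i
    by (rule homogeneous_polys_range[OF homogeneous_polys_partial(1)[OF monogenicsD(1)[OF f]]])
      (rule multivectors_real_subspace)+
  have W: "?W \<in> multivectors n (Suc t)" and B: "?B \<in> multivectors n (t - 1)"
    by (intro multivectors_sum wedge_gen_multivectors p bullet_gen_multivectors; assumption)+
  have "?W + ?B = dirac n f x"
    by (simp add: dirac_def wedge_plus_bullet flip: sum.distrib)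
  then have eq: "?W = - ?B" using monogenicsD(2)[OF f] by (simp add: eq_neg_iff_add_eq_0)
  have "?W \<in> multivectors n (t - 1)" unfolding eq by (rule multivectors_minus[OF B])
  then show "?W = 0" using multivectors_disjoint[OF W] by simp
  then show "?B = 0" using eq by simp
qed

section \<open>Harmonic polynomials and the separation of their degrees on the sphere\<close>

definition laplacian :: "nat \<Rightarrow> ((nat \<Rightarrow> real) \<Rightarrow> 'b::real_normed_vector) \<Rightarrow> (nat \<Rightarrow> real) \<Rightarrow> 'b"
  where "laplacian n f x = (\<Sum>i=1..n. partial i (partial i f) x)"

text \<open>The square of the Dirac operator is minus the Laplacian: mixed derivatives commute, so
  the double sum may be symmetrized in \<open>i\<close> and \<open>l\<close>, and the anticommutator
  of the generators is \<open>- 2\<close> on the diagonal and \<open>0\<close> elsewhere.\<close>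

lemma monogenic_harmonic:
  fixes f :: "(nat \<Rightarrow> real) \<Rightarrow> 'a::real_normed_field clifford"
  assumes f: "f \<in> homogeneous_polys n j V" and d: "\<And>x. dirac n f x = 0"
  shows "laplacian n f x = 0"
proof -
  have "partial i (dirac n f) x = (\<Sum>l=1..n. gen l * partial i (partial l f) x)" for i
    unfolding dirac_def[abs_def]
    by (intro partialI has_partial_sum has_partial_map_poly[OF partial_in_poly[OF f]] linear_mult_left)
  moreover have "dirac n f = (\<lambda>_. 0)" using d by (rule ext)
  ultimately have z: "(\<Sum>i=1..n. \<Sum>l=1..n. gen i * gen l * partial i (partial l f) x) = 0"
    by (simp add: sum_distrib_left[symmetric] mult.assoc flip: sum_distrib_left)
  have z': "(\<Sum>i=1..n. \<Sum>l=1..n. gen l * gen i * partial i (partial l f) x) = 0"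
    using z by (subst sum.swap) (simp add: partial_commute_poly[OF f, of _ _ x])
  have "0 = (\<Sum>i=1..n. \<Sum>l=1..n. (gen i * gen l + gen l * gen i) * partial i (partial l f) x)"
    using z z' by (simp add: distrib_right sum.distrib)
  also have "\<dots> = (\<Sum>i=1..n. - 2 * partial i (partial i f) x)"
    by (intro sum.cong refl) (simp add: gen_anticommute if_distrib if_distribR cong: if_cong)
  also have "\<dots> = - 2 * laplacian n f x"
    by (simp add: laplacian_def sum_distrib_left sum_negf)
  also have "\<dots> = (- 2) *\<^sub>R laplacian n f x" by (simp add: scaleR_conv_of_real)
  finally show ?thesis by simp
qed

context left_product
begin

lemma laplacian_cvec:
  assumes f: "f \<in> homogeneous_polys n j V"
  shows "laplacian n (\<lambda>x. \<B> (cvec n x) (f x)) x =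
    2 *\<^sub>R (\<Sum>i=1..n. \<B> (gen i) (partial i f x)) + \<B> (cvec n x) (laplacian n f x)"
proof -
  have "partial i (partial i (\<lambda>x. \<B> (cvec n x) (f x))) x =
      2 *\<^sub>R \<B> (gen i) (partial i f x) + \<B> (cvec n x) (partial i (partial i f) x)" if i: "i \<in> {1..n}" for i
  proof -
    have "partial i (\<lambda>x. \<B> (cvec n x) (f x)) = (\<lambda>x. \<B> (gen i) (f x) + \<B> (cvec n x) (partial i f x))"
      using partialI[OF has_partial[OF f, of i n]] i by auto
    moreover have "has_partial i (\<lambda>x. \<B> (gen i) (f x) + \<B> (cvec n x) (partial i f x)) x
      (\<B> (gen i) (partial i f x) + ((if i \<in> {1..n} then \<B> (gen i) (partial i f x) else 0) +
        \<B> (cvec n x) (partial i (partial i f) x)))"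
      by (intro has_partial_add has_partial[OF partial_in_poly[OF f]] has_partial_map_poly[OF f] linear_right)
    ultimately show ?thesis using partialI i by (simp add: scaleR_2 add.assoc)
  qed
  then show ?thesis
    unfolding laplacian_def by (simp add: sum.distrib scaleR_sum_right linear_sum[OF linear_right])
qed

end

text \<open>The first-order term in \<open>laplacian_cvec\<close> is the outer or inner part of the
  Dirac operator, and \<open>monogenic_closed\<close> makes each of them vanish separately.\<close>

lemma wedge_cvec_harmonic:
  assumes f: "f \<in> monogenics n t j"
  shows "laplacian n (\<lambda>x. wedge (cvec n x) (f x)) x = 0" "laplacian n (\<lambda>x. bullet (cvec n x) (f x)) x = 0"
  using monogenic_closed[OF f, of x] monogenic_harmonic[OF monogenicsD[OF f]]
  by (simp_all add: wedge.laplacian_cvec[OF monogenicsD(1)[OF f]] bullet.laplacian_cvec[OF monogenicsD(1)[OF f]])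

definition sqnorm :: "nat \<Rightarrow> (nat \<Rightarrow> real) \<Rightarrow> real"
  where "sqnorm n x = (\<Sum>i=1..n. (x i)\<^sup>2)"

lemma sqnorm_poly: "sqnorm n \<in> homogeneous_polys n 2 UNIV"
proof -
  have "(\<lambda>x. \<Sum>i=1..n. x i *\<^sub>R (x i *\<^sub>R (1::real))) \<in> homogeneous_polys n (Suc (Suc 0)) UNIV"
    by (intro homogeneous_polys_Suc homogeneous_polys_var homogeneous_polys_const) auto
  then show ?thesis by (simp add: sqnorm_def[abs_def] power2_eq_square numeral_2_eq_2)
qed

lemma has_partial_sqnorm:
  assumes "i \<in> {1..n}"
  shows "has_partial i (sqnorm n) x (2 * x i)"
proof -
  have "has_partial i (\<lambda>x. \<Sum>l=1..n. x l *\<^sub>R x l) x (\<Sum>l=1..n. (if l = i then x l else 0) + x l *\<^sub>R (if l = i then 1 else 0))"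
    by (intro has_partial_sum has_partial_coord_scaleR has_partial_coord)
  moreover have "(\<Sum>l=1..n. (if l = i then x l else 0) + x l *\<^sub>R (if l = i then 1 else 0)) = 2 * x i"
    using assms by (simp add: sum.distrib if_distrib cong: if_cong)
  ultimately show ?thesis by (simp add: sqnorm_def[abs_def] power2_eq_square)
qed

lemma sqnorm_nonneg: "0 \<le> sqnorm n x"
  by (simp add: sqnorm_def sum_nonneg)

lemma sqnorm_scale: "sqnorm n (\<lambda>i. c * x i) = c\<^sup>2 * sqnorm n x"
  by (simp add: sqnorm_def power_mult_distrib sum_distrib_left)

lemma laplacian_sqnorm_scaleR:
  assumes f: "f \<in> homogeneous_polys n j V"
  shows "laplacian n (\<lambda>x. sqnorm n x *\<^sub>R f x) x = sqnorm n x *\<^sub>R laplacian n f x + (2 * real n + 4 * real j) *\<^sub>R f x"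
proof -
  have "partial i (partial i (\<lambda>x. sqnorm n x *\<^sub>R f x)) x =
      sqnorm n x *\<^sub>R partial i (partial i f) x + 4 *\<^sub>R x i *\<^sub>R partial i f x + 2 *\<^sub>R f x" if i: "i \<in> {1..n}" for i
  proof -
    have "partial i (\<lambda>x. sqnorm n x *\<^sub>R f x) = (\<lambda>x. sqnorm n x *\<^sub>R partial i f x + 2 *\<^sub>R x i *\<^sub>R f x)"
      using partialI[OF has_partial_scaleR[OF has_partial_sqnorm[OF i] has_partial_poly[OF f]]]
      by (auto simp: mult.commute)
    moreover have "has_partial i (\<lambda>x. sqnorm n x *\<^sub>R partial i f x + 2 *\<^sub>R x i *\<^sub>R f x) x
      ((sqnorm n x *\<^sub>R partial i (partial i f) x + (2 * x i) *\<^sub>R partial i f x) +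
       2 *\<^sub>R ((if i = i then f x else 0) + x i *\<^sub>R partial i f x))"
      by (intro has_partial_add has_partial_cmult has_partial_coord_scaleR has_partial_scaleR
        has_partial_sqnorm[OF i] has_partial_poly[OF f] has_partial_poly[OF partial_in_poly[OF f]])
    ultimately have "partial i (partial i (\<lambda>x. sqnorm n x *\<^sub>R f x)) x =
      (sqnorm n x *\<^sub>R partial i (partial i f) x + (2 * x i) *\<^sub>R partial i f x) +
       2 *\<^sub>R ((if i = i then f x else 0) + x i *\<^sub>R partial i f x)"
      by (simp only: partialI)
    then show ?thesis by (simp add: scaleR_add_right flip: scaleR_add_left)
  qed
  then have "laplacian n (\<lambda>x. sqnorm n x *\<^sub>R f x) x =
      sqnorm n x *\<^sub>R laplacian n f x + 4 *\<^sub>R (\<Sum>i=1..n. x i *\<^sub>R partial i f x) + (2 * real n) *\<^sub>R f x"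
    unfolding laplacian_def by (simp add: sum.distrib scaleR_sum_right sum_constant_scaleR mult.commute)
  then show ?thesis unfolding euler_poly[OF f] by (simp add: algebra_simps)
qed

lemma laplacian_sqnorm_power:
  assumes f: "f \<in> homogeneous_polys n j UNIV" and "\<And>x. laplacian n f x = 0" "1 \<le> n"
  shows "(\<lambda>x. sqnorm n x ^ l *\<^sub>R f x) \<in> homogeneous_polys n (j + 2 * l) UNIV \<and>
    (\<exists>c>0. \<forall>x. laplacian n (\<lambda>x. sqnorm n x ^ Suc l *\<^sub>R f x) x = c *\<^sub>R sqnorm n x ^ l *\<^sub>R f x)"
proof (induction l)
  case 0
  then show ?case
    using laplacian_sqnorm_scaleR[OF f] assms by (auto intro!: exI[of _ "2 * real n + 4 * real j"])
next
  case (Suc l)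
  then obtain c where c: "c > 0" "\<And>x. laplacian n (\<lambda>x. sqnorm n x ^ Suc l *\<^sub>R f x) x = c *\<^sub>R sqnorm n x ^ l *\<^sub>R f x"
    by blast
  have p: "(\<lambda>x. sqnorm n x ^ Suc l *\<^sub>R f x) \<in> homogeneous_polys n (j + 2 * Suc l) UNIV"
    using homogeneous_polys_mult[OF sqnorm_poly subspace_UNIV conjunct1[OF Suc.IH]] by (simp add: add_ac)
  have "laplacian n (\<lambda>x. sqnorm n x ^ Suc (Suc l) *\<^sub>R f x) x =
      (c + (2 * real n + 4 * real (j + 2 * Suc l))) *\<^sub>R sqnorm n x ^ Suc l *\<^sub>R f x" for x
    using laplacian_sqnorm_scaleR[OF p, of x] unfolding c(2) by (simp add: algebra_simps)
  moreover have "0 < c + (2 * real n + 4 * real (j + 2 * Suc l))" using c(1) by simp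
  ultimately show ?case using p by blast
qed

lemma homogeneous_polys_zero_sphere:
  assumes f: "f \<in> homogeneous_polys n j V" and "1 \<le> n" and z: "\<And>x. sqnorm n x = 1 \<Longrightarrow> f x = 0"
  shows "f x = 0"
proof (cases "sqnorm n x = 0")
  case False
  define c where "c = sqrt (sqnorm n x)"
  have c: "c \<noteq> 0" "c\<^sup>2 = sqnorm n x" using False sqnorm_nonneg[of n x] by (auto simp: c_def)
  then have "sqnorm n (\<lambda>i. inverse c * x i) = 1"
    using False by (simp add: sqnorm_scale power_inverse)
  then have "f (\<lambda>i. inverse c * x i) = 0" by (rule z)
  then show ?thesis using c homogeneous_polys_homogeneous[OF hp_UNIV[OF f] subspace_UNIV, of "inverse c" x] by simp
next
  case True
  then have "\<And>i. i \<in> {1..n} \<Longrightarrow> x i = 0 * x i"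
    unfolding sqnorm_def by (subst (asm) sum_nonneg_eq_0_iff) auto
  then have "f x = f (\<lambda>i. 0 * x i)" by (rule homogeneous_polys_cong[OF f])
  then have *: "f x = 0 ^ j *\<^sub>R f x"
    using homogeneous_polys_homogeneous[OF hp_UNIV[OF f] subspace_UNIV, of 0 x] by simp
  show ?thesis
  \<comment> \<open>At the origin homogeneity says nothing in degree \<open>0\<close>. A constant is
    compared with its value at a unit vector, which exists because \<open>1 \<le> n\<close>.\<close>
  proof (cases "j = 0")
    case True
    then obtain v where v: "f = (\<lambda>_. v)" using f by (auto simp: homogeneous_polys_0)
    have "sqnorm n (\<lambda>i. if i = 1 then 1 else 0) = 1"
      using assms(2) by (simp add: sqnorm_def if_distrib if_distribR cong: if_cong)
    then show ?thesis using z v by metis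
  qed (use * in \<open>simp add: power_0_left\<close>)
qed

text \<open>If \<open>i + j\<close> is odd, comparing \<open>x\<close> with \<open>- x\<close> gives
  \<open>f x = - f x\<close>. If it is even, homogeneity extends the equality to
  \<open>g = |x|^(2 l + 2) f\<close> on the whole space, and the Laplacian of the right side is a
  positive multiple of \<open>|x|^(2 l) f\<close>, while that of \<open>g\<close> is
  \<open>0\<close>.\<close>

lemma harmonic_separation_less:
  assumes f: "f \<in> homogeneous_polys n i UNIV" "\<And>x. laplacian n f x = 0"
    and g: "g \<in> homogeneous_polys n j UNIV" "\<And>x. laplacian n g x = 0"
    and "1 \<le> n" "i < j" and eq: "\<And>x. sqnorm n x = 1 \<Longrightarrow> f x = g x" and x: "sqnorm n x = 1"
  shows "f x = 0"
proof (cases "even (i + j)")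
  case False
  have minus: "sqnorm n (\<lambda>l. (- 1) * x l) = 1" using sqnorm_scale[of n "- 1" x] x by simp
  have "(- 1) ^ i *\<^sub>R f x = (- 1) ^ j *\<^sub>R g x"
    using eq[OF minus] homogeneous_polys_homogeneous[OF f(1) subspace_UNIV, of "- 1"]
      homogeneous_polys_homogeneous[OF g(1) subspace_UNIV, of "- 1"] by simp
  then have "f x = - f x" using False eq[OF x] by (auto simp: minus_one_power_iff split: if_splits)
  then have "2 *\<^sub>R f x = 0" by (metis scaleR_2 add.right_inverse)
  then show ?thesis by simp
next
  case True
  then obtain l where l: "j = i + 2 * Suc l"
    using \<open>i < j\<close> by (metis add_diff_cancel_left' even_add even_diff_nat less_imp_add_positive evenE
        mult_Suc_right not0_implies_Suc add.commute mult_0_right neq0_conv)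
  have "sqnorm n y ^ Suc l *\<^sub>R f y - g y = 0" for y
  proof (rule homogeneous_polys_zero_sphere[where x = y])
    show "(\<lambda>y. sqnorm n y ^ Suc l *\<^sub>R f y - g y) \<in> homogeneous_polys n j UNIV"
      using homogeneous_polys_add[OF subspace_UNIV, OF _ homogeneous_polys_scaleR[OF subspace_UNIV g(1), of "- 1"]]
        conjunct1[OF laplacian_sqnorm_power[OF f \<open>1 \<le> n\<close>, of "Suc l"]] l by fastforce
  qed (use eq assms in auto)
  then have "g = (\<lambda>y. sqnorm n y ^ Suc l *\<^sub>R f y)" by (intro ext) simp
  moreover obtain c where "c > 0" "\<And>y. laplacian n (\<lambda>y. sqnorm n y ^ Suc l *\<^sub>R f y) y = c *\<^sub>R sqnorm n y ^ l *\<^sub>R f y"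
    using laplacian_sqnorm_power[OF f \<open>1 \<le> n\<close>, of l] by blast
  ultimately have "c *\<^sub>R sqnorm n x ^ l *\<^sub>R f x = 0" using g(2) by metis
  then show ?thesis using x \<open>c > 0\<close> by simp
qed

lemma harmonic_separation:
  assumes f: "f \<in> homogeneous_polys n i V" "\<And>x. laplacian n f x = 0"
    and g: "g \<in> homogeneous_polys n j W" "\<And>x. laplacian n g x = 0"
    and n: "1 \<le> n" and "i \<noteq> j" and eq: "\<And>x. sqnorm n x = 1 \<Longrightarrow> f x = g x"
  shows "f x = 0"
proof (rule homogeneous_polys_zero_sphere[OF f(1) n])
  fix x assume x: "sqnorm n x = 1"
  note f' = hp_UNIV[OF f(1)] f(2) and g' = hp_UNIV[OF g(1)] g(2)
  show "f x = 0"
  proof (cases "i < j")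
    case True
    then show ?thesis using harmonic_separation_less[OF f' g' n _ eq x] by blast
  next
    case False
    then have "g x = 0" using harmonic_separation_less[OF g' f' n _ eq[symmetric] x] \<open>i \<noteq> j\<close> by simp
    then show ?thesis using eq[OF x] by simp
  qed
qed

section \<open>The scalar embedding factors\<close>

text \<open>Divided powers with integer exponent, zero for negative exponents: with this convention the
  differentiation rules below hold without exception at the boundary of the range of summation.\<close>

definition divpow :: "int \<Rightarrow> real \<Rightarrow> real"
  where "divpow z t = (if z < 0 then 0 else t ^ nat z / fact (nat z))"

lemma divpow_neg [simp]: "z < 0 \<Longrightarrow> divpow z t = 0"
  by (simp add: divpow_def)

lemma divpow_int: "divpow (int n) t = t ^ n / fact n"
  by (simp add: divpow_def)

lemma divpow_mult: "t * divpow z t = (of_int z + 1) * divpow (z + 1) t"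
proof (cases "z \<ge> 0")
  case True
  then obtain p where z: "z = int p" by (elim nonneg_int_cases)
  have "nat (z + 1) = Suc p" by (simp add: z)
  moreover have "(real p + 1) * (t ^ Suc p / fact (Suc p)) = t * (t ^ p / fact p)"
    by (simp add: add.commute)
  ultimately show ?thesis by (simp add: divpow_def z del: fact_Suc power_Suc)
next
  case False
  then show ?thesis by (cases "z = - 1") (simp_all add: divpow_def)
qed

lemma DERIV_divpow: "(divpow z has_real_derivative divpow (z - 1) t) (at t)"
proof (cases "z > 0")
  case True
  then obtain p where p: "nat z = Suc p" "nat (z - 1) = p"
    by (metis Suc_nat_eq_nat_zadd1 add.commute diff_add_cancel zle_diff1_eq)
  have "((\<lambda>t. t ^ Suc p / fact (Suc p)) has_real_derivative t ^ p / fact p) (at t)"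
    by (rule derivative_eq_intros refl | simp)+
  then show ?thesis using True p by (simp add: divpow_def[abs_def])
next
  case False
  have "divpow z = (\<lambda>t. if z = 0 then 1 else 0)"
    using False by (auto simp: divpow_def)
  then show ?thesis using False by simp
qed

text \<open>If \<open>H\<close> is harmonic of degree \<open>j\<close> on \<open>R^N\<close>, the
  Laplacian sends \<open>|x|^(2 i) H\<close> to
  \<open>4 i (N/2 + j + i - 1) |x|^(2 i - 2) H\<close>. The denominators are the products of these
  numbers, so that the series with the terms
  \<open>ck_coeff N j i * |x|^(2 i) * t^(z - 2 i) / (z - 2 i)! * H\<close> is harmonic in one more
  variable \<open>t\<close>.\<close>

definition ck_coeff :: "nat \<Rightarrow> nat \<Rightarrow> nat \<Rightarrow> real"
  where "ck_coeff N j i = (- 1) ^ i / (4 ^ i * fact i * pochhammer (real N / 2 + real j) i)"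

text \<open>Up to a Pochhammer factor, this is \<open>F\<^sup>(\<^sup>z\<^sup>)\<^bsub>N+1,j\<^esub>\<close> as a polynomial in \<open>t = x\<^sub>m\<close> and \<open>r = |\<underline>x|\<^sup>2\<close>.
  Unlike the Gegenbauer form, it is meaningful for \<open>N = 1\<close>, where the induction on the dimension starts.\<close>

definition ck_sum :: "nat \<Rightarrow> nat \<Rightarrow> int \<Rightarrow> real \<Rightarrow> real \<Rightarrow> real"
  where "ck_sum N j z t r = (\<Sum>i\<le>nat z. ck_coeff N j i * r ^ i * divpow (z - 2 * int i) t)"

text \<open>Terms with \<open>2 i > z\<close> vanish by the convention for \<open>divpow\<close>.
  The freedom in the upper bound lets sums with different \<open>z\<close> be compared term by
  term.\<close>

lemma ck_sum_bound:
  "nat z \<le> M \<Longrightarrow> ck_sum N j z t r = (\<Sum>i\<le>M. ck_coeff N j i * r ^ i * divpow (z - 2 * int i) t)"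
  unfolding ck_sum_def by (rule sum.mono_neutral_left) auto

lemma ck_sum_le:
  "w \<le> z \<Longrightarrow> ck_sum N j w t r = (\<Sum>i\<le>nat z. ck_coeff N j i * r ^ i * divpow (w - 2 * int i) t)"
  by (intro ck_sum_bound nat_mono)

lemma ck_sum_neg [simp]: "z < 0 \<Longrightarrow> ck_sum N j z t r = 0"
  by (simp add: ck_sum_def)

lemma ck_sum_0 [simp]: "ck_sum N j 0 t r = 1"
  by (simp add: ck_sum_def ck_coeff_def divpow_def)

lemma DERIV_ck_sum_t: "((\<lambda>t. ck_sum N j z t r) has_real_derivative ck_sum N j (z - 1) t r) (at t)"
proof -
  have "ck_sum N j (z - 1) t r = (\<Sum>i\<le>nat z. ck_coeff N j i * r ^ i * divpow (z - 2 * int i - 1) t)"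
    by (subst ck_sum_le[of _ z]) (simp_all add: algebra_simps)
  then show ?thesis
    unfolding ck_sum_def by (simp only:) (intro DERIV_sum DERIV_cmult DERIV_divpow)
qed

lemma ck_coeff_Suc:
  assumes "1 \<le> N"
  shows "ck_coeff N j (Suc i) * real (Suc i) = - (1 / (2 * (real N + 2 * real j))) * ck_coeff N (Suc j) i"
proof -
  define a where "a = real N / 2 + real j"
  have a: "0 < a" "real N + 2 * real j = 2 * a" "real N / 2 + real (Suc j) = a + 1"
    using assms by (simp_all add: a_def)
  have "pochhammer (a + 1) i \<noteq> 0" using a(1) by (intro pochhammer_nonneg less_imp_neq[THEN not_sym] pochhammer_pos) simp
  moreover have "- \<sigma> / (4 * q * (l * f) * (a * p)) * l = - (1 / (2 * (2 * a))) * (\<sigma> / (q * f * p))"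
    if "l \<noteq> 0" "f \<noteq> 0" "q \<noteq> 0" "p \<noteq> 0" for \<sigma> l f q p :: real
    using that a(1) by (simp add: field_simps)
  from this[of "real (Suc i)" "fact i" "4 ^ i" "pochhammer (a + 1) i" "(- 1) ^ i"]
  have "- ((- 1) ^ i) / (4 * 4 ^ i * (real (Suc i) * fact i) * (a * pochhammer (a + 1) i)) * real (Suc i) =
      - (1 / (2 * (2 * a))) * ((- 1) ^ i / (4 ^ i * fact i * pochhammer (a + 1) i))"
    using calculation by simp
  ultimately show ?thesis
    unfolding ck_coeff_def a a_def[symmetric] pochhammer_rec by simp
qed

text \<open>Differentiating \<open>r^i\<close> and shifting the index trades \<open>j\<close> for
  \<open>j + 1\<close> and \<open>z\<close> for \<open>z - 2\<close>. The sum is first extended by a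
  vanishing term so that the shift stays within range.\<close>

lemma DERIV_ck_sum_r:
  assumes "1 \<le> N"
  shows "((\<lambda>r. ck_sum N j z t r) has_real_derivative
    - (1 / (2 * (real N + 2 * real j))) * ck_sum N (Suc j) (z - 2) t r) (at r)"
proof -
  have "((\<lambda>r. \<Sum>i\<le>Suc (nat z). ck_coeff N j i * r ^ i * divpow (z - 2 * int i) t) has_real_derivative
      (\<Sum>i\<le>Suc (nat z). ck_coeff N j i * (real i * r ^ (i - 1)) * divpow (z - 2 * int i) t)) (at r)"
    by (rule DERIV_sum) (auto intro!: DERIV_cmult_right DERIV_cmult DERIV_cong[OF DERIV_pow])
  moreover have "(\<Sum>i\<le>Suc (nat z). ck_coeff N j i * (real i * r ^ (i - 1)) * divpow (z - 2 * int i) t) =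
      (\<Sum>i\<le>nat z. (ck_coeff N j (Suc i) * real (Suc i)) * r ^ i * divpow (z - 2 - 2 * int i) t)"
    unfolding sum.atMost_Suc_shift by (simp add: algebra_simps)
  moreover have "\<dots> = - (1 / (2 * (real N + 2 * real j))) * ck_sum N (Suc j) (z - 2) t r"
  proof -
    have "ck_sum N (Suc j) (z - 2) t r =
        (\<Sum>i\<le>nat z. ck_coeff N (Suc j) i * r ^ i * divpow (z - 2 - 2 * int i) t)"
      by (rule ck_sum_le) simp
    then show ?thesis unfolding ck_coeff_Suc[OF assms] by (simp only: sum_distrib_left mult.assoc)
  qed
  moreover have "(\<lambda>r. ck_sum N j z t r) = (\<lambda>r. \<Sum>i\<le>Suc (nat z). ck_coeff N j i * r ^ i * divpow (z - 2 * int i) t)"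
    by (intro ext ck_sum_bound) simp
  ultimately show ?thesis by simp
qed

text \<open>Over a common Pochhammer factor \<open>p\<close> this is the partial fraction identity
  \<open>1 / a = 1 / b + (i + 1) / (a b)\<close> with \<open>a = N/2 + j\<close> and
  \<open>b = a + 1 + i\<close>.\<close>

lemma ck_coeff_three_term:
  assumes "1 \<le> N"
  shows "ck_coeff N j (Suc i) = ck_coeff N (Suc j) (Suc i) -
    1 / ((real N + 2 * real j) * (real N + 2 * real j + 2)) * ck_coeff N (Suc (Suc j)) i"
proof -
  define a where "a = real N / 2 + real j"
  have a: "0 < a" "real N + 2 * real j = 2 * a" "real N / 2 + real (Suc j) = a + 1"
    "real N / 2 + real (Suc (Suc j)) = a + 2"
    using assms by (simp_all add: a_def)
  define p where "p = pochhammer (a + 1) i"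
  have p: "p \<noteq> 0" unfolding p_def using a(1) by (intro less_imp_neq[THEN not_sym] pochhammer_pos) simp
  have e: "pochhammer a (Suc i) = a * p" "pochhammer (a + 1) (Suc i) = p * (a + 1 + real i)"
    by (simp add: p_def pochhammer_rec) (simp add: p_def pochhammer_Suc)
  have "(a + 1) * pochhammer (a + 2) i = p * (a + 1 + real i)"
  proof -
    have "a + 1 + 1 = a + 2" by simp
    then show ?thesis using pochhammer_rec[of "a + 1" i] e(2) by (simp only:)
  qed
  then have e3: "pochhammer (a + 2) i = p * (a + 1 + real i) / (a + 1)"
    using a(1) by (simp add: field_simps)
  have nz: "a + 1 + real i \<noteq> 0" "a + 1 \<noteq> 0" "a \<noteq> 0" using a(1) by simp_all
  have "1 / a = 1 / (a + 1 + real i) + real (Suc i) / (a * (a + 1 + real i))"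
  proof -
    have "1 / a = 1 / b + l / (a * b)" if "a \<noteq> 0" "b \<noteq> 0" "b = a + l" for a b l :: real
      using that by (simp add: divide_simps)
    from this[OF nz(3,1)] show ?thesis by simp
  qed
  moreover define K where "K = (- 1) ^ Suc i / (4 ^ Suc i * fact (Suc i) * p)"
  ultimately have "K * (1 / a) = K * (1 / (a + 1 + real i)) + K * (real (Suc i) / (a * (a + 1 + real i)))"
    by (simp only: distrib_left)
  moreover have "K * (real (Suc i) / (a * (a + 1 + real i))) =
      - (1 / (2 * a * (2 * a + 2)) * ((- 1) ^ i / (4 ^ i * fact i * (p * (a + 1 + real i) / (a + 1)))))"
    using nz p unfolding K_def by (simp add: divide_simps) (simp add: algebra_simps)
  moreover have "ck_coeff N j (Suc i) = K * (1 / a)"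
    unfolding ck_coeff_def a_def[symmetric] e K_def by (simp del: fact_Suc power_Suc add: mult_ac)
  moreover have "ck_coeff N (Suc j) (Suc i) = K * (1 / (a + 1 + real i))"
    unfolding ck_coeff_def a e K_def by (simp del: fact_Suc power_Suc add: mult_ac)
  ultimately show ?thesis
    unfolding ck_coeff_def[of N "Suc (Suc j)"] a e3 by linarith
qed

lemma ck_sum_three_term:
  assumes "1 \<le> N"
  shows "ck_sum N j z t r = ck_sum N (Suc j) z t r -
    1 / ((real N + 2 * real j) * (real N + 2 * real j + 2)) * (r * ck_sum N (Suc (Suc j)) (z - 2) t r)"
proof -
  have b: "ck_sum N j z t r = ck_coeff N j 0 * divpow z t +
      (\<Sum>i\<le>nat z. ck_coeff N j (Suc i) * r ^ Suc i * divpow (z - 2 - 2 * int i) t)" for j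
    using ck_sum_bound[of z "Suc (nat z)" N j t r] unfolding sum.atMost_Suc_shift by (simp add: algebra_simps)
  have c: "ck_sum N (Suc (Suc j)) (z - 2) t r =
      (\<Sum>i\<le>nat z. ck_coeff N (Suc (Suc j)) i * r ^ i * divpow (z - 2 - 2 * int i) t)"
    by (rule ck_sum_le) simp
  have *: "(\<Sum>i\<le>M. (f i - c * g i) * r ^ Suc i * d i) =
      (\<Sum>i\<le>M. f i * r ^ Suc i * d i) - c * (r * (\<Sum>i\<le>M. g i * r ^ i * d i))"
    for M c and f g d :: "nat \<Rightarrow> real"
    unfolding sum_distrib_left sum_subtractf[symmetric] by (intro sum.cong refl) (simp add: algebra_simps)
  have "ck_coeff N j 0 = ck_coeff N (Suc j) 0" by (simp add: ck_coeff_def)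
  then show ?thesis
    unfolding b[of j] b[of "Suc j"] ck_coeff_three_term[OF assms, of j] * c by simp
qed

text \<open>The Pochhammer factor is the normalization that makes the derivative in the last
  variable lower \<open>z\<close> with the factor \<open>z + j\<close>. This is the total degree
  once a polynomial of degree \<open>j\<close> is attached.\<close>

definition ck_factor :: "nat \<Rightarrow> nat \<Rightarrow> int \<Rightarrow> (nat \<Rightarrow> real) \<Rightarrow> real"
  where "ck_factor N j z x = pochhammer (real j + 1) (nat z) * ck_sum N j z (x (Suc N)) (sqnorm N x)"

lemma ck_factor_neg [simp]: "z < 0 \<Longrightarrow> ck_factor N j z x = 0"
  and ck_factor_0 [simp]: "ck_factor N j 0 x = 1"
  by (simp_all add: ck_factor_def)

lemma pochhammer_nat_pred:
  assumes "0 < z"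
  shows "pochhammer (a :: real) (nat z) = pochhammer a (nat (z - 1)) * (a + of_int z - 1)"
    "pochhammer a (nat z) = a * pochhammer (a + 1) (nat (z - 1))"
proof -
  obtain p where p: "nat z = Suc p" "nat (z - 1) = p" "z = int p + 1"
    using assms by (metis Suc_nat_eq_nat_zadd1 add.commute diff_add_cancel zle_diff1_eq int_nat_eq nat_int less_le
        add_diff_cancel_left')
  then show "pochhammer a (nat z) = pochhammer a (nat (z - 1)) * (a + of_int z - 1)"
    "pochhammer a (nat z) = a * pochhammer (a + 1) (nat (z - 1))"
    unfolding p(1,2) by (simp add: pochhammer_Suc p(3) add_ac, simp add: pochhammer_rec)
qed

text \<open>The coefficient \<open>(j + 1) / (m + 2 j - 1)\<close> of the second term of
  \<open>X_factor\<close>, with \<open>N = m - 1\<close>.\<close>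

definition ck_ratio :: "nat \<Rightarrow> nat \<Rightarrow> real"
  where "ck_ratio N j = (real j + 1) / (real N + 2 * real j)"

lemma has_partial_ck_factor_last:
  "has_partial (Suc N) (ck_factor N j z) x ((of_int z + real j) * ck_factor N j (z - 1) x)"
proof -
  have r: "sqnorm N (x(Suc N := t)) = sqnorm N x" for t by (simp add: sqnorm_def)
  have "((\<lambda>t. ck_factor N j z (x(Suc N := t))) has_real_derivative
      pochhammer (real j + 1) (nat z) * ck_sum N j (z - 1) (x (Suc N)) (sqnorm N x)) (at (x (Suc N)))"
    unfolding ck_factor_def r by (auto intro!: DERIV_cmult DERIV_ck_sum_t)
  moreover have "pochhammer (real j + 1) (nat z) * ck_sum N j (z - 1) (x (Suc N)) (sqnorm N x) =
      (of_int z + real j) * ck_factor N j (z - 1) x"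
  proof (cases "z > 0")
    case True
    then show ?thesis unfolding ck_factor_def pochhammer_nat_pred(1)[OF True] by simp
  qed (simp add: ck_factor_def)
  ultimately show ?thesis
    by (simp add: has_partial_def has_real_derivative_iff_has_vector_derivative)
qed

lemma ck_factor_reindex:
  assumes "1 \<le> N"
  shows "pochhammer (real j + 1) (nat z) * ck_sum N (Suc j) (z - 2) t r =
    (of_int z + real j) * (real j + 1) * (pochhammer (real (Suc j) + 1) (nat (z - 2)) * ck_sum N (Suc j) (z - 2) t r)"
proof (cases "z \<ge> 2")
  case True
  then have "pochhammer (real j + 1) (nat z) = (real j + 1) * (pochhammer (real j + 1 + 1) (nat (z - 2)) * (real j + of_int z))"
    using pochhammer_nat_pred(2)[of z "real j + 1"] pochhammer_nat_pred(1)[of "z - 1" "real j + 1 + 1"] by simp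
  then show ?thesis by (simp add: mult_ac add_ac)
qed simp

lemma has_partial_ck_factor:
  assumes "1 \<le> N" "i \<in> {1..N}"
  shows "has_partial i (ck_factor N j z) x
    (- (ck_ratio N j * (of_int z + real j) * x i * ck_factor N (Suc j) (z - 2) x))"
proof -
  have ne: "i \<noteq> Suc N" using assms by auto
  have "((\<lambda>t. sqnorm N (x(i := t))) has_real_derivative 2 * x i) (at (x i))"
    using has_partial_sqnorm[OF assms(2), of x]
    by (simp add: has_partial_def has_real_derivative_iff_has_vector_derivative)
  from DERIV_chain2[OF _ this, of "\<lambda>r. pochhammer (real j + 1) (nat z) * ck_sum N j z (x (Suc N)) r",
      OF DERIV_cmult[OF DERIV_ck_sum_r[OF assms(1)]]]
  have "((\<lambda>t. ck_factor N j z (x(i := t))) has_real_derivative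
      pochhammer (real j + 1) (nat z) * (- (1 / (2 * (real N + 2 * real j))) *
        ck_sum N (Suc j) (z - 2) (x (Suc N)) (sqnorm N x)) * (2 * x i)) (at (x i))"
    unfolding ck_factor_def using ne by simp
  moreover have "pochhammer (real j + 1) (nat z) * (- (1 / (2 * (real N + 2 * real j))) *
        ck_sum N (Suc j) (z - 2) (x (Suc N)) (sqnorm N x)) * (2 * x i) =
      - (ck_ratio N j * (of_int z + real j) * x i * ck_factor N (Suc j) (z - 2) x)"
  proof -
    have "pochhammer (real j + 1) (nat z) * (- (1 / (2 * (real N + 2 * real j))) *
        ck_sum N (Suc j) (z - 2) (x (Suc N)) (sqnorm N x)) * (2 * x i) =
      - (x i / (real N + 2 * real j)) * (pochhammer (real j + 1) (nat z) * ck_sum N (Suc j) (z - 2) (x (Suc N)) (sqnorm N x))"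
      using assms(1) by (simp add: field_simps)
    also have "\<dots> = - (ck_ratio N j * (of_int z + real j) * x i * ck_factor N (Suc j) (z - 2) x)"
      unfolding ck_factor_reindex[OF assms(1)] ck_factor_def ck_ratio_def by (simp add: mult_ac)
    finally show ?thesis .
  qed
  ultimately show ?thesis
    by (simp add: has_partial_def has_real_derivative_iff_has_vector_derivative)
qed

text \<open>The three-term relation of \<open>ck_sum\<close> in the normalization in which
  \<open>ck_mult_monogenic\<close> uses it. For \<open>z \<le> 0\<close> every factor is
  \<open>0\<close>.\<close>

lemma ck_factor_three_term:
  assumes "1 \<le> N"
  shows "(of_int z + real j) * ck_factor N j (z - 1) x = (real j + 1) * ck_factor N (Suc j) (z - 1) x -
    (of_int z + real j) * ck_ratio N j * ck_ratio N (Suc j) * sqnorm N x * ck_factor N (Suc (Suc j)) (z - 3) x"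
proof (cases "z > 0")
  case True
  let ?S = "\<lambda>j z. ck_sum N j z (x (Suc N)) (sqnorm N x)"
  have 1: "(of_int z + real j) * ck_factor N j (z - 1) x = pochhammer (real j + 1) (nat z) * ?S j (z - 1)"
    unfolding ck_factor_def pochhammer_nat_pred(1)[OF True] by simp
  have 2: "(real j + 1) * ck_factor N (Suc j) (z - 1) x = pochhammer (real j + 1) (nat z) * ?S (Suc j) (z - 1)"
    unfolding ck_factor_def pochhammer_nat_pred(2)[OF True] by (simp add: add_ac)
  have 3: "(of_int z + real j) * (real j + 1) * (real j + 2) * ck_factor N (Suc (Suc j)) (z - 3) x =
      pochhammer (real j + 1) (nat z) * ?S (Suc (Suc j)) (z - 3)"
  proof -
    have "pochhammer (real j + 1) (nat z) * ?S (Suc (Suc j)) (z - 3) =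
        (real j + 1) * (pochhammer (real (Suc j) + 1) (nat (z - 1)) * ?S (Suc (Suc j)) (z - 1 - 2))"
      unfolding pochhammer_nat_pred(2)[OF True] by (simp add: add_ac)
    also have "\<dots> = (of_int z + real j) * (real j + 1) * (real j + 2) * ck_factor N (Suc (Suc j)) (z - 3) x"
      unfolding ck_factor_reindex[OF assms, of "Suc j"] ck_factor_def by (simp add: mult_ac add_ac)
    finally show ?thesis ..
  qed
  have "(of_int z + real j) * ck_ratio N j * ck_ratio N (Suc j) * sqnorm N x * ck_factor N (Suc (Suc j)) (z - 3) x =
      1 / ((real N + 2 * real j) * (real N + 2 * real j + 2)) * (sqnorm N x *
       ((of_int z + real j) * (real j + 1) * (real j + 2) * ck_factor N (Suc (Suc j)) (z - 3) x))"
    by (simp add: ck_ratio_def add_ac)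
  then show ?thesis
    unfolding 1 2 3 ck_sum_three_term[OF assms, of j "z - 1"] by (simp add: algebra_simps)
qed simp

lemma homogeneous_polys_extend:
  assumes "f \<in> homogeneous_polys n j V" "subspace V" "n \<le> m"
  shows "f \<in> homogeneous_polys m j V"
proof -
  have "(\<lambda>x. f ((\<lambda>x. x) x)) \<in> homogeneous_polys m j V"
    by (rule homogeneous_polys_subst[OF assms(1,2), where M = "\<lambda>i l. if l = i then 1 else 0"])
      (use assms(3) in \<open>simp add: if_distrib if_distribR cong: if_cong\<close>)
  then show ?thesis by simp
qed

lemma homogeneous_polys_power:
  assumes p: "p \<in> homogeneous_polys n d (UNIV :: real set)"
  shows "(\<lambda>x. p x ^ i) \<in> homogeneous_polys n (i * d) (UNIV :: real set)"
proof (induction i)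
  case 0
  then show ?case by (simp add: homogeneous_polys_const)
next
  case (Suc i)
  then show ?case using homogeneous_polys_mult[OF p subspace_UNIV Suc] by simp
qed

lemma ck_factor_poly:
  assumes "0 \<le> z"
  shows "ck_factor N j z \<in> homogeneous_polys (Suc N) (nat z) (UNIV :: real set)"
proof -
  have "(\<lambda>x. ck_coeff N j i * sqnorm N x ^ i * divpow (z - 2 * int i) (x (Suc N))) \<in> homogeneous_polys (Suc N) (nat z) UNIV" for i
  proof (cases "z - 2 * int i < 0")
    case True
    then show ?thesis by (simp add: homogeneous_polys_zero)
  next
    case False
    define l where "l = nat (z - 2 * int i)"
    have l: "i * 2 + l * 1 = nat z" using False by (simp add: l_def)
    have x: "(\<lambda>x. x (Suc N) *\<^sub>R (1::real)) \<in> homogeneous_polys (Suc N) (Suc 0) UNIV"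
      by (intro homogeneous_polys_var homogeneous_polys_const) auto
    have "(\<lambda>x. sqnorm N x ^ i *\<^sub>R (x (Suc N) ^ l)) \<in> homogeneous_polys (Suc N) (i * 2 + l * 1) UNIV"
      using homogeneous_polys_mult[OF homogeneous_polys_power[OF homogeneous_polys_extend[OF sqnorm_poly]]
        subspace_UNIV homogeneous_polys_power[OF x]] by simp
    from homogeneous_polys_scaleR[OF subspace_UNIV this[unfolded l], of "ck_coeff N j i / fact l"]
    show ?thesis using False by (simp add: divpow_def l_def mult_ac)
  qed
  then have "(\<lambda>x. pochhammer (real j + 1) (nat z) *\<^sub>R (\<Sum>i\<le>nat z. ck_coeff N j i * sqnorm N x ^ i * divpow (z - 2 * int i) (x (Suc N))))
      \<in> homogeneous_polys (Suc N) (nat z) UNIV"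
    by (intro homogeneous_polys_scaleR homogeneous_polys_sum subspace_UNIV)
  then show ?thesis by (simp add: ck_factor_def[abs_def] ck_sum_def)
qed

lemma ck_factor_mult_poly:
  assumes f: "f \<in> homogeneous_polys n d V" "subspace V" "n \<le> Suc N" and "z + int d = int k"
  shows "(\<lambda>x. ck_factor N j z x *\<^sub>R f x) \<in> homogeneous_polys (Suc N) k V"
proof (cases "z \<ge> 0")
  case True
  have "nat z + d = k" using assms(4) True by linarith
  then show ?thesis
    using homogeneous_polys_mult[OF ck_factor_poly[OF True] f(2) homogeneous_polys_extend[OF f]] by simp
next
  case False
  then show ?thesis by (simp add: homogeneous_polys_zero subspace_0[OF f(2)])
qed

text \<open>The homogenized Gegenbauer polynomial, equal to \<open>R^(n/2) C_n(t / sqrt R)\<close>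
  for \<open>R > 0\<close>. Being a polynomial in \<open>t\<close> and \<open>R\<close>, it needs no
  case distinction at the origin.\<close>

definition gegenbauer_hom :: "real \<Rightarrow> nat \<Rightarrow> real \<Rightarrow> real \<Rightarrow> real"
  where "gegenbauer_hom \<nu> n t R =
    (\<Sum>i\<le>n. (- 1) ^ i * pochhammer \<nu> (n - i) / fact i * R ^ i * divpow (int n - 2 * int i) (2 * t))"

lemma gegenbauer_hom_eq:
  "gegenbauer_hom \<nu> n t R = (\<Sum>i=0..n div 2. (- 1) ^ i * pochhammer \<nu> (n - i) / (fact i * fact (n - 2 * i)) * (2 * t) ^ (n - 2 * i) * R ^ i)"
proof -
  have "gegenbauer_hom \<nu> n t R =
      (\<Sum>i=0..n div 2. (- 1) ^ i * pochhammer \<nu> (n - i) / fact i * R ^ i * divpow (int n - 2 * int i) (2 * t))"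
    unfolding gegenbauer_hom_def by (rule sum.mono_neutral_right) auto
  also have "\<dots> = (\<Sum>i=0..n div 2. (- 1) ^ i * pochhammer \<nu> (n - i) / (fact i * fact (n - 2 * i)) * (2 * t) ^ (n - 2 * i) * R ^ i)"
  proof (rule sum.cong[OF refl])
    fix i assume "i \<in> {0..n div 2}"
    then have *: "int n - 2 * int i = int (n - 2 * i)" by auto
    show "(- 1) ^ i * pochhammer \<nu> (n - i) / fact i * R ^ i * divpow (int n - 2 * int i) (2 * t) =
        (- 1) ^ i * pochhammer \<nu> (n - i) / (fact i * fact (n - 2 * i)) * (2 * t) ^ (n - 2 * i) * R ^ i"
      unfolding * divpow_int by simp
  qed
  finally show ?thesis .
qed

lemma DERIV_gegenbauer_hom:
  "((\<lambda>t. gegenbauer_hom \<nu> (Suc n) t (t\<^sup>2 + r)) has_real_derivative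
    (2 * \<nu> + real n) * gegenbauer_hom \<nu> n t (t\<^sup>2 + r)) (at t)"
proof -
  let ?c = "\<lambda>i. (- 1) ^ i * pochhammer \<nu> (Suc n - i) / fact i :: real"
  let ?R = "t\<^sup>2 + r"
  let ?d = "\<lambda>z. divpow z (2 * t)"
  have 1: "((\<lambda>t. gegenbauer_hom \<nu> (Suc n) t (t\<^sup>2 + r)) has_real_derivative
      (\<Sum>i\<le>Suc n. ?c i * (real i * ?R ^ (i - 1) * (2 * t)) * ?d (int (Suc n) - 2 * int i) +
        ?c i * ?R ^ i * (?d (int (Suc n) - 2 * int i - 1) * 2))) (at t)"
    unfolding gegenbauer_hom_def
  proof (rule DERIV_sum)
    fix i
    let ?z = "int (Suc n) - 2 * int i"
    have "((\<lambda>t. (t\<^sup>2 + r) ^ i) has_real_derivative real i * ?R ^ (i - 1) * (2 * t)) (at t)"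
      by (auto intro!: derivative_eq_intros)
    from DERIV_cmult[OF this, of "?c i"]
    have a: "((\<lambda>t. ?c i * (t\<^sup>2 + r) ^ i) has_real_derivative ?c i * (real i * ?R ^ (i - 1) * (2 * t))) (at t)" .
    have "((\<lambda>t. 2 * t) has_real_derivative 2) (at t)"
      by (auto intro!: derivative_eq_intros)
    from DERIV_chain2[OF DERIV_divpow this]
    have b: "((\<lambda>t. divpow ?z (2 * t)) has_real_derivative divpow (?z - 1) (2 * t) * 2) (at t)" .
    from DERIV_mult[OF a b]
    show "((\<lambda>t. ?c i * (t\<^sup>2 + r) ^ i * divpow ?z (2 * t)) has_real_derivative
        ?c i * (real i * ?R ^ (i - 1) * (2 * t)) * ?d ?z + ?c i * ?R ^ i * (?d (?z - 1) * 2)) (at t)"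
      by (simp only: mult_ac)
  qed
  have "(\<Sum>i\<le>Suc n. ?c i * (real i * ?R ^ (i - 1) * (2 * t)) * ?d (int (Suc n) - 2 * int i)) =
      (\<Sum>i\<le>Suc n. ?c i * (real i * ?R ^ (i - 1)) * ((of_int (int (Suc n) - 2 * int i) + 1) * ?d (int (Suc n) - 2 * int i + 1)))"
    unfolding divpow_mult[symmetric] by (simp only: mult_ac)
  also have "\<dots> = (\<Sum>i\<le>n. (?c (Suc i) * real (Suc i)) * ?R ^ i * ((real n - 2 * real i) * ?d (int n - 2 * int i)))"
  proof -
    have 1: "int (Suc n) - 2 * int (Suc i) + 1 = int n - 2 * int i"
      and 2: "of_int (int (Suc n) - 2 * int (Suc i)) + 1 = real n - 2 * real i" for i by simp_all
    show ?thesis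
      unfolding sum.atMost_Suc_shift 1 2 by (simp add: mult.assoc del: of_nat_Suc fact_Suc power_Suc)
  qed
  also have "\<dots> = (\<Sum>i\<le>n. - ((- 1) ^ i * pochhammer \<nu> (n - i) / fact i) * ?R ^ i * ((real n - 2 * real i) * ?d (int n - 2 * int i)))"
    by (intro sum.cong refl arg_cong2[of _ _ _ _ "(*)"]) (simp del: of_nat_Suc)
  finally have 2: "(\<Sum>i\<le>Suc n. ?c i * (real i * ?R ^ (i - 1) * (2 * t)) * ?d (int (Suc n) - 2 * int i)) = \<dots>" .
  have 3: "(\<Sum>i\<le>Suc n. ?c i * ?R ^ i * (?d (int (Suc n) - 2 * int i - 1) * 2)) =
      (\<Sum>i\<le>n. ((- 1) ^ i * pochhammer \<nu> (n - i) / fact i) * ?R ^ i * (2 * (\<nu> + real n - real i) * ?d (int n - 2 * int i)))"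
  proof -
    have "(\<Sum>i\<le>Suc n. ?c i * ?R ^ i * (?d (int (Suc n) - 2 * int i - 1) * 2)) =
        (\<Sum>i\<le>n. ?c i * ?R ^ i * (?d (int n - 2 * int i) * 2))"
      unfolding sum.atMost_Suc by simp
    also have "\<dots> = (\<Sum>i\<le>n. ((- 1) ^ i * pochhammer \<nu> (n - i) / fact i) * ?R ^ i * (2 * (\<nu> + real n - real i) * ?d (int n - 2 * int i)))"
      by (intro sum.cong refl) (simp add: Suc_diff_le pochhammer_Suc of_nat_diff mult_ac)
    finally show ?thesis .
  qed
  have "(\<Sum>i\<le>Suc n. ?c i * (real i * ?R ^ (i - 1) * (2 * t)) * ?d (int (Suc n) - 2 * int i) +
        ?c i * ?R ^ i * (?d (int (Suc n) - 2 * int i - 1) * 2)) =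
      (2 * \<nu> + real n) * gegenbauer_hom \<nu> n t (t\<^sup>2 + r)"
    unfolding sum.distrib 2 3 gegenbauer_hom_def sum_distrib_left
    unfolding sum.distrib[symmetric]
  proof (intro sum.cong refl)
    fix i
    have "- C * X * ((real n - 2 * real i) * d) + C * X * (2 * (\<nu> + real n - real i) * d) =
        (2 * \<nu> + real n) * (C * X * d)" for C X d :: real
      by (simp add: algebra_simps)
    then show "- ((- 1) ^ i * pochhammer \<nu> (n - i) / fact i) * ?R ^ i * ((real n - 2 * real i) * ?d (int n - 2 * int i)) +
        (- 1) ^ i * pochhammer \<nu> (n - i) / fact i * ?R ^ i * (2 * (\<nu> + real n - real i) * ?d (int n - 2 * int i)) =
        (2 * \<nu> + real n) * ((- 1) ^ i * pochhammer \<nu> (n - i) / fact i * ?R ^ i * ?d (int n - 2 * int i))"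
      by this
  qed
  with 1 show ?thesis by simp
qed

text \<open>For fixed \<open>r\<close> differentiation in \<open>t\<close> lowers \<open>n\<close>
  on both sides with the factor \<open>2 \<nu> + n\<close>, so induction on \<open>n\<close> leaves
  only the comparison at \<open>t = 0\<close>. There both sides vanish for odd degree; for even
  degree one term survives on each side, and these agree by the duplication formula for Pochhammer
  symbols.\<close>

lemma gegenbauer_hom_ck_sum:
  assumes "2 \<le> N" and \<nu>: "\<nu> = (real N - 1) / 2 + real j"
  shows "gegenbauer_hom \<nu> n t (t\<^sup>2 + r) = pochhammer (2 * \<nu>) n * ck_sum N j (int n) t r"
proof (induction n arbitrary: t)
  case 0
  then show ?case by (simp add: gegenbauer_hom_def divpow_def)
next
  case (Suc n)
  let ?f = "\<lambda>t. gegenbauer_hom \<nu> (Suc n) t (t\<^sup>2 + r) - pochhammer (2 * \<nu>) (Suc n) * ck_sum N j (int (Suc n)) t r"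
  have "(?f has_real_derivative 0) (at t)" for t
  proof -
    have "(?f has_real_derivative (2 * \<nu> + real n) * gegenbauer_hom \<nu> n t (t\<^sup>2 + r) -
        pochhammer (2 * \<nu>) (Suc n) * ck_sum N j (int (Suc n) - 1) t r) (at t)"
      by (intro DERIV_diff DERIV_gegenbauer_hom DERIV_cmult DERIV_ck_sum_t)
    then show ?thesis unfolding Suc.IH by (simp add: pochhammer_Suc)
  qed
  then have "?f t = ?f 0" by (rule DERIV_isconst_all[of ?f, rule_format]) 
  moreover have "?f 0 = 0"
  proof -
    have z: "divpow z 0 = (if z = 0 then 1 else 0)" for z by (auto simp: divpow_def)
    show ?thesis
    proof (cases "even (Suc n)")
      case True
      then obtain l where l: "Suc n = 2 * l" by (elim evenE)
      have iff: "int (2 * l) - 2 * int i = 0 \<longleftrightarrow> i = l" for i by auto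
      have "gegenbauer_hom \<nu> (Suc n) 0 (0\<^sup>2 + r) = (- 1) ^ l * pochhammer \<nu> l / fact l * r ^ l"
        unfolding gegenbauer_hom_def l mult_zero_right z iff by (simp add: if_distrib cong: if_cong)
      moreover have "ck_sum N j (int (Suc n)) 0 r = ck_coeff N j l * r ^ l"
        unfolding ck_sum_def l z iff by (simp add: if_distrib cong: if_cong)
      moreover have "pochhammer (2 * \<nu>) (2 * l) * ck_coeff N j l = (- 1) ^ l * pochhammer \<nu> l / fact l"
      proof -
        have "real N / 2 + real j = \<nu> + 1/2" by (simp add: \<nu> field_simps)
        moreover have "pochhammer (\<nu> + 1/2) l \<noteq> 0"
          using assms(1) by (intro less_imp_neq[THEN not_sym] pochhammer_pos) (simp add: \<nu> field_simps)
        ultimately show ?thesis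
          unfolding ck_coeff_def pochhammer_double by (simp add: power_mult)
      qed
      ultimately show ?thesis unfolding l by (simp add: mult_ac) 
    next
      case False
      then have "int (Suc n) - 2 * int i \<noteq> 0" for i by presburger
      then show ?thesis unfolding gegenbauer_hom_def ck_sum_def mult_zero_right z by simp
    qed
  qed
  ultimately show ?case by simp
qed

lemma F_factor_eq_ck_factor:
  assumes "3 \<le> m"
  shows "F_factor m j z x = ck_factor (m - 1) j z x"
proof (cases "z < 0")
  case False
  define n where "n = nat z"
  have n: "z = int n" using False by (simp add: n_def)
  define N where "N = m - 1"
  have N: "m = Suc N" "2 \<le> N" using assms by (simp_all add: N_def)
  define \<nu> where "\<nu> = real m / 2 + real j - 1"
  have \<nu>: "\<nu> = (real N - 1) / 2 + real j" "real m - 2 + 2 * real j = 2 * \<nu>"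
    by (simp_all add: \<nu>_def N(1) field_simps)
  have pos: "pochhammer (2 * \<nu>) n \<noteq> 0"
    using N(2) by (intro less_imp_neq[THEN not_sym] pochhammer_pos) (simp add: \<nu>(1) field_simps)
  define \<rho> where "\<rho> = L2_set x {1..m}"
  define t where "t = x m"
  have sq: "\<rho>\<^sup>2 = t\<^sup>2 + sqnorm N x"
    unfolding \<rho>_def L2_set_def t_def N(1) sqnorm_def by (simp add: sum_nonneg)
  have "\<rho> ^ n * gegenbauer \<nu> n (t / \<rho>) = gegenbauer_hom \<nu> n t (\<rho>\<^sup>2)"
  proof (cases "\<rho> = 0")
    case False
    show ?thesis
      unfolding gegenbauer_def gegenbauer_hom_eq sum_distrib_left
    proof (rule sum.cong[OF refl])
      fix i assume "i \<in> {0..n div 2}"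
      then have "n = (n - 2 * i) + 2 * i" by auto
      then have 1: "\<rho> ^ n = \<rho> ^ (n - 2 * i) * (\<rho>\<^sup>2) ^ i" by (metis power_add power_mult)
      have 2: "(2 * t) ^ (n - 2 * i) = (2 * (t / \<rho>)) ^ (n - 2 * i) * \<rho> ^ (n - 2 * i)"
      proof -
        have "2 * (t / \<rho>) * \<rho> = 2 * t" using False by simp
        then show ?thesis by (metis power_mult_distrib)
      qed
      show "\<rho> ^ n * ((- 1) ^ i * pochhammer \<nu> (n - i) / (fact i * fact (n - 2 * i)) * (2 * (t / \<rho>)) ^ (n - 2 * i)) =
          (- 1) ^ i * pochhammer \<nu> (n - i) / (fact i * fact (n - 2 * i)) * (2 * t) ^ (n - 2 * i) * (\<rho>\<^sup>2) ^ i"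
      proof -
        have "C * D * (A * B) = A * (B * C) * D" for A B C D :: real by simp
        then show ?thesis unfolding 1 2 by this
      qed
    qed
  next
    case True
    \<comment> \<open>At the origin \<open>t / \<rho>\<close> is \<open>0\<close> by the convention
      for division. The two sides still agree: both are \<open>1\<close> for \<open>n = 0\<close>
      and \<open>0\<close> otherwise.\<close>
    then have "t\<^sup>2 + sqnorm N x = 0" using sq by simp
    then have t: "t = 0" using sqnorm_nonneg[of N x] by (simp add: add_nonneg_eq_0_iff)
    show ?thesis
    proof (cases "n = 0")
      case False
      have "gegenbauer_hom \<nu> n 0 0 = 0"
        unfolding gegenbauer_hom_def
        using False by (intro sum.neutral) (auto simp: divpow_def power_0_left)
      then show ?thesis using True False t by simp
    qed (simp add: gegenbauer_def gegenbauer_hom_def divpow_def)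
  qed
  moreover have "F_factor m j z x = pochhammer (real j + 1) n / pochhammer (2 * \<nu>) n * (\<rho> ^ n * gegenbauer \<nu> n (t / \<rho>))"
    unfolding F_factor_def n \<nu>(2) \<rho>_def t_def \<nu>_def by simp
  ultimately show ?thesis
    unfolding sq gegenbauer_hom_ck_sum[OF N(2) \<nu>(1)] using pos
    by (simp add: ck_factor_def n t_def N(1))
qed (simp add: F_factor_def)

section \<open>The embeddings\<close>

lemma gen_Suc_cvec: "gen (Suc n) * cvec n x = - (cvec n x * gen (Suc n) :: 'a::real_normed_field clifford)"
proof -
  have "gen (Suc n) * gen i = - (gen i * gen (Suc n) :: 'a clifford)" if "i \<in> {1..n}" for i
    using gen_anticommute[of "Suc n" i, where 'a='a] that by (simp add: eq_neg_iff_add_eq_0)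
  then show ?thesis unfolding cvec_def by (simp add: sum_distrib_left sum_distrib_right sum_negf)
qed

lemma gen_Suc_cvec_mult: "gen (Suc n) * (cvec n x * a) = - (cvec n x * (gen (Suc n) * a))"
  for a :: "'a::real_normed_field clifford"
  by (simp add: gen_Suc_cvec flip: mult.assoc)

lemma cvec_cvec_mult: "cvec n x * (cvec n x * a) = - sqnorm n x *\<^sub>R (a :: 'a::real_normed_field clifford)"
  by (simp add: cvec_square sqnorm_def flip: mult.assoc)

lemma wedge_bullet_gen: "wedge (gen i) (bullet (gen i) a) + bullet (gen i) (wedge (gen i) a) = - a"
  for a :: "'a::real_normed_field clifford"
  by (simp add: wedge_def bullet_def involute_scaleR involute_add involute_diff involute_mult
      distrib_left distrib_right left_diff_distrib right_diff_distrib gen_gen_mult mult.assoc gen_square)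
    (simp add: algebra_simps flip: scaleR_add_left)

lemma bullet_gen_outside:
  fixes a :: "'a::real_normed_field clifford"
  assumes "a \<in> multivectors n s" "n < i"
  shows "bullet (gen i) a = 0"
proof (rule clifford_eqI)
  fix C
  have "coeff a (insert i C) = 0" using assms by (auto simp: multivectors_iff)
  then show "coeff (bullet (gen i) a) C = coeff 0 C" by (simp add: coeff_bullet_gen coeff_gen_mult)
qed

lemma gen_Suc_mult_multivectors:
  fixes a :: "'a::real_normed_field clifford"
  assumes "a \<in> multivectors n s"
  shows "gen (Suc n) * a \<in> multivectors (Suc n) (Suc s)"
proof -
  have "gen (Suc n) * a = wedge (gen (Suc n)) a"
    using wedge_plus_bullet[of "gen (Suc n)" a] bullet_gen_outside[OF assms, of "Suc n"] by simp
  then show ?thesis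
    using wedge_gen_multivectors[OF multivectors_mono[OF _ assms], of "Suc n" "Suc n"] by simp
qed

lemma mult_left_poly:
  "f \<in> homogeneous_polys n j UNIV \<Longrightarrow> (\<lambda>x. a * f x) \<in> homogeneous_polys n j UNIV"
  for a :: "'a::real_normed_field clifford"
  by (rule homogeneous_polys_map[OF _ linear_mult_left]) simp_all

lemma dirac_Suc: "dirac (Suc n) f x = dirac n f x + gen (Suc n) * partial (Suc n) f x"
  by (simp add: dirac_def)

lemma dirac_gen_Suc_mult:
  fixes f :: "(nat \<Rightarrow> real) \<Rightarrow> 'a::real_normed_field clifford"
  assumes f: "f \<in> homogeneous_polys n j V"
  shows "dirac n (\<lambda>x. gen (Suc n) * f x) x = - (gen (Suc n) * dirac n f x)"
proof -
  have *: "gen i * (gen (Suc n) * a) = - (gen (Suc n) * (gen i * a))" if "i \<in> {1..n}" for i and a :: "'a clifford"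
    using gen_anticommute[of "Suc n" i, where 'a='a] that
    by (simp add: eq_neg_iff_add_eq_0 flip: mult.assoc distrib_right) (simp add: add.commute)
  show ?thesis
    unfolding dirac_def partial_map_poly[OF f linear_mult_left]
    by (simp add: * sum_negf sum_distrib_left)
qed

text \<open>Left multiplication by the factor \<open>X\<close> of the theorem, with
  \<open>F_factor\<close> replaced by \<open>ck_factor\<close>; in this form it is available for
  \<open>n = 1\<close> as well.\<close>

definition ck_mult :: "nat \<Rightarrow> nat \<Rightarrow> int \<Rightarrow> ((nat \<Rightarrow> real) \<Rightarrow> 'a::real_normed_field clifford) \<Rightarrow> (nat \<Rightarrow> real) \<Rightarrow> 'a clifford"
  where "ck_mult n j z Q x = ck_factor n j z x *\<^sub>R Q x +
    (ck_ratio n j * ck_factor n (Suc j) (z - 1) x) *\<^sub>R (cvec n x * (gen (Suc n) * Q x))"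

lemma ck_mult_neg [simp]: "z < 0 \<Longrightarrow> ck_mult n j z Q x = 0"
  and ck_mult_0 [simp]: "ck_mult n j 0 Q x = Q x"
  by (simp_all add: ck_mult_def)

lemma cvec_gen_mult_poly:
  assumes "Q \<in> homogeneous_polys n j UNIV"
  shows "(\<lambda>x. cvec n x * (gen (Suc n) * Q x)) \<in> homogeneous_polys n (Suc j) UNIV"
  by (rule mult.poly[OF homogeneous_polys_map[OF assms linear_mult_left]]) auto

lemma ck_mult_poly:
  assumes "Q \<in> homogeneous_polys n j UNIV" "z + int j = int k"
  shows "ck_mult n j z Q \<in> homogeneous_polys (Suc n) k UNIV"
proof -
  have "(\<lambda>x. ck_factor n j z x *\<^sub>R Q x + ck_ratio n j *\<^sub>R (ck_factor n (Suc j) (z - 1) x *\<^sub>R (cvec n x * (gen (Suc n) * Q x))))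
      \<in> homogeneous_polys (Suc n) k UNIV"
    by (intro homogeneous_polys_add homogeneous_polys_scaleR subspace_UNIV
        ck_factor_mult_poly[OF assms(1)] ck_factor_mult_poly[OF cvec_gen_mult_poly[OF assms(1)]])
      (use assms(2) in auto)
  then show ?thesis by (simp add: ck_mult_def[abs_def])
qed

text \<open>The second summand has \<open>j\<close> raised and \<open>z\<close> lowered by one.
  Hence \<open>z + j\<close> is the same for both summands, and a common factor comes out.\<close>

lemma has_partial_ck_mult_last:
  assumes Q: "Q \<in> homogeneous_polys n j UNIV"
  shows "has_partial (Suc n) (ck_mult n j z Q) x ((of_int z + real j) *\<^sub>R ck_mult n j (z - 1) Q x)"
proof -
  let ?R = "\<lambda>x. cvec n x * (gen (Suc n) * Q x)"
  note R = cvec_gen_mult_poly[OF Q]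
  have 0: "has_partial (Suc n) Q x 0" "has_partial (Suc n) ?R x 0"
    using has_partial_poly[OF Q, of "Suc n" x] has_partial_poly[OF R, of "Suc n" x]
      partial_outside[OF Q, of "Suc n" x] partial_outside[OF R, of "Suc n" x] by simp_all
  have "has_partial (Suc n) (\<lambda>x. ck_factor n j z x *\<^sub>R Q x + ck_ratio n j *\<^sub>R (ck_factor n (Suc j) (z - 1) x *\<^sub>R ?R x)) x
      ((ck_factor n j z x *\<^sub>R 0 + ((of_int z + real j) * ck_factor n j (z - 1) x) *\<^sub>R Q x) +
       ck_ratio n j *\<^sub>R (ck_factor n (Suc j) (z - 1) x *\<^sub>R 0 +
         ((of_int (z - 1) + real (Suc j)) * ck_factor n (Suc j) (z - 1 - 1) x) *\<^sub>R ?R x))"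
    by (intro has_partial_add has_partial_cmult has_partial_scaleR has_partial_ck_factor_last 0)
  then show ?thesis by (simp add: ck_mult_def[abs_def] scaleR_add_right mult_ac)
qed

text \<open>Everything is a combination of \<open>x Q\<close> and \<open>e Q\<close>, where
  \<open>e\<close> is the last generator. The terms with \<open>x Q\<close> from the Dirac operator
  of \<open>R^n\<close> and from the last variable are negatives of each other; the terms with
  \<open>e Q\<close> cancel by \<open>ck_factor_three_term\<close>.\<close>

lemma ck_mult_monogenic:
  fixes Q :: "(nat \<Rightarrow> real) \<Rightarrow> 'a::real_normed_field clifford"
  assumes Q: "Q \<in> homogeneous_polys n j UNIV" and d: "\<And>x. dirac n Q x = 0" and n: "1 \<le> n"
  shows "dirac (Suc n) (ck_mult n j z Q) x = 0"
proof -
  let ?e = "gen (Suc n) :: 'a clifford" and ?u = "cvec n x :: 'a clifford"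
  let ?R = "\<lambda>x. cvec n x * (?e * Q x)"
  note R = cvec_gen_mult_poly[OF Q]
  define c c' where "c = ck_ratio n j" and "c' = ck_ratio n (Suc j)"
  define y where "y = of_int z + real j"
  define G1 G2 G3 where "G1 = ck_factor n (Suc j) (z - 1) x" and "G2 = ck_factor n (Suc j) (z - 2) x"
    and "G3 = ck_factor n (Suc (Suc j)) (z - 3) x"
  have p: "partial i (ck_mult n j z Q) x =
      ck_factor n j z x *\<^sub>R partial i Q x - (c * y * x i * G2) *\<^sub>R Q x +
      c *\<^sub>R (G1 *\<^sub>R partial i ?R x - (c' * y * x i * G3) *\<^sub>R ?R x)" if i: "i \<in> {1..n}" for i
  proof -
    have "has_partial i (\<lambda>x. ck_factor n j z x *\<^sub>R Q x + c *\<^sub>R (ck_factor n (Suc j) (z - 1) x *\<^sub>R ?R x)) x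
        ((ck_factor n j z x *\<^sub>R partial i Q x + (- (c * y * x i * G2)) *\<^sub>R Q x) +
        c *\<^sub>R (G1 *\<^sub>R partial i ?R x + (- (c' * (of_int (z - 1) + real (Suc j)) * x i * ck_factor n (Suc (Suc j)) (z - 1 - 2) x)) *\<^sub>R ?R x))"
      unfolding c_def c'_def y_def G1_def G2_def
      by (intro has_partial_add has_partial_cmult has_partial_scaleR has_partial_ck_factor n i
          has_partial_poly[OF Q] has_partial_poly[OF R])
    then show ?thesis by (simp add: partialI ck_mult_def[abs_def] c_def y_def G3_def)
  qed
  have dR: "dirac n ?R x = - (real n + 2 * real j) *\<^sub>R (?e * Q x)"
    unfolding dirac_cvec_mult[OF mult_left_poly[OF Q]]
      dirac_gen_Suc_mult[OF Q] d by simp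
  have sum_x: "(\<Sum>i=1..n. gen i * (r * x i * s) *\<^sub>R a) = (r * s) *\<^sub>R (?u * a)" for r s and a :: "'a clifford"
    by (simp add: cvec_def sum_distrib_right scaleR_sum_right mult_ac)
  have "dirac n (ck_mult n j z Q) x = (\<Sum>i=1..n. ck_factor n j z x *\<^sub>R (gen i * partial i Q x)
      - gen i * (c * y * x i * G2) *\<^sub>R Q x + (c * G1) *\<^sub>R (gen i * partial i ?R x)
      - c *\<^sub>R (gen i * (c' * y * x i * G3) *\<^sub>R ?R x))"
    unfolding dirac_def
    by (intro sum.cong refl) (simp add: p distrib_left right_diff_distrib scaleR_diff_right)
  also have "\<dots> = ck_factor n j z x *\<^sub>R dirac n Q x - (c * y * G2) *\<^sub>R (?u * Q x)
      + (c * G1) *\<^sub>R dirac n ?R x - (c * (c' * y * G3)) *\<^sub>R (?u * ?R x)"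
    unfolding sum.distrib sum_subtractf scaleR_sum_right[symmetric] sum_x by (simp add: dirac_def)
  also have "\<dots> = - (c * y * G2) *\<^sub>R (?u * Q x)
      + (c * c' * y * G3 * sqnorm n x - c * (real n + 2 * real j) * G1) *\<^sub>R (?e * Q x)"
    unfolding d dR cvec_cvec_mult by (simp add: algebra_simps)
  also have "c * (real n + 2 * real j) = real j + 1"
    using n by (simp add: c_def ck_ratio_def)
  finally have 1: "dirac n (ck_mult n j z Q) x = - (c * y * G2) *\<^sub>R (?u * Q x)
      + (c * c' * y * G3 * sqnorm n x - (real j + 1) * G1) *\<^sub>R (?e * Q x)" .
  have "?e * partial (Suc n) (ck_mult n j z Q) x =
      (y * ck_factor n j (z - 1) x) *\<^sub>R (?e * Q x) + (c * y * G2) *\<^sub>R (?e * ?R x)"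
    by (simp add: partialI[OF has_partial_ck_mult_last[OF Q]] ck_mult_def y_def c_def G2_def distrib_left
      scaleR_add_right mult_ac distrib_right)
  also have "?e * ?R x = ?u * Q x"
    by (simp add: gen_Suc_cvec_mult gen_gen_mult)
  also have "y * ck_factor n j (z - 1) x = (real j + 1) * G1 - c * c' * y * G3 * sqnorm n x"
    using ck_factor_three_term[OF n, of z j x] by (simp add: y_def G1_def G3_def c_def c'_def mult_ac)
  finally show ?thesis unfolding dirac_Suc 1 by (simp add: algebra_simps)
qed

text \<open>The constant \<open>\<beta>\<close> of the theorem for \<open>m = n + 1\<close>.\<close>

definition shift_ratio :: "nat \<Rightarrow> nat \<Rightarrow> nat \<Rightarrow> real"
  where "shift_ratio n t j = - (real j + real n - real t) / (real j + real t)"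

definition shift :: "nat \<Rightarrow> nat \<Rightarrow> nat \<Rightarrow> ((nat \<Rightarrow> real) \<Rightarrow> 'a::real_normed_field clifford) \<Rightarrow> (nat \<Rightarrow> real) \<Rightarrow> 'a clifford"
  where "shift n t j P x = wedge (cvec n x) (P x) + shift_ratio n t j *\<^sub>R bullet (cvec n x) (P x)"

lemma shift_poly:
  assumes P: "P \<in> homogeneous_polys n j UNIV"
  shows "shift n t j P \<in> homogeneous_polys n (Suc j) UNIV"
proof -
  have "(\<lambda>x. wedge (cvec n x) (P x) + shift_ratio n t j *\<^sub>R bullet (cvec n x) (P x)) \<in> homogeneous_polys n (Suc j) UNIV"
    by (intro homogeneous_polys_add homogeneous_polys_scaleR wedge.poly[OF P] bullet.poly[OF P]) auto
  then show ?thesis by (simp add: shift_def[abs_def])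
qed

text \<open>The coefficient \<open>\<beta>\<close> is the one for which the two contributions to \<open>\<partial>(x \<and> P + \<beta> x \<bullet> P)\<close> cancel.\<close>

lemma shift_monogenic:
  assumes P: "P \<in> monogenics n t j" and "t + j \<noteq> 0"
  shows "dirac n (shift n t j P) x = 0"
proof -
  note P' = monogenicsD(1)[OF P]
  have "dirac n (\<lambda>x. 1 *\<^sub>R wedge (cvec n x) (P x) + shift_ratio n t j *\<^sub>R bullet (cvec n x) (P x)) x =
      1 *\<^sub>R dirac n (\<lambda>x. wedge (cvec n x) (P x)) x + shift_ratio n t j *\<^sub>R dirac n (\<lambda>x. bullet (cvec n x) (P x)) x"
    by (intro dirac_scaleR_add has_partial_partial[OF wedge.has_partial[OF P']]
      has_partial_partial[OF bullet.has_partial[OF P']])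
  also have "\<dots> = (real t - real n - real j - shift_ratio n t j * (real t + real j)) *\<^sub>R P x"
    unfolding dirac_wedge_bullet[OF P] by (simp add: algebra_simps)
  also have "real t - real n - real j - shift_ratio n t j * (real t + real j) = 0"
    using assms(2) by (simp add: shift_ratio_def field_simps flip: of_nat_add)
  finally show ?thesis by (simp add: shift_def[abs_def])
qed

text \<open>This is \<open>- \<alpha>\<close>. The sign is absorbed when \<open>e_m\<close> is moved
  to the left past the vector (\<open>s = t\<close>) or squared (\<open>s = t + 1\<close>).\<close>

definition emb_ratio :: "nat \<Rightarrow> nat \<Rightarrow> nat \<Rightarrow> real"
  where "emb_ratio n t j = (if t = 0 \<or> t = n then 0 else ck_ratio n j)"

text \<open>The powers of \<open>\<beta>\<close> and \<open>e_m\<close> are evaluated in the two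
  admissible cases; the second branch is meant for \<open>s = t + 1\<close>, where
  \<open>\<beta>\<close> occurs with exponents \<open>- 1\<close> and \<open>0\<close>, so that
  \<open>1 / \<beta>\<close> can be taken out of \<open>shift\<close>.\<close>

definition ck_embedding :: "nat \<Rightarrow> nat \<Rightarrow> nat \<Rightarrow> nat \<Rightarrow> nat \<Rightarrow>
    ((nat \<Rightarrow> real) \<Rightarrow> 'a::real_normed_field clifford) \<Rightarrow> (nat \<Rightarrow> real) \<Rightarrow> 'a clifford"
  where "ck_embedding n s t k j P x = (if s = t
    then ck_mult n j (int k - int j) P x +
      emb_ratio n t j *\<^sub>R ck_mult n (Suc j) (int k - 1 - int j) (\<lambda>x. gen (Suc n) * shift n t j P x) x
    else ck_mult n j (int k - int j) (\<lambda>x. gen (Suc n) * P x) x +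
      (emb_ratio n t j / shift_ratio n t j) *\<^sub>R ck_mult n (Suc j) (int k - 1 - int j) (shift n t j P) x)"

lemma embedding_eq_ck_embedding:
  fixes P :: "(nat \<Rightarrow> real) \<Rightarrow> 'a::real_normed_field clifford"
  assumes m: "3 \<le> m" and t: "t \<le> m - 1" "s = t \<or> s = Suc t"
  shows "embedding m s t k j P = ck_embedding (m - 1) s t k j P"
proof
  fix x
  define n where "n = m - 1"
  have mn: "m = Suc n" "m - 1 = n" "2 \<le> n" using m by (simp_all add: n_def)
  let ?e = "gen (Suc n) :: 'a clifford" and ?u = "cvec n x :: 'a clifford"
  let ?\<beta> = "shift_ratio n t j"
  have X: "X_factor m j z x * Q x = ck_mult n j z Q x" for j z and Q :: "(nat \<Rightarrow> real) \<Rightarrow> 'a clifford"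
  proof (cases "z < 0")
    case False
    have "real m - 1 = real n" by (simp add: mn)
    then have "(real j + 1) / (real m + 2 * real j - 1) = ck_ratio n j"
      by (simp add: ck_ratio_def mn(1))
    with False show ?thesis
      unfolding X_factor_def ck_mult_def F_factor_eq_ck_factor[OF m]
      by (simp add: mn distrib_right mult.assoc)
  qed (simp add: X_factor_def)
  have \<beta>: "- (real j + real m - 1 - real t) / (real j + real t) = ?\<beta>"
    by (simp add: shift_ratio_def mn(1) add_ac)
  have \<alpha>: "(if t = 0 \<or> t = m - 1 then 0 else - (real j + 1) / (real m + 2 * real j - 1)) = - emb_ratio n t j"
    by (simp add: emb_ratio_def ck_ratio_def mn(1) minus_divide_left)
  have inv: "involute (?e * a) = - (?e * involute a)" for a :: "'a clifford"
    by (simp add: involute_mult)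
  have w: "wedge ?u (?e * a) = - (?e * wedge ?u a)" "bullet ?u (?e * a) = - (?e * bullet ?u a)" for a
    by (simp_all add: wedge_def bullet_def inv gen_Suc_cvec_mult mult.assoc distrib_left right_diff_distrib)
      (simp_all add: algebra_simps)
  show "embedding m s t k j P x = ck_embedding (m - 1) s t k j P x"
  proof (cases "s = t")
    case True
    have "embedding m s t k j P x = X_factor m j (int k - int j) x * P x +
        (- emb_ratio n t j) *\<^sub>R (X_factor m (j + 1) (int k - 1 - int j) x * - (?e * shift n t j P x))"
      unfolding embedding_def Let_def \<beta> \<alpha> unfolding mn(2) mn(1) True
      by (simp add: w shift_def distrib_left)
    also have "\<dots> = ck_embedding n s t k j P x"
      using X[of "j + 1" _ "\<lambda>x. ?e * shift n t j P x"] True by (simp add: ck_embedding_def X)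
    finally show ?thesis by (simp add: mn)
  next
    case False
    then have s: "s = Suc t" using t by simp
    \<comment> \<open>Dividing by \<open>\<beta>\<close> is harmless: if
      \<open>\<alpha> \<noteq> 0\<close>, then \<open>0 < t < n\<close>, and numerator and
      denominator of \<open>\<beta>\<close> are nonzero.\<close>
    have nz: "?\<beta> \<noteq> 0 \<or> emb_ratio n t j = 0"
      using t mn by (auto simp: emb_ratio_def shift_ratio_def)
    have e: "?e * (?e * a) = - a" for a by (rule gen_gen_mult)
    have "embedding m s t k j P x = X_factor m j (int k - int j) x * (?e * P x) +
        (- emb_ratio n t j) *\<^sub>R (X_factor m (j + 1) (int k - 1 - int j) x *
          - (inverse ?\<beta> *\<^sub>R wedge ?u (P x) + bullet ?u (P x)))"
      unfolding embedding_def Let_def \<beta> \<alpha> unfolding mn(2) mn(1) s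
      by (simp add: mult.assoc e wedge_minus_right bullet_minus_right distrib_left numeral_2_eq_2 power_int_minus)
    also have "\<dots> = X_factor m j (int k - int j) x * (?e * P x) +
        emb_ratio n t j *\<^sub>R (X_factor m (j + 1) (int k - 1 - int j) x * (inverse ?\<beta> *\<^sub>R shift n t j P x))"
      using nz by (auto simp: shift_def scaleR_add_right scaleR_diff_right distrib_left right_diff_distrib)
    also have "\<dots> = ck_embedding n s t k j P x"
      using X[of "j + 1" _ "shift n t j P"] X[of j _ "\<lambda>x. ?e * P x"] False
      by (simp add: ck_embedding_def divide_inverse)
    finally show ?thesis by (simp add: mn)
  qed
qed

lemma has_partial_ck_embedding:
  assumes P: "P \<in> homogeneous_polys n j UNIV"
  shows "has_partial (Suc n) (ck_embedding n s t (Suc k) j P) x (real (Suc k) *\<^sub>R ck_embedding n s t k j P x)"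
proof -
  have z: "of_int (int (Suc k) - int j) + real j = real (Suc k)" "int (Suc k) - int j - 1 = int k - int j"
    "of_int (int (Suc k) - 1 - int j) + real (Suc j) = real (Suc k)"
    "int (Suc k) - 1 - int j - 1 = int k - 1 - int j"
    by simp_all
  note sP = shift_poly[OF P]
  note e = mult_left_poly
  show ?thesis
  proof (cases "s = t")
    case True
    have "has_partial (Suc n) (\<lambda>x. ck_mult n j (int (Suc k) - int j) P x +
        emb_ratio n t j *\<^sub>R ck_mult n (Suc j) (int (Suc k) - 1 - int j) (\<lambda>x. gen (Suc n) * shift n t j P x) x) x
      (real (Suc k) *\<^sub>R ck_mult n j (int k - int j) P x + emb_ratio n t j *\<^sub>R
        real (Suc k) *\<^sub>R ck_mult n (Suc j) (int k - 1 - int j) (\<lambda>x. gen (Suc n) * shift n t j P x) x)"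
      using has_partial_ck_mult_last[OF P, where z = "int (Suc k) - int j" and x = x, unfolded z]
        has_partial_ck_mult_last[OF e[OF sP], where z = "int (Suc k) - 1 - int j" and x = x, unfolded z]
      by (intro has_partial_add has_partial_cmult)
    then show ?thesis
      unfolding ck_embedding_def[abs_def] if_P[OF True] by (simp only: scaleR_add_right scaleR_left_commute)
  next
    case False
    have "has_partial (Suc n) (\<lambda>x. ck_mult n j (int (Suc k) - int j) (\<lambda>x. gen (Suc n) * P x) x +
        (emb_ratio n t j / shift_ratio n t j) *\<^sub>R ck_mult n (Suc j) (int (Suc k) - 1 - int j) (shift n t j P) x) x
      (real (Suc k) *\<^sub>R ck_mult n j (int k - int j) (\<lambda>x. gen (Suc n) * P x) x + (emb_ratio n t j / shift_ratio n t j) *\<^sub>R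
        real (Suc k) *\<^sub>R ck_mult n (Suc j) (int k - 1 - int j) (shift n t j P) x)"
      using has_partial_ck_mult_last[OF e[OF P], where z = "int (Suc k) - int j" and x = x, unfolded z]
        has_partial_ck_mult_last[OF sP, where z = "int (Suc k) - 1 - int j" and x = x, unfolded z]
      by (intro has_partial_add has_partial_cmult)
    then show ?thesis
      unfolding ck_embedding_def[abs_def] if_not_P[OF False] by (simp only: scaleR_add_right scaleR_left_commute)
  qed
qed

lemma ck_embedding_top:
  "ck_embedding n s t k k P x = (if s = t then P x else gen (Suc n) * P x)"
  and ck_embedding_above: "k < j \<Longrightarrow> ck_embedding n s t k j P x = 0"
  by (simp_all add: ck_embedding_def)

lemma finite_index_pairs [simp]: "finite (index_pairs m s k)"
  by (rule finite_subset[of _ "{0..m - 1} \<times> {0..k}"]) (auto simp: index_pairs_def)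

lemma ck_embedding_dirac:
  assumes P: "P \<in> monogenics n t j" and n: "1 \<le> n"
  shows "dirac (Suc n) (ck_embedding n s t k j P) x = 0"
proof -
  note P' = hp_UNIV[OF monogenicsD(1)[OF P]]
  note e = mult_left_poly
  note sP = shift_poly[OF P']
  have hp: "has_partial i (ck_mult n j z Q) x (partial i (ck_mult n j z Q) x)"
    if Q: "Q \<in> homogeneous_polys n j UNIV" for i j z and Q :: "(nat \<Rightarrow> real) \<Rightarrow> 'a clifford"
  proof (cases "z < 0")
    case True
    then have "ck_mult n j z Q = (\<lambda>_. 0)" by (intro ext) simp
    then show ?thesis by (simp add: has_partial_const)
  next
    case False
    then have "z + int j = int (nat z + j)" by simp
    from has_partial_poly[OF ck_mult_poly[OF Q this]] show ?thesis .
  qed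
  \<comment> \<open>Monogenicity of \<open>Q'\<close> is asked for only if its coefficient
    \<open>a\<close> is nonzero, since \<open>shift_monogenic\<close> does not cover
    \<open>t = j = 0\<close>, where \<open>emb_ratio\<close> is \<open>0\<close>.\<close>
  have *: "dirac (Suc n) (\<lambda>x. ck_mult n j z Q x + a *\<^sub>R ck_mult n (Suc j) z' Q' x) x = 0"
    if Q: "Q \<in> homogeneous_polys n j UNIV" "\<And>x. dirac n Q x = 0"
    and Q': "Q' \<in> homogeneous_polys n (Suc j) UNIV" "a \<noteq> 0 \<Longrightarrow> (\<And>x. dirac n Q' x = 0)"
    for a z z' and Q Q' :: "(nat \<Rightarrow> real) \<Rightarrow> 'a clifford"
  proof -
    have "dirac (Suc n) (\<lambda>x. 1 *\<^sub>R ck_mult n j z Q x + a *\<^sub>R ck_mult n (Suc j) z' Q' x) x =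
        1 *\<^sub>R dirac (Suc n) (ck_mult n j z Q) x + a *\<^sub>R dirac (Suc n) (ck_mult n (Suc j) z' Q') x"
      by (intro dirac_scaleR_add hp Q Q')
    then show ?thesis
      using ck_mult_monogenic[OF Q n] ck_mult_monogenic[OF Q' n] by (cases "a = 0") simp_all
  qed
  have sh: "dirac n (shift n t j P) x = 0" if "emb_ratio n t j \<noteq> 0" for x
    using that by (intro shift_monogenic P) (auto simp: emb_ratio_def split: if_splits)
  show ?thesis
  proof (cases "s = t")
    case True
    then show ?thesis
      unfolding ck_embedding_def[abs_def]
      by (simp only: if_True simp_thms)
        (intro * P' monogenicsD(2)[OF P] e sP, simp add: dirac_gen_Suc_mult[OF sP] sh)
  next
    case False
    then show ?thesis
      unfolding ck_embedding_def[abs_def]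
      by (simp only: if_False simp_thms)
        (intro * e P' sP, simp add: dirac_gen_Suc_mult[OF P'] monogenicsD(2)[OF P], simp add: sh)
  qed
qed

lemma mult_eq_wedge_bullet: "u * a = wedge u a + bullet u a"
  by (rule wedge_plus_bullet[symmetric])

lemma cvec_shift:
  "cvec n x * shift n t j P x = bullet (cvec n x) (wedge (cvec n x) (P x)) +
    shift_ratio n t j *\<^sub>R wedge (cvec n x) (bullet (cvec n x) (P x))"
  by (simp add: shift_def mult_eq_wedge_bullet wedge_add_right bullet_add_right wedge_scaleR_right bullet_scaleR_right)

text \<open>In the two expansions below the components of degree \<open>s + 2\<close> and \<open>s - 2\<close>, respectively,
  have cancelled. In the exceptional cases the hypothesis replaces the cancellation.\<close>

lemma ck_embedding_same:
  fixes P :: "(nat \<Rightarrow> real) \<Rightarrow> 'a::real_normed_field clifford"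
  assumes "emb_ratio n t j = ck_ratio n j \<or> wedge (cvec n x) (P x) = 0 \<or> k \<le> j"
  shows "ck_embedding n t t k j P x = ck_factor n j (int k - int j) x *\<^sub>R P x +
    ck_factor n (Suc j) (int k - int (Suc j)) x *\<^sub>R (gen (Suc n) *
      ((emb_ratio n t j * shift_ratio n t j - ck_ratio n j) *\<^sub>R bullet (cvec n x) (P x))) +
    ck_factor n (Suc (Suc j)) (int k - int (Suc (Suc j))) x *\<^sub>R
      ((- emb_ratio n t j * ck_ratio n (Suc j)) *\<^sub>R (cvec n x * shift n t j P x))"
proof -
  let ?e = "gen (Suc n) :: 'a clifford" and ?u = "cvec n x :: 'a clifford"
  let ?F1 = "ck_factor n (Suc j) (int k - int (Suc j)) x" and ?F2 = "ck_factor n (Suc (Suc j)) (int k - int (Suc (Suc j))) x"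
  let ?c = "ck_ratio n j" and ?a = "emb_ratio n t j" and ?b = "shift_ratio n t j"
  have z: "int k - int j - 1 = int k - int (Suc j)" "int k - 1 - int j = int k - int (Suc j)"
    "int k - int (Suc j) - 1 = int k - int (Suc (Suc j))" by simp_all
  have 0: "((?a - ?c) * ?F1) *\<^sub>R (?e * wedge ?u (P x)) = 0"
    using assms by auto
  have 1: "?u * (?e * P x) = - (?e * wedge ?u (P x)) - ?e * bullet ?u (P x)"
  proof -
    have "?u * (?e * P x) = - (?e * (?u * P x))" by (simp add: gen_Suc_cvec_mult)
    then show ?thesis by (simp add: mult_eq_wedge_bullet[of ?u "P x"] distrib_left)
  qed
  have 2: "?u * (?e * (?e * shift n t j P x)) = - (?u * shift n t j P x)"
    by (simp add: gen_gen_mult)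
  have "ck_embedding n t t k j P x = ck_factor n j (int k - int j) x *\<^sub>R P x +
      (?c * ?F1) *\<^sub>R (- (?e * wedge ?u (P x)) - ?e * bullet ?u (P x)) +
      ?a *\<^sub>R (?F1 *\<^sub>R (?e * wedge ?u (P x) + ?b *\<^sub>R (?e * bullet ?u (P x))) +
        (ck_ratio n (Suc j) * ?F2) *\<^sub>R (- (?u * shift n t j P x)))"
    unfolding ck_embedding_def ck_mult_def z 1 2 by (simp add: shift_def distrib_left)
  also have "\<dots> = ck_factor n j (int k - int j) x *\<^sub>R P x + ((?a - ?c) * ?F1) *\<^sub>R (?e * wedge ?u (P x)) +
      ?F1 *\<^sub>R (?e * ((?a * ?b - ?c) *\<^sub>R bullet ?u (P x))) +
      ?F2 *\<^sub>R ((- ?a * ck_ratio n (Suc j)) *\<^sub>R (?u * shift n t j P x))"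
    by (simp add: algebra_simps)
  finally show ?thesis unfolding 0 by simp
qed

lemma ck_embedding_Suc:
  fixes P :: "(nat \<Rightarrow> real) \<Rightarrow> 'a::real_normed_field clifford"
  assumes "emb_ratio n t j = ck_ratio n j \<and> shift_ratio n t j \<noteq> 0 \<or> emb_ratio n t j = 0 \<and> bullet (cvec n x) (P x) = 0 \<or> k \<le> j"
  shows "ck_embedding n (Suc t) t k j P x = ck_factor n j (int k - int j) x *\<^sub>R (gen (Suc n) * P x) +
    ck_factor n (Suc j) (int k - int (Suc j)) x *\<^sub>R
      ((emb_ratio n t j / shift_ratio n t j - ck_ratio n j) *\<^sub>R wedge (cvec n x) (P x)) +
    ck_factor n (Suc (Suc j)) (int k - int (Suc (Suc j))) x *\<^sub>R
      (gen (Suc n) * ((- (emb_ratio n t j / shift_ratio n t j) * ck_ratio n (Suc j)) *\<^sub>R (cvec n x * shift n t j P x)))"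
proof -
  let ?e = "gen (Suc n) :: 'a clifford" and ?u = "cvec n x :: 'a clifford"
  let ?F1 = "ck_factor n (Suc j) (int k - int (Suc j)) x" and ?F2 = "ck_factor n (Suc (Suc j)) (int k - int (Suc (Suc j))) x"
  let ?c = "ck_ratio n j" and ?b = "shift_ratio n t j" and ?d = "emb_ratio n t j / shift_ratio n t j"
  have z: "int k - int j - 1 = int k - int (Suc j)" "int k - 1 - int j = int k - int (Suc j)"
    "int k - int (Suc j) - 1 = int k - int (Suc (Suc j))" by simp_all
  have 0: "((?d * ?b - ?c) * ?F1) *\<^sub>R bullet ?u (P x) = 0"
    using assms by auto
  have 1: "?u * (?e * (?e * P x)) = - wedge ?u (P x) - bullet ?u (P x)"
    by (simp add: gen_gen_mult mult_eq_wedge_bullet[of ?u "P x"])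
  have 2: "?u * (?e * shift n t j P x) = - (?e * (?u * shift n t j P x))"
    by (simp add: gen_Suc_cvec_mult)
  have "ck_embedding n (Suc t) t k j P x = ck_factor n j (int k - int j) x *\<^sub>R (?e * P x) +
      (?c * ?F1) *\<^sub>R (- wedge ?u (P x) - bullet ?u (P x)) +
      ?d *\<^sub>R (?F1 *\<^sub>R (wedge ?u (P x) + ?b *\<^sub>R bullet ?u (P x)) +
        (ck_ratio n (Suc j) * ?F2) *\<^sub>R (- (?e * (?u * shift n t j P x))))"
    unfolding ck_embedding_def ck_mult_def z 1 2 by (simp add: shift_def)
  also have "\<dots> = ck_factor n j (int k - int j) x *\<^sub>R (?e * P x) + ((?d * ?b - ?c) * ?F1) *\<^sub>R bullet ?u (P x) +
      ?F1 *\<^sub>R ((?d - ?c) *\<^sub>R wedge ?u (P x)) +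
      ?F2 *\<^sub>R (?e * ((- ?d * ck_ratio n (Suc j)) *\<^sub>R (?u * shift n t j P x)))"
    by (simp add: algebra_simps)
  finally show ?thesis unfolding 0 by simp
qed

lemma wedge_poly:
  assumes P: "P \<in> homogeneous_polys n j (multivectors n t)"
  shows "(\<lambda>x. wedge (cvec n x) (P x)) \<in> homogeneous_polys n (Suc j) (multivectors n (Suc t))"
    and bullet_poly: "(\<lambda>x. bullet (cvec n x) (P x)) \<in> homogeneous_polys n (Suc j) (multivectors n (t - 1))"
  by (rule wedge.poly[OF P multivectors_real_subspace order_refl]; rule wedge_gen_multivectors; assumption)
    (rule bullet.poly[OF P multivectors_real_subspace order_refl]; rule bullet_gen_multivectors; assumption)

lemma cvec_shift_poly:
  assumes P: "P \<in> homogeneous_polys n j (multivectors n t)"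
  shows "(\<lambda>x. cvec n x * shift n t j P x) \<in> homogeneous_polys n (Suc (Suc j)) (multivectors n t)"
proof -
  have b: "(\<lambda>x. bullet (cvec n x) (wedge (cvec n x) (P x))) \<in> homogeneous_polys n (Suc (Suc j)) (multivectors n t)"
    using bullet_poly[OF wedge_poly(1)[OF P]] by simp
  have w: "(\<lambda>x. wedge (cvec n x) (bullet (cvec n x) (P x))) \<in> homogeneous_polys n (Suc (Suc j)) (multivectors n t)"
  \<comment> \<open>For \<open>t = 0\<close> truncated subtraction would give degree
    \<open>0\<close> for the inner product and degree \<open>1\<close> after the wedge; instead the
    inner product vanishes.\<close>
  proof (cases t)
    case 0
    then have "bullet (cvec n x) (P x) = 0" for x
      using homogeneous_polys_range[OF P multivectors_real_subspace] bullet_cvec_scalar by blast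
    then show ?thesis by (simp add: homogeneous_polys_zero)
  next
    case (Suc p)
    then show ?thesis using wedge_poly(1)[OF bullet_poly[OF P]] by simp
  qed
  show ?thesis
    unfolding cvec_shift
    by (intro homogeneous_polys_add homogeneous_polys_scaleR multivectors_real_subspace b w)
qed

lemma gen_Suc_mult_poly:
  assumes P: "P \<in> homogeneous_polys n j (multivectors n t)"
  shows "(\<lambda>x. gen (Suc n) * P x) \<in> homogeneous_polys n j (multivectors (Suc n) (Suc t))"
  by (rule homogeneous_polys_map[OF P linear_mult_left gen_Suc_mult_multivectors])

lemma poly_multivectors_Suc:
  "P \<in> homogeneous_polys n j (multivectors n t) \<Longrightarrow> P \<in> homogeneous_polys n j (multivectors (Suc n) t)"
  by (erule homogeneous_polys_mono) (auto intro: multivectors_mono[rotated])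

text \<open>For \<open>m \<ge> 1\<close> this turns out to be the criterion for the space of
  monogenics to be nonzero, see \<open>monogenics_trivial\<close> and
  \<open>monogenics_nonzero\<close>. It describes the admissible pairs \<open>(t, j)\<close> as well
  as the nonexceptional \<open>(s, k)\<close>.\<close>

definition nontrivial :: "nat \<Rightarrow> nat \<Rightarrow> nat \<Rightarrow> bool"
  where "nontrivial m s k \<longleftrightarrow> s \<le> m \<and> (s \<in> {0, m} \<longrightarrow> k = 0)"

lemma index_pairs_iff:
  "(t, j) \<in> index_pairs (Suc n) s k \<longleftrightarrow> nontrivial n t j \<and> j \<le> k \<and> (s = t \<or> s = Suc t)"
  by (auto simp: index_pairs_def nontrivial_def)

lemma ck_embedding_monogenic:
  fixes P :: "(nat \<Rightarrow> real) \<Rightarrow> 'a::real_normed_field clifford"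
  assumes P: "P \<in> monogenics n t j" and I: "(t, j) \<in> index_pairs (Suc n) s k"
    and s: "nontrivial (Suc n) s k" and n: "1 \<le> n"
  shows "ck_embedding n s t k j P \<in> monogenics (Suc n) s k"
proof -
  note P' = monogenicsD(1)[OF P]
  have I': "nontrivial n t j" "j \<le> k" "s = t \<or> s = Suc t" using I by (auto simp: index_pairs_iff)
  have cong: "f \<in> S" if "\<And>x. f x = g x" "g \<in> S" for f g :: "(nat \<Rightarrow> real) \<Rightarrow> 'a clifford" and S
    using that by (metis ext)
  have V: "subspace (multivectors (Suc n) s :: 'a clifford set)" by (rule multivectors_real_subspace)
  have range: "P x \<in> multivectors n t" for x by (rule homogeneous_polys_range[OF P' multivectors_real_subspace])
  have r: "emb_ratio n t j = ck_ratio n j" "shift_ratio n t j \<noteq> 0" if "t \<noteq> 0" "t \<noteq> n"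
    using that I'(1) by (auto simp: emb_ratio_def shift_ratio_def nontrivial_def)
  have "ck_embedding n s t k j P \<in> homogeneous_polys (Suc n) k (multivectors (Suc n) s)"
  proof (cases "s = t")
    case True
    \<comment> \<open>For \<open>t = n\<close> the wedge with a pseudoscalar is \<open>0\<close>.
      For \<open>t = s = 0\<close> the assumption on \<open>(s, k)\<close> forces
      \<open>k = 0\<close>, so the term with the wedge has a negative index and is absent. The case
      \<open>s = t + 1\<close> below is dual to this one.\<close>
    have A: "emb_ratio n t j = ck_ratio n j \<or> wedge (cvec n x) (P x) = 0 \<or> k \<le> j" for x
    proof (cases "t = n")
      case True
      then show ?thesis using range wedge_cvec_pseudoscalar by blast
    next
      case False
      then show ?thesis using r I' s \<open>s = t\<close> by (cases "t = 0") (auto simp: nontrivial_def)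
    qed
    have B: "(\<lambda>x. gen (Suc n) * (a *\<^sub>R bullet (cvec n x) (P x))) \<in> homogeneous_polys n (Suc j) (multivectors (Suc n) t)" for a
    proof (cases t)
      case 0
      then have "bullet (cvec n x) (P x) = 0" for x using range bullet_cvec_scalar by blast
      then show ?thesis by (simp add: homogeneous_polys_zero)
    next
      case (Suc p)
      then show ?thesis
        using gen_Suc_mult_poly[OF homogeneous_polys_scaleR[OF multivectors_real_subspace bullet_poly[OF P']]] by simp
    qed
    show ?thesis
      unfolding True
      by (rule cong[OF ck_embedding_same[OF A]])
        (intro homogeneous_polys_add V[unfolded True] ck_factor_mult_poly[OF poly_multivectors_Suc[OF P']]
          ck_factor_mult_poly[OF B]
          ck_factor_mult_poly[OF homogeneous_polys_scaleR[OF V[unfolded True] poly_multivectors_Suc[OF cvec_shift_poly[OF P']]]];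
         simp)
  next
    case False
    then have s': "s = Suc t" using I' by simp
    have A: "emb_ratio n t j = ck_ratio n j \<and> shift_ratio n t j \<noteq> 0 \<or> emb_ratio n t j = 0 \<and> bullet (cvec n x) (P x) = 0 \<or> k \<le> j" for x
    proof (cases "t = 0")
      case True
      then show ?thesis using range bullet_cvec_scalar[of "P x" n n x] by (auto simp: emb_ratio_def)
    next
      case False
      then show ?thesis using r I' s s' by (cases "t = n") (auto simp: nontrivial_def)
    qed
    show ?thesis
      unfolding s'
      by (rule cong[OF ck_embedding_Suc[OF A]])
        (intro homogeneous_polys_add V[unfolded s'] ck_factor_mult_poly[OF gen_Suc_mult_poly[OF P']]
          ck_factor_mult_poly[OF homogeneous_polys_scaleR[OF V[unfolded s'] poly_multivectors_Suc[OF wedge_poly(1)[OF P']]]]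
          ck_factor_mult_poly[OF gen_Suc_mult_poly[OF homogeneous_polys_scaleR[OF multivectors_real_subspace cvec_shift_poly[OF P']]]];
         simp)
  qed
  then show ?thesis using ck_embedding_dirac[OF P n] by (simp add: monogenics_def)
qed

subsection \<open>Linearity\<close>

lemma monogenics_zero: "(\<lambda>_. 0) \<in> monogenics n t j"
  by (simp add: monogenics_def homogeneous_polys_zero)

lemma monogenics_add_scaleR:
  assumes f: "f \<in> monogenics n t j" and g: "g \<in> monogenics n t j"
  shows "(\<lambda>x. a *\<^sub>R f x + b *\<^sub>R g x) \<in> monogenics n t j"
  unfolding monogenics_def
  using homogeneous_polys_add[OF multivectors_real_subspace
      homogeneous_polys_scaleR[OF multivectors_real_subspace monogenicsD(1)[OF f]]
      homogeneous_polys_scaleR[OF multivectors_real_subspace monogenicsD(1)[OF g]]]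
    dirac_scaleR_add[OF has_partial_poly[OF monogenicsD(1)[OF f]] has_partial_poly[OF monogenicsD(1)[OF g]]]
    monogenicsD(2)[OF f] monogenicsD(2)[OF g]
  by simp

lemma monogenics_add: "f \<in> monogenics n t j \<Longrightarrow> g \<in> monogenics n t j \<Longrightarrow> (\<lambda>x. f x + g x) \<in> monogenics n t j"
  using monogenics_add_scaleR[of f n t j g 1 1] by simp

lemma monogenics_diff: "f \<in> monogenics n t j \<Longrightarrow> g \<in> monogenics n t j \<Longrightarrow> (\<lambda>x. f x - g x) \<in> monogenics n t j"
  using monogenics_add_scaleR[of f n t j g 1 "- 1"] by simp

lemma monogenics_scaleR: "f \<in> monogenics n t j \<Longrightarrow> (\<lambda>x. a *\<^sub>R f x) \<in> monogenics n t j"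
  using monogenics_add_scaleR[of f n t j f a 0] by simp

lemma monogenics_sum:
  "(\<And>i. i \<in> S \<Longrightarrow> f i \<in> monogenics n t j) \<Longrightarrow> (\<lambda>x. \<Sum>i\<in>S. f i x) \<in> monogenics n t j"
  by (induction S rule: infinite_finite_induct) (auto intro: monogenics_zero monogenics_add)

lemma monogenics_map:
  fixes f :: "(nat \<Rightarrow> real) \<Rightarrow> 'a::real_normed_field clifford"
  assumes f: "f \<in> monogenics n t j" and h: "linear h" "\<And>v. v \<in> multivectors n t \<Longrightarrow> h v \<in> multivectors n t'"
    and h': "\<And>i v. i \<in> {1..n} \<Longrightarrow> gen i * h v = h' (gen i * v)" "linear h'"
  shows "(\<lambda>x. h (f x)) \<in> monogenics n t' j"
proof -
  have "dirac n (\<lambda>x. h (f x)) x = h' (dirac n f x)" for x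
    unfolding dirac_def partial_map_poly[OF monogenicsD(1)[OF f] h(1)]
    by (simp add: h'(1) linear_sum[OF h'(2)])
  then show ?thesis
    using homogeneous_polys_map[OF monogenicsD(1)[OF f] h] monogenicsD(2)[OF f] linear_0[OF h'(2)]
    by (simp add: monogenics_def)
qed

lemma monogenics_cscale: "f \<in> monogenics n t j \<Longrightarrow> (\<lambda>x. c *\<^sub>C f x) \<in> monogenics n t j"
  by (rule monogenics_map[where h' = "\<lambda>a. c *\<^sub>C a"])
    (auto intro: linear_cscale multivectors_cscale simp: cscale_mult_right)

lemma monogenics_partial:
  fixes f :: "(nat \<Rightarrow> real) \<Rightarrow> 'a::real_normed_field clifford"
  assumes f: "f \<in> monogenics n t j"
  shows "partial i f \<in> monogenics n t (j - 1)"
proof -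
  have "dirac n (partial i f) x = partial i (dirac n f) x" for x
  proof -
    have "dirac n (partial i f) x = (\<Sum>l=1..n. gen l * partial i (partial l f) x)"
      unfolding dirac_def by (intro sum.cong refl arg_cong2[of _ _ _ _ "(*)"] partial_commute_poly[OF monogenicsD(1)[OF f]])
    also have "\<dots> = partial i (dirac n f) x"
      unfolding dirac_def[abs_def]
      by (intro partialI[symmetric] has_partial_sum has_partial_map_poly[OF partial_in_poly[OF monogenicsD(1)[OF f]]] linear_mult_left)
    finally show ?thesis .
  qed
  moreover have "dirac n f = (\<lambda>_. 0)" using monogenicsD(2)[OF f] by (rule ext)
  ultimately show ?thesis
    using homogeneous_polys_partial(1)[OF monogenicsD(1)[OF f] multivectors_real_subspace]
    by (simp add: monogenics_def)
qed

lemma ck_mult_linear: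
  "ck_mult n j z (\<lambda>x. P x + Q x) x = ck_mult n j z P x + ck_mult n j z Q x"
  "ck_mult n j z (\<lambda>x. r *\<^sub>R P x) x = r *\<^sub>R ck_mult n j z P x"
  "ck_mult n j z (\<lambda>x. c *\<^sub>C P x) x = c *\<^sub>C ck_mult n j z P x"
  by (simp_all add: ck_mult_def distrib_left scaleR_add_right cscale_mult_right cscale_scaleR
      cliff.scale_right_distrib mult.commute)

lemma shift_linear:
  "shift n t j (\<lambda>x. P x + Q x) x = shift n t j P x + shift n t j Q x"
  "shift n t j (\<lambda>x. r *\<^sub>R P x) x = r *\<^sub>R shift n t j P x"
  "shift n t j (\<lambda>x. c *\<^sub>C P x) x = c *\<^sub>C shift n t j P x"
  by (simp_all add: shift_def wedge_add_right bullet_add_right wedge_scaleR_right bullet_scaleR_right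
      wedge_cscale bullet_cscale scaleR_add_right cscale_scaleR cliff.scale_right_distrib mult.commute)

lemma ck_embedding_linear:
  "ck_embedding n s t k j (\<lambda>x. P x + Q x) x = ck_embedding n s t k j P x + ck_embedding n s t k j Q x"
  "ck_embedding n s t k j (\<lambda>x. r *\<^sub>R P x) x = r *\<^sub>R ck_embedding n s t k j P x"
  "ck_embedding n s t k j (\<lambda>x. c *\<^sub>C P x) x = c *\<^sub>C ck_embedding n s t k j P x"
  unfolding ck_embedding_def shift_linear[abs_def]
  by (simp_all add: distrib_left cscale_mult_right ck_mult_linear scaleR_add_right cscale_scaleR
      cliff.scale_right_distrib scaleR_left_commute)

lemma ck_embedding_zero: "ck_embedding n s t k j (\<lambda>_. 0) x = 0"
  using ck_embedding_linear(2)[of n s t k j 0 "\<lambda>_. 0" x] by simp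

subsection \<open>The decomposition\<close>

lemma bullet_bullet_gen: "bullet (gen i) (bullet (gen i) a) = 0"
  for a :: "'a::real_normed_field clifford"
  by (rule clifford_eqI) (auto simp: coeff_bullet_gen coeff_gen_mult)

lemma bullet_gen_Suc_multivectors:
  fixes a :: "'a::real_normed_field clifford"
  assumes "a \<in> multivectors (Suc n) s"
  shows "bullet (gen (Suc n)) a \<in> multivectors n (s - 1)"
  unfolding multivectors_iff
proof (intro allI impI)
  fix C assume C: "coeff (bullet (gen (Suc n)) a) C \<noteq> 0"
  then have "Suc n \<notin> C" by (auto simp: coeff_bullet_gen split: if_splits)
  moreover have "C \<subseteq> {1..Suc n}" "card C = s - 1"
    using bullet_gen_multivectors[OF assms, of "Suc n"] C by (auto simp: multivectors_iff)
  ultimately show "C \<subseteq> {1..n} \<and> card C = s - 1" by (force simp: le_Suc_eq)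
qed

lemma bullet_gen_gen_mult:
  fixes b :: "'a::real_normed_field clifford"
  assumes "bullet (gen i) b = 0"
  shows "bullet (gen i) (gen i * b) = - b"
  using wedge_bullet_gen[of i b] assms by (simp add: mult_eq_wedge_bullet bullet_add_right)

lemma gen_part_unique:
  fixes a b :: "'a::real_normed_field clifford"
  assumes "bullet (gen i) a = 0" "bullet (gen i) b = 0" "a + gen i * b = 0"
  shows "a = 0" "b = 0"
proof -
  have "bullet (gen i) (a + gen i * b) = - b"
    using bullet_gen_gen_mult[OF assms(2)] assms(1) by (simp add: bullet_add_right)
  then show "b = 0" using assms(3) by simp
  then show "a = 0" using assms(3) by simp
qed

text \<open>From \<open>e \<and> (e \<bullet> a) + e \<bullet> (e \<and> a) = - a\<close>. Both
  \<open>- e \<bullet> (e \<and> a)\<close> and \<open>- e \<bullet> a\<close> are free of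
  \<open>e\<close>, so \<open>a = A + e B\<close> is split into its two components;
  \<open>gen_part_unique\<close> shows that they are determined.\<close>

lemma gen_part_split:
  "a = - bullet (gen i) (wedge (gen i) a) + gen i * - bullet (gen i) (a :: 'a::real_normed_field clifford)"
proof -
  have "gen i * - bullet (gen i) a = - wedge (gen i) (bullet (gen i) a)"
    by (simp add: mult_eq_wedge_bullet[of _ "- bullet (gen i) a"] bullet_bullet_gen wedge_minus_right
        bullet_minus_right del: mult_minus_right)
  then have "- bullet (gen i) (wedge (gen i) a) + gen i * - bullet (gen i) a =
      - (wedge (gen i) (bullet (gen i) a) + bullet (gen i) (wedge (gen i) a))"
    by (simp del: mult_minus_right)
  then show ?thesis unfolding wedge_bullet_gen by simp
qed

text \<open>Without dependence on the last variable, \<open>h\<close> is annihilated by the Dirac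
  operator of \<open>R^n\<close>. As \<open>e\<close> anticommutes with the other generators, this
  operator respects the splitting \<open>h = A + e B\<close> up to sign, so both parts are monogenic
  on \<open>R^n\<close>.\<close>

lemma bullet_gen_Suc_monogenic:
  assumes h: "h \<in> monogenics (Suc n) s k" and p: "\<And>x. partial (Suc n) h x = 0"
  shows "h \<in> homogeneous_polys n k (multivectors (Suc n) s)" "dirac n h x = 0"
    "(\<lambda>x. - bullet (gen (Suc n)) (h x)) \<in> monogenics n (s - 1) k"
    "(\<lambda>x. - bullet (gen (Suc n)) (wedge (gen (Suc n)) (h x))) \<in> monogenics n s k"
proof -
  let ?e = "gen (Suc n) :: 'a clifford"
  note h' = monogenicsD(1)[OF h]
  have const: "h x = h (x(Suc n := 0))" for x
  proof -
    have "((\<lambda>t. h (x(Suc n := t))) has_vector_derivative 0) (at t within UNIV)" for t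
      using has_partial_poly[OF h', of "Suc n" "x(Suc n := t)"] p by (simp add: has_partial_def)
    then obtain c where "\<And>t. h (x(Suc n := t)) = c"
      using has_vector_derivative_zero_constant[OF convex_UNIV, of "\<lambda>t. h (x(Suc n := t))"] by auto
    from this[of "x (Suc n)"] this[of 0] show ?thesis by simp
  qed
  have "(\<lambda>x. h (x(Suc n := 0))) \<in> homogeneous_polys n k (multivectors (Suc n) s)"
    by (rule homogeneous_polys_subst[OF h' multivectors_real_subspace, where M = "\<lambda>i l. if l = i then 1 else 0"])
      (auto simp: if_distrib if_distribR cong: if_cong)
  then show hp: "h \<in> homogeneous_polys n k (multivectors (Suc n) s)"
    using const by (metis (no_types, lifting) ext)
  show d: "dirac n h x = 0" for x
    using monogenicsD(2)[OF h, of x] by (simp add: dirac_Suc p)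
  have b: "linear (\<lambda>a. - bullet ?e a)"
    by (intro linearI) (simp_all add: bullet_add_right bullet_scaleR_right)
  have B: "(\<lambda>x. - bullet ?e (h x)) \<in> homogeneous_polys n k (multivectors n (s - 1))"
    by (rule homogeneous_polys_map[OF hp b]) (intro multivectors_minus bullet_gen_Suc_multivectors)
  have anti: "gen i * ?e = - (?e * gen i)" if "i \<in> {1..n}" for i
    using gen_anticommute[of i "Suc n", where 'a='a] that by (simp add: eq_neg_iff_add_eq_0)
  have comm: "gen i * bullet ?e a = - bullet ?e (gen i * a)" if i: "i \<in> {1..n}" for i and a :: "'a clifford"
  proof -
    have "?e * (gen i * a) = - (gen i * (?e * a))" using anti[OF i] by (simp flip: mult.assoc)
    then show ?thesis by (simp add: bullet_def involute_mult right_diff_distrib mult.assoc flip: scaleR_minus_right)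
  qed
  have "dirac n (\<lambda>x. - bullet ?e (h x)) x = bullet ?e (dirac n h x)" for x
    unfolding dirac_def partial_map_poly[OF hp b]
    by (simp add: comm bullet_sum_right)
  then have dB: "dirac n (\<lambda>x. - bullet ?e (h x)) x = 0" for x by (simp add: d)
  with B show B': "(\<lambda>x. - bullet ?e (h x)) \<in> monogenics n (s - 1) k" by (simp add: monogenics_def)
  have w: "linear (\<lambda>a. - bullet ?e (wedge ?e a))"
    by (intro linearI) (simp_all add: bullet_add_right bullet_scaleR_right wedge_add_right wedge_scaleR_right)
  have A: "(\<lambda>x. - bullet ?e (wedge ?e (h x))) \<in> homogeneous_polys n k (multivectors n s)"
  proof (rule homogeneous_polys_map[OF hp w])
    fix v :: "'a clifford" assume "v \<in> multivectors (Suc n) s"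
    then have "wedge ?e v \<in> multivectors (Suc n) (Suc s)" by (intro wedge_gen_multivectors) auto
    from multivectors_minus[OF bullet_gen_Suc_multivectors[OF this]]
    show "- bullet ?e (wedge ?e v) \<in> multivectors n s" by simp
  qed
  have eq: "(\<lambda>x. - bullet ?e (wedge ?e (h x))) = (\<lambda>x. 1 *\<^sub>R h x + (- 1) *\<^sub>R (?e * - bullet ?e (h x)))"
  proof
    fix x
    have "h x - ?e * - bullet ?e (h x) = - bullet ?e (wedge ?e (h x))"
      using gen_part_split[of "h x" "Suc n"] by (simp only: diff_eq_eq)
    then show "- bullet ?e (wedge ?e (h x)) = 1 *\<^sub>R h x + (- 1) *\<^sub>R (?e * - bullet ?e (h x))"
      by (simp del: mult_minus_right)
  qed
  have dA: "dirac n (\<lambda>x. - bullet ?e (wedge ?e (h x))) x = 0" for x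
    unfolding eq
    by (subst dirac_scaleR_add)
      (use d dB dirac_gen_Suc_mult[OF B] in \<open>auto intro: has_partial_poly[OF hp] has_partial_partial[OF has_partial_map_poly[OF B linear_mult_left]] simp del: mult_minus_right\<close>)
  with A show "(\<lambda>x. - bullet ?e (wedge ?e (h x))) \<in> monogenics n s k" by (simp add: monogenics_def)
qed

text \<open>There are no \<open>t\<close>-vectors for \<open>t > n\<close>. For pseudoscalars
  \<open>x \<and> f = 0\<close> and for scalars \<open>x \<bullet> f = 0\<close> hold trivially, and
  in positive degree either of them forces \<open>f = 0\<close>.\<close>

lemma monogenics_trivial:
  assumes f: "f \<in> monogenics n t j" and "\<not> nontrivial n t j"
  shows "f x = 0"
proof -
  have range: "f x \<in> multivectors n t" for x
    by (rule homogeneous_polys_range[OF monogenicsD(1)[OF f] multivectors_real_subspace])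
  consider "n < t" | "t = n" "j \<noteq> 0" | "t = 0" "j \<noteq> 0"
    using assms(2) by (auto simp: nontrivial_def)
  then show ?thesis
  proof cases
    case 1
    have "coeff (f x) A = 0" for A
    proof (rule ccontr)
      assume "coeff (f x) A \<noteq> 0"
      then have "A \<subseteq> {1..n}" "card A = t" using range by (auto simp: multivectors_iff)
      then show False using 1 card_mono[of "{1..n}" A] by simp
    qed
    then show ?thesis by (intro clifford_eqI) simp
  next
    case 2
    then show ?thesis using range wedge_cvec_pseudoscalar by (intro monogenic_wedge_zero[OF f]) auto
  next
    case 3
    then have "bullet (cvec n x) (f x) = 0" for x using range bullet_cvec_scalar by blast
    then show ?thesis using 3 by (intro monogenic_bullet_zero[OF f]) auto
  qed
qed

lemma index_pairs_mono: "index_pairs m s k \<subseteq> index_pairs m s (Suc k)"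
  by (auto simp: index_pairs_def)

lemma index_pairs_top:
  assumes p: "p \<in> index_pairs (Suc n) s k" "k \<le> snd p"
  shows "p = (s, k) \<or> (s \<noteq> 0 \<and> p = (s - 1, k))"
  using assms by (cases p) (auto simp: index_pairs_iff)

lemma ck_decomposition_top:
  fixes h :: "(nat \<Rightarrow> real) \<Rightarrow> 'a::real_normed_field clifford"
  assumes h: "h \<in> monogenics (Suc n) s k" and p: "\<And>x. partial (Suc n) h x = 0"
    and s: "nontrivial (Suc n) s k" and n: "1 \<le> n"
  obtains P where "\<And>t j. P (t, j) \<in> monogenics n t j" "\<And>t j. j \<noteq> k \<Longrightarrow> P (t, j) = (\<lambda>_. 0)"
    "\<And>x. h x = (\<Sum>(t, j)\<in>index_pairs (Suc n) s k. ck_embedding n s t k j (P (t, j)) x)"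
proof -
  let ?e = "gen (Suc n) :: 'a clifford"
  let ?I = "index_pairs (Suc n) s k"
  define A where "A = (\<lambda>x. - bullet ?e (wedge ?e (h x)))"
  define B where "B = (\<lambda>x. - bullet ?e (h x))"
  note * = bullet_gen_Suc_monogenic[OF h p]
  have A: "A \<in> monogenics n s k" and B: "B \<in> monogenics n (s - 1) k" using * by (simp_all add: A_def B_def)
  have hAB: "h x = A x + ?e * B x" for x unfolding A_def B_def by (rule gen_part_split)
  define P where "P = (\<lambda>(t, j). if j = k \<and> t = s then A else if j = k \<and> s \<noteq> 0 \<and> t = s - 1 then B else (\<lambda>_. 0))"
  have P: "P (t, j) \<in> monogenics n t j" for t j
    using A B by (auto simp: P_def monogenics_zero)
  have P0: "P (t, j) = (\<lambda>_. 0)" if "j \<noteq> k" for t j using that by (simp add: P_def)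
  let ?g = "\<lambda>x (t, j). ck_embedding n s t k j (P (t, j)) x"
  \<comment> \<open>The two candidates \<open>(s, k)\<close> and \<open>(s - 1, k)\<close>,
    admissible or not; the latter is left out for \<open>s = 0\<close>, where \<open>s - 1\<close>
    is truncated. At a candidate outside \<open>?I\<close> the component lies in a zero
    space.\<close>
  let ?T = "insert (s, k) (if s = 0 then {} else {(s - 1, k)})"
  have "h x = sum (?g x) ?I" for x
  proof -
    have out: "?g x q = 0" if q: "q \<in> ?T - ?I" for q
    proof -
      obtain t where t: "q = (t, k)" "s = t \<or> s = Suc t" using q by (auto split: if_splits)
      then have "\<not> nontrivial n t k" using q by (auto simp: index_pairs_iff)
      then have "P (t, k) = (\<lambda>_. 0)" using monogenics_trivial[OF P] by (intro ext)
      then show ?thesis by (simp add: t ck_embedding_zero)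
    qed
    have "sum (?g x) ?I = sum (?g x) (?I \<union> ?T)"
      by (rule sum.mono_neutral_left) (use out in auto)
    also have "\<dots> = sum (?g x) ?T"
    proof (rule sum.mono_neutral_right)
      show "\<forall>q\<in>?I \<union> ?T - ?T. ?g x q = 0"
      proof
        fix q assume q: "q \<in> ?I \<union> ?T - ?T"
        then have "\<not> k \<le> snd q" using index_pairs_top[of q n s k] by (auto split: if_splits)
        then show "?g x q = 0" by (cases q) (simp add: P0 ck_embedding_zero)
      qed
    qed auto
    also have "\<dots> = h x"
    proof (cases "s = 0")
      case True
      have "A x = h x" "B x = 0"
        using bullet_gen_scalar[of "h x" "Suc n" "Suc n"] True wedge_bullet_gen[of "Suc n" "h x"]
          homogeneous_polys_range[OF monogenicsD(1)[OF h] multivectors_real_subspace, of x]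
        by (auto simp: A_def B_def minus_equation_iff)
      then show ?thesis using True by (simp add: ck_embedding_top P_def)
    next
      case False
      then have "s \<noteq> s - 1" "s - 1 \<noteq> s" by simp_all
      then show ?thesis using False by (simp add: ck_embedding_top P_def hAB del: One_nat_def)
    qed
    finally show ?thesis ..
  qed
  then show ?thesis using that[of P] P P0 by simp
qed

lemma ck_decomposition_exists:
  fixes f :: "(nat \<Rightarrow> real) \<Rightarrow> 'a::real_normed_field clifford"
  assumes "f \<in> monogenics (Suc n) s k" and n: "1 \<le> n" and "nontrivial (Suc n) s k"
  shows "\<exists>P. (\<forall>t j. P (t, j) \<in> monogenics n t j) \<and>
    (\<forall>x. f x = (\<Sum>(t, j)\<in>index_pairs (Suc n) s k. ck_embedding n s t k j (P (t, j)) x))"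
  using assms(1,3)
proof (induction k arbitrary: f)
  case 0
  have "partial (Suc n) f x = 0" for x
    by (rule homogeneous_polys_partial_0[OF monogenicsD(1)[OF 0(1)] multivectors_real_subspace]) simp
  then show ?case by (rule ck_decomposition_top[OF 0(1) _ 0(2) n]) blast
next
  case (Suc k)
  let ?I = "index_pairs (Suc n) s k" and ?J = "index_pairs (Suc n) s (Suc k)"
  have nt: "nontrivial (Suc n) s k" using Suc.prems(2) by (auto simp: nontrivial_def)
  have "partial (Suc n) f \<in> monogenics (Suc n) s k"
    using monogenics_partial[OF Suc.prems(1)] by simp
  from Suc.IH[OF this nt] obtain P where P: "\<And>t j. P (t, j) \<in> monogenics n t j"
    and f': "\<And>x. partial (Suc n) f x = (\<Sum>(t, j)\<in>?I. ck_embedding n s t k j (P (t, j)) x)" by blast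
  \<comment> \<open>Division by \<open>Suc k\<close> inverts the factor in
    \<open>has_partial_ck_embedding\<close>. Components with \<open>j = Suc k\<close> are invisible
    to the derivative and start as \<open>0\<close>; they are supplied by the remainder
    \<open>h\<close>.\<close>
  define Q where "Q = (\<lambda>p x. if p \<in> ?I then (1 / real (Suc k)) *\<^sub>R P p x else 0)"
  have Q: "Q (t, j) \<in> monogenics n t j" for t j
    unfolding Q_def using monogenics_scaleR[OF P] by (cases "(t, j) \<in> ?I") (simp_all add: monogenics_zero)
  define g where "g x = (\<Sum>(t, j)\<in>?J. ck_embedding n s t (Suc k) j (Q (t, j)) x)" for x
  have g: "g \<in> monogenics (Suc n) s (Suc k)"
  proof -
    have "(\<lambda>x. \<Sum>p\<in>?J. ck_embedding n s (fst p) (Suc k) (snd p) (Q p) x) \<in> monogenics (Suc n) s (Suc k)"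
    proof (intro monogenics_sum)
      fix p assume "p \<in> ?J"
      then show "ck_embedding n s (fst p) (Suc k) (snd p) (Q p) \<in> monogenics (Suc n) s (Suc k)"
        using ck_embedding_monogenic[OF Q _ Suc.prems(2) n, of "fst p" "snd p"] by simp
    qed
    then show ?thesis by (simp add: g_def[abs_def] case_prod_unfold)
  qed
  have hg: "has_partial (Suc n) g x (partial (Suc n) f x)" for x
  proof -
    have "has_partial (Suc n) (\<lambda>x. \<Sum>p\<in>?J. ck_embedding n s (fst p) (Suc k) (snd p) (Q p) x) x
        (\<Sum>p\<in>?J. real (Suc k) *\<^sub>R ck_embedding n s (fst p) k (snd p) (Q p) x)"
    proof (intro has_partial_sum has_partial_ck_embedding)
      fix p show "Q p \<in> homogeneous_polys n (snd p) UNIV"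
        using hp_UNIV[OF monogenicsD(1)[OF Q[of "fst p" "snd p"]]] by simp
    qed
    moreover have "(\<Sum>p\<in>?J. real (Suc k) *\<^sub>R ck_embedding n s (fst p) k (snd p) (Q p) x) =
        (\<Sum>p\<in>?I. real (Suc k) *\<^sub>R ck_embedding n s (fst p) k (snd p) (Q p) x)"
      by (rule sum.mono_neutral_right) (use index_pairs_mono in \<open>auto simp: Q_def ck_embedding_zero\<close>)
    moreover have "\<dots> = (\<Sum>p\<in>?I. ck_embedding n s (fst p) k (snd p) (P p) x)"
      by (intro sum.cong refl) (simp add: Q_def ck_embedding_linear)
    ultimately show ?thesis by (simp add: f' g_def[abs_def] case_prod_unfold)
  qed
  define h where "h x = f x - g x" for x
  have h: "h \<in> monogenics (Suc n) s (Suc k)" using monogenics_diff[OF Suc.prems(1) g] by (simp add: h_def[abs_def])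
  have "partial (Suc n) h x = 0" for x
  proof -
    have "has_partial (Suc n) (\<lambda>x. f x + (- 1) *\<^sub>R g x) x (partial (Suc n) f x + (- 1) *\<^sub>R partial (Suc n) f x)"
      by (intro has_partial_add has_partial_cmult hg has_partial_poly[OF monogenicsD(1)[OF Suc.prems(1)]])
    then show ?thesis by (intro partialI) (simp add: h_def[abs_def])
  qed
  then obtain R
    where R: "\<And>t j. R (t, j) \<in> monogenics n t j"
      "\<And>x. h x = (\<Sum>(t, j)\<in>?J. ck_embedding n s t (Suc k) j (R (t, j)) x)"
    by (rule ck_decomposition_top[OF h _ Suc.prems(2) n]) (rule that)
  have "f x = (\<Sum>(t, j)\<in>?J. ck_embedding n s t (Suc k) j (\<lambda>x. Q (t, j) x + R (t, j) x) x)" for x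
  proof -
    have "f x = g x + h x" by (simp add: h_def)
    then show ?thesis unfolding g_def R(2) ck_embedding_linear(1) by (simp add: sum.distrib case_prod_unfold)
  qed
  then show ?case
    using monogenics_add[OF Q R(1)] by (intro exI[of _ "\<lambda>p x. Q p x + R p x"]) simp
qed

text \<open>The derivative in the last variable removes the components with \<open>j = k\<close> and
  keeps the others up to a nonzero factor, so induction makes the latter vanish. What remains is
  \<open>A + e B = 0\<close> with \<open>A\<close> and \<open>B\<close> free of \<open>e\<close>,
  hence \<open>A = B = 0\<close>.\<close>

lemma ck_decomposition_unique:
  fixes P :: "nat \<times> nat \<Rightarrow> (nat \<Rightarrow> real) \<Rightarrow> 'a::real_normed_field clifford"
  assumes P: "\<And>t j. (t, j) \<in> index_pairs (Suc n) s k \<Longrightarrow> P (t, j) \<in> monogenics n t j"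
    and "\<And>x. (\<Sum>(t, j)\<in>index_pairs (Suc n) s k. ck_embedding n s t k j (P (t, j)) x) = 0"
    and "p \<in> index_pairs (Suc n) s k"
  shows "P p x = 0"
proof -
  have top: "P p x = 0"
    if P: "\<And>t j. (t, j) \<in> index_pairs (Suc n) s k \<Longrightarrow> P (t, j) \<in> monogenics n t j"
      and z: "\<And>x. (\<Sum>(t, j)\<in>index_pairs (Suc n) s k. ck_embedding n s t k j (P (t, j)) x) = 0"
      and below: "\<And>t j x. (t, j) \<in> index_pairs (Suc n) s k \<Longrightarrow> j < k \<Longrightarrow> P (t, j) x = 0"
      and p: "p \<in> index_pairs (Suc n) s k" for k p x
  proof -
    let ?I = "index_pairs (Suc n) s k"
    define A where "A = (if (s, k) \<in> ?I then P (s, k) x else 0)"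
    define B where "B = (if s \<noteq> 0 \<and> (s - 1, k) \<in> ?I then P (s - 1, k) x else 0)"
    have "ck_embedding n s t k j (P (t, j)) x = (if (t, j) = (s, k) then A else 0) +
        (if s \<noteq> 0 \<and> (t, j) = (s - 1, k) then gen (Suc n) * B else 0)" (is "?g t j = ?h t j") if I: "(t, j) \<in> ?I" for t j
    proof (cases "j < k")
      case True
      then have "P (t, j) = (\<lambda>_. 0)" using below[OF I] by (intro ext)
      then show ?thesis using True by (simp add: ck_embedding_zero)
    next
      case False
      then have "j = k" "s = t \<or> s = Suc t" using I by (auto simp: index_pairs_iff)
      then show ?thesis using I by (auto simp: A_def B_def ck_embedding_top)
    qed
    then have "(\<Sum>(t, j)\<in>?I. ck_embedding n s t k j (P (t, j)) x) = (\<Sum>(t, j)\<in>?I. (if (t, j) = (s, k) then A else 0) +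
        (if s \<noteq> 0 \<and> (t, j) = (s - 1, k) then gen (Suc n) * B else 0))"
      by (intro sum.cong refl) auto
    also have "\<dots> = A + gen (Suc n) * B"
    proof -
      have "(\<Sum>q\<in>?I. if q = (s, k) then A else 0) = A"
        by (subst sum.delta) (auto simp: A_def)
      moreover have "(\<Sum>q\<in>?I. if s \<noteq> 0 \<and> q = (s - 1, k) then gen (Suc n) * B else 0) = gen (Suc n) * B"
        by (cases "s = 0") (auto simp: B_def)
      ultimately show ?thesis by (simp only: case_prod_unfold prod.collapse sum.distrib)
    qed
    finally have "A + gen (Suc n) * B = 0" using z[of x] by simp
    moreover have "P (t, j) x \<in> multivectors n t" if "(t, j) \<in> ?I" for t j
      using homogeneous_polys_range[OF monogenicsD(1)[OF P[OF that]] multivectors_real_subspace] .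
    then have "bullet (gen (Suc n)) A = 0" "bullet (gen (Suc n)) B = 0"
      unfolding A_def B_def by (auto intro: bullet_gen_outside)
    ultimately have "A = 0" "B = 0" using gen_part_unique by blast+
    then show ?thesis
      using p below[of "fst p" "snd p"] index_pairs_top[of p n s k]
      by (cases "snd p < k") (auto simp: A_def B_def split: if_splits)
  qed
  show ?thesis
    using assms
  proof (induction k arbitrary: p x)
    case 0
    show ?case by (rule top[OF 0(1,2) _ 0(3)]) simp_all
  next
    case (Suc k)
    let ?I = "index_pairs (Suc n) s k" and ?J = "index_pairs (Suc n) s (Suc k)"
    have "(\<Sum>(t, j)\<in>?I. ck_embedding n s t k j (P (t, j)) x) = 0" for x
    proof -
      have "has_partial (Suc n) (\<lambda>x. \<Sum>p\<in>?J. ck_embedding n s (fst p) (Suc k) (snd p) (P p) x) x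
          (\<Sum>p\<in>?J. real (Suc k) *\<^sub>R ck_embedding n s (fst p) k (snd p) (P p) x)"
      proof (intro has_partial_sum has_partial_ck_embedding)
        fix p assume "p \<in> ?J"
        then show "P p \<in> homogeneous_polys n (snd p) UNIV"
          using hp_UNIV[OF monogenicsD(1)[OF Suc.prems(1)[of "fst p" "snd p"]]] by simp
      qed
      moreover have "(\<lambda>x. \<Sum>p\<in>?J. ck_embedding n s (fst p) (Suc k) (snd p) (P p) x) = (\<lambda>_. 0)"
        using Suc.prems(2) by (simp add: case_prod_unfold fun_eq_iff)
      ultimately have "has_partial (Suc n) (\<lambda>_. 0) x (\<Sum>p\<in>?J. real (Suc k) *\<^sub>R ck_embedding n s (fst p) k (snd p) (P p) x)"
        by (simp only:)
      from partialI[OF this] have "(\<Sum>p\<in>?J. real (Suc k) *\<^sub>R ck_embedding n s (fst p) k (snd p) (P p) x) = 0"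
        by (simp only: partial_const)
      moreover have "(\<Sum>p\<in>?J. real (Suc k) *\<^sub>R ck_embedding n s (fst p) k (snd p) (P p) x) =
          (\<Sum>p\<in>?I. real (Suc k) *\<^sub>R ck_embedding n s (fst p) k (snd p) (P p) x)"
        by (rule sum.mono_neutral_right)
          (use index_pairs_mono in \<open>auto simp: index_pairs_iff intro!: ck_embedding_above\<close>)
      ultimately show ?thesis by (simp add: case_prod_unfold flip: scaleR_sum_right)
    qed
    then have "P q y = 0" if "q \<in> ?I" for q y
      using Suc.IH[OF Suc.prems(1)] index_pairs_mono that by blast
    then show ?case
      by (intro top[OF Suc.prems(1,2) _ Suc.prems(3)]) (auto simp: index_pairs_iff)
  qed
qed

lemma ck_embedding_injective:
  fixes P :: "(nat \<Rightarrow> real) \<Rightarrow> 'a::real_normed_field clifford"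
  assumes P: "P \<in> monogenics n t j" and I: "(t, j) \<in> index_pairs (Suc n) s k"
    and z: "\<And>x. ck_embedding n s t k j P x = 0"
  shows "P x = 0"
proof -
  let ?P = "\<lambda>p. if p = (t, j) then P else (\<lambda>_. 0)"
  have "ck_embedding n s t' k j' (?P (t', j')) y = 0" for t' j' y
    using z by (simp add: ck_embedding_zero)
  then have "(\<Sum>(t', j')\<in>index_pairs (Suc n) s k. ck_embedding n s t' k j' (?P (t', j')) y) = 0" for y
    by (auto intro!: sum.neutral)
  from ck_decomposition_unique[OF _ this I, of x] show ?thesis using P by (simp add: monogenics_zero)
qed

section \<open>Reflections\<close>

definition dot :: "nat \<Rightarrow> (nat \<Rightarrow> real) \<Rightarrow> (nat \<Rightarrow> real) \<Rightarrow> real"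
  where "dot n a x = (\<Sum>i=1..n. a i * x i)"

text \<open>The coordinates outside \<open>{1..n}\<close> are required to be \<open>0\<close>, so
  that a unit vector of \<open>R^n\<close> is literally one of \<open>R^m\<close> for
  \<open>m \<ge> n\<close> and reflects functions in the same way there.\<close>

definition unit_vec :: "nat \<Rightarrow> (nat \<Rightarrow> real) \<Rightarrow> bool"
  where "unit_vec n a \<longleftrightarrow> sqnorm n a = 1 \<and> (\<forall>i. i \<notin> {1..n} \<longrightarrow> a i = 0)"

definition reflect :: "nat \<Rightarrow> (nat \<Rightarrow> real) \<Rightarrow> (nat \<Rightarrow> real) \<Rightarrow> nat \<Rightarrow> real"
  where "reflect n a x = (\<lambda>i. x i - 2 * dot n a x * a i)"

text \<open>For a unit vector \<open>u\<close> the inverse is \<open>- u\<close>, so this is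
  \<open>b \<mapsto> u * involute b * cinverse u\<close>: the automorphism of the Clifford algebra
  that extends the reflection of vectors. The involution removes the sign that plain conjugation
  would produce.\<close>

definition cl_reflect :: "'a::real_normed_field clifford \<Rightarrow> 'a clifford \<Rightarrow> 'a clifford"
  where "cl_reflect u b = - (u * involute b * u)"

text \<open>The natural action of a reflection on functions. On homogeneous \<open>s\<close>-vector-valued polynomials
  of degree \<open>k\<close> it agrees with the \<open>H\<close>-action of the unit vector up to the sign \<open>(- 1)\<^sup>k\<^sup>+\<^sup>s\<close>.\<close>

definition fun_reflect :: "nat \<Rightarrow> (nat \<Rightarrow> real) \<Rightarrow> ((nat \<Rightarrow> real) \<Rightarrow> 'a::real_normed_field clifford) \<Rightarrow> (nat \<Rightarrow> real) \<Rightarrow> 'a clifford"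
  where "fun_reflect n a f = (\<lambda>x. cl_reflect (cvec n a) (f (reflect n a x)))"

lemma unit_vec_outside: "unit_vec n a \<Longrightarrow> i \<notin> {1..n} \<Longrightarrow> a i = 0"
  by (simp add: unit_vec_def)

lemma unit_vec_sqnorm: "unit_vec n a \<Longrightarrow> n \<le> m \<Longrightarrow> sqnorm m a = 1"
  unfolding unit_vec_def sqnorm_def by (subst sum.mono_neutral_right[of "{1..m}" "{1..n}"]) auto

lemma unit_vec_dot: "unit_vec n a \<Longrightarrow> n \<le> m \<Longrightarrow> dot m a x = dot n a x"
  unfolding unit_vec_def dot_def by (rule sum.mono_neutral_right) auto

lemma unit_vec_cvec: "unit_vec n a \<Longrightarrow> n \<le> m \<Longrightarrow> cvec m a = cvec n a"
  unfolding unit_vec_def cvec_def by (rule sum.mono_neutral_right) auto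

lemma unit_vec_mono: "unit_vec n a \<Longrightarrow> n \<le> m \<Longrightarrow> unit_vec m a"
  using unit_vec_sqnorm[of n a m] by (auto simp: unit_vec_def)

lemma fun_reflect_mono: "unit_vec n a \<Longrightarrow> n \<le> m \<Longrightarrow> fun_reflect m a f = fun_reflect n a f"
  unfolding fun_reflect_def reflect_def by (simp add: unit_vec_cvec[of n a m] unit_vec_dot[of n a m])

lemma dot_self: "dot n a a = sqnorm n a"
  by (simp add: dot_def sqnorm_def power2_eq_square)

lemma dot_commute: "dot n a x = dot n x a"
  by (simp add: dot_def mult.commute)

lemma dot_lincomb: "dot n a (\<lambda>i. p * x i + q * y i) = p * dot n a x + q * dot n a y"
  by (simp add: dot_def distrib_left sum.distrib sum_distrib_left mult_ac)

lemma dot_reflect: "unit_vec n a \<Longrightarrow> dot n a (reflect n a x) = - dot n a x"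
  using dot_lincomb[of n a 1 x "- 2 * dot n a x" a]
  by (simp add: reflect_def dot_self unit_vec_def)

lemma reflect_reflect: "unit_vec n a \<Longrightarrow> reflect n a (reflect n a x) = x"
  by (rule ext) (simp add: reflect_def[of n a "reflect n a x"] dot_reflect, simp add: reflect_def)

lemma sqnorm_reflect: "unit_vec n a \<Longrightarrow> sqnorm n (reflect n a x) = sqnorm n x"
proof -
  assume a: "unit_vec n a"
  have e: "reflect n a x = (\<lambda>i. 1 * x i + (- 2 * dot n a x) * a i)" by (simp add: reflect_def)
  have D: "dot n y (reflect n a x) = dot n y x - 2 * dot n a x * dot n y a" for y
    unfolding e dot_lincomb by simp
  have "dot n (reflect n a x) x = dot n x x - 2 * dot n a x * dot n a x"
    using D[of x] dot_commute[of n x "reflect n a x"] dot_commute[of n x a] by simp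
  moreover have "dot n (reflect n a x) a = - dot n a x"
    using dot_reflect[OF a, of x] dot_commute[of n a "reflect n a x"] by simp
  ultimately show ?thesis using D[of "reflect n a x"] by (simp add: dot_self)
qed

lemma reflect_outside: "unit_vec n a \<Longrightarrow> i \<notin> {1..n} \<Longrightarrow> reflect n a x i = x i"
  by (simp add: reflect_def unit_vec_outside)

lemma cvec_cong: "(\<And>i. i \<in> {1..n} \<Longrightarrow> x i = y i) \<Longrightarrow> cvec n x = cvec n y"
  by (simp add: cvec_def)

lemma cvec_lincomb: "cvec n (\<lambda>i. p * x i + q * y i) = p *\<^sub>R cvec n x + q *\<^sub>R cvec n y"
  by (simp add: cvec_def scaleR_add_left sum.distrib scaleR_sum_right)

lemma unit_vec_square: "unit_vec n a \<Longrightarrow> cvec n a * cvec n a = (- 1 :: 'a::real_normed_field clifford)"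
  by (simp add: cvec_square unit_vec_def sqnorm_def)

lemma unit_vec_cancel: "unit_vec n a \<Longrightarrow> cvec n a * (cvec n a * b) = - (b :: 'a::real_normed_field clifford)"
  by (simp add: unit_vec_square flip: mult.assoc)

lemma linear_cl_reflect: "linear (cl_reflect u)"
  by (intro linearI) (simp_all add: cl_reflect_def involute_add involute_scaleR algebra_simps)

lemma cl_reflect_cscale: "cl_reflect u (c *\<^sub>C b) = c *\<^sub>C cl_reflect u b"
  by (simp add: cl_reflect_def involute_cscale cscale_mult_left cscale_mult_right)

lemma cl_reflect_mult:
  "unit_vec n a \<Longrightarrow> cl_reflect (cvec n a) (b * c) = cl_reflect (cvec n a) b * cl_reflect (cvec n a) c"
  by (simp add: cl_reflect_def involute_mult mult.assoc unit_vec_cancel)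

lemma cl_reflect_involute: "cl_reflect (cvec n a) (involute b) = involute (cl_reflect (cvec n a) b)"
  by (simp add: cl_reflect_def involute_minus involute_mult)

lemma cl_reflect_cl_reflect:
  "unit_vec n a \<Longrightarrow> cl_reflect (cvec n a) (cl_reflect (cvec n a) b) = b"
  by (simp add: cl_reflect_def involute_minus involute_mult mult.assoc unit_vec_cancel unit_vec_square)

lemma cl_reflect_eq_iff:
  "unit_vec n a \<Longrightarrow> cl_reflect (cvec n a) b = cl_reflect (cvec n a) c \<longleftrightarrow> b = c"
  by (metis cl_reflect_cl_reflect)

lemma cl_reflect_wedge: "unit_vec n a \<Longrightarrow>
    cl_reflect (cvec n a) (wedge v b) = wedge (cl_reflect (cvec n a) v) (cl_reflect (cvec n a) b)"
  and cl_reflect_bullet: "unit_vec n a \<Longrightarrow>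
    cl_reflect (cvec n a) (bullet v b) = bullet (cl_reflect (cvec n a) v) (cl_reflect (cvec n a) b)"
  by (simp_all add: wedge_def bullet_def linear_scale[OF linear_cl_reflect] linear_add[OF linear_cl_reflect]
      linear_diff[OF linear_cl_reflect] cl_reflect_mult cl_reflect_involute)

lemma cl_reflect_cvec:
  fixes a :: "nat \<Rightarrow> real"
  assumes a: "unit_vec n a" "n \<le> m"
  shows "cl_reflect (cvec n a) (cvec m x) = (cvec m (reflect n a x) :: 'b::real_normed_field clifford)"
proof -
  let ?u = "cvec m a :: 'b clifford"
  have u: "unit_vec m a" using unit_vec_mono[OF a] .
  have "?u * cvec m x + cvec m x * ?u = (- 2 * dot n a x) *\<^sub>R 1"
    using cvec_anticommute[of m a x, where 'a='b] unit_vec_dot[OF a, of x] by (simp add: dot_def[of m])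
  then have "cvec m x * ?u = (- 2 * dot n a x) *\<^sub>R 1 - ?u * cvec m x"
    by (simp only: eq_diff_eq add.commute)
  then have "?u * (cvec m x * ?u) = cvec m x + (- 2 * dot n a x) *\<^sub>R ?u"
    by (simp add: distrib_left unit_vec_cancel[OF u] right_diff_distrib)
  also have "\<dots> = cvec m (reflect n a x)"
    using cvec_lincomb[of m 1 x "- 2 * dot n a x" a, where 'a='b] by (simp add: reflect_def)
  finally show ?thesis
    unfolding unit_vec_cvec[OF a, symmetric] by (simp add: cl_reflect_def mult.assoc)
qed

text \<open>The reflected element equals
  \<open>u \<and> (u \<bullet> b) - u \<bullet> (u \<and> b)\<close>; the parts of degree
  \<open>t + 2\<close> and \<open>t - 2\<close> vanish because \<open>u \<and> (u \<and> b)\<close>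
  and \<open>u \<bullet> (u \<bullet> b)\<close> do.\<close>

lemma cl_reflect_multivectors:
  fixes b :: "'a::real_normed_field clifford"
  assumes "unit_vec n a" "n \<le> m" and b: "b \<in> multivectors m t"
  shows "cl_reflect (cvec n a) b \<in> multivectors m t"
proof -
  let ?u = "cvec m a :: 'a clifford"
  have iu: "involute b * ?u = wedge ?u b - bullet ?u b"
    by (simp add: wedge_def bullet_def algebra_simps flip: scaleR_add_left)
  have "cl_reflect (cvec n a) b = - (?u * (wedge ?u b - bullet ?u b))"
    unfolding cl_reflect_def unit_vec_cvec[OF assms(1,2), symmetric] mult.assoc iu ..
  also have "\<dots> = wedge ?u (bullet ?u b) - bullet ?u (wedge ?u b)"
    unfolding mult_eq_wedge_bullet[of ?u] by (simp add: wedge_diff_right bullet_diff_right)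
  also have "\<dots> \<in> multivectors m t"
  proof (intro multivectors_diff)
    show "bullet ?u (wedge ?u b) \<in> multivectors m t"
      using bullet_cvec_multivectors[OF wedge_cvec_multivectors[OF b]] by simp
    show "wedge ?u (bullet ?u b) \<in> multivectors m t"
    proof (cases t)
      case 0
      then have "bullet ?u b = 0" using b bullet_cvec_scalar by blast
      then show ?thesis by simp
    next
      case (Suc p)
      then show ?thesis using wedge_cvec_multivectors[OF bullet_cvec_multivectors[OF b]] by simp
    qed
  qed
  finally show ?thesis .
qed

lemma fun_reflect_monogenic:
  fixes f :: "(nat \<Rightarrow> real) \<Rightarrow> 'a::real_normed_field clifford"
  assumes a: "unit_vec n a" "n \<le> m" and f: "f \<in> monogenics m t j"
  shows "fun_reflect n a f \<in> monogenics m t j"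
proof -
  let ?g = "cl_reflect (cvec n a) :: 'a clifford \<Rightarrow> _"
  let ?M = "\<lambda>i l. (if l = i then 1 else 0) - 2 * a l * a i"
  note f' = monogenicsD(1)[OF f]
  have L: "reflect n a x i = (\<Sum>l=1..m. ?M i l * x l)" if "i \<in> {1..m}" for x i
  proof -
    have "(\<Sum>l=1..m. ?M i l * x l) = x i - 2 * dot m a x * a i"
      unfolding left_diff_distrib sum_subtractf
      using that by (simp add: if_distrib if_distribR dot_def sum_distrib_left sum_distrib_right mult_ac cong: if_cong)
    then show ?thesis by (simp add: reflect_def unit_vec_dot[OF a])
  qed
  have s: "(\<lambda>x. f (reflect n a x)) \<in> homogeneous_polys m j (multivectors m t)"
    by (rule homogeneous_polys_subst[OF f' multivectors_real_subspace, where M = ?M]) (rule L)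
  have "fun_reflect n a f \<in> homogeneous_polys m j (multivectors m t)"
    unfolding fun_reflect_def
    by (rule homogeneous_polys_map[OF s linear_cl_reflect cl_reflect_multivectors[OF a]])
  moreover have "dirac m (fun_reflect n a f) x = 0" for x
  proof -
    \<comment> \<open>The matrix \<open>?M\<close> of the reflection is symmetric and serves both
      for the chain rule and for the images of the generators. This is why the Dirac operator
      commutes with the action.\<close>
    have col: "(\<Sum>i=1..m. ?M l i *\<^sub>R gen i) = ?g (gen l)" if l: "l \<in> {1..m}" for l
    proof -
      let ?d = "\<lambda>i. if i = l then 1 else 0 :: real"
      have "dot n a ?d = a l"
        unfolding unit_vec_dot[OF a, symmetric] dot_def using l unit_vec_outside[OF a(1), of l] by (auto simp: if_distrib cong: if_cong)
      then have "?g (gen l) = cvec m (\<lambda>i. ?d i - 2 * a l * a i)"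
        unfolding gen_eq_cvec[OF l] cl_reflect_cvec[OF a] by (simp add: reflect_def)
      also have "\<dots> = (\<Sum>i=1..m. ?M l i *\<^sub>R gen i)"
        unfolding cvec_def by (intro sum.cong refl) (simp add: mult.commute mult.left_commute)
      finally show ?thesis ..
    qed
    have "dirac m (fun_reflect n a f) x = (\<Sum>i=1..m. gen i * ?g (\<Sum>l=1..m. ?M l i *\<^sub>R partial l f (reflect n a x)))"
      unfolding dirac_def
    proof (intro sum.cong refl arg_cong2[of _ _ _ _ "(*)"])
      fix i assume i: "i \<in> {1..m}"
      have "partial i (fun_reflect n a f) x = ?g (partial i (\<lambda>x. f (reflect n a x)) x)"
        unfolding fun_reflect_def by (rule partial_map_poly[OF s linear_cl_reflect])
      also have "partial i (\<lambda>x. f (reflect n a x)) x = (\<Sum>l=1..m. ?M l i *\<^sub>R partial l f (reflect n a x))"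
        by (rule partial_subst_poly[OF f' _ i, where M = ?M]) (rule L)
      finally show "partial i (fun_reflect n a f) x = ?g \<dots>" .
    qed
    also have "\<dots> = (\<Sum>l=1..m. (\<Sum>i=1..m. ?M l i *\<^sub>R gen i) * ?g (partial l f (reflect n a x)))"
      unfolding linear_sum[OF linear_cl_reflect] linear_scale[OF linear_cl_reflect] sum_distrib_left sum_distrib_right
      by (subst sum.swap) simp
    also have "\<dots> = ?g (dirac m f (reflect n a x))"
      unfolding dirac_def linear_sum[OF linear_cl_reflect] cl_reflect_mult[OF a(1)]
      by (intro sum.cong refl arg_cong2[of _ _ _ _ "(*)"] col)
    finally show ?thesis by (simp add: monogenicsD(2)[OF f] linear_0[OF linear_cl_reflect])
  qed
  ultimately show ?thesis by (simp add: monogenics_def)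
qed

lemma fun_reflect_fun_reflect: "unit_vec n a \<Longrightarrow> fun_reflect n a (fun_reflect n a f) = f"
  by (simp add: fun_reflect_def reflect_reflect cl_reflect_cl_reflect)

text \<open>\<open>e_(n+1)\<close> anticommutes with vectors of \<open>R^n\<close>, and the
  involution contributes the second sign.\<close>

lemma cl_reflect_gen_Suc:
  assumes "unit_vec n a"
  shows "cl_reflect (cvec n a) (gen (Suc n)) = gen (Suc n)"
  unfolding cl_reflect_def
  using gen_Suc_cvec_mult[of n a "cvec n a"] unit_vec_square[OF assms]
  by (simp add: mult.assoc gen_Suc_cvec unit_vec_cancel[OF assms])

text \<open>The scalar factors depend only on the last coordinate and the norm of the others, both
  invariant; the last generator is fixed, and \<open>cvec n\<close> is covariant. So the reflection
  passes through every ingredient.\<close>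

lemma fun_reflect_ck_embedding:
  fixes P :: "(nat \<Rightarrow> real) \<Rightarrow> 'a::real_normed_field clifford"
  assumes a: "unit_vec n a"
  shows "fun_reflect n a (ck_embedding n s t k j P) = ck_embedding n s t k j (fun_reflect n a P)"
proof
  fix x
  let ?u = "cvec n a :: 'a clifford"
  note lin = linear_add[OF linear_cl_reflect] linear_scale[OF linear_cl_reflect]
  have F: "ck_factor n j z (reflect n a x) = ck_factor n j z x" for j z
    using reflect_outside[OF a, of "Suc n" x] by (simp add: ck_factor_def sqnorm_reflect[OF a])
  have u: "cl_reflect ?u (cvec n (reflect n a x)) = cvec n x"
    unfolding cl_reflect_cvec[OF a order_refl] by (simp add: reflect_reflect[OF a])
  have ck: "cl_reflect ?u (ck_mult n j z Q (reflect n a x)) = ck_mult n j z (\<lambda>x. cl_reflect ?u (Q (reflect n a x))) x" for j z Q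
    by (simp add: ck_mult_def F lin cl_reflect_mult[OF a] u cl_reflect_gen_Suc[OF a])
  have sh: "cl_reflect ?u (shift n t j P (reflect n a y)) = shift n t j (\<lambda>x. cl_reflect ?u (P (reflect n a x))) y" for y
    using cl_reflect_cvec[OF a order_refl, of "reflect n a y", where 'b='a]
    by (simp add: shift_def lin cl_reflect_wedge[OF a] cl_reflect_bullet[OF a] reflect_reflect[OF a])
  show "fun_reflect n a (ck_embedding n s t k j P) x = ck_embedding n s t k j (fun_reflect n a P) x"
    unfolding fun_reflect_def ck_embedding_def
    by (simp add: lin ck cl_reflect_mult[OF a] cl_reflect_gen_Suc[OF a] sh)
qed

section \<open>Transitivity of the reflections on the sphere\<close>

definition pole :: "nat \<Rightarrow> nat \<Rightarrow> real"
  where "pole m = (\<lambda>i. if i = m then 1 else 0)"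

lemma reflect_to_pole:
  assumes m: "1 \<le> m" and y: "sqnorm m y = 1" and ne: "i \<in> {1..m}" "y i \<noteq> pole m i"
  obtains a where "unit_vec m a" "\<And>i. i \<in> {1..m} \<Longrightarrow> reflect m a (pole m) i = y i"
proof -
  \<comment> \<open>The mirror is orthogonal to \<open>y - pole m\<close>. Its coordinates outside
    \<open>{1..m}\<close> are cut off to satisfy \<open>unit_vec\<close>; the norm is given by
    \<open>r * r = 2 * (1 - y m)\<close>.\<close>
  define d where "d = (\<lambda>i. if i \<in> {1..m} then y i - pole m i else 0)"
  define r where "r = sqrt (sqnorm m d)"
  have "(d i)\<^sup>2 \<le> sqnorm m d"
    unfolding sqnorm_def by (rule member_le_sum[OF ne(1)]) auto
  moreover have "0 < (d i)\<^sup>2" using ne by (simp add: d_def)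
  ultimately have "0 < sqnorm m d" by linarith
  then have r: "0 < r" "r * r = sqnorm m d" by (simp_all add: r_def)
  have pd: "dot m d (pole m) = y m - 1"
    using m by (simp add: dot_def pole_def d_def if_distrib cong: if_cong)
  have "sqnorm m d = (\<Sum>i=1..m. (y i)\<^sup>2 - 2 * (y i * pole m i) + (pole m i)\<^sup>2)"
    unfolding sqnorm_def by (intro sum.cong refl) (simp add: d_def power2_diff)
  also have "\<dots> = sqnorm m y - 2 * y m + 1"
    unfolding sum.distrib sum_subtractf sum_distrib_left[symmetric]
    using m by (simp add: sqnorm_def pole_def if_distrib if_distribR cong: if_cong)
  finally have rr: "r * r = 2 * (1 - y m)" using y r by simp
  define a where "a = (\<lambda>i. (1 / r) * d i)"
  have a: "unit_vec m a"
  proof -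
    have "sqnorm m a = 1" unfolding a_def sqnorm_scale r(2)[symmetric] using r(1) by (simp add: power2_eq_square)
    then show ?thesis by (auto simp: unit_vec_def a_def d_def)
  qed
  have da: "dot m a (pole m) = (y m - 1) / r"
    using pd by (simp add: a_def dot_def flip: sum_divide_distrib)
  have "reflect m a (pole m) i = y i" if "i \<in> {1..m}" for i
  proof -
    have "reflect m a (pole m) i = pole m i + (2 * (1 - y m) / (r * r)) * d i"
    proof -
      have ai: "a i = d i / r" by (simp add: a_def)
      show ?thesis unfolding reflect_def da ai using r(1) by (simp add: divide_simps) (simp add: algebra_simps)
    qed
    also have "2 * (1 - y m) / (r * r) = 1" unfolding rr[symmetric] using r(1) by simp
    also have "pole m i + 1 * d i = y i" using that by (simp add: d_def)
    finally show ?thesis .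
  qed
  with a show ?thesis using that by blast
qed

section \<open>Equivariant maps\<close>

text \<open>Only reflections are required, in the natural action: unlike the \<open>H\<close>-action
  it carries no sign depending on \<open>t\<close> and \<open>j\<close>, so source and target may
  have different parity.\<close>

definition equivariant_map :: "nat \<Rightarrow> nat \<Rightarrow> nat \<Rightarrow> nat \<Rightarrow> nat \<Rightarrow>
    (((nat \<Rightarrow> real) \<Rightarrow> 'a::real_normed_field clifford) \<Rightarrow> (nat \<Rightarrow> real) \<Rightarrow> 'a clifford) \<Rightarrow> bool"
  where "equivariant_map n t j t' j' T \<longleftrightarrow>
    (\<forall>f\<in>monogenics n t j. T f \<in> monogenics n t' j') \<and>
    (\<forall>f\<in>monogenics n t j. \<forall>g\<in>monogenics n t j. T (\<lambda>x. f x + g x) = (\<lambda>x. T f x + T g x)) \<and>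
    (\<forall>c. \<forall>f\<in>monogenics n t j. T (\<lambda>x. c *\<^sub>C f x) = (\<lambda>x. c *\<^sub>C T f x)) \<and>
    (\<forall>a. unit_vec n a \<longrightarrow> (\<forall>f\<in>monogenics n t j. T (fun_reflect n a f) = fun_reflect n a (T f)))"

context
  fixes n t j t' j' :: nat
    and T :: "((nat \<Rightarrow> real) \<Rightarrow> 'a::real_normed_field clifford) \<Rightarrow> (nat \<Rightarrow> real) \<Rightarrow> 'a clifford"
  assumes T: "equivariant_map n t j t' j' T"
begin

lemma equivariant_mapD:
  shows "f \<in> monogenics n t j \<Longrightarrow> T f \<in> monogenics n t' j'"
    and "f \<in> monogenics n t j \<Longrightarrow> g \<in> monogenics n t j \<Longrightarrow> T (\<lambda>x. f x + g x) = (\<lambda>x. T f x + T g x)"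
    and "f \<in> monogenics n t j \<Longrightarrow> T (\<lambda>x. c *\<^sub>C f x) = (\<lambda>x. c *\<^sub>C T f x)"
    and "unit_vec n a \<Longrightarrow> f \<in> monogenics n t j \<Longrightarrow> T (fun_reflect n a f) = fun_reflect n a (T f)"
  using T by (auto simp: equivariant_map_def)

lemma equivariant_map_zero: "T (\<lambda>_. 0) = (\<lambda>_. 0)"
  using equivariant_mapD(3)[OF monogenics_zero, of 0] by simp

lemma equivariant_map_sum:
  "finite S \<Longrightarrow> (\<And>i. i \<in> S \<Longrightarrow> f i \<in> monogenics n t j) \<Longrightarrow>
    T (\<lambda>x. \<Sum>i\<in>S. f i x) = (\<lambda>x. \<Sum>i\<in>S. T (f i) x)"
  by (induction S rule: finite_induct)
    (simp_all add: equivariant_map_zero equivariant_mapD(2) monogenics_sum)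

text \<open>The group acts transitively on the sphere, so an equivariant relation between \<open>f\<close> and \<open>T f\<close>
  needs to be checked at one point only.\<close>

lemma equivariant_map_transport:
  fixes \<Phi> :: "'a clifford \<Rightarrow> 'a clifford \<Rightarrow> 'a clifford \<Rightarrow> bool"
  assumes n: "1 \<le> n" and \<Phi>: "\<And>a v b c. unit_vec n a \<Longrightarrow>
      \<Phi> (cl_reflect (cvec n a) v) (cl_reflect (cvec n a) b) (cl_reflect (cvec n a) c) \<Longrightarrow> \<Phi> v b c"
    and *: "\<And>f. f \<in> monogenics n t j \<Longrightarrow> \<Phi> (gen n) (f (pole n)) (T f (pole n))"
    and f: "f \<in> monogenics n t j" and y: "sqnorm n y = 1"
  shows "\<Phi> (cvec n y) (f y) (T f y)"
proof -
  have gen: "gen n = (cvec n (pole n) :: 'a clifford)"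
    unfolding pole_def using n by (intro gen_eq_cvec) simp
  note cong = homogeneous_polys_cong[OF monogenicsD(1)]
  show ?thesis
  proof (cases "\<forall>i\<in>{1..n}. y i = pole n i")
    case True
    then have "cvec n y = (gen n :: 'a clifford)" "f y = f (pole n)" "T f y = T f (pole n)"
      using cvec_cong[of n y "pole n"] cong[OF f, of y "pole n"] cong[OF equivariant_mapD(1)[OF f], of y "pole n"]
      by (auto simp: gen)
    then show ?thesis using *[OF f] by simp
  next
    case False
    then obtain a where a: "unit_vec n a" "\<And>i. i \<in> {1..n} \<Longrightarrow> reflect n a (pole n) i = y i"
      using reflect_to_pole[OF n y] by blast
    let ?g = "cl_reflect (cvec n a) :: 'a clifford \<Rightarrow> _"
    have f2: "fun_reflect n a f \<in> monogenics n t j" by (rule fun_reflect_monogenic[OF a(1) order_refl f])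
    have "fun_reflect n a f (pole n) = ?g (f y)"
      unfolding fun_reflect_def using cong[OF f, of "reflect n a (pole n)" y] a(2) by simp
    moreover have "T (fun_reflect n a f) (pole n) = ?g (T f y)"
      unfolding equivariant_mapD(4)[OF a(1) f] unfolding fun_reflect_def
      using cong[OF equivariant_mapD(1)[OF f], of "reflect n a (pole n)" y] a(2) by simp
    moreover have "gen n = ?g (cvec n y)"
    proof -
      have "?g (gen n) = cvec n (reflect n a (pole n))" unfolding gen by (rule cl_reflect_cvec[OF a(1) order_refl])
      also have "\<dots> = cvec n y" using a(2) by (rule cvec_cong)
      finally show ?thesis using cl_reflect_cl_reflect[OF a(1)] by metis
    qed
    ultimately show ?thesis using \<Phi>[OF a(1)] *[OF f2] by metis
  qed
qed

end

definition schur :: "nat \<Rightarrow> 'a::real_normed_field itself \<Rightarrow> bool"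
  where "schur n _ \<longleftrightarrow> (\<forall>t j t' j' T. equivariant_map n t j t' j' T \<longrightarrow>
    (\<exists>c. \<forall>f\<in>monogenics n t j. \<forall>x. T f x = (if (t, j) = (t', j') then c else 0) *\<^sub>C (f x :: 'a clifford)))"

lemma schurD:
  assumes "schur n TYPE('a::real_normed_field)" "equivariant_map n t j t' j' T"
  obtains c where "\<And>f x. f \<in> monogenics n t j \<Longrightarrow> T f x = (if (t, j) = (t', j') then c else 0) *\<^sub>C (f x :: 'a clifford)"
  using assms unfolding schur_def by blast

lemma bullet_gen_wedge_gen:
  fixes A B :: "'a::real_normed_field clifford"
  assumes "bullet (gen i) A = 0" "bullet (gen i) B = 0"
  shows "- bullet (gen i) (A + gen i * B) = B" "- bullet (gen i) (wedge (gen i) (A + gen i * B)) = A"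
proof -
  let ?f = "A + gen i * B"
  show 1: "- bullet (gen i) ?f = B"
    using bullet_gen_gen_mult[OF assms(2)] assms(1) by (simp add: bullet_add_right)
  have "A + gen i * B = - bullet (gen i) (wedge (gen i) ?f) + gen i * B"
    using gen_part_split[of ?f i] unfolding 1 .
  then show "- bullet (gen i) (wedge (gen i) ?f) = A" by simp
qed

text \<open>At the pole the first \<open>n\<close> coordinates vanish, so of the embedding only the
  term with \<open>ck_factor\<close> and \<open>P\<close> survives. It vanishes if \<open>P\<close>
  has positive degree; for \<open>j = 0\<close> the factor is \<open>(1)_k / k! = 1\<close>.\<close>

lemma ck_embedding_pole:
  fixes P :: "(nat \<Rightarrow> real) \<Rightarrow> 'a::real_normed_field clifford"
  assumes P: "P \<in> monogenics n t j" and "j \<le> k"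
  shows "ck_embedding n s t k j P (pole (Suc n)) =
    (if j = 0 then if s = t then P (pole (Suc n)) else gen (Suc n) * P (pole (Suc n)) else 0)"
proof -
  let ?x = "pole (Suc n)"
  have u: "cvec n ?x = (0 :: 'a clifford)" by (simp add: cvec_def pole_def)
  have ck: "ck_mult n j z Q ?x = ck_factor n j z ?x *\<^sub>R Q ?x" for j z and Q :: "(nat \<Rightarrow> real) \<Rightarrow> 'a clifford"
    by (simp add: ck_mult_def u)
  have sh: "shift n t l P ?x = 0" for l by (simp add: shift_def u)
  show ?thesis
  proof (cases "j = 0")
    case True
    have r: "sqnorm n ?x = 0" "?x (Suc n) = 1" by (simp_all add: sqnorm_def pole_def)
    have "ck_sum n 0 (int k) 1 0 = (\<Sum>i\<le>k. if i = 0 then divpow (int k) 1 else 0)"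
      unfolding ck_sum_def by (intro sum.cong) (auto simp: ck_coeff_def power_0_left)
    then have "ck_factor n 0 (int k) ?x = 1"
      by (simp add: ck_factor_def r divpow_int flip: pochhammer_fact)
    then show ?thesis using True by (simp add: ck_embedding_def ck sh)
  next
    case False
    have "P ?x = P (\<lambda>i. 0 * ?x i)"
      by (rule homogeneous_polys_cong[OF monogenicsD(1)[OF P]]) (simp add: pole_def)
    then have "P ?x = 0"
      using homogeneous_polys_homogeneous[OF monogenicsD(1)[OF P] multivectors_real_subspace, of 0 ?x] False
      by (simp add: power_0_left)
    then show ?thesis using False by (simp add: ck_embedding_def ck sh)
  qed
qed

lemma monogenics_const: "v \<in> multivectors n t \<Longrightarrow> (\<lambda>_. v) \<in> monogenics n t 0"
  by (simp add: monogenics_def homogeneous_polys_const dirac_def)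

text \<open>A component of \<open>(T f)(e\<^sub>m)\<close>, composed with an embedding, is an equivariant map into constants
  in one dimension less. By induction it only sees the constant components of \<open>f\<close>, which are
  recovered from \<open>f(e\<^sub>m)\<close>.\<close>

lemma schur_pole_value:
  fixes T :: "((nat \<Rightarrow> real) \<Rightarrow> 'a::real_normed_field clifford) \<Rightarrow> (nat \<Rightarrow> real) \<Rightarrow> 'a clifford"
  assumes IH: "schur n TYPE('a)" and n: "1 \<le> n"
    and T: "equivariant_map (Suc n) t j t' j' T" and nt: "nontrivial (Suc n) t j"
    and \<eta>: "linear \<eta>" "\<And>c b. \<eta> (c *\<^sub>C b) = c *\<^sub>C \<eta> b" "\<And>b. b \<in> multivectors (Suc n) t' \<Longrightarrow> \<eta> b \<in> multivectors n q"
      "\<And>a b. unit_vec n a \<Longrightarrow> \<eta> (cl_reflect (cvec n a) b) = cl_reflect (cvec n a) (\<eta> b)"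
  shows "\<exists>c. \<forall>f\<in>monogenics (Suc n) t j. \<eta> (T f (pole (Suc n))) = c *\<^sub>C
    (if q = t then - bullet (gen (Suc n)) (wedge (gen (Suc n)) (f (pole (Suc n))))
     else if Suc q = t then - bullet (gen (Suc n)) (f (pole (Suc n))) else 0)"
proof -
  let ?m = "Suc n" and ?e = "gen (Suc n) :: 'a clifford" and ?x = "pole (Suc n)"
  let ?I = "index_pairs ?m t j" and ?E = "\<lambda>p i. ck_embedding n t p j i"
  note TD = equivariant_mapD[OF T]
  have E: "?E p i P \<in> monogenics ?m t j" if "P \<in> monogenics n p i" "(p, i) \<in> ?I" for p i P
    using ck_embedding_monogenic[OF that nt n] .
  have mu: "equivariant_map n p i q 0 (\<lambda>P _. \<eta> (T (?E p i P) ?x))" if I: "(p, i) \<in> ?I" for p i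
    unfolding equivariant_map_def
  proof (intro conjI ballI allI impI)
    fix P :: "(nat \<Rightarrow> real) \<Rightarrow> 'a clifford" assume P: "P \<in> monogenics n p i"
    have "T (?E p i P) ?x \<in> multivectors ?m t'"
      by (rule homogeneous_polys_range[OF monogenicsD(1)[OF TD(1)[OF E[OF P I]]] multivectors_real_subspace])
    then show "(\<lambda>_. \<eta> (T (?E p i P) ?x)) \<in> monogenics n q 0" by (intro monogenics_const \<eta>(3))
    show "(\<lambda>_. \<eta> (T (?E p i (\<lambda>x. P x + Q x)) ?x)) = (\<lambda>_. \<eta> (T (?E p i P) ?x) + \<eta> (T (?E p i Q) ?x))"
      if Q: "Q \<in> monogenics n p i" for Q
      using TD(2)[OF E[OF P I] E[OF Q I]] by (simp add: ck_embedding_linear(1)[abs_def] linear_add[OF \<eta>(1)])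
    show "(\<lambda>_. \<eta> (T (?E p i (\<lambda>x. c *\<^sub>C P x)) ?x)) = (\<lambda>_. c *\<^sub>C \<eta> (T (?E p i P) ?x))" for c
      using TD(3)[OF E[OF P I], of c] by (simp add: ck_embedding_linear(3)[abs_def] \<eta>(2))
    fix a assume a: "unit_vec n a"
    have "T (?E p i (fun_reflect n a P)) = fun_reflect n a (T (?E p i P))"
    proof -
      have e: "fun_reflect ?m a h = fun_reflect n a h" for h :: "(nat \<Rightarrow> real) \<Rightarrow> 'a clifford"
        by (rule fun_reflect_mono[OF a]) simp
      show ?thesis
        using TD(4)[OF unit_vec_mono[OF a] E[OF P I]] unfolding e fun_reflect_ck_embedding[OF a] by simp
    qed
    moreover have "reflect n a ?x = ?x"
      unfolding reflect_def dot_def by (simp add: pole_def)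
    ultimately show "(\<lambda>_. \<eta> (T (?E p i (fun_reflect n a P)) ?x)) = fun_reflect n a (\<lambda>_. \<eta> (T (?E p i P) ?x))"
      by (simp add: fun_reflect_def \<eta>(4)[OF a])
  qed
  have mu_value: "\<exists>c. \<forall>P\<in>monogenics n p i. \<eta> (T (?E p i P) ?x) = (if (p, i) = (q, 0) then c else 0) *\<^sub>C P ?x"
    if I: "(p, i) \<in> ?I" for p i
    by (rule schurD[OF IH mu[OF I]]) blast
  have "\<exists>c. \<forall>p i P. (p, i) \<in> ?I \<longrightarrow> P \<in> monogenics n p i \<longrightarrow>
      \<eta> (T (?E p i P) ?x) = (if (p, i) = (q, 0) then c else 0) *\<^sub>C P ?x"
  proof -
    \<comment> \<open>All pairs other than \<open>(q, 0)\<close> give zero, so the constant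
      belonging to this single pair can be used for all of them.\<close>
    obtain c where c: "(q, 0) \<in> ?I \<Longrightarrow> \<forall>P\<in>monogenics n q 0. \<eta> (T (?E q 0 P) ?x) = c *\<^sub>C P ?x"
    proof (cases "(q, 0) \<in> ?I")
      case True
      from mu_value[OF True] show ?thesis using that by auto
    qed (use that in blast)
    show ?thesis
    proof (intro exI[of _ c] allI impI)
      fix p i and P :: "(nat \<Rightarrow> real) \<Rightarrow> 'a clifford" assume I: "(p, i) \<in> ?I" "P \<in> monogenics n p i"
      show "\<eta> (T (?E p i P) ?x) = (if (p, i) = (q, 0) then c else 0) *\<^sub>C P ?x"
      proof (cases "(p, i) = (q, 0)")
        case True
        then show ?thesis using c I by auto
      next
        case False
        then show ?thesis using mu_value[OF I(1)] I(2) by auto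
      qed
    qed
  qed
  then obtain c where c: "\<And>p i P. (p, i) \<in> ?I \<Longrightarrow> P \<in> monogenics n p i \<Longrightarrow>
      \<eta> (T (?E p i P) ?x) = (if (p, i) = (q, 0) then c else 0) *\<^sub>C P ?x" by blast
  show ?thesis
  proof (intro exI[of _ c] ballI)
    fix f :: "(nat \<Rightarrow> real) \<Rightarrow> 'a clifford" assume f: "f \<in> monogenics ?m t j"
    obtain P where P: "\<And>p i. P (p, i) \<in> monogenics n p i"
      and fP: "\<And>x. f x = (\<Sum>(p, i)\<in>?I. ?E p i (P (p, i)) x)"
      using ck_decomposition_exists[OF f n nt] by blast
    define A where "A = (if (t, 0) \<in> ?I then P (t, 0) ?x else 0)"
    define B where "B = (if t \<noteq> 0 \<and> (t - 1, 0) \<in> ?I then P (t - 1, 0) ?x else 0)"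
    have "f ?x = (\<Sum>p\<in>?I. (if p = (t, 0) then A else 0) + (if t \<noteq> 0 \<and> p = (t - 1, 0) then ?e * B else 0))"
      unfolding fP
    proof (rule sum.cong[OF refl])
      fix p assume p: "p \<in> ?I"
      obtain p1 p2 where [simp]: "p = (p1, p2)" by force
      have "p2 \<le> j" "t = p1 \<or> t = Suc p1" using p by (auto simp: index_pairs_iff)
      then show "(case p of (p, i) \<Rightarrow> ?E p i (P (p, i)) ?x) =
          (if p = (t, 0) then A else 0) + (if t \<noteq> 0 \<and> p = (t - 1, 0) then ?e * B else 0)"
        using p ck_embedding_pole[OF P, of p2 j t p1] by (auto simp: A_def B_def)
    qed
    also have "\<dots> = A + ?e * B"
    proof -
      have "(\<Sum>q\<in>?I. if q = (t, 0) then A else 0) = A" by (subst sum.delta) (auto simp: A_def)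
      moreover have "(\<Sum>q\<in>?I. if t \<noteq> 0 \<and> q = (t - 1, 0) then ?e * B else 0) = ?e * B"
        by (cases "t = 0") (auto simp: B_def)
      ultimately show ?thesis by (simp only: sum.distrib)
    qed
    finally have fx: "f ?x = A + ?e * B" .
    have range: "P (p, 0) ?x \<in> multivectors n p" for p
      by (rule homogeneous_polys_range[OF monogenicsD(1)[OF P] multivectors_real_subspace])
    then have 0: "bullet ?e A = 0" "bullet ?e B = 0"
      unfolding A_def B_def by (auto intro: bullet_gen_outside)
    have "f = (\<lambda>x. \<Sum>p\<in>?I. ?E (fst p) (snd p) (P p) x)" by (simp add: fun_eq_iff fP case_prod_unfold)
    moreover have "T (\<lambda>x. \<Sum>p\<in>?I. ?E (fst p) (snd p) (P p) x) = (\<lambda>x. \<Sum>p\<in>?I. T (?E (fst p) (snd p) (P p)) x)"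
      using E[OF P] by (intro equivariant_map_sum[OF T]) (metis prod.collapse finite_index_pairs)+
    ultimately have "\<eta> (T f ?x) = (\<Sum>p\<in>?I. \<eta> (T (?E (fst p) (snd p) (P p)) ?x))"
      by (simp add: linear_sum[OF \<eta>(1)])
    also have "\<dots> = (\<Sum>p\<in>?I. if p = (q, 0) then c *\<^sub>C P (q, 0) ?x else 0)"
    proof (rule sum.cong[OF refl])
      fix p assume "p \<in> ?I"
      then show "\<eta> (T (?E (fst p) (snd p) (P p)) ?x) = (if p = (q, 0) then c *\<^sub>C P (q, 0) ?x else 0)"
        using c[OF _ P, of "fst p" "snd p"] by (cases p) auto
    qed
    also have "\<dots> = (if (q, 0) \<in> ?I then c *\<^sub>C P (q, 0) ?x else 0)" by simp
    also have "\<dots> = c *\<^sub>C (if q = t then A else if Suc q = t then B else 0)"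
      by (auto simp: A_def B_def index_pairs_iff)
    finally show "\<eta> (T f ?x) = c *\<^sub>C (if q = t then - bullet ?e (wedge ?e (f ?x))
        else if Suc q = t then - bullet ?e (f ?x) else 0)"
      unfolding fx bullet_gen_wedge_gen[OF 0] .
  qed
qed

text \<open>Split \<open>(T f)(e_m) = A + e_m B\<close>. By \<open>schur_pole_value\<close>,
  \<open>A\<close> of degree \<open>t'\<close> and \<open>B\<close> of degree \<open>t' - 1\<close>
  see only the parts of \<open>f(e_m)\<close> of the same degree, and these have degrees
  \<open>t\<close> and \<open>t - 1\<close>. For \<open>t' \<noteq> t\<close> at least one of
  \<open>A\<close> and \<open>B\<close> vanishes, which kills \<open>T f\<close> except at the ends
  \<open>t' = 0\<close> and \<open>t' = m\<close>. There \<open>T f\<close> is constant and equals a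
  multiple of \<open>x \<bullet> f\<close> or \<open>x \<and> f\<close> on the sphere, or is zero;
  harmonicity separates degree \<open>0\<close> from degree \<open>j + 1\<close>.\<close>

lemma schur_step:
  assumes IH: "schur n TYPE('a::real_normed_field)" and n: "1 \<le> n"
  shows "schur (Suc n) TYPE('a)"
  unfolding schur_def
proof (intro allI impI)
  fix t j t' j' and T :: "((nat \<Rightarrow> real) \<Rightarrow> 'a clifford) \<Rightarrow> (nat \<Rightarrow> real) \<Rightarrow> 'a clifford"
  assume T: "equivariant_map (Suc n) t j t' j' T"
  let ?m = "Suc n" and ?e = "gen (Suc n) :: 'a clifford" and ?x = "pole (Suc n)"
  let ?M = "monogenics ?m t j :: ((nat \<Rightarrow> real) \<Rightarrow> 'a clifford) set"
  let ?goal = "\<exists>c. \<forall>f\<in>?M. \<forall>x. T f x = (if (t, j) = (t', j') then c else 0) *\<^sub>C f x"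
  note TD = equivariant_mapD[OF T]
  have m: "1 \<le> ?m" by simp
  note split = gen_part_split[of _ ?m]
  have range: "f y \<in> multivectors ?m t'" if "f \<in> monogenics ?m t' j'" for f y
    by (rule homogeneous_polys_range[OF monogenicsD(1)[OF that] multivectors_real_subspace])
  show ?goal
  proof (cases "nontrivial ?m t j \<and> nontrivial ?m t' j'")
    case False
    have "T f x = 0" if f: "f \<in> ?M" for f x
    proof (cases "nontrivial ?m t j")
      case True
      then show ?thesis using monogenics_trivial[OF TD(1)[OF f]] False by simp
    next
      case False
      then have "f = (\<lambda>_. 0)" using monogenics_trivial[OF f] by (intro ext)
      then show ?thesis using equivariant_map_zero[OF T] by simp
    qed
    then show ?thesis by (intro exI[of _ 0]) simp
  next
    case True
    then have nt: "nontrivial ?m t j" and nt': "nontrivial ?m t' j'" by auto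
    have e_refl: "cl_reflect (cvec n a) ?e = ?e" if "unit_vec n a" for a by (rule cl_reflect_gen_Suc[OF that])
    have \<eta>0: "\<exists>c. \<forall>f\<in>?M. - bullet ?e (wedge ?e (T f ?x)) = c *\<^sub>C
        (if t' = t then - bullet ?e (wedge ?e (f ?x)) else if Suc t' = t then - bullet ?e (f ?x) else 0)"
    proof (rule schur_pole_value[OF IH n T nt, where \<eta> = "\<lambda>b. - bullet ?e (wedge ?e b)"])
      show "linear (\<lambda>b. - bullet ?e (wedge ?e b))"
        by (intro linearI) (simp_all add: bullet_add_right bullet_scaleR_right wedge_add_right wedge_scaleR_right)
      show "- bullet ?e (wedge ?e (c *\<^sub>C b)) = c *\<^sub>C - bullet ?e (wedge ?e b)" for c b
        by (simp add: wedge_cscale bullet_cscale)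
      show "- bullet ?e (wedge ?e b) \<in> multivectors n t'" if "b \<in> multivectors ?m t'" for b
        using multivectors_minus[OF bullet_gen_Suc_multivectors[OF wedge_gen_multivectors[OF that, of ?m]]] by simp
      show "- bullet ?e (wedge ?e (cl_reflect (cvec n a) b)) = cl_reflect (cvec n a) (- bullet ?e (wedge ?e b))"
        if "unit_vec n a" for a b
        by (simp add: linear_neg[OF linear_cl_reflect] cl_reflect_bullet[OF that] cl_reflect_wedge[OF that] e_refl[OF that])
    qed
    have \<eta>1: "\<exists>c. \<forall>f\<in>?M. - bullet ?e (T f ?x) = c *\<^sub>C
        (if t' - 1 = t then - bullet ?e (wedge ?e (f ?x)) else if Suc (t' - 1) = t then - bullet ?e (f ?x) else 0)"
    proof (rule schur_pole_value[OF IH n T nt, where \<eta> = "\<lambda>b. - bullet ?e b"])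
      show "linear (\<lambda>b. - bullet ?e b)"
        by (intro linearI) (simp_all add: bullet_add_right bullet_scaleR_right)
      show "- bullet ?e (c *\<^sub>C b) = c *\<^sub>C - bullet ?e b" for c b
        by (simp add: bullet_cscale)
      show "- bullet ?e b \<in> multivectors n (t' - 1)" if "b \<in> multivectors ?m t'" for b
        using multivectors_minus[OF bullet_gen_Suc_multivectors[OF that]] by simp
      show "- bullet ?e (cl_reflect (cvec n a) b) = cl_reflect (cvec n a) (- bullet ?e b)"
        if "unit_vec n a" for a b
        by (simp add: linear_neg[OF linear_cl_reflect] cl_reflect_bullet[OF that] e_refl[OF that])
    qed
    have wedge_e: "wedge ?e b = ?e * - bullet ?e (wedge ?e b)" for b
    proof -
      have "wedge ?e b = - wedge ?e (bullet ?e (wedge ?e b)) - bullet ?e (wedge ?e (wedge ?e b))"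
        using wedge_bullet_gen[of ?m "wedge ?e b"] by (metis add_diff_cancel_right' diff_conv_add_uminus minus_add_distrib minus_minus)
      moreover have "wedge ?e (wedge ?e b) = 0"
        by (rule clifford_eqI) (auto simp: coeff_wedge_gen coeff_gen_mult)
      ultimately show ?thesis
        by (simp add: mult_eq_wedge_bullet[of ?e "bullet ?e (wedge ?e b)"] bullet_bullet_gen)
    qed
    \<comment> \<open>The relation \<open>\<Phi>\<close> is invariant because reflections are
      automorphisms for the wedge and commute with scalars; so validity at the pole spreads over the
      sphere.\<close>
    have tr_wedge: "wedge (cvec ?m y) (T f y) = c *\<^sub>C wedge (cvec ?m y) (f y)"
      if "\<And>f. f \<in> ?M \<Longrightarrow> wedge ?e (T f ?x) = c *\<^sub>C wedge ?e (f ?x)" "f \<in> ?M" "sqnorm ?m y = 1" for c f y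
      by (rule equivariant_map_transport[OF T m, where \<Phi> = "\<lambda>v b b'. wedge v b' = c *\<^sub>C wedge v b"])
        (use that in \<open>simp_all flip: cl_reflect_wedge cl_reflect_cscale add: cl_reflect_eq_iff\<close>)
    have tr_bullet: "bullet (cvec ?m y) (T f y) = c *\<^sub>C bullet (cvec ?m y) (f y)"
      if "\<And>f. f \<in> ?M \<Longrightarrow> bullet ?e (T f ?x) = c *\<^sub>C bullet ?e (f ?x)" "f \<in> ?M" "sqnorm ?m y = 1" for c f y
      by (rule equivariant_map_transport[OF T m, where \<Phi> = "\<lambda>v b b'. bullet v b' = c *\<^sub>C bullet v b"])
        (use that in \<open>simp_all flip: cl_reflect_bullet cl_reflect_cscale add: cl_reflect_eq_iff\<close>)
    note wp = wedge_poly(1)[OF monogenicsD(1)] and bp = bullet_poly[OF monogenicsD(1)]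
    have zero_wedge: "T f x = 0"
      if "\<And>f. f \<in> ?M \<Longrightarrow> wedge ?e (T f ?x) = 0" "t' \<noteq> ?m + j'" "f \<in> ?M" for f x
    proof (rule monogenic_wedge_zero[OF TD(1)[OF that(3)] _ that(2)])
      show "wedge (cvec ?m x) (T f x) = 0" for x
        by (rule homogeneous_polys_zero_sphere[OF wp[OF TD(1)[OF that(3)]] m])
          (use tr_wedge[of 0] that in simp)
    qed
    have zero_bullet: "T f x = 0"
      if "\<And>f. f \<in> ?M \<Longrightarrow> bullet ?e (T f ?x) = 0" "t' + j' \<noteq> 0" "f \<in> ?M" for f x
    proof (rule monogenic_bullet_zero[OF TD(1)[OF that(3)] _ that(2)])
      show "bullet (cvec ?m x) (T f x) = 0" for x
        by (rule homogeneous_polys_zero_sphere[OF bp[OF TD(1)[OF that(3)]] m])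
          (use tr_bullet[of 0] that in simp)
    qed
    note harm = monogenic_harmonic[OF monogenicsD[OF TD(1)]]
    show ?thesis
    proof (cases "t' = t")
      case tt: True
      obtain c where "\<And>f. f \<in> ?M \<Longrightarrow> - bullet ?e (wedge ?e (T f ?x)) = c *\<^sub>C - bullet ?e (wedge ?e (f ?x))"
        using \<eta>0 tt by auto
      then have c: "wedge ?e (T f ?x) = c *\<^sub>C wedge ?e (f ?x)" if "f \<in> ?M" for f
        using that wedge_e by (metis cscale_mult_right)
      show ?thesis
      proof (cases "j' = j")
        case jj: True
        show ?thesis
        proof (cases "t = ?m")
          case False
          have "T f x = c *\<^sub>C f x" if f: "f \<in> ?M" for f x
          proof -
            have h: "(\<lambda>x. T f x - c *\<^sub>C f x) \<in> monogenics ?m t j"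
              using monogenics_diff[OF TD(1)[OF f, unfolded tt jj] monogenics_cscale[OF f]] .
            have "wedge (cvec ?m x) (T f x - c *\<^sub>C f x) = 0" for x
              by (rule homogeneous_polys_zero_sphere[OF wp[OF h] m])
                (simp add: wedge_diff_right wedge_cscale tr_wedge[OF c f])
            from monogenic_wedge_zero[OF h this] show ?thesis using nt False by (simp add: nontrivial_def)
          qed
          then show ?thesis using tt jj by auto
        next
          \<comment> \<open>For pseudoscalars the wedge relation is empty. The inner product with
            \<open>e\<close> is injective on them, and its relation at the pole comes from the other
            component.\<close>
          case True
          obtain d where d: "\<And>f. f \<in> ?M \<Longrightarrow> bullet ?e (T f ?x) = d *\<^sub>C bullet ?e (f ?x)"
            using \<eta>1 tt True by (auto simp: neg_equal_iff_equal)
          have "T f x = d *\<^sub>C f x" if f: "f \<in> ?M" for f x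
          proof -
            have h: "(\<lambda>x. T f x - d *\<^sub>C f x) \<in> monogenics ?m t j"
              using monogenics_diff[OF TD(1)[OF f, unfolded tt jj] monogenics_cscale[OF f]] .
            have "bullet (cvec ?m x) (T f x - d *\<^sub>C f x) = 0" for x
              by (rule homogeneous_polys_zero_sphere[OF bp[OF h] m])
                (simp add: bullet_diff_right bullet_cscale tr_bullet[OF d f])
            from monogenic_bullet_zero[OF h this] show ?thesis using True by simp
          qed
          then show ?thesis using tt jj by auto
        qed
      next
        case False
        \<comment> \<open>On the sphere \<open>x \<and> T f\<close> and
          \<open>c (x \<and> f)\<close> agree; they are harmonic of the different degrees
          \<open>j' + 1\<close> and \<open>j + 1\<close>.\<close>
        have "T f x = 0" if f: "f \<in> ?M" for f x
        proof (rule monogenic_wedge_zero[OF TD(1)[OF f]])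
          show "wedge (cvec ?m x) (T f x) = 0" for x
          proof (rule harmonic_separation[OF wp[OF TD(1)[OF f]] wedge_cvec_harmonic(1)[OF TD(1)[OF f]]
                wp[OF monogenics_cscale[OF f, of c]] wedge_cvec_harmonic(1)[OF monogenics_cscale[OF f, of c]] m])
            show "Suc j' \<noteq> Suc j" using False by simp
          qed (simp add: wedge_cscale tr_wedge[OF c f])
          show "t' \<noteq> ?m + j'" using nt nt' tt False by (auto simp: nontrivial_def)
        qed
        then show ?thesis using False by auto
      qed
    next
      case False
      have "T f x = 0" if f: "f \<in> ?M" for f x
      proof (cases "Suc t' = t")
        case st: True
        show ?thesis
        proof (cases "t' = 0")
          case False
          then obtain q where "t' = Suc q" by (cases t') auto
          then have "\<And>f. f \<in> ?M \<Longrightarrow> bullet ?e (T f ?x) = 0" using \<eta>1 st by auto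
          then show ?thesis using zero_bullet f False by simp
        next
          \<comment> \<open>Here \<open>t = 1\<close> and \<open>T f\<close> is a constant scalar.
            Truncation of \<open>t' - 1\<close> makes \<open>\<eta>1\<close> uninformative, so the
            value is taken from \<open>\<eta>0\<close>.\<close>
          case True
          then have j': "j' = 0" using nt' by (simp add: nontrivial_def)
          obtain c where c: "\<And>f. f \<in> ?M \<Longrightarrow> - bullet ?e (wedge ?e (T f ?x)) = c *\<^sub>C - bullet ?e (f ?x)"
            using \<eta>0 st by auto
          have *: "T f ?x = (- c) *\<^sub>C bullet ?e (f ?x)" if "f \<in> ?M" for f
          proof -
            have "bullet ?e (T f ?x) = 0" using range[OF TD(1)[OF that]] True bullet_gen_scalar by blast
            then show ?thesis using split[of "T f ?x"] c[OF that] by simp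
          qed
          have "T f y = bullet (cvec ?m y) ((- c) *\<^sub>C f y)" if "sqnorm ?m y = 1" for y
          proof -
            have "T f y = (- c) *\<^sub>C bullet (cvec ?m y) (f y)"
              by (rule equivariant_map_transport[OF T m, where \<Phi> = "\<lambda>v b b'. b' = (- c) *\<^sub>C bullet v b"])
                (use that f * in \<open>simp_all only: flip: cl_reflect_bullet cl_reflect_cscale add: cl_reflect_eq_iff\<close>)
            then show ?thesis by (simp only: bullet_cscale)
          qed
          then show ?thesis
            using f by (intro harmonic_separation[OF monogenicsD(1)[OF TD(1)[OF f]] harm[OF f] bp[OF monogenics_cscale[OF f, of "- c"]]
              wedge_cvec_harmonic(2)[OF monogenics_cscale[OF f, of "- c"]] m]) (simp_all add: j')
        qed
      next
        case st: False
        have w: "wedge ?e (T f ?x) = 0" if "f \<in> ?M" for f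
          using \<eta>0 st False wedge_e[of "T f ?x"] that by auto
        show ?thesis
        proof (cases "t' = ?m + j'")
          case False
          then show ?thesis using zero_wedge w f by blast
        next
          \<comment> \<open>Now \<open>T f\<close> is a constant pseudoscalar, for which the
            vanishing wedge says nothing; the component seen by \<open>\<eta>1\<close> has degree
            \<open>n\<close> and can be nonzero only if \<open>t = n\<close>.\<close>
          case True
          then have j': "j' = 0" "t' = ?m" using nt' by (auto simp: nontrivial_def)
          obtain c where c: "\<And>f. f \<in> ?M \<Longrightarrow> - bullet ?e (T f ?x) = c *\<^sub>C (if n = t then - bullet ?e (wedge ?e (f ?x)) else 0)"
            using \<eta>1[unfolded j'(2) diff_Suc_1] j'(2) \<open>t' \<noteq> t\<close> by (auto cong: if_cong)
          show ?thesis
          proof (cases "n = t")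
            case False
            then have "\<And>f. f \<in> ?M \<Longrightarrow> bullet ?e (T f ?x) = 0" using c by auto
            then show ?thesis using zero_bullet f j'(2) by simp
          next
            case True
            have *: "T f ?x = c *\<^sub>C wedge ?e (f ?x)" if "f \<in> ?M" for f
            proof -
              have "T f ?x = ?e * (c *\<^sub>C - bullet ?e (wedge ?e (f ?x)))"
                using split[of "T f ?x"] w[OF that] c[OF that] True by simp
              also have "\<dots> = c *\<^sub>C wedge ?e (f ?x)"
                unfolding cscale_mult_right wedge_e[symmetric] ..
              finally show ?thesis .
            qed
            have "T f y = wedge (cvec ?m y) (c *\<^sub>C f y)" if "sqnorm ?m y = 1" for y
            proof -
              have "T f y = c *\<^sub>C wedge (cvec ?m y) (f y)"
                by (rule equivariant_map_transport[OF T m, where \<Phi> = "\<lambda>v b b'. b' = c *\<^sub>C wedge v b"])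
                  (use that f * in \<open>simp_all only: flip: cl_reflect_wedge cl_reflect_cscale add: cl_reflect_eq_iff\<close>)
              then show ?thesis by (simp only: wedge_cscale)
            qed
            then show ?thesis
              using f by (intro harmonic_separation[OF monogenicsD(1)[OF TD(1)[OF f]] harm[OF f] wp[OF monogenics_cscale[OF f, of c]]
                wedge_cvec_harmonic(1)[OF monogenics_cscale[OF f, of c]] m]) (simp_all add: j')
          qed
        qed
      qed
      then show ?thesis using False by auto
    qed
  qed
qed

lemma multivectors_1:
  fixes v :: "'a::real_normed_field clifford"
  assumes "v \<in> multivectors 1 t" "t \<le> 1"
  shows "v = coeff v (if t = 0 then {} else {1}) *\<^sub>C blade (if t = 0 then {} else {1})"
proof (rule clifford_eqI)
  fix A
  have "A = (if t = 0 then {} else {1})" if "coeff v A \<noteq> 0"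
  proof -
    have "A \<subseteq> {1}" "card A = t" using assms(1) that by (auto simp: multivectors_iff)
    then show ?thesis using assms(2) by (auto simp: subset_singleton_iff)
  qed
  then show "coeff v A = coeff (coeff v (if t = 0 then {} else {1}) *\<^sub>C blade (if t = 0 then {} else {1})) A"
    by (cases "coeff v A = 0") (auto simp: coeff_blade)
qed

text \<open>On \<open>R^1\<close> only constants remain, spanned by \<open>1\<close> for
  \<open>t = 0\<close> and by \<open>e_1\<close> for \<open>t = 1\<close>. The reflection in the
  origin acts on them by \<open>(- 1) ^ t\<close> and so tells the two spaces apart.\<close>

lemma schur_1: "schur 1 TYPE('a::real_normed_field)"
  unfolding schur_def
proof (intro allI impI)
  fix t j t' j' and T :: "((nat \<Rightarrow> real) \<Rightarrow> 'a clifford) \<Rightarrow> (nat \<Rightarrow> real) \<Rightarrow> 'a clifford"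
  assume T: "equivariant_map 1 t j t' j' T"
  let ?M = "monogenics 1 t j :: ((nat \<Rightarrow> real) \<Rightarrow> 'a clifford) set"
  note TD = equivariant_mapD[OF T]
  show "\<exists>c. \<forall>f\<in>?M. \<forall>x. T f x = (if (t, j) = (t', j') then c else 0) *\<^sub>C f x"
  proof (cases "nontrivial 1 t j \<and> nontrivial 1 t' j'")
    case False
    have "T f x = 0" if f: "f \<in> ?M" for f x
    proof (cases "nontrivial 1 t j")
      case True
      then show ?thesis using monogenics_trivial[OF TD(1)[OF f]] False by simp
    next
      case False
      then have "f = (\<lambda>_. 0)" using monogenics_trivial[OF f] by (intro ext)
      then show ?thesis using equivariant_map_zero[OF T] by simp
    qed
    then show ?thesis by (intro exI[of _ 0]) simp
  next
    case True
    then have t: "t \<le> 1" "t' \<le> 1" "j = 0" "j' = 0" by (auto simp: nontrivial_def le_Suc_eq)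
    define b where "b = (\<lambda>t::nat. blade (if t = 0 then {} else {1}) :: 'a clifford)"
    have b: "b t \<in> multivectors 1 t" if "t \<le> 1" for t
      using that by (auto simp: b_def multivectors_iff coeff_blade le_Suc_eq split: if_splits)
    have const: "\<exists>c. f = (\<lambda>_. c *\<^sub>C b t)" if f: "f \<in> monogenics 1 t 0" "t \<le> 1" for f t
    proof -
      obtain v where v: "f = (\<lambda>_. v)" using monogenicsD(1)[OF f(1)] by (auto simp: homogeneous_polys_0)
      then have "v \<in> multivectors 1 t"
        using homogeneous_polys_range[OF monogenicsD(1)[OF f(1)] multivectors_real_subspace] by simp
      then show ?thesis using multivectors_1[OF _ f(2)] v unfolding b_def by blast
    qed
    have bM: "(\<lambda>_. b t) \<in> ?M" using monogenics_const[OF b[OF t(1)]] t by simp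
    obtain d where d: "T (\<lambda>_. b t) = (\<lambda>_. d *\<^sub>C b t')" using const[OF TD(1)[OF bM, unfolded t(4)] t(2)] by blast
    have Tf: "T (\<lambda>_. c *\<^sub>C b t) = (\<lambda>_. c *\<^sub>C d *\<^sub>C b t')" for c
      using TD(3)[OF bM, of c] d by simp
    show ?thesis
    proof (cases "t = t'")
      case True
      have "T f x = d *\<^sub>C f x" if "f \<in> ?M" for f x
        using const[of f t] that t Tf True by (auto simp: mult.commute)
      then show ?thesis using True t by auto
    next
      case False
      have a: "unit_vec 1 (pole 1)" by (simp add: unit_vec_def sqnorm_def pole_def)
      have g: "cl_reflect (cvec 1 (pole 1)) (b t) = (- 1) ^ t *\<^sub>R b t" if "t \<le> 1" for t
      proof -
        have "cvec 1 (pole 1) = (gen 1 :: 'a clifford)" by (simp add: cvec_def pole_def)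
        then show ?thesis
          using that by (auto simp: cl_reflect_def b_def le_Suc_eq gen_square simp flip: one_clifford_def)
      qed
      have r: "fun_reflect 1 (pole 1) (\<lambda>_. b t) = (\<lambda>_. (- 1) ^ t *\<^sub>C b t)"
        unfolding fun_reflect_def g[OF t(1)] scaleR_clifford_def by simp
      have "(\<lambda>_. (- 1) ^ t *\<^sub>C d *\<^sub>C b t') = fun_reflect 1 (pole 1) (\<lambda>_. d *\<^sub>C b t')"
        using TD(4)[OF a bM] unfolding r d Tf .
      then have "(- 1) ^ t *\<^sub>C d *\<^sub>C b t' = d *\<^sub>C (- 1) ^ t' *\<^sub>R b t'"
        unfolding fun_reflect_def cl_reflect_cscale g[OF t(2)] by (simp only: fun_eq_iff)
      then have "coeff ((- 1) ^ t *\<^sub>C d *\<^sub>C b t') (if t' = 0 then {} else {1}) =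
          coeff (d *\<^sub>C (- 1) ^ t' *\<^sub>R b t') (if t' = 0 then {} else {1})" by simp
      then have "(- 1) ^ t * d = (- 1) ^ t' * d"
        by (simp add: b_def coeff_blade scaleR_conv_of_real[where 'a='a] mult.commute)
      then have "d = - d" using False t by (auto simp: le_Suc_eq)
      then have "2 * d = 0" by (metis mult_2 add.right_inverse)
      then have "d = 0" by simp
      have "T f x = 0" if "f \<in> ?M" for f x
        using const[of f t] that t Tf \<open>d = 0\<close> by auto
      then show ?thesis using False by auto
    qed
  qed
qed

lemma schur: "1 \<le> n \<Longrightarrow> schur n TYPE('a::real_normed_field)"
  by (induction n rule: dec_induct) (use schur_1 schur_step in auto)

section \<open>The \<open>L\<^sup>2\<close> inner product\<close>

definition hform :: "'a::real_or_complex clifford \<Rightarrow> 'a clifford \<Rightarrow> 'a"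
  where "hform a b = scalar_part (cconj a * b)"

text \<open>The sign of \<open>e_A e_A\<close>. Adding a new largest index \<open>x\<close>
  contributes \<open>card A + 1\<close> signs from pairs \<open>b \<le> x\<close>, and none from
  pairs with \<open>x\<close> on the right and a smaller index on the left.\<close>

lemma bsign_self:
  "finite A \<Longrightarrow> bsign A A = ((- 1) ^ (card A * (card A + 1) div 2) :: 'a::comm_ring_1)"
proof (induction A rule: finite_linorder_max_induct)
  case (insert x A)
  then have x: "x \<notin> A" by auto
  have "bsign (insert x A) (insert x A) = (\<Prod>b\<in>insert x A. - 1) * (\<Prod>a\<in>A. \<Prod>b\<in>A. if b \<le> a then - 1 else (1::'a))"
  proof -
    have "(\<Prod>b\<in>insert x A. if b \<le> x then - 1 else (1::'a)) = (\<Prod>b\<in>insert x A. - 1)"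
      by (rule prod.cong) (use insert(2) in \<open>auto intro: less_imp_le\<close>)
    moreover have "(\<Prod>b\<in>insert x A. if b \<le> a then - 1 else (1::'a)) = (\<Prod>b\<in>A. if b \<le> a then - 1 else 1)"
      if "a \<in> A" for a
      using insert(1,2) x that by (auto simp: not_le)
    moreover have "bsign (insert x A) (insert x A) = (\<Prod>b\<in>insert x A. if b \<le> x then - 1 else (1::'a)) *
        (\<Prod>a\<in>A. \<Prod>b\<in>insert x A. if b \<le> a then - 1 else (1::'a))"
      unfolding bsign_def by (rule prod.insert[OF insert(1) x])
    ultimately show ?thesis by (simp only: cong: prod.cong)
  qed
  also have "\<dots> = (- 1) ^ (card A + 1) * (- 1) ^ (card A * (card A + 1) div 2)"
    using insert.IH insert(1) x by (simp add: bsign_def)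
  also have "\<dots> = (- 1) ^ (card (insert x A) * (card (insert x A) + 1) div 2)"
  proof -
    have "card (insert x A) * (card (insert x A) + 1) = card A * (card A + 1) + (card A + 1) * 2"
      using insert(1) x by simp
    then have "card (insert x A) * (card (insert x A) + 1) div 2 = card A * (card A + 1) div 2 + (card A + 1)"
      by (simp only:) simp
    then show ?thesis by (simp add: power_add mult.commute)
  qed
  finally show ?case .
qed simp

text \<open>The sign in \<open>cconj\<close> is that of \<open>e_A e_A\<close>, hence the conjugate
  of a blade is its inverse. So the blades are orthonormal for \<open>hform\<close>, which becomes
  the standard hermitian form of the coefficients.\<close>

lemma hform_expand:
  assumes "finite S" "{A. coeff a A \<noteq> 0} \<subseteq> S"
  shows "hform a b = (\<Sum>A\<in>S. sconj (coeff a A) * coeff b A)"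
proof -
  have c: "coeff (cconj a) A = (- 1) ^ (card A * (card A + 1) div 2) * sconj (coeff a A)" for A
    by (simp add: cconj.rep_eq)
  have "hform a b = (\<Sum>A\<in>S. bsign A (sym_diff A {}) * coeff (cconj a) A * coeff b (sym_diff A {}))"
    unfolding hform_def scalar_part_def by (rule coeff_mult[OF assms(1)]) (use assms(2) c in auto)
  also have "\<dots> = (\<Sum>A\<in>S. sconj (coeff a A) * coeff b A)"
  proof (rule sum.cong[OF refl])
    fix A
    show "bsign A (sym_diff A {}) * coeff (cconj a) A * coeff b (sym_diff A {}) = sconj (coeff a A) * coeff b A"
    proof (cases "finite A")
      case True
      have "(- 1) ^ l * ((- 1) ^ l * z) = z" for l and z :: 'a by (simp flip: mult.assoc power_add)
      then show ?thesis using True by (simp add: c bsign_self)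
    qed (simp add: coeff_infinite)
  qed
  finally show ?thesis .
qed

lemma sconj_scaleR: "sconj (r *\<^sub>R x) = r *\<^sub>R sconj (x :: 'a::real_or_complex)"
  by (simp add: scaleR_conv_of_real sconj_mult)

lemma sconj_sum: "sconj (sum f S) = (\<Sum>i\<in>S. sconj (f i :: 'a::real_or_complex))"
  by (induction S rule: infinite_finite_induct) (auto simp: sconj_add)

lemma hform_add_left: "hform (a + b) c = hform a c + hform b c"
  and hform_add_right: "hform a (b + c) = hform a b + hform a c"
  and hform_scaleR_left: "hform (r *\<^sub>R a) b = r *\<^sub>R hform a b"
  and hform_scaleR_right: "hform a (r *\<^sub>R b) = r *\<^sub>R hform a b"
  and hform_cscale_right: "hform a (d *\<^sub>C b) = d * hform a b"
  and hform_commute: "hform b a = sconj (hform a b)"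
proof -
  let ?S = "{A. coeff a A \<noteq> 0} \<union> {A. coeff b A \<noteq> 0}"
  have S: "finite ?S" by simp
  have e: "hform x y = (\<Sum>A\<in>?S. sconj (coeff x A) * coeff y A)" if "{A. coeff x A \<noteq> 0} \<subseteq> ?S" for x y
    by (rule hform_expand[OF S that])
  show "hform (a + b) c = hform a c + hform b c"
    by (subst (1 2 3) e) (auto simp: sconj_add distrib_right sum.distrib)
  show "hform a (b + c) = hform a b + hform a c" "hform a (r *\<^sub>R b) = r *\<^sub>R hform a b" "hform a (d *\<^sub>C b) = d * hform a b"
    by (simp_all add: hform_def scalar_part_def distrib_left cscale_mult_right)
  show "hform (r *\<^sub>R a) b = r *\<^sub>R hform a b"
    by (subst (1 2) e) (auto simp: sconj_scaleR scaleR_sum_right)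
  show "hform b a = sconj (hform a b)"
    by (subst (1 2) e) (auto simp: sconj_sum sconj_mult mult.commute)
qed

lemma hform_sum_left: "hform (sum f S) b = (\<Sum>i\<in>S. hform (f i) b)"
  and hform_sum_right: "hform b (sum f S) = (\<Sum>i\<in>S. hform b (f i))"
proof -
  have "hform 0 b = 0" by (simp add: hform_expand[of "{}"])
  then show "hform (sum f S) b = (\<Sum>i\<in>S. hform (f i) b)"
    by (induction S rule: infinite_finite_induct) (auto simp: hform_add_left)
  have "hform b 0 = 0" by (simp add: hform_def scalar_part_def)
  then show "hform b (sum f S) = (\<Sum>i\<in>S. hform b (f i))"
    by (induction S rule: infinite_finite_induct) (auto simp: hform_add_right)
qed

lemma sconj_bsign: "sconj (bsign A B :: 'a::real_or_complex) = bsign A B"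
proof -
  have "(bsign A B :: 'a) = of_real (bsign A B)"
    unfolding bsign_def of_real_prod by (intro prod.cong refl) auto
  then show ?thesis by (metis sconj_of_real)
qed

lemma bsign_gen_toggle:
  assumes "finite D"
  shows "bsign {i} (sym_diff {i} D) = - (bsign {i} D :: 'a::comm_ring_1)"
    "bsign (sym_diff {i} D) {i} = - (bsign D {i} :: 'a::comm_ring_1)"
  using bsign_sym_diff_right[of "{i}" D "{i}", where 'a='a] bsign_sym_diff_left[of "{i}" D "{i}", where 'a='a] assms
  by (auto simp: bsign_def)

text \<open>Multiplication by a generator toggles \<open>i\<close> in the index set; going back with
  the same generator changes the sign because \<open>e_i e_i = - 1\<close>. So generators act
  skew-adjointly from both sides.\<close>

lemma hform_gen_mult:
  fixes a b :: "'a::real_or_complex clifford"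
  shows "hform (gen i * a) b = - hform a (gen i * b)" "hform (a * gen i) b = - hform a (b * gen i)"
proof -
  let ?t = "sym_diff {i}"
  define T where "T = {A. coeff a A \<noteq> 0} \<union> {A. coeff b A \<noteq> 0}"
  \<comment> \<open>A finite index set that contains both supports and is closed under toggling
    \<open>i\<close>, so that the toggle permutes the summands.\<close>
  define S where "S = T \<union> ?t ` T"
  have S: "finite S" by (simp add: S_def T_def)
  have tt: "?t (?t A) = A" for A by (rule sym_diff_cancel)
  have img: "?t ` S = S"
    unfolding S_def image_Un image_image tt by (simp add: Un_commute)
  have inj: "inj_on ?t S" by (rule inj_on_inverseI[where g = ?t]) (rule tt)
  have out: "coeff a A = 0" "coeff a (?t A) = 0" if "A \<notin> S" for A
  proof -
    show "coeff a A = 0" using that by (auto simp: S_def T_def)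
    have "?t A \<notin> T" using that tt[of A] by (auto simp: S_def intro: rev_image_eqI)
    then show "coeff a (?t A) = 0" by (auto simp: T_def)
  qed
  have fin: "finite A" if "A \<in> S" for A
  proof -
    have "finite A" if "A \<in> T" for A using that coeff_infinite by (auto simp: T_def)
    then show ?thesis using that by (auto simp: S_def)
  qed
  have flip: "(\<Sum>A\<in>S. h A) = (\<Sum>A\<in>S. h (?t A))" for h :: "nat set \<Rightarrow> 'a"
    using sum.reindex[OF inj, of h] by (simp add: img)
  have e: "hform x y = (\<Sum>A\<in>S. sconj (coeff x A) * coeff y A)" if "\<And>A. A \<notin> S \<Longrightarrow> coeff x A = 0" for x y
    by (rule hform_expand[OF S]) (use that in blast)
  have "hform (gen i * a) b = (\<Sum>A\<in>S. sconj (bsign {i} (?t A) * coeff a (?t A)) * coeff b A)"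
    by (subst e) (auto simp: coeff_gen_mult out(2))
  also have "\<dots> = (\<Sum>A\<in>S. sconj (bsign {i} A * coeff a A) * coeff b (?t A))"
    by (subst flip) (simp only: tt)
  also have "\<dots> = - (\<Sum>A\<in>S. sconj (coeff a A) * coeff (gen i * b) A)"
    unfolding sum_negf[symmetric]
    by (intro sum.cong refl) (simp add: coeff_gen_mult sconj_mult sconj_bsign bsign_gen_toggle(1)[OF fin])
  also have "(\<Sum>A\<in>S. sconj (coeff a A) * coeff (gen i * b) A) = hform a (gen i * b)"
    by (rule e[symmetric]) (rule out)
  finally show "hform (gen i * a) b = - hform a (gen i * b)" .
  have "hform (a * gen i) b = (\<Sum>A\<in>S. sconj (bsign (?t A) {i} * coeff a (?t A)) * coeff b A)"
    by (subst e) (auto simp: coeff_mult_gen out(2))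
  also have "\<dots> = (\<Sum>A\<in>S. sconj (bsign A {i} * coeff a A) * coeff b (?t A))"
    by (subst flip) (simp only: tt)
  also have "\<dots> = - (\<Sum>A\<in>S. sconj (coeff a A) * coeff (b * gen i) A)"
    unfolding sum_negf[symmetric]
    by (intro sum.cong refl) (simp add: coeff_mult_gen sconj_mult sconj_bsign bsign_gen_toggle(2)[OF fin])
  also have "(\<Sum>A\<in>S. sconj (coeff a A) * coeff (b * gen i) A) = hform a (b * gen i)"
    by (rule e[symmetric]) (rule out)
  finally show "hform (a * gen i) b = - hform a (b * gen i)" .
qed

lemma hform_cvec_mult:
  fixes a b :: "'a::real_or_complex clifford"
  shows "hform (cvec n x * a) b = - hform a (cvec n x * b)" "hform (a * cvec n x) b = - hform a (b * cvec n x)"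
  by (simp_all add: cvec_def sum_distrib_left sum_distrib_right hform_sum_left hform_sum_right
      hform_scaleR_left hform_scaleR_right hform_gen_mult sum_negf)

lemma hform_minus: "hform (- a) (- b) = hform a b"
  using hform_scaleR_left[of "- 1" a "- b"] hform_scaleR_right[of a "- 1" b] by simp

lemma hform_involute: "hform (involute a) (involute b) = hform a b"
proof -
  have A: "sconj ((- 1) ^ l) = ((- 1) ^ l :: 'a)" for l
    using sconj_of_real[of "(- 1) ^ l", where 'a='a] by simp
  have B: "(- 1) ^ l * z * ((- 1) ^ l * w) = z * w" for l and z w :: 'a
    by (cases "even l") simp_all
  show ?thesis
    by (subst (1 2) hform_expand[of "{A. coeff a A \<noteq> 0}"]) (auto simp: sconj_mult A B)
qed

text \<open>A unit vector is skew-adjoint with square \<open>- 1\<close>, so multiplication by it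
  preserves \<open>hform\<close> on either side; the main involution does so as well.\<close>

lemma hform_cl_reflect:
  assumes a: "unit_vec n a"
  shows "hform (cl_reflect (cvec n a) b) (cl_reflect (cvec n a) c) = hform b c"
proof -
  have u: "c * cvec n a * cvec n a = - c" for c :: "'a clifford"
    by (simp add: mult.assoc unit_vec_square[OF a])
  have neg: "- hform b (- c) = hform b c" for b c
    using hform_scaleR_right[of b "- 1" c] by simp
  have "hform (cl_reflect (cvec n a) b) (cl_reflect (cvec n a) c) =
      hform (cvec n a * (involute b * cvec n a)) (cvec n a * (involute c * cvec n a))"
    by (simp add: cl_reflect_def hform_minus mult.assoc)
  also have "\<dots> = hform (involute b * cvec n a) (involute c * cvec n a)"
    unfolding hform_cvec_mult(1) unit_vec_cancel[OF a] by (rule neg)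
  also have "\<dots> = hform (involute b) (involute c)"
    unfolding hform_cvec_mult(2) u by (rule neg)
  finally show ?thesis by (simp add: hform_involute)
qed

subsection \<open>Invariance of the product measure under reflections\<close>

abbreviation coord_measure :: "nat \<Rightarrow> (nat \<Rightarrow> real) measure"
  where "coord_measure m \<equiv> \<Pi>\<^sub>M i\<in>{1..m}. lborel"

lemma coord_measure_sigma: "product_sigma_finite (\<lambda>i::nat. lborel :: real measure)"
  by (simp add: product_sigma_finite_def sigma_finite_lborel)

lemma measurable_coord [measurable]: "i \<in> {1..m} \<Longrightarrow> (\<lambda>x. x i) \<in> borel_measurable (coord_measure m)"
  using measurable_component_singleton[of i "{1..m}" "\<lambda>_. lborel :: real measure"] by simp

definition preserves :: "nat \<Rightarrow> ((nat \<Rightarrow> real) \<Rightarrow> nat \<Rightarrow> real) \<Rightarrow> bool"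
  where "preserves m h \<longleftrightarrow> h \<in> measurable (coord_measure m) (coord_measure m) \<and>
    distr (coord_measure m) (coord_measure m) h = coord_measure m"

lemma preserves_id: "preserves m (\<lambda>x. x)"
  by (simp add: preserves_def)

lemma preserves_comp: "preserves m g \<Longrightarrow> preserves m h \<Longrightarrow> preserves m (\<lambda>x. g (h x))"
  unfolding preserves_def using distr_distr[of g "coord_measure m" "coord_measure m" h "coord_measure m"]
  by (auto simp: o_def intro: measurable_compose)

text \<open>Fubini with the coordinate \<open>l\<close> integrated first: as \<open>\<phi>\<close>
  does not depend on it, the map is a translation of the line, possibly after
  \<open>y \<mapsto> - y\<close>.\<close>

lemma preserves_shear:
  assumes l: "l \<in> {1..m}" and \<sigma>: "\<sigma> = 1 \<or> \<sigma> = - 1"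
    and \<phi>: "\<phi> \<in> borel_measurable (coord_measure m)" "\<And>x y. \<phi> (x(l := y)) = \<phi> x"
  shows "preserves m (\<lambda>x. x(l := \<sigma> * x l + \<phi> x))"
proof -
  let ?M = "coord_measure m" and ?I = "{1..m} - {l}"
  let ?h = "\<lambda>x. x(l := \<sigma> * x l + \<phi> x)"
  have I: "{1..m} = insert l ?I" using l by auto
  have h: "?h \<in> measurable ?M ?M"
  proof (rule measurable_PiM_single')
    fix i assume i: "i \<in> {1..m}"
    show "(\<lambda>x. ?h x i) \<in> measurable ?M lborel"
    proof (cases "i = l")
      case True
      then show ?thesis
        using \<phi>(1) measurable_coord[OF l] by simp
    next
      case False
      then show ?thesis using measurable_coord[OF i] by simp
    qed
  qed (use l in \<open>auto simp: space_PiM PiE_iff extensional_def\<close>)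
  have "distr ?M ?M ?h = ?M"
  proof (rule measure_eqI)
    fix A assume "A \<in> sets (distr ?M ?M ?h)"
    then have A: "A \<in> sets ?M" by simp
    have fold: "(\<integral>\<^sup>+x. f x \<partial>?M) = (\<integral>\<^sup>+x. \<integral>\<^sup>+y. f (x(l := y)) \<partial>lborel \<partial>Pi\<^sub>M ?I (\<lambda>_. lborel))"
      if "f \<in> borel_measurable ?M" for f
      using product_sigma_finite.product_nn_integral_insert[OF coord_measure_sigma, of ?I l f] that
      unfolding I[symmetric] by simp
    have iA: "indicator A \<in> borel_measurable ?M" using A by simp
    have "emeasure (distr ?M ?M ?h) A = (\<integral>\<^sup>+x. indicator A (?h x) \<partial>?M)"
      using nn_integral_distr[OF h, of "indicator A"] A by simp
    also have "\<dots> = (\<integral>\<^sup>+x. \<integral>\<^sup>+y. indicator A (x(l := \<sigma> * y + \<phi> x)) \<partial>lborel \<partial>Pi\<^sub>M ?I (\<lambda>_. lborel))"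
      using measurable_compose[OF h iA] by (subst fold) (simp_all add: \<phi>(2))
    also have "\<dots> = (\<integral>\<^sup>+x. \<integral>\<^sup>+y. indicator A (x(l := y)) \<partial>lborel \<partial>Pi\<^sub>M ?I (\<lambda>_. lborel))"
    proof (rule nn_integral_cong)
      fix x assume x: "x \<in> space (Pi\<^sub>M ?I (\<lambda>_. lborel :: real measure))"
      have "(\<lambda>y. x(l := y)) \<in> measurable lborel ?M"
      proof (rule measurable_PiM_single')
        fix i assume "i \<in> {1..m}"
        show "(\<lambda>y. (x(l := y)) i) \<in> measurable lborel lborel" by (cases "i = l") simp_all
      qed (use l x in \<open>auto simp: space_PiM PiE_iff extensional_def\<close>)
      then have "(\<lambda>y. indicator A (x(l := y)) :: ennreal) \<in> borel_measurable borel"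
        using measurable_compose[OF _ iA] by simp
      from nn_integral_real_affine[OF this, of \<sigma> "\<phi> x"] \<sigma>
      show "(\<integral>\<^sup>+y. indicator A (x(l := \<sigma> * y + \<phi> x)) \<partial>lborel) = (\<integral>\<^sup>+y. indicator A (x(l := y)) \<partial>lborel)"
        by (auto simp: add.commute)
    qed
    also have "\<dots> = emeasure ?M A"
      using fold[OF iA] A by simp
    finally show "emeasure (distr ?M ?M ?h) A = emeasure ?M A" .
  qed simp
  with h show ?thesis by (simp add: preserves_def)
qed

text \<open>If \<open>a\<^sub>l \<noteq> 0\<close>, then conjugation with the shear \<open>y\<^sub>i = x\<^sub>i - (a\<^sub>i/a\<^sub>l) x\<^sub>l\<close> turns the reflection into a map
  that changes the coordinate \<open>y\<^sub>l\<close> only.\<close>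

lemma preserves_reflect:
  assumes a: "unit_vec m a"
  shows "preserves m (reflect m a)"
proof -
  have "\<exists>l\<in>{1..m}. a l \<noteq> 0"
  proof (rule ccontr)
    assume "\<not> ?thesis"
    then have "sqnorm m a = 0" by (simp add: sqnorm_def)
    then show False using a by (simp add: unit_vec_def)
  qed
  then obtain l where l: "l \<in> {1..m}" "a l \<noteq> 0" by blast
  define S where "S \<epsilon> J = (\<lambda>x i. if i \<in> J then x i + \<epsilon> * (a i / a l) * x l else x i)" for \<epsilon> :: real and J
  have S: "preserves m (S \<epsilon> J)" if "finite J" "J \<subseteq> {1..m} - {l}" for \<epsilon> J
    using that
  proof (induction J rule: finite_induct)
    case empty
    then show ?case using preserves_id by (simp add: S_def)
  next
    case (insert p J)
    have eq: "S \<epsilon> (insert p J) = (\<lambda>x. (\<lambda>x. x(p := 1 * x p + \<epsilon> * (a p / a l) * x l)) (S \<epsilon> J x))"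
      using insert by (auto simp: S_def fun_eq_iff)
    have p: "preserves m (\<lambda>x. x(p := 1 * x p + \<epsilon> * (a p / a l) * x l))"
      by (rule preserves_shear)
        (use insert l in \<open>auto intro!: borel_measurable_times borel_measurable_const measurable_coord simp del: One_nat_def\<close>)
    have J: "preserves m (S \<epsilon> J)" using insert by blast
    show ?case unfolding eq by (rule preserves_comp[OF p J])
  qed
  let ?J = "{1..m} - {l}"
  \<comment> \<open>The reflection in the sheared coordinates. They express \<open>dot m a x\<close>
    as \<open>y_l / a_l\<close> plus the sum of \<open>a_i y_i\<close> over
    \<open>i \<noteq> l\<close>, by \<open>|a| = 1\<close>; hence
    \<open>y_l - 2 (dot m a x) a_l\<close> has the coefficient \<open>- 1\<close> at
    \<open>y_l\<close>.\<close>
  define \<tau> where "\<tau> x = x(l := - 1 * x l + (- 2 * a l * (\<Sum>i\<in>?J. a i * x i)))" for x :: "nat \<Rightarrow> real"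
  have "preserves m \<tau>"
    unfolding \<tau>_def
    by (rule preserves_shear) (use l in \<open>auto intro!: borel_measurable_times borel_measurable_const borel_measurable_sum measurable_coord sum.cong simp del: One_nat_def\<close>)
  then have "preserves m (\<lambda>x. S 1 ?J (\<tau> (S (- 1) ?J x)))"
    using preserves_comp[OF S[of ?J 1] preserves_comp[OF _ S[of ?J "- 1"]]] by simp
  moreover have "S 1 ?J (\<tau> (S (- 1) ?J x)) = reflect m a x" for x
  proof -
    have sq: "a l * a l + (\<Sum>i\<in>?J. a i * a i) = 1"
      using a sum.remove[OF finite_atLeastAtMost l(1), of "\<lambda>i. a i * a i"]
      by (simp add: unit_vec_def sqnorm_def power2_eq_square)
    have d: "dot m a x = a l * x l + (\<Sum>i\<in>?J. a i * x i)"
      unfolding dot_def by (rule sum.remove[OF finite_atLeastAtMost l(1)])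
    define y where "y = S (- 1) ?J x"
    have y: "y i = (if i \<in> ?J then x i - a i / a l * x l else x i)" for i by (simp add: y_def S_def)
    have "(\<Sum>i\<in>?J. a i * y i) = (\<Sum>i\<in>?J. a i * x i) - (x l / a l) * (\<Sum>i\<in>?J. a i * a i)"
      unfolding sum_distrib_left sum_subtractf[symmetric] by (intro sum.cong refl) (simp add: y field_simps)
    also have "(\<Sum>i\<in>?J. a i * a i) = 1 - a l * a l" using sq by simp
    finally have "- y l - 2 * a l * (\<Sum>i\<in>?J. a i * y i) = x l - 2 * dot m a x * a l"
      unfolding d using l(2) by (simp add: y field_simps)
    then have \<tau>l: "\<tau> y l = x l - 2 * dot m a x * a l" by (simp add: \<tau>_def)
    show ?thesis
    proof
      fix i
      consider "i = l" | "i \<in> ?J" | "i \<notin> {1..m}" by auto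
      then show "S 1 ?J (\<tau> (S (- 1) ?J x)) i = reflect m a x i"
      proof cases
        case 1
        then show ?thesis using \<tau>l unfolding y_def[symmetric] by (simp add: S_def reflect_def)
      next
        case 2
        then have "S 1 ?J (\<tau> y) i = y i + a i / a l * \<tau> y l" by (simp add: S_def \<tau>_def)
        also have "\<dots> = x i - 2 * dot m a x * a i"
          unfolding \<tau>l using 2 l(2) by (simp add: y right_diff_distrib)
        finally show ?thesis by (simp add: reflect_def y_def)
      next
        case 3
        then have "i \<noteq> l" using l by auto
        then show ?thesis using 3 unit_vec_outside[OF a 3] by (simp add: S_def \<tau>_def reflect_def)
      qed
    qed
  qed
  ultimately show ?thesis by simp
qed

subsection \<open>Integrals of polynomials\<close>

abbreviation unit_ball :: "nat \<Rightarrow> (nat \<Rightarrow> real) set"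
  where "unit_ball m \<equiv> {x \<in> {1..m} \<rightarrow>\<^sub>E UNIV. (\<Sum>i=1..m. (x i)\<^sup>2) < 1}"

lemma poly_measurable:
  fixes f :: "(nat \<Rightarrow> real) \<Rightarrow> 'b::{real_normed_vector, second_countable_topology}"
  assumes "f \<in> homogeneous_polys m k V"
  shows "f \<in> borel_measurable (coord_measure m)"
proof -
  obtain c where f: "f = (\<lambda>x. \<Sum>a\<in>multi_indices m k. (\<Prod>i=1..m. x i ^ a i) *\<^sub>R c a)"
    using assms unfolding homogeneous_polys_def by blast
  show ?thesis
    unfolding f
    by (intro borel_measurable_sum borel_measurable_scaleR borel_measurable_prod borel_measurable_power
        borel_measurable_const measurable_coord)
qed

lemma unit_ball_sets: "unit_ball m \<in> sets (coord_measure m)"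
proof -
  have "sqnorm m \<in> borel_measurable (coord_measure m)" by (rule poly_measurable[OF sqnorm_poly])
  then have "{x \<in> space (coord_measure m). sqnorm m x < 1} \<in> sets (coord_measure m)"
    by (intro borel_measurable_less borel_measurable_const) (auto simp: borel_measurable_iff_less)
  then show ?thesis by (simp add: space_PiM sqnorm_def)
qed

lemma unit_ball_coord: "x \<in> unit_ball m \<Longrightarrow> i \<in> {1..m} \<Longrightarrow> \<bar>x i\<bar> \<le> 1"
proof -
  assume x: "x \<in> unit_ball m" and i: "i \<in> {1..m}"
  have "(x i)\<^sup>2 \<le> (\<Sum>i=1..m. (x i)\<^sup>2)" by (rule member_le_sum[OF i]) auto
  then have "(x i)\<^sup>2 \<le> 1" using x by simp
  then show ?thesis by (simp add: abs_square_le_1)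
qed

lemma unit_ball_finite: "emeasure (coord_measure m) (unit_ball m) < \<infinity>"
proof -
  let ?C = "PiE {1..m} (\<lambda>_. {-1..1::real})"
  have "unit_ball m \<subseteq> ?C"
  proof
    fix x assume x: "x \<in> unit_ball m"
    then show "x \<in> ?C" using unit_ball_coord[OF x] by (auto simp: PiE_iff abs_le_iff)
  qed
  then have "emeasure (coord_measure m) (unit_ball m) \<le> emeasure (coord_measure m) ?C"
    by (rule emeasure_mono) (auto intro!: sets_PiM_I_finite)
  also have "\<dots> = (\<Prod>i\<in>{1..m}. emeasure lborel {-1..1::real})"
    by (rule product_sigma_finite.emeasure_PiM[OF coord_measure_sigma]) auto
  also have "\<dots> < \<infinity>" by (simp add: ennreal_power flip: ennreal_numeral)
  finally show ?thesis .
qed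

lemma poly_bounded:
  assumes "f \<in> homogeneous_polys m k V"
  obtains C where "\<And>x. x \<in> unit_ball m \<Longrightarrow> norm (f x) \<le> C"
proof -
  obtain c where f: "f = (\<lambda>x. \<Sum>a\<in>multi_indices m k. (\<Prod>i=1..m. x i ^ a i) *\<^sub>R c a)"
    using assms unfolding homogeneous_polys_def by blast
  have "norm (f x) \<le> (\<Sum>a\<in>multi_indices m k. norm (c a))" if x: "x \<in> unit_ball m" for x
    unfolding f
  proof (rule order_trans[OF norm_sum], rule sum_mono)
    fix a
    have "\<bar>\<Prod>i=1..m. x i ^ a i\<bar> \<le> 1"
      unfolding abs_prod power_abs
      by (rule prod_le_1) (use unit_ball_coord[OF x] in \<open>auto intro: power_le_one\<close>)
    then show "norm ((\<Prod>i=1..m. x i ^ a i) *\<^sub>R c a) \<le> norm (c a)"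
      by (simp add: mult_left_le_one_le)
  qed
  then show ?thesis using that by blast
qed

lemma poly_mult_integrable:
  fixes f g :: "(nat \<Rightarrow> real) \<Rightarrow> 'a::real_or_complex"
  assumes f: "f \<in> homogeneous_polys m k V" and g: "g \<in> homogeneous_polys m l W"
  shows "set_integrable (coord_measure m) (unit_ball m) (\<lambda>x. f x * g x)"
proof -
  obtain C D where C: "\<And>x. x \<in> unit_ball m \<Longrightarrow> norm (f x) \<le> C" and D: "\<And>x. x \<in> unit_ball m \<Longrightarrow> norm (g x) \<le> D"
    by (rule poly_bounded[OF f], rule poly_bounded[OF g]) blast
  show ?thesis
    unfolding set_integrable_def
  proof (rule integrableI_bounded_set_indicator[OF unit_ball_sets _ unit_ball_finite])
    show "(\<lambda>x. f x * g x) \<in> borel_measurable (coord_measure m)"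
      by (intro borel_measurable_times poly_measurable[OF f] poly_measurable[OF g])
    have "norm (f x * g x) \<le> C * D" if "x \<in> unit_ball m" for x
      unfolding norm_mult
      by (rule mult_mono[OF C[OF that] D[OF that] order_trans[OF norm_ge_zero C[OF that]] norm_ge_zero])
    then show "AE x in coord_measure m. x \<in> unit_ball m \<longrightarrow> norm (f x * g x) \<le> C * D"
      by (intro AE_I2 impI)
  qed
qed

lemma linear_sconj_coeff: "linear (\<lambda>a::'a::real_or_complex clifford. sconj (coeff a A))"
  by (intro linearI) (simp_all add: sconj_add sconj_scaleR)

lemma hform_poly:
  assumes "f x \<in> multivectors m s"
  shows "hform (f x) b = (\<Sum>A\<in>Pow {1..m}. sconj (coeff (f x) A) * coeff b A)"
  by (rule hform_expand) (use assms in \<open>auto simp: multivectors_iff\<close>)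

lemma L2_integrable:
  fixes f g :: "(nat \<Rightarrow> real) \<Rightarrow> 'a::real_or_complex clifford"
  assumes f: "f \<in> homogeneous_polys m k (multivectors m s)" and g: "g \<in> homogeneous_polys m l W"
  shows "set_integrable (coord_measure m) (unit_ball m) (\<lambda>x. hform (f x) (g x))"
proof -
  have range: "f x \<in> multivectors m s" for x by (rule homogeneous_polys_range[OF f multivectors_real_subspace])
  have "(\<lambda>x. sconj (coeff (f x) A)) \<in> homogeneous_polys m k UNIV" "(\<lambda>x. coeff (g x) A) \<in> homogeneous_polys m l UNIV" for A
    by (rule homogeneous_polys_map[OF f linear_sconj_coeff] homogeneous_polys_map[OF g linear_coeff]; simp)+
  from poly_mult_integrable[OF this]
  show ?thesis
    unfolding hform_poly[of f, OF range] set_integrable_def scaleR_sum_right by (intro Bochner_Integration.integrable_sum)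
qed

lemma L2_inner_hform: "L2_inner m f g = set_lebesgue_integral (coord_measure m) (unit_ball m) (\<lambda>x. hform (f x) (g x))"
  by (simp add: L2_inner_def hform_def)

lemma L2_inner_reflect:
  fixes f g :: "(nat \<Rightarrow> real) \<Rightarrow> 'a::real_or_complex clifford"
  assumes a: "unit_vec m a"
    and f: "f \<in> homogeneous_polys m k (multivectors m s)" and g: "g \<in> homogeneous_polys m l W"
  shows "L2_inner m (fun_reflect m a f) (fun_reflect m a g) = L2_inner m f g"
proof -
  let ?M = "coord_measure m"
  let ?F = "\<lambda>x. indicator (unit_ball m) x *\<^sub>R hform (f x) (g x)"
  have p: "reflect m a \<in> measurable ?M ?M" "distr ?M ?M (reflect m a) = ?M"
    using preserves_reflect[OF a] by (auto simp: preserves_def)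
  have F: "?F \<in> borel_measurable ?M"
    using L2_integrable[OF f g] unfolding set_integrable_def by (rule borel_measurable_integrable)
  have "reflect m a x \<in> unit_ball m \<longleftrightarrow> x \<in> unit_ball m" for x
  proof -
    have "reflect m a x \<in> {1..m} \<rightarrow>\<^sub>E UNIV \<longleftrightarrow> x \<in> {1..m} \<rightarrow>\<^sub>E UNIV"
      using reflect_outside[OF a] by (auto simp: PiE_iff extensional_def)
    then show ?thesis using sqnorm_reflect[OF a, of x] by (simp add: sqnorm_def)
  qed
  then have "L2_inner m (fun_reflect m a f) (fun_reflect m a g) = (\<integral>x. ?F (reflect m a x) \<partial>?M)"
    unfolding L2_inner_hform set_lebesgue_integral_def fun_reflect_def hform_cl_reflect[OF a]
    by (intro Bochner_Integration.integral_cong refl) (simp add: indicator_def)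
  also have "\<dots> = (\<integral>x. ?F x \<partial>distr ?M ?M (reflect m a))"
    by (rule integral_distr[OF p(1) F, symmetric])
  also have "\<dots> = L2_inner m f g"
    unfolding p(2) L2_inner_hform set_lebesgue_integral_def ..
  finally show ?thesis .
qed

lemma poly_continuous:
  fixes f :: "(nat \<Rightarrow> real) \<Rightarrow> 'b::real_normed_vector"
  assumes "f \<in> homogeneous_polys m k V"
  shows "continuous_on UNIV f"
proof -
  obtain c where f: "f = (\<lambda>x. \<Sum>a\<in>multi_indices m k. (\<Prod>i=1..m. x i ^ a i) *\<^sub>R c a)"
    using assms unfolding homogeneous_polys_def by blast
  show ?thesis
    unfolding f by (intro continuous_on_sum continuous_on_scaleR continuous_on_prod continuous_on_power
      continuous_on_const continuous_on_product_coordinates)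
qed

lemma emeasure_lborel_open_pos:
  assumes "open (X :: real set)" "x \<in> X"
  shows "0 < emeasure lborel X"
proof -
  obtain e where e: "0 < e" "ball x e \<subseteq> X" using assms open_contains_ball by blast
  have "0 < emeasure lborel {x - e / 2 .. x + e / 2}" using e(1) by simp
  also have "{x - e / 2 .. x + e / 2} \<subseteq> X" using e by (auto simp: subset_iff ball_def dist_real_def abs_if)
  then have "emeasure lborel {x - e / 2 .. x + e / 2} \<le> emeasure lborel X"
    using assms(1) by (intro emeasure_mono) auto
  finally show ?thesis .
qed

text \<open>The integrand is a continuous nonnegative function that is positive at some point of the
  ball, hence on an open box around that point, and a box of nonempty open intervals or open sets
  has positive product measure.\<close>

lemma L2_inner_positive:
  fixes f :: "(nat \<Rightarrow> real) \<Rightarrow> 'a::real_or_complex clifford"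
  assumes f: "f \<in> homogeneous_polys m k (multivectors m s)" and ne: "f x \<noteq> 0"
  shows "\<exists>p>0. L2_inner m f f = of_real p"
proof -
  let ?M = "coord_measure m"
  have range: "f x \<in> multivectors m s" for x by (rule homogeneous_polys_range[OF f multivectors_real_subspace])
  have hp: "(\<lambda>x. coeff (f x) A) \<in> homogeneous_polys m k UNIV" for A
    by (rule homogeneous_polys_map[OF f linear_coeff]) simp
  define h where "h x = (\<Sum>A\<in>Pow {1..m}. (norm (coeff (f x) A))\<^sup>2)" for x
  have hform: "hform (f x) (f x) = of_real (h x)" for x
    unfolding hform_poly[of f, OF range] h_def by (simp add: mult.commute[of "sconj _"] mult_sconj)
  have h_nonneg: "0 \<le> h x" for x unfolding h_def by (intro sum_nonneg) simp
  have h_meas: "h \<in> borel_measurable ?M"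
    unfolding h_def[abs_def] by (intro borel_measurable_sum borel_measurable_power measurable_compose[OF poly_measurable[OF hp] borel_measurable_norm])
  have int: "integrable ?M (\<lambda>x. indicator (unit_ball m) x *\<^sub>R h x)"
  proof -
    have "integrable ?M (\<lambda>x. norm (indicator (unit_ball m) x *\<^sub>R hform (f x) (f x)))"
      using L2_integrable[OF f f] unfolding set_integrable_def by (rule integrable_norm)
    then show ?thesis by (simp add: hform h_nonneg indicator_def if_distrib cong: if_cong)
  qed
  have "L2_inner m f f = of_real (\<integral>x. indicator (unit_ball m) x *\<^sub>R h x \<partial>?M)"
  proof -
    have "L2_inner m f f = (\<integral>x. of_real (indicator (unit_ball m) x *\<^sub>R h x) \<partial>?M)"
      unfolding L2_inner_hform set_lebesgue_integral_def hform
      by (intro Bochner_Integration.integral_cong refl) (simp add: scaleR_conv_of_real[where 'a='a])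
    also have "\<dots> = of_real (\<integral>x. indicator (unit_ball m) x *\<^sub>R h x \<partial>?M)"
      by (rule integral_bounded_linear[OF bounded_linear_of_real int])
    finally show ?thesis .
  qed
  moreover have "0 < (\<integral>x. indicator (unit_ball m) x *\<^sub>R h x \<partial>?M)"
  proof (rule ccontr)
    assume "\<not> ?thesis"
    moreover have "0 \<le> (\<integral>x. indicator (unit_ball m) x *\<^sub>R h x \<partial>?M)"
      by (rule integral_nonneg_AE) (simp add: h_nonneg)
    ultimately have "(\<integral>x. indicator (unit_ball m) x *\<^sub>R h x \<partial>?M) = 0" by simp
    then have AE: "AE x in ?M. indicator (unit_ball m) x *\<^sub>R h x = 0"
      using integral_nonneg_eq_0_iff_AE[OF int] by (simp add: h_nonneg)
    \<comment> \<open>Scaling moves a point with \<open>f x \<noteq> 0\<close> into the open ball,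
      because \<open>|x|^2 < (1 + |x|^2)^2\<close>; homogeneity keeps the value nonzero.\<close>
    define c where "c = 1 / (1 + sqnorm m x)"
    have c: "0 < c" "c \<noteq> 0" using sqnorm_nonneg[of m x] by (simp_all add: c_def)
    define y where "y = (\<lambda>i. c * x i)"
    have "sqnorm m y < 1"
    proof -
      have "sqnorm m x < (1 + sqnorm m x)\<^sup>2"
        using sqnorm_nonneg[of m x] by (simp add: power2_eq_square algebra_simps add_pos_nonneg)
      then show ?thesis
        unfolding y_def sqnorm_scale using sqnorm_nonneg[of m x] by (simp add: c_def power_divide)
    qed
    moreover have "f y \<noteq> 0"
      using homogeneous_polys_homogeneous[OF f multivectors_real_subspace, of c x] ne c by (simp add: y_def)
    then obtain A where A: "coeff (f y) A \<noteq> 0" using clifford_eqI[of "f y" 0] by auto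
    moreover define U where "U = {z. sqnorm m z < 1} \<inter> {z. coeff (f z) A \<noteq> 0}"
    ultimately have "y \<in> U" by simp
    have "open U"
      unfolding U_def
      by (intro open_Int open_Collect_less open_Collect_neq continuous_on_const poly_continuous[OF sqnorm_poly] poly_continuous[OF hp])
    then obtain X where X: "y \<in> PiE UNIV X" "\<And>i. open (X i)" "PiE UNIV X \<subseteq> U"
      using product_topology_open_contains_basis[of "\<lambda>_::nat. euclidean :: real topology" UNIV U y] \<open>y \<in> U\<close>
      by (auto simp: open_fun_def)
    have yX: "y i \<in> X i" for i using X(1) by (auto simp: PiE_iff)
    let ?P = "PiE {1..m} X"
    have P: "?P \<in> sets ?M" using X(2) by (intro sets_PiM_I_finite) auto
    have "emeasure ?M ?P = (\<Prod>i\<in>{1..m}. emeasure lborel (X i))"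
      using X(2) by (intro product_sigma_finite.emeasure_PiM[OF coord_measure_sigma]) auto
    moreover have "emeasure lborel (X i) \<noteq> 0" for i
      using emeasure_lborel_open_pos[OF X(2) yX, of i] by simp
    ultimately have pos: "emeasure ?M ?P \<noteq> 0" by (simp add: prod_zero_iff)
    have nz: "indicator (unit_ball m) z *\<^sub>R h z \<noteq> 0" if z: "z \<in> ?P" for z
    proof -
      \<comment> \<open>\<open>U\<close> is open in the space of all functions on the naturals,
        while points of the product measure are extensional outside \<open>{1..m}\<close>. Filling
        up with the coordinates of \<open>y\<close> moves \<open>z\<close> into \<open>U\<close>
        without changing \<open>f\<close>.\<close>
      define z' where "z' i = (if i \<in> {1..m} then z i else y i)" for i
      have "z' \<in> PiE UNIV X" using z yX by (auto simp: z'_def PiE_iff)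
      then have z': "sqnorm m z' < 1" "coeff (f z') A \<noteq> 0" using X(3) by (auto simp: U_def)
      have eq: "f z' = f z" by (rule homogeneous_polys_cong[OF f]) (simp add: z'_def)
      have "sqnorm m z' = sqnorm m z" by (simp add: sqnorm_def z'_def)
      then have "z \<in> unit_ball m" using z z' by (auto simp: PiE_iff sqnorm_def)
      moreover have "h z \<noteq> 0"
      proof -
        have "A \<in> Pow {1..m}" using z'(2) range by (auto simp: multivectors_iff)
        then have "(norm (coeff (f z) A))\<^sup>2 \<le> h z" unfolding h_def by (intro member_le_sum) auto
        moreover have "0 < (norm (coeff (f z) A))\<^sup>2" using z'(2) eq by simp
        ultimately show ?thesis by linarith
      qed
      ultimately show ?thesis by simp
    qed
    have "AE z in ?M. z \<notin> ?P" using AE by eventually_elim (use nz in blast)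
    then have "emeasure ?M ?P = 0" using P by (subst (asm) AE_iff_measurable[OF P]) (auto dest: sets.sets_into_space)
    with pos show False by simp
  qed
  ultimately show ?thesis by blast
qed

lemma fscale_lambda: "fscale c f = (\<lambda>x. c *\<^sub>C f x)"
  by (simp add: fscale_def)

lemma L2_inner_product_on:
  "inner_product_on fscale (monogenics m s k :: ((nat \<Rightarrow> real) \<Rightarrow> 'a::real_or_complex clifford) set) (L2_inner m)"
  unfolding inner_product_on_def
proof (intro conjI ballI allI impI)
  fix f g h :: "(nat \<Rightarrow> real) \<Rightarrow> 'a clifford"
  assume f: "f \<in> monogenics m s k" and g: "g \<in> monogenics m s k"
  note i = L2_integrable[OF monogenicsD(1)[OF f] monogenicsD(1)]
  show "L2_inner m f (g + h) = L2_inner m f g + L2_inner m f h" if h: "h \<in> monogenics m s k"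
    unfolding L2_inner_hform plus_fun_apply hform_add_right by (rule set_integral_add(2)[OF i[OF g] i[OF h]])
  show "L2_inner m f (fscale c g) = c * L2_inner m f g" for c
    unfolding L2_inner_hform fscale_def hform_cscale_right by (rule set_integral_mult_right)
  \<comment> \<open>Conjugation is taken out of the integral as a bounded linear map; it preserves
    the norm because \<open>x * sconj x = |x|^2\<close>.\<close>
  have bl: "bounded_linear (sconj :: 'a \<Rightarrow> 'a)"
  proof (rule bounded_linear_intro[where K = 1])
    fix x :: 'a
    have "norm x * norm (sconj x) = norm x * norm x"
      using arg_cong[OF mult_sconj[of x], of norm] by (simp add: norm_mult power2_eq_square del: of_real_power)
    then show "norm (sconj x) \<le> norm x * 1" by (cases "x = 0") auto
  qed (auto simp: sconj_add sconj_scaleR)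
  show "L2_inner m g f = sconj (L2_inner m f g)"
  proof -
    have "(\<lambda>x. indicator (unit_ball m) x *\<^sub>R hform (g x) (f x)) =
        (\<lambda>x. sconj (indicator (unit_ball m) x *\<^sub>R hform (f x) (g x)))"
      by (simp add: sconj_scaleR hform_commute[of "g _" "f _"])
    then show ?thesis
      unfolding L2_inner_hform set_lebesgue_integral_def
      using integral_bounded_linear[OF bl i[OF g, unfolded set_integrable_def]] by simp
  qed
  show "\<exists>p>0. L2_inner m f f = of_real p" if "f \<noteq> 0"
    using L2_inner_positive[OF monogenicsD(1)[OF f]] that by (auto simp: fun_eq_iff)
qed

section \<open>The action of the Pin group\<close>

text \<open>\<open>coords\<close> returns the representative that vanishes outside
  \<open>{1..m}\<close>, so this is \<open>coords\<close> after \<open>cvec\<close>. Polynomials do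
  not see the difference.\<close>

definition restr :: "nat \<Rightarrow> (nat \<Rightarrow> real) \<Rightarrow> nat \<Rightarrow> real"
  where "restr m x = (\<lambda>i. if i \<in> {1..m} then x i else 0)"

lemma cvec_restr [simp]: "cvec m (restr m x) = cvec m x"
  by (rule cvec_cong) (simp add: restr_def)

lemma sqnorm_restr [simp]: "sqnorm m (restr m x) = sqnorm m x"
  by (simp add: sqnorm_def restr_def)

lemma poly_restr: "f \<in> homogeneous_polys m k V \<Longrightarrow> f (restr m x) = f x"
  by (erule homogeneous_polys_cong) (simp add: restr_def)

lemma coeff_cvec: "i \<in> {1..m} \<Longrightarrow> coeff (cvec m x) {i} = (of_real (x i) :: 'a::real_normed_field)"
proof -
  assume i: "i \<in> {1..m}"
  have "coeff (cvec m x) {i} = (\<Sum>l=1..m. if l = i then of_real (x i) else (0 :: 'a))"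
    unfolding cvec_def coeff_sum by (intro sum.cong refl) (auto simp: coeff_blade scaleR_conv_of_real[where 'a='a])
  then show ?thesis using i by simp
qed

lemma cvec_eqD:
  assumes "cvec m x = (cvec m y :: 'a::real_normed_field clifford)" "i \<in> {1..m}"
  shows "x i = y i"
  using coeff_cvec[OF assms(2), of x, where 'a='a] coeff_cvec[OF assms(2), of y, where 'a='a] assms(1) by simp

lemma coords_cvec: "coords m (cvec m x :: 'a::real_normed_field clifford) = restr m x"
proof -
  let ?S = "{x. \<forall>i. i \<notin> {1..m} \<longrightarrow> x i = (0::real)}"
  have "inj_on (cvec m :: _ \<Rightarrow> 'a clifford) ?S"
  proof (rule inj_onI)
    fix x y assume xy: "x \<in> ?S" "y \<in> ?S" "cvec m x = (cvec m y :: 'a clifford)"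
    show "x = y"
    proof
      fix i show "x i = y i" using cvec_eqD[OF xy(3), of i] xy(1,2) by (cases "i \<in> {1..m}") auto
    qed
  qed
  moreover have "restr m x \<in> ?S" by (simp add: restr_def)
  ultimately have "the_inv_into ?S (cvec m) (cvec m (restr m x) :: 'a clifford) = restr m x" by (rule the_inv_into_f_f)
  then show ?thesis unfolding coords_def cvec_restr .
qed

lemma cinverse_eqI:
  assumes "r * q = 1" "q * r = 1"
  shows "cinverse r = q"
  unfolding cinverse_def
proof (rule the_equality)
  show "r * q = 1 \<and> q * r = 1" using assms by blast
  fix p assume "r * p = 1 \<and> p * r = 1"
  then have "p * r * q = q" by simp
  then show "p = q" using assms(1) by (simp add: mult.assoc)
qed

lemma cinverse_unit_vec: "unit_vec m a \<Longrightarrow> cinverse (cvec m a) = - cvec m a"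
  by (rule cinverse_eqI) (simp_all add: unit_vec_square)

lemma Pin_induct [consumes 1, case_names one mult]:
  fixes r :: "'a::real_normed_field clifford"
  assumes "r \<in> Pin m" and "Q 1"
    and "\<And>a r. unit_vec m a \<Longrightarrow> r \<in> Pin m \<Longrightarrow> Q r \<Longrightarrow> Q (cvec m a * r)"
  shows "Q r"
proof -
  obtain us where us: "set us \<subseteq> cvec m ` {x. (\<Sum>i=1..m. (x i)\<^sup>2) = 1}" "r = prod_list us"
    using assms(1) unfolding Pin_def by blast
  from us(1) have "prod_list us \<in> Pin m \<and> Q (prod_list us)"
  proof (induction us)
    case Nil
    have "prod_list [] \<in> Pin m" unfolding Pin_def by (intro CollectI exI[of _ "[]"]) simp
    then show ?case using assms(2) by simp
  next
    case (Cons u us)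
    then obtain x where x: "u = cvec m x" "sqnorm m x = 1" by (auto simp: sqnorm_def)
    then have "unit_vec m (restr m x)" "u = cvec m (restr m x)"
      by (simp_all add: unit_vec_def) (simp add: restr_def)
    then have "Q (u * prod_list us)" using assms(3)[of "restr m x" "prod_list us"] Cons by simp
    moreover have "prod_list (u # us) \<in> Pin m" unfolding Pin_def using Cons.prems by blast
    ultimately show ?case by simp
  qed
  then show ?thesis using us(2) by simp
qed

lemma unit_vec_Pin: "unit_vec m a \<Longrightarrow> cvec m a \<in> Pin m"
  unfolding Pin_def by (intro CollectI exI[of _ "[cvec m a]"]) (auto simp: unit_vec_def sqnorm_def)

lemma cinverse_unit_vec_mult:
  fixes r :: "'a::real_normed_field clifford"
  assumes a: "unit_vec m a" and r: "r * cinverse r = 1" "cinverse r * r = 1"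
  shows "cinverse (cvec m a * r) = cinverse r * - cvec m a"
    and "cvec m a * r * (cinverse r * - cvec m a) = 1" and "cinverse r * - cvec m a * (cvec m a * r) = 1"
proof -
  let ?u = "cvec m a :: 'a clifford"
  have "?u * r * (cinverse r * - ?u) = ?u * (r * cinverse r) * - ?u" by (simp only: mult.assoc)
  then show 1: "?u * r * (cinverse r * - ?u) = 1" by (simp add: r(1) unit_vec_square[OF a])
  have "cinverse r * - ?u * (?u * r) = cinverse r * - (?u * (?u * r))" by (simp add: mult.assoc)
  then show 2: "cinverse r * - ?u * (?u * r) = 1" by (simp add: unit_vec_cancel[OF a] r(2))
  show "cinverse (?u * r) = cinverse r * - ?u" by (rule cinverse_eqI[OF 1 2])
qed

lemma unit_vec_conj:
  fixes a x :: "nat \<Rightarrow> real"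
  assumes a: "unit_vec m a"
  shows "(- cvec m a) * cvec m x * cvec m a = (cvec m (\<lambda>i. - 1 * reflect m a x i) :: 'a::real_normed_field clifford)"
proof -
  let ?u = "cvec m a :: 'a clifford"
  have "cvec m (\<lambda>i. - 1 * reflect m a x i) = - (cvec m (reflect m a x) :: 'a clifford)"
    by (simp add: cvec_def sum_negf)
  also have "cvec m (reflect m a x) = cl_reflect ?u (cvec m x)"
    by (rule cl_reflect_cvec[OF a order_refl, symmetric])
  also have "- cl_reflect ?u (cvec m x) = - ?u * cvec m x * ?u"
    by (simp add: cl_reflect_def involute_cvec)
  finally show ?thesis by (rule sym)
qed

text \<open>\<open>H_action\<close> evaluates \<open>f\<close> at \<open>coords\<close> of a
  conjugated vector, which is specified only on the image of \<open>cvec\<close>; hence it has to be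
  known that conjugation maps vectors to vectors. The sign \<open>\<sigma>\<close> is the parity of
  the number of factors of \<open>r\<close>.\<close>

lemma Pin_properties:
  fixes r :: "'a::real_normed_field clifford"
  assumes "r \<in> Pin m"
  shows "r * cinverse r = 1 \<and> cinverse r * r = 1 \<and> (\<exists>\<sigma>. (\<sigma> = 1 \<or> \<sigma> = - 1) \<and> involute r = \<sigma> *\<^sub>R r) \<and>
    (\<forall>x. \<exists>y. cinverse r * cvec m x * r = cvec m y \<and> sqnorm m y = sqnorm m x)"
  using assms
proof (induction rule: Pin_induct)
  case one
  have "cinverse 1 = (1 :: 'a clifford)" by (rule cinverse_eqI) simp_all
  then show ?case by (auto intro: exI[of _ "1::real"])
next
  case (mult a r)
  let ?u = "cvec m a :: 'a clifford"
  from mult obtain \<sigma> where IH: "r * cinverse r = 1" "cinverse r * r = 1" "\<sigma> = 1 \<or> \<sigma> = - 1" "involute r = \<sigma> *\<^sub>R r"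
    "\<And>x. \<exists>y. cinverse r * cvec m x * r = cvec m y \<and> sqnorm m y = sqnorm m x" by blast
  note inv = cinverse_unit_vec_mult[OF mult(1) IH(1,2)]
  have "\<exists>y. cinverse (?u * r) * cvec m x * (?u * r) = cvec m y \<and> sqnorm m y = sqnorm m x" for x
  proof -
    have "cinverse (?u * r) * cvec m x * (?u * r) = cinverse r * (- ?u * cvec m x * ?u) * r"
      unfolding inv(1) by (simp add: mult.assoc)
    also have "\<dots> = cinverse r * cvec m (\<lambda>i. - 1 * reflect m a x i) * r"
      unfolding unit_vec_conj[OF mult(1)] ..
    finally show ?thesis
      using IH(5)[of "\<lambda>i. - 1 * reflect m a x i"] sqnorm_scale[of m "- 1" "reflect m a x"] sqnorm_reflect[OF mult(1)] by simp
  qed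
  moreover have "\<exists>\<sigma>. (\<sigma> = 1 \<or> \<sigma> = - 1) \<and> involute (?u * r) = \<sigma> *\<^sub>R (?u * r)"
    using IH(3,4) by (intro exI[of _ "- \<sigma>"]) (auto simp: involute_mult)
  ultimately show ?case using inv(2,3) unfolding inv(1) by blast
qed

lemma H_action_one: "f \<in> homogeneous_polys m k V \<Longrightarrow> H_action m 1 f = f"
proof
  fix x assume f: "f \<in> homogeneous_polys m k V"
  have "cinverse 1 = (1 :: 'a clifford)" by (rule cinverse_eqI) simp_all
  then show "H_action m 1 f x = f x" by (simp add: H_action_def coords_cvec poly_restr[OF f])
qed

lemma H_action_mult:
  fixes r :: "'a::real_normed_field clifford"
  assumes a: "unit_vec m a" and r: "r \<in> Pin m"
  shows "H_action m (cvec m a * r) f = H_action m (cvec m a) (H_action m r f)"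
proof
  fix x
  let ?u = "cvec m a :: 'a clifford"
  have rr: "r * cinverse r = 1" "cinverse r * r = 1" using Pin_properties[OF r] by auto
  note inv = cinverse_unit_vec_mult(1)[OF a rr]
  obtain y where y: "(- ?u) * cvec m x * ?u = cvec m y" using unit_vec_conj[OF a] by blast
  have "cinverse (?u * r) * cvec m x * (?u * r) = cinverse r * ((- ?u) * cvec m x * ?u) * r"
    unfolding inv by (simp only: mult.assoc)
  also have "\<dots> = cinverse r * cvec m (restr m y) * r" unfolding y cvec_restr ..
  finally have "coords m (cinverse (?u * r) * cvec m x * (?u * r)) = coords m (cinverse r * cvec m (restr m y) * r)"
    by simp
  then show "H_action m (?u * r) f x = H_action m ?u (H_action m r f) x"
    unfolding H_action_def cinverse_unit_vec[OF a] y coords_cvec inv by (simp add: mult.assoc)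
qed

text \<open>The factor \<open>(- 1) ^ k\<close> arises since plain conjugation evaluates
  \<open>f\<close> at the negative of the reflected point, the factor \<open>(- 1) ^ s\<close> since
  the value is conjugated without the main involution.\<close>

lemma H_action_unit_vec:
  fixes f :: "(nat \<Rightarrow> real) \<Rightarrow> 'a::real_normed_field clifford"
  assumes a: "unit_vec m a" and f: "f \<in> homogeneous_polys m k (multivectors m s)"
  shows "H_action m (cvec m a) f = (\<lambda>x. (- 1) ^ (k + s) *\<^sub>R fun_reflect m a f x)"
proof
  fix x
  let ?u = "cvec m a :: 'a clifford" and ?b = "f (reflect m a x)"
  have "?b \<in> multivectors m s" by (rule homogeneous_polys_range[OF f multivectors_real_subspace])
  from involute_multivectors[OF this] have b: "?b = (- 1) ^ s *\<^sub>R involute ?b"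
    by (cases "even s") simp_all
  have "f (\<lambda>i. - 1 * reflect m a x i) = (- 1) ^ k *\<^sub>R ?b"
    by (rule homogeneous_polys_homogeneous[OF f multivectors_real_subspace])
  then have "H_action m ?u f x = ?u * ((- 1) ^ k *\<^sub>R ?b) * - ?u"
    unfolding H_action_def cinverse_unit_vec[OF a] unit_vec_conj[OF a] coords_cvec poly_restr[OF f] by simp
  also have "\<dots> = ?u * ((- 1) ^ (k + s) *\<^sub>R involute ?b) * - ?u"
    by (subst b) (simp add: power_add)
  finally show "H_action m ?u f x = (- 1) ^ (k + s) *\<^sub>R fun_reflect m a f x"
    by (simp add: fun_reflect_def cl_reflect_def)
qed

lemma H_action_monogenic:
  assumes r: "r \<in> Pin m" and f: "f \<in> monogenics m s k"
  shows "H_action m r f \<in> monogenics m s k"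
  using r
proof (induction rule: Pin_induct)
  case one
  then show ?case using H_action_one[OF monogenicsD(1)[OF f]] f by simp
next
  case (mult a r)
  show ?case
    unfolding H_action_mult[OF mult(1,2)] H_action_unit_vec[OF mult(1) monogenicsD(1)[OF mult(3)]]
    by (intro monogenics_scaleR fun_reflect_monogenic[OF mult(1) order_refl] mult(3))
qed

lemma L2_inner_scaleR_sign:
  "L2_inner m (\<lambda>x. (- 1) ^ l *\<^sub>R f x) (\<lambda>x. (- 1) ^ l *\<^sub>R g x) = L2_inner m f g"
  by (simp add: L2_inner_hform hform_scaleR_left hform_scaleR_right flip: power_add)

lemma L2_inner_H_action:
  fixes f g :: "(nat \<Rightarrow> real) \<Rightarrow> 'a::real_or_complex clifford"
  assumes r: "r \<in> Pin m" and f: "f \<in> monogenics m s k" and g: "g \<in> monogenics m s k"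
  shows "L2_inner m (H_action m r f) (H_action m r g) = L2_inner m f g"
  using r
proof (induction rule: Pin_induct)
  case one
  then show ?case using H_action_one[OF monogenicsD(1)[OF f]] H_action_one[OF monogenicsD(1)[OF g]] by simp
next
  case (mult a r)
  note f' = monogenicsD(1)[OF H_action_monogenic[OF mult(2) f]] and g' = monogenicsD(1)[OF H_action_monogenic[OF mult(2) g]]
  show ?case
    unfolding H_action_mult[OF mult(1,2)] H_action_unit_vec[OF mult(1) f'] H_action_unit_vec[OF mult(1) g']
      L2_inner_scaleR_sign L2_inner_reflect[OF mult(1) f' g'] by (rule mult(3))
qed

section \<open>The stabilizer of \<open>e_m\<close> and the embeddings\<close>

lemma unit_vec_Pin_fix:
  assumes a: "unit_vec n a"
  shows "(cvec (Suc n) a :: 'a::real_normed_field clifford) \<in> Pin_fix (Suc n)"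
proof -
  let ?u = "cvec n a :: 'a clifford"
  have u: "cvec (Suc n) a = ?u" by (rule unit_vec_cvec[OF a]) simp
  have a': "unit_vec (Suc n) a" by (rule unit_vec_mono[OF a]) simp
  have "involute ?u * gen (Suc n) * cinverse ?u = gen (Suc n)"
    using cinverse_unit_vec[OF a', where 'a='a] cl_reflect_gen_Suc[OF a, where 'a='a] unfolding u by (simp add: cl_reflect_def)
  then show ?thesis using unit_vec_Pin[OF a', where 'a='a] unfolding Pin_fix_def u by blast
qed

text \<open>\<open>ck_factor\<close> contains the last variable only in powers
  \<open>z - 2 i\<close>, all of the parity of \<open>z\<close>.\<close>

lemma ck_factor_sign:
  assumes \<sigma>: "\<sigma> = 1 \<or> \<sigma> = - 1" and y: "y (Suc n) = \<sigma> * x (Suc n)" "sqnorm n y = sqnorm n x"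
  shows "ck_factor n j z y = \<sigma> ^ nat z * ck_factor n j z x"
proof -
  have D: "divpow (z - 2 * int i) (\<sigma> * t) = \<sigma> ^ nat z * divpow (z - 2 * int i) t" for i t
  proof (cases "z - 2 * int i < 0")
    case False
    then have "nat z = nat (z - 2 * int i) + 2 * i" by simp
    moreover have "\<sigma> ^ (2 * i) = 1" using \<sigma> by (auto simp: power_mult)
    ultimately have "\<sigma> ^ nat z = \<sigma> ^ nat (z - 2 * int i)" by (simp add: power_add)
    then show ?thesis by (simp add: divpow_def power_mult_distrib)
  qed simp
  show ?thesis
    unfolding ck_factor_def ck_sum_def y D by (simp only: sum_distrib_left mult_ac)
qed

text \<open>A factorization of \<open>r\<close> into unit vectors of \<open>R^m\<close> says little
  about \<open>R^n\<close>. Instead, conjugation by \<open>r\<close> is used as an algebra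
  automorphism \<open>c\<close>: fixing \<open>e_m\<close> with the involution means
  \<open>c e_m = \<sigma> e_m\<close> with the parity \<open>\<sigma>\<close> of \<open>r\<close>.
  So the last coordinate is multiplied by \<open>\<sigma>\<close>, the others are moved among
  themselves, and the embedding is respected up to a sign.\<close>

lemma H_action_ck_embedding:
  fixes P :: "(nat \<Rightarrow> real) \<Rightarrow> 'a::real_normed_field clifford"
  assumes r: "r \<in> Pin_fix (Suc n)" and P: "P \<in> monogenics n t j" and jk: "j \<le> k" and st: "s = t \<or> s = Suc t"
  shows "H_action (Suc n) r P \<in> monogenics n t j"
    and "\<exists>\<epsilon>. H_action (Suc n) r (ck_embedding n s t k j P) =
      (\<lambda>x. \<epsilon> *\<^sub>R ck_embedding n s t k j (H_action (Suc n) r P) x)"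
proof -
  let ?m = "Suc n" and ?e = "gen (Suc n) :: 'a clifford"
  define q where "q = cinverse r"
  have rP: "r \<in> Pin ?m" and fixes_e: "involute r * ?e * q = ?e" using r by (auto simp: Pin_fix_def q_def)
  obtain \<sigma> where \<sigma>: "\<sigma> = 1 \<or> \<sigma> = - 1" "involute r = \<sigma> *\<^sub>R r"
    and rq: "r * q = 1" "q * r = 1"
    and vec: "\<And>x. \<exists>y. q * cvec ?m x * r = cvec ?m y \<and> sqnorm ?m y = sqnorm ?m x"
    using Pin_properties[OF rP] unfolding q_def by blast
  have \<sigma>\<sigma>: "\<sigma> * \<sigma> = 1" using \<sigma>(1) by auto
  define c where "c b = r * b * q" for b
  have c_mult: "c (a * b) = c a * c b" for a b
    unfolding c_def using rq(2) by (metis mult.assoc mult.right_neutral)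
  have lin: "linear c" unfolding c_def by (intro linearI) (simp_all add: algebra_simps)
  note c_lin = linear_add[OF lin] linear_scale[OF lin] linear_diff[OF lin] linear_neg[OF lin]
  have c_one: "c 1 = 1" by (simp add: c_def rq)
  have iq: "involute q = \<sigma> *\<^sub>R q"
  proof -
    have "\<sigma> *\<^sub>R (r * involute q) = 1"
      using arg_cong[OF rq(1), of involute] by (simp add: involute_mult \<sigma>(2))
    then have "q * (\<sigma> *\<^sub>R (r * involute q)) = q" by simp
    then have "\<sigma> *\<^sub>R involute q = q" using rq(2) by (simp flip: mult.assoc)
    then show ?thesis by (metis \<sigma>\<sigma> scaleR_scaleR scaleR_one)
  qed
  have c_inv: "c (involute b) = involute (c b)" for b
    unfolding c_def by (simp add: involute_mult \<sigma>(2) iq \<sigma>\<sigma>)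
  have c_wedge: "c (wedge u b) = wedge (c u) (c b)" and c_bullet: "c (bullet u b) = bullet (c u) (c b)" for u b
    by (simp_all add: wedge_def bullet_def c_lin c_mult c_inv)
  have er: "?e * r = \<sigma> *\<^sub>R (r * ?e)"
    using arg_cong[OF fixes_e, of "\<lambda>b. b * r"] by (simp add: mult.assoc rq \<sigma>(2))
  \<comment> \<open>The condition of \<open>Pin_fix\<close> reads \<open>\<sigma> r e q = e\<close>
    after replacing \<open>involute r\<close> by \<open>\<sigma> r\<close>.\<close>
  have ce: "c ?e = \<sigma> *\<^sub>R ?e"
  proof -
    have "r * ?e = \<sigma> *\<^sub>R (?e * r)" using er by (simp add: \<sigma>\<sigma>)
    then show ?thesis unfolding c_def using rq(1) by (simp add: mult.assoc)
  qed
  define y where "y x = coords ?m (q * cvec ?m x * r)" for x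
  have y: "cvec ?m (y x) = q * cvec ?m x * r" "sqnorm ?m (y x) = sqnorm ?m x" for x
  proof -
    obtain z where z: "q * cvec ?m x * r = cvec ?m z" "sqnorm ?m z = sqnorm ?m x" using vec by blast
    then show "cvec ?m (y x) = q * cvec ?m x * r" "sqnorm ?m (y x) = sqnorm ?m x"
      unfolding y_def z(1) coords_cvec by simp_all
  qed
  have H: "H_action ?m r f x = c (f (y x))" for f x
    by (simp add: H_action_def c_def y_def q_def)
  have cy: "c (cvec ?m (y x)) = cvec ?m x" for x
    unfolding c_def y(1) using rq(1) by (metis mult.assoc mult.left_neutral mult.right_neutral)
  \<comment> \<open>The anticommutator of a vector with \<open>e\<close> is \<open>- 2\<close> times
    its last coordinate; \<open>c\<close> turns that of \<open>y x\<close> into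
    \<open>\<sigma>\<close> times that of \<open>x\<close>.\<close>
  have ym: "y x ?m = \<sigma> * x ?m" for x
  proof -
    have g: "?e * cvec ?m z + cvec ?m z * ?e = (- 2 * z ?m) *\<^sub>R 1" for z
      using gen_cvec[of ?m ?m z, where 'a='a] by simp
    have "(- 2 * y x ?m) *\<^sub>R (1 :: 'a clifford) = c (?e * cvec ?m (y x) + cvec ?m (y x) * ?e)"
      unfolding g c_lin c_one ..
    also have "\<dots> = \<sigma> *\<^sub>R (?e * cvec ?m x + cvec ?m x * ?e)"
      by (simp add: c_lin c_mult ce cy scaleR_add_right)
    also have "\<dots> = (- 2 * (\<sigma> * x ?m)) *\<^sub>R 1" unfolding g by simp
    finally show ?thesis by (simp add: scaleR_cancel_right)
  qed
  have cvec_Suc: "cvec ?m z = cvec n z + z ?m *\<^sub>R ?e" for z by (simp add: cvec_def)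
  have sq_Suc: "sqnorm ?m z = sqnorm n z + (z ?m)\<^sup>2" for z by (simp add: sqnorm_def)
  have cyn: "c (cvec n (y x)) = cvec n x" for x
  proof -
    have "c (cvec ?m (y x)) = c (cvec n (y x)) + (\<sigma> * x ?m) *\<^sub>R \<sigma> *\<^sub>R ?e"
      by (simp add: cvec_Suc[of "y x"] c_lin ce ym)
    also have "(\<sigma> * x ?m) *\<^sub>R \<sigma> *\<^sub>R ?e = x ?m *\<^sub>R ?e" using \<sigma>\<sigma> by simp
    finally show ?thesis unfolding cy cvec_Suc[of x] by simp
  qed
  have yn: "sqnorm n (y x) = sqnorm n x" for x
  proof -
    have "(y x ?m)\<^sup>2 = (x ?m)\<^sup>2" unfolding ym using \<sigma>(1) by auto
    then show ?thesis using y(2)[of x] by (simp add: sq_Suc)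
  qed
  have F: "ck_factor n j z (y x) = \<sigma> ^ nat z * ck_factor n j z x" for j z x
    by (rule ck_factor_sign[OF \<sigma>(1) ym yn])
  have ck: "c (ck_mult n j z Q (y x)) = \<sigma> ^ nat z *\<^sub>R ck_mult n j z (\<lambda>x. c (Q (y x))) x" for j z x and Q :: "(nat \<Rightarrow> real) \<Rightarrow> 'a clifford"
  proof -
    have "\<sigma> ^ nat (z - 1) * ck_factor n (Suc j) (z - 1) x * \<sigma> = \<sigma> ^ nat z * ck_factor n (Suc j) (z - 1) x"
    proof (cases "z \<le> 0")
      case False
      then have "nat z = Suc (nat (z - 1))" by simp
      then show ?thesis by simp
    qed simp
    then show ?thesis
      by (simp add: ck_mult_def c_lin c_mult F ce cyn scaleR_add_right mult_ac)
  qed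
  have sh: "c (shift n t j P (y x)) = shift n t j (\<lambda>x. c (P (y x))) x" for x
    by (simp add: shift_def c_lin c_wedge c_bullet cyn)
  have nz: "nat (int k - int j) = k - j" "nat (int k - 1 - int j) = k - j - 1" by simp_all
  show "\<exists>\<epsilon>. H_action ?m r (ck_embedding n s t k j P) = (\<lambda>x. \<epsilon> *\<^sub>R ck_embedding n s t k j (H_action ?m r P) x)"
  proof (cases "s = t")
    case True
    \<comment> \<open>The second summand has one power of \<open>\<sigma>\<close> less and regains
      it from \<open>c ?e\<close>. For \<open>j = k\<close>, where \<open>k - j - 1\<close> is
      truncated, its index is negative and it is \<open>0\<close>.\<close>
    have sg: "(\<sigma> ^ (k - j - 1) * \<sigma>) *\<^sub>R ck_mult n l (int k - 1 - int j) Q x = \<sigma> ^ (k - j) *\<^sub>R ck_mult n l (int k - 1 - int j) Q x" for l Q x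
    proof (cases "j = k")
      case False
      then have "k - j = Suc (k - j - 1)" using jk by simp
      then have "\<sigma> ^ (k - j) = \<sigma> ^ (k - j - 1) * \<sigma>" by (metis power_Suc2)
      then show ?thesis by simp
    qed simp
    have "H_action ?m r (ck_embedding n s t k j P) x = \<sigma> ^ (k - j) *\<^sub>R ck_embedding n s t k j (H_action ?m r P) x" for x
    proof -
      have "ck_mult n (Suc j) (int k - 1 - int j) (\<lambda>x. c (?e * shift n t j P (y x))) x =
          \<sigma> *\<^sub>R ck_mult n (Suc j) (int k - 1 - int j) (\<lambda>x. ?e * shift n t j (\<lambda>x. c (P (y x))) x) x"
        unfolding c_mult ce sh by (simp add: ck_mult_linear(2)[symmetric])
      then show ?thesis
        unfolding ck_embedding_def if_P[OF True] H c_lin ck nz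
        using sg[of "Suc j" "\<lambda>x. ?e * shift n t j (\<lambda>x. c (P (y x))) x" x]
        by (auto simp add: scaleR_add_right H[abs_def] mult.commute mult.left_commute)
    qed
    then show ?thesis by blast
  next
    case False
    have sg: "\<sigma> ^ (k - j - 1) *\<^sub>R ck_mult n l (int k - 1 - int j) Q x = (\<sigma> ^ (k - j) * \<sigma>) *\<^sub>R ck_mult n l (int k - 1 - int j) Q x" for l Q x
    proof (cases "j = k")
      case False
      then have "k - j = Suc (k - j - 1)" using jk by simp
      then have "\<sigma> ^ (k - j) * \<sigma> = \<sigma> ^ (k - j - 1) * (\<sigma> * \<sigma>)" by (metis power_Suc2 mult.assoc)
      then show ?thesis by (simp add: \<sigma>\<sigma>)
    qed simp
    have "H_action ?m r (ck_embedding n s t k j P) x = (\<sigma> ^ (k - j) * \<sigma>) *\<^sub>R ck_embedding n s t k j (H_action ?m r P) x" for x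
    proof -
      have "ck_mult n j (int k - int j) (\<lambda>x. c (?e * P (y x))) x =
          \<sigma> *\<^sub>R ck_mult n j (int k - int j) (\<lambda>x. ?e * c (P (y x))) x"
        unfolding c_mult ce by (simp add: ck_mult_linear(2)[symmetric])
      then show ?thesis
        unfolding ck_embedding_def if_not_P[OF False] H c_lin ck nz sg
        by (simp add: scaleR_add_right H[abs_def] sh mult.commute mult.left_commute)
    qed
    then show ?thesis by blast
  qed
  note P' = monogenicsD(1)[OF P]
  have Pm: "P \<in> monogenics ?m t j"
  proof -
    have "P \<in> homogeneous_polys ?m j (multivectors ?m t)"
      by (rule homogeneous_polys_extend[OF poly_multivectors_Suc[OF P'] multivectors_real_subspace]) simp
    moreover have "dirac ?m P x = 0" for x
      using monogenicsD(2)[OF P] partial_outside[OF P', of ?m x] by (simp add: dirac_Suc)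
    ultimately show ?thesis by (simp add: monogenics_def)
  qed
  have HP: "H_action ?m r P \<in> monogenics ?m t j" by (rule H_action_monogenic[OF rP Pm])
  \<comment> \<open>It remains to return from \<open>R^m\<close> to \<open>R^n\<close>:
    \<open>H_action\<close> of \<open>P\<close> is independent of the last variable, and its values
    have no component containing \<open>e\<close>.\<close>
  have "partial ?m (H_action ?m r P) x = 0" for x
  proof -
    have "P (y (x(?m := v))) = P (y x)" for v
    proof (rule homogeneous_polys_cong[OF P'])
      fix i assume i: "i \<in> {1..n}"
      have cn: "c (cvec n (y (x(?m := v)))) = c (cvec n (y x))"
        unfolding cyn by (rule cvec_cong) simp
      have "q * c b * r = b" for b
        unfolding c_def using rq(2) by (metis mult.assoc mult.left_neutral mult.right_neutral)
      then have "cvec n (y (x(?m := v))) = (cvec n (y x) :: 'a clifford)" using cn by metis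
      then show "y (x(?m := v)) i = y x i" using i by (rule cvec_eqD)
    qed
    then have "has_partial ?m (H_action ?m r P) x 0"
      unfolding has_partial_def H by simp
    then show ?thesis by (rule partialI)
  qed
  from bullet_gen_Suc_monogenic(4)[OF HP this]
  have "(\<lambda>x. - bullet ?e (wedge ?e (H_action ?m r P x))) \<in> monogenics n t j" .
  moreover have "- bullet ?e (wedge ?e (H_action ?m r P x)) = H_action ?m r P x" for x
  proof -
    have "bullet ?e (P (y x)) = 0"
      by (rule bullet_gen_outside[OF homogeneous_polys_range[OF P' multivectors_real_subspace]]) simp
    then have "\<sigma> *\<^sub>R bullet ?e (c (P (y x))) = 0"
      using c_bullet[of ?e "P (y x)"] linear_0[OF lin] by (simp add: ce bullet_scaleR_left)
    then have "bullet ?e (H_action ?m r P x) = 0" using \<sigma>(1) by (auto simp: H)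
    then show ?thesis using gen_part_split[of "H_action ?m r P x" ?m] by simp
  qed
  ultimately show "H_action ?m r P \<in> monogenics n t j" by simp
qed

section \<open>Orthogonal projections\<close>

text \<open>The inner product is an arbitrary one whose laws hold on the finite-dimensional subspace
  \<open>V\<close> only, so orthogonal projections are constructed directly from these laws.\<close>

locale hermitian_space = vector_space scl
  for scl :: "'a::real_or_complex \<Rightarrow> 'v::ab_group_add \<Rightarrow> 'v" (infixr \<open>*s\<close> 75) +
  fixes V :: "'v set" and ip :: "'v \<Rightarrow> 'v \<Rightarrow> 'a"
  assumes subspace_V: "subspace V" and ip: "inner_product_on scl V ip"
    and fin_dim: "\<exists>S. finite S \<and> V \<subseteq> span S"
begin

lemmas ip_laws = ip[unfolded inner_product_on_def]

lemma ip_add: "f \<in> V \<Longrightarrow> g \<in> V \<Longrightarrow> h \<in> V \<Longrightarrow> ip f (g + h) = ip f g + ip f h"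
  using ip_laws[THEN conjunct1] by blast

lemma ip_scale: "f \<in> V \<Longrightarrow> g \<in> V \<Longrightarrow> ip f (c *s g) = c * ip f g"
  using ip_laws[THEN conjunct2, THEN conjunct1] by blast

lemma ip_sym: "f \<in> V \<Longrightarrow> g \<in> V \<Longrightarrow> ip g f = sconj (ip f g)"
  using ip_laws[THEN conjunct2, THEN conjunct2, THEN conjunct1] by blast

lemma ip_pos: "f \<in> V \<Longrightarrow> f \<noteq> 0 \<Longrightarrow> \<exists>p>0. ip f f = of_real p"
  using ip_laws[THEN conjunct2, THEN conjunct2, THEN conjunct2] by blast

lemma ip_diff: "f \<in> V \<Longrightarrow> g \<in> V \<Longrightarrow> h \<in> V \<Longrightarrow> ip f (g - h) = ip f g - ip f h"
  using ip_add[of f "g - h" h] subspace_diff[OF subspace_V] by simp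

lemma ip_eq_zero: "f \<in> V \<Longrightarrow> ip f f = 0 \<Longrightarrow> f = 0"
  using ip_pos[of f] by auto

lemma ip_orthogonal_sym: "f \<in> V \<Longrightarrow> g \<in> V \<Longrightarrow> ip f g = 0 \<Longrightarrow> ip g f = 0"
  using ip_sym[of f g] by simp

text \<open>Gram-Schmidt without normalization: the new vector \<open>b\<close> is replaced by its
  part \<open>b - q\<close> orthogonal to the span of \<open>B\<close>. If this is \<open>0\<close>,
  the projection to the span of \<open>B\<close> already serves.\<close>

lemma projection_span:
  assumes "finite B" "B \<subseteq> V" "f \<in> V"
  shows "\<exists>p\<in>span B. \<forall>u\<in>span B. ip (f - p) u = 0"
  using assms
proof (induction B arbitrary: f rule: finite_induct)
  case empty
  have "ip f 0 = 0" using ip_diff[of f f f] empty by simp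
  then show ?case by simp
next
  case (insert b B)
  note closed = subspace_diff[OF subspace_V] subspace_add[OF subspace_V] subspace_scale[OF subspace_V]
  from insert.prems have b: "b \<in> V" and B: "B \<subseteq> V" and f: "f \<in> V" by auto
  have BV: "span B \<subseteq> V" using span_minimal[OF B subspace_V] .
  obtain p where p: "p \<in> span B" "\<forall>u\<in>span B. ip (f - p) u = 0" using insert.IH[OF B f] by blast
  obtain q where q: "q \<in> span B" "\<forall>u\<in>span B. ip (b - q) u = 0" using insert.IH[OF B b] by blast
  have V: "p \<in> V" "q \<in> V" "f - p \<in> V" "b - q \<in> V" using p(1) q(1) BV f b closed(1) by blast+
  have spl: "\<exists>w\<in>span B. \<exists>l. u = w + l *s (b - q)" if "u \<in> span (insert b B)" for u
  proof -
    obtain l where "u - l *s b \<in> span B" using \<open>u \<in> span (insert b B)\<close> by (auto simp: span_breakdown_eq)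
    then have "u - l *s b + l *s q \<in> span B" using q(1) by (intro span_add span_scale)
    moreover have "u = (u - l *s b + l *s q) + l *s (b - q)" by (simp add: scale_right_diff_distrib)
    ultimately show ?thesis by blast
  qed
  have mono: "span B \<subseteq> span (insert b B)" by (rule span_mono) auto
  show ?case
  proof (cases "b - q = 0")
    case True
    have "ip (f - p) u = 0" if u: "u \<in> span (insert b B)" for u
      using spl[OF u] True p(2) by auto
    then show ?thesis using p(1) mono by blast
  next
    case False
    let ?b = "b - q"
    define l where "l = ip ?b (f - p) / ip ?b ?b"
    have ne: "ip ?b ?b \<noteq> 0" using ip_eq_zero V(4) False by blast
    have lb: "l *s ?b \<in> V" using V(4) closed(3) by blast
    have z: "f - p - l *s ?b \<in> V" using V(3) lb closed(1) by blast
    have "p \<in> span (insert b B)" "q \<in> span (insert b B)" using p(1) q(1) mono by blast+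
    then have "p + l *s ?b \<in> span (insert b B)"
      by (intro span_add span_scale span_diff) (auto intro: span_base)
    moreover have "ip (f - (p + l *s ?b)) u = 0" if u: "u \<in> span (insert b B)" for u
    proof -
      obtain w k where w: "w \<in> span B" "u = w + k *s ?b" using spl[OF u] by blast
      have wV: "w \<in> V" using w(1) BV by blast
      have "ip w (f - p) = 0" "ip w ?b = 0"
        using ip_orthogonal_sym V wV p(2) q(2) w(1) by blast+
      then have "ip w (f - p - l *s ?b) = 0"
        using V lb wV by (simp add: ip_diff ip_scale)
      then have 1: "ip (f - p - l *s ?b) w = 0" by (rule ip_orthogonal_sym[OF wV z])
      have "ip ?b (f - p - l *s ?b) = 0"
        unfolding ip_diff[OF V(4) V(3) lb] ip_scale[OF V(4) V(4)] using ne by (simp add: l_def)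
      then have 2: "ip (f - p - l *s ?b) ?b = 0" by (rule ip_orthogonal_sym[OF V(4) z])
      have "ip (f - p - l *s ?b) u = 0"
        unfolding w(2) using 1 2 z wV V(4) closed(3) by (simp add: ip_add ip_scale)
      then show ?thesis by (simp add: algebra_simps)
    qed
    ultimately show ?thesis by blast
  qed
qed

definition proj :: "'v set \<Rightarrow> 'v \<Rightarrow> 'v"
  where "proj U f = (THE p. p \<in> U \<and> (\<forall>u\<in>U. ip (f - p) u = 0))"

lemma proj_eqI:
  assumes U: "subspace U" "U \<subseteq> V" and f: "f \<in> V" and p: "p \<in> U" "\<And>u. u \<in> U \<Longrightarrow> ip (f - p) u = 0"
  shows "proj U f = p"
  unfolding proj_def
proof (rule the_equality)
  show "p \<in> U \<and> (\<forall>u\<in>U. ip (f - p) u = 0)" using p by blast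
  fix q assume q: "q \<in> U \<and> (\<forall>u\<in>U. ip (f - q) u = 0)"
  note closed = subspace_diff[OF subspace_V]
  have V: "p \<in> V" "q \<in> V" "f - p \<in> V" "f - q \<in> V" and d: "q - p \<in> U" "q - p \<in> V"
    using p(1) q U f closed subspace_diff[OF U(1)] by blast+
  have "ip (q - p) (f - p) = 0" "ip (q - p) (f - q) = 0"
    using ip_orthogonal_sym V d p(2) q by blast+
  then have "ip (q - p) (q - p) = 0" using ip_diff[OF d(2) V(3,4)] by simp
  then have "q - p = 0" using ip_eq_zero[OF d(2)] by simp
  then show "q = p" by simp
qed

lemma proj:
  assumes U: "subspace U" "U \<subseteq> V" and f: "f \<in> V"
  shows "proj U f \<in> U" and "u \<in> U \<Longrightarrow> ip (f - proj U f) u = 0"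
proof -
  obtain S where S: "finite S" "V \<subseteq> span S" using fin_dim by blast
  obtain B where B: "B \<subseteq> U" "independent B" "U \<subseteq> span B" by (rule maximal_independent_subset)
  have "finite B" using independent_span_bound[OF S(1) B(2)] B(1) U(2) S(2) by blast
  moreover have "span B = U" by (rule span_subspace[OF B(1,3) U(1)])
  ultimately obtain p where p: "p \<in> U" "\<forall>u\<in>U. ip (f - p) u = 0"
    using projection_span[of B f] B(1) U(2) f by auto
  then have "proj U f = p" by (intro proj_eqI[OF U f]) auto
  then show "proj U f \<in> U" "u \<in> U \<Longrightarrow> ip (f - proj U f) u = 0" using p by auto
qed

lemma proj_add:
  assumes U: "subspace U" "U \<subseteq> V" and f: "f \<in> V" and g: "g \<in> V"
  shows "proj U (f + g) = proj U f + proj U g"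
proof (rule proj_eqI[OF U])
  note closed = subspace_diff[OF subspace_V] subspace_add[OF subspace_V]
  note P = proj(1)[OF U f] proj(1)[OF U g]
  show "f + g \<in> V" using f g closed(2) by blast
  show "proj U f + proj U g \<in> U" using P subspace_add[OF U(1)] by blast
  fix u assume u: "u \<in> U"
  have V: "u \<in> V" "f - proj U f \<in> V" "g - proj U g \<in> V" using u U P f g closed(1) by blast+
  have "ip u (f - proj U f) = 0" "ip u (g - proj U g) = 0"
    using ip_orthogonal_sym V proj(2)[OF U f u] proj(2)[OF U g u] by blast+
  then have "ip u ((f - proj U f) + (g - proj U g)) = 0" using V by (simp add: ip_add)
  then have "ip ((f - proj U f) + (g - proj U g)) u = 0" using ip_orthogonal_sym V closed(2) by blast
  then show "ip (f + g - (proj U f + proj U g)) u = 0" by (simp add: algebra_simps)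
qed

lemma proj_scale:
  assumes U: "subspace U" "U \<subseteq> V" and f: "f \<in> V"
  shows "proj U (c *s f) = c *s proj U f"
proof (rule proj_eqI[OF U])
  note closed = subspace_diff[OF subspace_V] subspace_scale[OF subspace_V]
  note P = proj(1)[OF U f]
  show "c *s f \<in> V" using f closed(2) by blast
  show "c *s proj U f \<in> U" using P subspace_scale[OF U(1)] by blast
  fix u assume u: "u \<in> U"
  have V: "u \<in> V" "f - proj U f \<in> V" using u U P f closed(1) by blast+
  have "ip u (f - proj U f) = 0" using ip_orthogonal_sym V proj(2)[OF U f u] by blast
  then have "ip u (c *s (f - proj U f)) = 0" using V by (simp add: ip_scale)
  then have "ip (c *s (f - proj U f)) u = 0" using ip_orthogonal_sym V closed(2) by blast
  then show "ip (c *s f - c *s proj U f) u = 0" by (simp add: scale_right_diff_distrib)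
qed

text \<open>An isometric involution is self-adjoint, so the orthogonality of
  \<open>f - proj U f\<close> to \<open>U\<close> is carried over to
  \<open>R f - R (proj U f)\<close>. This applies to a reflection in the
  \<open>H\<close>-action.\<close>

lemma proj_involution:
  assumes U: "subspace U" "U \<subseteq> V" and f: "f \<in> V"
    and R: "\<And>f g. f \<in> V \<Longrightarrow> g \<in> V \<Longrightarrow> ip (R f) (R g) = ip f g" "\<And>f. f \<in> V \<Longrightarrow> R (R f) = f"
      "\<And>f g. R (f - g) = R f - R g" "\<And>f. f \<in> V \<Longrightarrow> R f \<in> V" "\<And>f. f \<in> U \<Longrightarrow> R f \<in> U"
  shows "proj U (R f) = R (proj U f)"
proof (rule proj_eqI[OF U])
  note P = proj(1)[OF U f]
  show "R f \<in> V" "R (proj U f) \<in> U" using R f P by blast+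
  fix u assume u: "u \<in> U"
  have u': "u \<in> V" "proj U f \<in> V" using u U(2) P by blast+
  have V: "R u \<in> V" "f - proj U f \<in> V" by (rule R(4)[OF u'(1)], rule subspace_diff[OF subspace_V f u'(2)])
  have "ip (R (f - proj U f)) (R (R u)) = ip (f - proj U f) (R u)" by (rule R(1)[OF V(2,1)])
  also have "\<dots> = 0" by (rule proj(2)[OF U f R(5)[OF u]])
  finally show "ip (R f - R (proj U f)) u = 0" using R(2)[OF u'(1)] R(3) by simp
qed

end

section \<open>The spaces of monogenics as finite-dimensional vector spaces\<close>

lemma sum_fun_apply: "(\<Sum>i\<in>S. f i) x = (\<Sum>i\<in>S. f i x)"
  for f :: "'i \<Rightarrow> 'b \<Rightarrow> 'c::comm_monoid_add"
  by (induction S rule: infinite_finite_induct) simp_all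

lemma multivector_expand:
  fixes v :: "'a::field clifford"
  assumes "v \<in> multivectors m s"
  shows "v = (\<Sum>A\<in>Pow {1..m}. coeff v A *\<^sub>C blade A)"
proof (rule clifford_eqI)
  fix B
  have "coeff (\<Sum>A\<in>Pow {1..m}. coeff v A *\<^sub>C blade A) B = (\<Sum>A\<in>Pow {1..m}. if A = B then coeff v A else 0)"
    unfolding coeff_sum
  proof (intro sum.cong refl)
    fix A assume "A \<in> Pow {1..m}"
    then have "finite A" by (auto intro: finite_subset)
    then show "coeff (coeff v A *\<^sub>C blade A) B = (if A = B then coeff v A else 0)" by (simp add: coeff_blade)
  qed
  also have "\<dots> = coeff v B" using assms by (auto simp: multivectors_iff)
  finally show "coeff v B = coeff (\<Sum>A\<in>Pow {1..m}. coeff v A *\<^sub>C blade A) B" ..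
qed

lemma subspace_monogenics: "fun_space.subspace (monogenics n t j :: ((nat \<Rightarrow> real) \<Rightarrow> 'a::real_normed_field clifford) set)"
  by (intro fun_space.subspaceI)
    (simp_all add: fscale_lambda zero_fun_def plus_fun_def monogenics_zero monogenics_add monogenics_cscale)

lemma monogenics_finite_dim:
  "\<exists>S. finite S \<and> monogenics m s k \<subseteq> fun_space.span (S :: ((nat \<Rightarrow> real) \<Rightarrow> 'a::real_normed_field clifford) set)"
proof -
  define g where "g a A x = (\<Prod>i=1..m. x i ^ a i) *\<^sub>R (blade A :: 'a clifford)" for a :: "nat \<Rightarrow> nat" and A and x :: "nat \<Rightarrow> real"
  let ?S = "(\<lambda>(a, A). g a A) ` (multi_indices m k \<times> Pow {1..m})"
  have "f \<in> fun_space.span ?S" if f_in: "f \<in> monogenics m s k" for f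
  proof -
    obtain c where f: "f = (\<lambda>x. \<Sum>a\<in>multi_indices m k. (\<Prod>i=1..m. x i ^ a i) *\<^sub>R c a)"
      and c: "\<And>a. c a \<in> multivectors m s"
      using monogenicsD(1)[OF f_in] unfolding homogeneous_polys_def by blast
    have "f = (\<Sum>a\<in>multi_indices m k. \<Sum>A\<in>Pow {1..m}. fscale (coeff (c a) A) (g a A))"
    proof
      fix x
      show "f x = (\<Sum>a\<in>multi_indices m k. \<Sum>A\<in>Pow {1..m}. fscale (coeff (c a) A) (g a A)) x"
        unfolding f sum_fun_apply fscale_def g_def
        by (intro sum.cong refl, subst multivector_expand[OF c])
          (simp add: scaleR_sum_right cscale_scaleR)
    qed
    moreover have "fscale (coeff (c a) A) (g a A) \<in> fun_space.span ?S" if "a \<in> multi_indices m k" "A \<in> Pow {1..m}" for a A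
      using that by (intro fun_space.span_scale fun_space.span_base) (auto intro: image_eqI[of _ _ "(a, A)"])
    ultimately show ?thesis by (metis (no_types, lifting) fun_space.span_sum)
  qed
  moreover have "finite ?S" by (intro finite_imageI finite_cartesian_product finite_multi_indices) simp
  ultimately show ?thesis by blast
qed

section \<open>Irreducibility and orthogonality\<close>

definition ck_component :: "nat \<Rightarrow> nat \<Rightarrow> nat \<Rightarrow> nat \<times> nat \<Rightarrow> ((nat \<Rightarrow> real) \<Rightarrow> 'a::real_normed_field clifford) set"
  where "ck_component n s k = (\<lambda>(t, j). ck_embedding n s t k j ` monogenics n t j)"

lemma ck_embedding_add: "ck_embedding n s t k j (P + Q) = ck_embedding n s t k j P + ck_embedding n s t k j Q"
  and ck_embedding_fscale: "ck_embedding n s t k j (fscale c P) = fscale c (ck_embedding n s t k j P)"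
  by (simp_all add: plus_fun_def fscale_lambda ck_embedding_linear[abs_def] fun_eq_iff)

lemma ck_embedding_eqD:
  assumes "P \<in> monogenics n t j" "Q \<in> monogenics n t j" "(t, j) \<in> index_pairs (Suc n) s k"
    and "ck_embedding n s t k j P = ck_embedding n s t k j Q"
  shows "P = Q"
proof
  fix x
  have "ck_embedding n s t k j (\<lambda>x. P x + (- 1) *\<^sub>R Q x) y = 0" for y
    using assms(4) by (simp only: ck_embedding_linear) simp
  from ck_embedding_injective[OF _ assms(3) this, of x] monogenics_diff[OF assms(1,2)]
  show "P x = Q x" by simp
qed

lemma H_action_add: "H_action m r (f + g) = H_action m r f + H_action m r g"
  and H_action_diff: "H_action m r (f - g) = H_action m r f - H_action m r g"
  and H_action_fscale: "H_action m r (fscale c f) = fscale c (H_action m r f)"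
  by (simp_all add: H_action_def fscale_def fun_eq_iff distrib_left distrib_right left_diff_distrib
      right_diff_distrib cscale_mult_left cscale_mult_right)

lemma H_action_scaleR: "H_action m r (\<lambda>x. c *\<^sub>R f x) = (\<lambda>x. c *\<^sub>R H_action m r f x)"
  by (simp add: H_action_def fun_eq_iff)

lemma H_action_involution:
  assumes a: "unit_vec m a" and f: "f \<in> monogenics m s k"
  shows "H_action m (cvec m a) (H_action m (cvec m a) f) = f"
proof -
  have fr: "fun_reflect m a f \<in> monogenics m s k" by (rule fun_reflect_monogenic[OF a order_refl f])
  show ?thesis
    unfolding H_action_unit_vec[OF a monogenicsD(1)[OF f]] H_action_scaleR H_action_unit_vec[OF a monogenicsD(1)[OF fr]]
    by (simp add: fun_reflect_fun_reflect[OF a] flip: power_add)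
qed

lemma hermitian_space_monogenics:
  "inner_product_on fscale (monogenics m s k) ip \<Longrightarrow>
    hermitian_space fscale (monogenics m s k :: ((nat \<Rightarrow> real) \<Rightarrow> 'a::real_or_complex clifford) set) ip"
  by unfold_locales (rule subspace_monogenics, assumption, rule monogenics_finite_dim)

text \<open>In degree \<open>0\<close> a constant blade is enough. In positive degree
  \<open>0 < t < n\<close> holds, and the embedding of a nonzero constant \<open>t\<close>-vector
  from one dimension below is nonzero by injectivity.\<close>

lemma monogenics_nonzero:
  assumes n: "1 \<le> n" and nt: "nontrivial n t j"
  shows "monogenics n t j \<noteq> {0 :: (nat \<Rightarrow> real) \<Rightarrow> 'a::real_normed_field clifford}"
proof -
  have const: "\<exists>f \<in> monogenics l t 0. f \<noteq> (0 :: (nat \<Rightarrow> real) \<Rightarrow> 'a clifford)" if "t \<le> l" for l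
  proof (rule bexI)
    show "(\<lambda>_. blade {1..t}) \<in> monogenics l t 0"
      using that by (intro monogenics_const) (auto simp: multivectors_iff coeff_blade split: if_splits)
    have "coeff (blade {1..t} :: 'a clifford) {1..t} = 1" by (simp add: coeff_blade)
    then show "(\<lambda>_. blade {1..t}) \<noteq> (0 :: (nat \<Rightarrow> real) \<Rightarrow> 'a clifford)" by (auto simp: fun_eq_iff)
  qed
  have "\<exists>f \<in> monogenics n t j. f \<noteq> (0 :: (nat \<Rightarrow> real) \<Rightarrow> 'a clifford)"
  proof (cases "j = 0")
    case True
    then show ?thesis using const[of n] nt by (simp add: nontrivial_def)
  next
    case False
    then have t: "0 < t" "t < n" using nt by (auto simp: nontrivial_def intro: le_neq_implies_less)
    then obtain l where l: "n = Suc l" "t \<le> l" "1 \<le> l" by (cases n) auto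
    have I: "(t, 0) \<in> index_pairs (Suc l) t j" using l by (simp add: index_pairs_iff nontrivial_def)
    obtain P :: "(nat \<Rightarrow> real) \<Rightarrow> 'a clifford" where P: "P \<in> monogenics l t 0" "P \<noteq> 0" using const[OF l(2)] by blast
    have "ck_embedding l t t j 0 P \<in> monogenics n t j"
      using ck_embedding_monogenic[OF P(1) I _ l(3)] nt l(1) by simp
    moreover have "ck_embedding l t t j 0 P \<noteq> 0"
    proof
      assume "ck_embedding l t t j 0 P = 0"
      then have "P x = 0" for x using ck_embedding_injective[OF P(1) I] by simp
      then show False using P(2) by (simp add: fun_eq_iff)
    qed
    ultimately show ?thesis by blast
  qed
  then show ?thesis by blast
qed

context
  fixes n s k :: nat
  assumes n: "1 \<le> n" and nt: "nontrivial (Suc n) s k"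
begin

lemma ck_component_monogenics:
  "p \<in> index_pairs (Suc n) s k \<Longrightarrow> ck_component n s k p \<subseteq> (monogenics (Suc n) s k :: ((nat \<Rightarrow> real) \<Rightarrow> 'a::real_normed_field clifford) set)"
  by (cases p) (auto simp: ck_component_def intro: ck_embedding_monogenic[OF _ _ nt n])

lemma subspace_ck_component:
  "fun_space.subspace (ck_component n s k p :: ((nat \<Rightarrow> real) \<Rightarrow> 'a::real_normed_field clifford) set)"
proof (cases p)
  case (Pair t j)
  let ?M = "monogenics n t j :: ((nat \<Rightarrow> real) \<Rightarrow> 'a clifford) set"
  note M = subspace_monogenics[of n t j, where 'a='a]
  show ?thesis
    unfolding Pair ck_component_def prod.case
  proof (intro fun_space.subspaceI)
    have "ck_embedding n s t k j (\<lambda>_. 0) = (0 :: _ \<Rightarrow> 'a clifford)" by (simp add: fun_eq_iff ck_embedding_zero)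
    then show "0 \<in> ck_embedding n s t k j ` ?M" using monogenics_zero by (metis image_eqI)
  next
    fix f g assume "f \<in> ck_embedding n s t k j ` ?M" "g \<in> ck_embedding n s t k j ` ?M"
    then show "f + g \<in> ck_embedding n s t k j ` ?M"
      using fun_space.subspace_add[OF M] by (auto simp flip: ck_embedding_add)
  next
    fix c f assume "f \<in> ck_embedding n s t k j ` ?M"
    then show "fscale c f \<in> ck_embedding n s t k j ` ?M"
      using fun_space.subspace_scale[OF M] by (auto simp flip: ck_embedding_fscale)
  qed
qed

lemma H_action_ck_component:
  assumes p: "p \<in> index_pairs (Suc n) s k" and r: "r \<in> Pin_fix (Suc n)" and f: "f \<in> ck_component n s k p"
  shows "H_action (Suc n) r f \<in> ck_component n s k p"
proof (cases p)
  case (Pair t j)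
  obtain P where P: "P \<in> monogenics n t j" "f = ck_embedding n s t k j P"
    using f unfolding Pair ck_component_def by auto
  have "j \<le> k" "s = t \<or> s = Suc t" using p by (auto simp: Pair index_pairs_iff)
  note H = H_action_ck_embedding[OF r P(1) this]
  obtain \<epsilon> where "H_action (Suc n) r f = (\<lambda>x. \<epsilon> *\<^sub>R ck_embedding n s t k j (H_action (Suc n) r P) x)"
    using H(2) unfolding P(2) by blast
  also have "\<dots> = ck_embedding n s t k j (\<lambda>x. \<epsilon> *\<^sub>R H_action (Suc n) r P x)"
    by (simp add: fun_eq_iff ck_embedding_linear)
  finally show ?thesis unfolding Pair ck_component_def using monogenics_scaleR[OF H(1)] by auto
qed

lemma ck_component_nonzero:
  assumes "p \<in> index_pairs (Suc n) s k"
  shows "ck_component n s k p \<noteq> {0 :: (nat \<Rightarrow> real) \<Rightarrow> 'a::real_normed_field clifford}"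
proof (cases p)
  case (Pair t j)
  note I = assms[unfolded Pair]
  have "monogenics n t j \<noteq> {0 :: (nat \<Rightarrow> real) \<Rightarrow> 'a clifford}"
    using I by (intro monogenics_nonzero[OF n]) (simp add: index_pairs_iff)
  moreover have "0 \<in> (monogenics n t j :: ((nat \<Rightarrow> real) \<Rightarrow> 'a clifford) set)"
    using subspace_monogenics by (rule fun_space.subspace_0)
  ultimately obtain P :: "(nat \<Rightarrow> real) \<Rightarrow> 'a clifford" where P: "P \<in> monogenics n t j" "P \<noteq> 0" by blast
  have "ck_embedding n s t k j P \<noteq> 0"
  proof
    assume "ck_embedding n s t k j P = 0"
    then have "P x = 0" for x using ck_embedding_injective[OF P(1) I] by simp
    then show False using P(2) by (simp add: fun_eq_iff)
  qed
  then show ?thesis unfolding Pair ck_component_def using P(1) by auto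
qed

lemma ck_component_direct_sum:
  "internal_direct_sum (monogenics (Suc n) s k :: ((nat \<Rightarrow> real) \<Rightarrow> 'a::real_normed_field clifford) set)
    (index_pairs (Suc n) s k) (ck_component n s k)"
  unfolding internal_direct_sum_def bij_betw_def
proof (intro conjI inj_onI subset_antisym subsetI)
  let ?I = "index_pairs (Suc n) s k" and ?V = "monogenics (Suc n) s k :: ((nat \<Rightarrow> real) \<Rightarrow> 'a clifford) set"
  let ?W = "ck_component n s k :: _ \<Rightarrow> ((nat \<Rightarrow> real) \<Rightarrow> 'a clifford) set"
  fix v w assume v: "v \<in> Pi\<^sub>E ?I ?W" and w: "w \<in> Pi\<^sub>E ?I ?W" and eq: "(\<Sum>i\<in>?I. v i) = (\<Sum>i\<in>?I. w i)"
  have "\<exists>P. P \<in> monogenics n (fst p) (snd p) \<and> v p - w p = ck_embedding n s (fst p) k (snd p) P" if "p \<in> ?I" for p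
  proof -
    have "v p - w p \<in> ?W p"
      using fun_space.subspace_diff[OF subspace_ck_component] PiE_mem[OF v that] PiE_mem[OF w that] by blast
    then show ?thesis by (cases p) (auto simp: ck_component_def)
  qed
  then obtain P where P: "\<And>p. p \<in> ?I \<Longrightarrow> P p \<in> monogenics n (fst p) (snd p)"
    "\<And>p. p \<in> ?I \<Longrightarrow> v p - w p = ck_embedding n s (fst p) k (snd p) (P p)" by metis
  have "(\<Sum>(t, j)\<in>?I. ck_embedding n s t k j (P (t, j)) x) = (\<Sum>p\<in>?I. (v p - w p) x)" for x
    by (intro sum.cong refl) (auto simp: P(2))
  also have "(\<Sum>p\<in>?I. (v p - w p) x) = 0" for x
    using fun_cong[OF eq, of x] by (simp add: sum_fun_apply sum_subtractf)
  finally have "P p x = 0" if "p \<in> ?I" for p x using ck_decomposition_unique[of n s k P p x] P(1) that by auto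
  then have "v p - w p = 0" if "p \<in> ?I" for p
    using that by (simp add: P(2) fun_eq_iff ck_embedding_zero flip: zero_fun_def) (metis ck_embedding_zero ext)
  then show "v = w" using PiE_ext[OF v w] by simp
next
  let ?I = "index_pairs (Suc n) s k" and ?V = "monogenics (Suc n) s k :: ((nat \<Rightarrow> real) \<Rightarrow> 'a clifford) set"
  let ?W = "ck_component n s k :: _ \<Rightarrow> ((nat \<Rightarrow> real) \<Rightarrow> 'a clifford) set"
  {
    fix f assume "f \<in> (\<lambda>w. \<Sum>i\<in>?I. w i) ` Pi\<^sub>E ?I ?W"
    then obtain w where w: "w \<in> Pi\<^sub>E ?I ?W" "f = (\<Sum>i\<in>?I. w i)" by blast
    then have "w i \<in> ?V" if "i \<in> ?I" for i using ck_component_monogenics[OF that] that by (blast dest!: PiE_mem)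
    then show "f \<in> ?V" unfolding w(2) by (intro fun_space.subspace_sum[OF subspace_monogenics])
  next
    fix f assume "f \<in> ?V"
    from ck_decomposition_exists[OF this n nt] obtain P where P: "\<And>t j. P (t, j) \<in> monogenics n t j"
      "\<And>x. f x = (\<Sum>(t, j)\<in>?I. ck_embedding n s t k j (P (t, j)) x)" by blast
    define w where "w = restrict (\<lambda>p. ck_embedding n s (fst p) k (snd p) (P p)) ?I"
    have "w \<in> Pi\<^sub>E ?I ?W" using P(1) by (auto simp: w_def ck_component_def)
    moreover have "f = (\<Sum>i\<in>?I. w i)"
    proof
      fix x show "f x = (\<Sum>i\<in>?I. w i) x"
        unfolding P(2) sum_fun_apply by (intro sum.cong refl) (auto simp: w_def)
    qed
    ultimately show "f \<in> (\<lambda>w. \<Sum>i\<in>?I. w i) ` Pi\<^sub>E ?I ?W" by blast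
  }
qed

text \<open>Conjugating with the embeddings turns \<open>T\<close> into an equivariant map between spaces of monogenics.\<close>

lemma ck_component_schur:
  fixes T :: "((nat \<Rightarrow> real) \<Rightarrow> 'a::real_normed_field clifford) \<Rightarrow> (nat \<Rightarrow> real) \<Rightarrow> 'a clifford"
  assumes p: "p \<in> index_pairs (Suc n) s k" and p': "p' \<in> index_pairs (Suc n) s k"
    and T: "\<And>f. f \<in> ck_component n s k p \<Longrightarrow> T f \<in> ck_component n s k p'"
    and add: "\<And>f g. f \<in> ck_component n s k p \<Longrightarrow> g \<in> ck_component n s k p \<Longrightarrow> T (f + g) = T f + T g"
    and scale: "\<And>c f. f \<in> ck_component n s k p \<Longrightarrow> T (fscale c f) = fscale c (T f)"
    and comm: "\<And>a f. unit_vec n a \<Longrightarrow> f \<in> ck_component n s k p \<Longrightarrow>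
      T (H_action (Suc n) (cvec (Suc n) a) f) = H_action (Suc n) (cvec (Suc n) a) (T f)"
  shows "\<exists>c. \<forall>f\<in>ck_component n s k p. T f = fscale (if p = p' then c else 0) f"
proof -
  obtain t j t' j' where pp: "p = (t, j)" "p' = (t', j')" by (cases p, cases p') auto
  let ?E = "ck_embedding n s t k j" and ?E' = "ck_embedding n s t' k j'"
  let ?M = "monogenics n t j :: ((nat \<Rightarrow> real) \<Rightarrow> 'a clifford) set"
  let ?M' = "monogenics n t' j' :: ((nat \<Rightarrow> real) \<Rightarrow> 'a clifford) set"
  let ?W = "ck_component n s k p :: ((nat \<Rightarrow> real) \<Rightarrow> 'a clifford) set"
  have WE: "?W = ?E ` ?M" "ck_component n s k p' = ?E' ` ?M'" by (simp_all add: ck_component_def pp)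
  have "\<exists>Q\<in>?M'. T (?E P) = ?E' Q" if "P \<in> ?M" for P using T[of "?E P"] that unfolding WE by blast
  then obtain S where S: "\<And>P. P \<in> ?M \<Longrightarrow> S P \<in> ?M'" "\<And>P. P \<in> ?M \<Longrightarrow> T (?E P) = ?E' (S P)" by metis
  note inj = ck_embedding_eqD[OF _ _ p'[unfolded pp]]
  have refl: "T (fun_reflect n a f) = fun_reflect n a (T f)" if a: "unit_vec n a" and f: "f \<in> ?W" for a f
  proof -
    note a' = unit_vec_mono[OF a, of "Suc n", simplified]
    have H: "H_action (Suc n) (cvec (Suc n) a) g = fscale ((- 1) ^ (k + s)) (fun_reflect n a g)"
      if "g \<in> monogenics (Suc n) s k" for g :: "(nat \<Rightarrow> real) \<Rightarrow> 'a clifford"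
      unfolding H_action_unit_vec[OF a' monogenicsD(1)[OF that]] fun_reflect_mono[OF a, of "Suc n", simplified]
      by (cases "even (k + s)") (simp_all add: fscale_def)
    have fr: "fun_reflect n a f \<in> ?W"
      using f fun_reflect_monogenic[OF a order_refl] unfolding WE(1) by (fastforce simp: fun_reflect_ck_embedding[OF a])
    have V: "f \<in> monogenics (Suc n) s k" "T f \<in> monogenics (Suc n) s k"
      using f T[OF f] ck_component_monogenics p p' by blast+
    \<comment> \<open>Source and target lie in the same space of degree \<open>k\<close> and
      \<open>s\<close>, so the sign between the \<open>H\<close>-action and the natural reflection
      is the same on both sides and cancels.\<close>
    have "fscale ((- 1) ^ (k + s)) (T (fun_reflect n a f)) = fscale ((- 1) ^ (k + s)) (fun_reflect n a (T f))"
      using comm[OF a f] unfolding H[OF V(1)] H[OF V(2)] scale[OF fr] .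
    then show ?thesis by (simp add: fun_space.scale_left_imp_eq)
  qed
  have eq: "equivariant_map n t j t' j' S"
    unfolding equivariant_map_def
  proof (intro conjI ballI allI impI)
    fix f assume f: "f \<in> ?M"
    show "S f \<in> ?M'" using S(1)[OF f] .
    fix c
    have cf: "(\<lambda>x. c *\<^sub>C f x) \<in> ?M" by (rule monogenics_cscale[OF f])
    show "S (\<lambda>x. c *\<^sub>C f x) = (\<lambda>x. c *\<^sub>C S f x)"
    proof (rule inj[OF S(1)[OF cf] monogenics_cscale[OF S(1)[OF f]]])
      have "?E' (S (\<lambda>x. c *\<^sub>C f x)) = T (fscale c (?E f))"
        unfolding S(2)[OF cf, symmetric] ck_embedding_fscale[symmetric] by (simp add: fscale_lambda)
      also have "\<dots> = fscale c (?E' (S f))" using scale[of "?E f" c] f S(2)[OF f] WE(1) by simp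
      also have "\<dots> = ?E' (\<lambda>x. c *\<^sub>C S f x)" unfolding ck_embedding_fscale[symmetric] by (simp add: fscale_lambda)
      finally show "?E' (S (\<lambda>x. c *\<^sub>C f x)) = ?E' (\<lambda>x. c *\<^sub>C S f x)" .
    qed
  next
    fix f g assume f: "f \<in> ?M" and g: "g \<in> ?M"
    have fg: "(\<lambda>x. f x + g x) \<in> ?M" by (rule monogenics_add[OF f g])
    show "S (\<lambda>x. f x + g x) = (\<lambda>x. S f x + S g x)"
    proof (rule inj[OF S(1)[OF fg] monogenics_add[OF S(1)[OF f] S(1)[OF g]]])
      have "?E' (S (\<lambda>x. f x + g x)) = T (?E f + ?E g)"
        unfolding S(2)[OF fg, symmetric] ck_embedding_add[symmetric] by (simp add: plus_fun_def)
      also have "\<dots> = ?E' (S f) + ?E' (S g)" using add[of "?E f" "?E g"] f g S(2) WE(1) by simp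
      also have "\<dots> = ?E' (\<lambda>x. S f x + S g x)" unfolding ck_embedding_add[symmetric] by (simp add: plus_fun_def)
      finally show "?E' (S (\<lambda>x. f x + g x)) = ?E' (\<lambda>x. S f x + S g x)" .
    qed
  next
    fix a f assume a: "unit_vec n a" and f: "f \<in> ?M"
    have rf: "fun_reflect n a f \<in> ?M" by (rule fun_reflect_monogenic[OF a order_refl f])
    show "S (fun_reflect n a f) = fun_reflect n a (S f)"
    proof (rule inj[OF S(1)[OF rf] fun_reflect_monogenic[OF a order_refl S(1)[OF f]]])
      have "?E' (S (fun_reflect n a f)) = T (fun_reflect n a (?E f))"
        unfolding S(2)[OF rf, symmetric] fun_reflect_ck_embedding[OF a] ..
      also have "\<dots> = ?E' (fun_reflect n a (S f))"
        using refl[OF a, of "?E f"] f S(2)[OF f] WE(1) by (simp add: fun_reflect_ck_embedding[OF a])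
      finally show "?E' (S (fun_reflect n a f)) = ?E' (fun_reflect n a (S f))" .
    qed
  qed
  obtain c where c: "\<And>f x. f \<in> ?M \<Longrightarrow> S f x = (if (t, j) = (t', j') then c else 0) *\<^sub>C f x"
    by (rule schurD[OF schur[OF n] eq]) blast
  have "T f = fscale (if p = p' then c else 0) f" if f_in: "f \<in> ?W" for f
  proof -
    obtain P where P: "P \<in> ?M" "f = ?E P" using f_in unfolding WE by blast
    have "S P = fscale (if p = p' then c else 0) P" using c[OF P(1)] by (simp add: fscale_def pp fun_eq_iff)
    then have "T f = fscale (if p = p' then c else 0) (?E' P)"
      using S(2)[OF P(1)] unfolding P(2) by (simp only: ck_embedding_fscale)
    also have "\<dots> = fscale (if p = p' then c else 0) (?E P)" by (auto simp: pp)
    finally show ?thesis unfolding P(2) .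
  qed
  then show ?thesis by blast
qed

text \<open>By Schur's lemma the orthogonal projection to an invariant subspace of a component is a scalar
  on every component. This gives irreducibility and orthogonality at once.\<close>

lemma projection_scalar:
  fixes ip :: "((nat \<Rightarrow> real) \<Rightarrow> 'a::real_or_complex clifford) \<Rightarrow> ((nat \<Rightarrow> real) \<Rightarrow> 'a clifford) \<Rightarrow> 'a"
  assumes inv: "invariant_inner_product fscale (Pin_fix (Suc n)) (H_action (Suc n)) (monogenics (Suc n) s k) ip"
    and p: "p \<in> index_pairs (Suc n) s k" and p': "p' \<in> index_pairs (Suc n) s k"
    and U: "invariant_subspace fscale (Pin_fix (Suc n)) (H_action (Suc n)) U" "U \<subseteq> ck_component n s k p'"
  shows "\<exists>c. \<forall>f\<in>ck_component n s k p.
    fscale (if p = p' then c else 0) f \<in> U \<and> (\<forall>u\<in>U. ip (f - fscale (if p = p' then c else 0) f) u = 0)"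
proof -
  let ?V = "monogenics (Suc n) s k :: ((nat \<Rightarrow> real) \<Rightarrow> 'a clifford) set"
  let ?H = "H_action (Suc n) :: 'a clifford \<Rightarrow> _"
  interpret hermitian_space fscale ?V ip
    using inv by (intro hermitian_space_monogenics) (simp add: invariant_inner_product_def)
  note W = ck_component_monogenics
  have sU: "fun_space.subspace U" "U \<subseteq> ?V" and HU: "\<And>r u. r \<in> Pin_fix (Suc n) \<Longrightarrow> u \<in> U \<Longrightarrow> ?H r u \<in> U"
    using U W[OF p'] unfolding invariant_subspace_def by blast+
  have V: "f \<in> ?V" if "f \<in> ck_component n s k p" for f using W[OF p] that by blast
  have "\<exists>c. \<forall>f\<in>ck_component n s k p. proj U f = fscale (if p = p' then c else 0) f"
  proof (rule ck_component_schur[OF p p'])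
    fix f g :: "(nat \<Rightarrow> real) \<Rightarrow> 'a clifford" assume f: "f \<in> ck_component n s k p"
    show "proj U f \<in> ck_component n s k p'" using proj(1)[OF sU V[OF f]] U(2) by blast
    show "proj U (fscale c f) = fscale c (proj U f)" for c by (rule proj_scale[OF sU V[OF f]])
    show "proj U (f + g) = proj U f + proj U g" if "g \<in> ck_component n s k p"
      by (rule proj_add[OF sU V[OF f] V[OF that]])
    fix a assume a: "unit_vec n a"
    have a': "unit_vec (Suc n) a" using unit_vec_mono[OF a] by simp
    note r = unit_vec_Pin_fix[OF a, where 'a='a]
    show "proj U (?H (cvec (Suc n) a) f) = ?H (cvec (Suc n) a) (proj U f)"
    proof (rule proj_involution[OF sU V[OF f]])
      show "ip (?H (cvec (Suc n) a) f) (?H (cvec (Suc n) a) g) = ip f g" if "f \<in> ?V" "g \<in> ?V" for f g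
        using inv r that unfolding invariant_inner_product_def by blast
      show "?H (cvec (Suc n) a) f \<in> ?V" if "f \<in> ?V" for f
        by (rule H_action_monogenic[OF unit_vec_Pin[OF a'] that])
    qed (rule H_action_involution[OF a'] H_action_diff HU[OF r]; assumption?)+
  qed
  then obtain c where c: "\<And>f. f \<in> ck_component n s k p \<Longrightarrow> proj U f = fscale (if p = p' then c else 0) f" by blast
  show ?thesis
  proof (intro exI[of _ c] ballI conjI)
    fix f :: "(nat \<Rightarrow> real) \<Rightarrow> 'a clifford" assume f: "f \<in> ck_component n s k p"
    show "fscale (if p = p' then c else 0) f \<in> U" using proj(1)[OF sU V[OF f]] unfolding c[OF f] .
    fix u assume "u \<in> U"
    then show "ip (f - fscale (if p = p' then c else 0) f) u = 0"
      using proj(2)[OF sU V[OF f]] unfolding c[OF f] by blast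
  qed
qed

lemma invariant_ck_component:
  assumes "p \<in> index_pairs (Suc n) s k"
  shows "invariant_subspace fscale (Pin_fix (Suc n)) (H_action (Suc n))
    (ck_component n s k p :: ((nat \<Rightarrow> real) \<Rightarrow> 'a::real_or_complex clifford) set)"
  unfolding invariant_subspace_def
  using subspace_ck_component H_action_ck_component[OF assms] by blast

text \<open>With \<open>U\<close> the whole component of \<open>p'\<close>, the projection of every
  \<open>f\<close> in another component is the scalar \<open>0\<close>; then \<open>f\<close> itself
  is orthogonal to \<open>U\<close>.\<close>

lemma ck_component_orthogonal:
  fixes ip :: "((nat \<Rightarrow> real) \<Rightarrow> 'a::real_or_complex clifford) \<Rightarrow> ((nat \<Rightarrow> real) \<Rightarrow> 'a clifford) \<Rightarrow> 'a"
  assumes ip: "invariant_inner_product fscale (Pin_fix (Suc n)) (H_action (Suc n)) (monogenics (Suc n) s k) ip"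
  shows "orthogonal_family ip (index_pairs (Suc n) s k) (ck_component n s k)"
  unfolding orthogonal_family_def
proof (intro ballI impI)
  fix p p' and f g :: "(nat \<Rightarrow> real) \<Rightarrow> 'a clifford"
  assume *: "p \<in> index_pairs (Suc n) s k" "p' \<in> index_pairs (Suc n) s k" "p \<noteq> p'"
    "f \<in> ck_component n s k p" "g \<in> ck_component n s k p'"
  from projection_scalar[OF ip *(1,2) invariant_ck_component[OF *(2)] order_refl] *(3-5)
  have "ip (f - fscale 0 f) g = 0" by auto
  then show "ip f g = 0" by simp
qed

text \<open>The projection to an invariant subspace \<open>U\<close> of the component acts on the
  component as a scalar \<open>c\<close>. If \<open>c = 0\<close>, then \<open>U\<close> is
  orthogonal to itself and vanishes; otherwise the component is contained in
  \<open>U\<close>.\<close>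

lemma ck_component_irreducible:
  assumes L2: "invariant_inner_product fscale (Pin_fix (Suc n)) (H_action (Suc n))
      (monogenics (Suc n) s k :: ((nat \<Rightarrow> real) \<Rightarrow> 'a::real_or_complex clifford) set) ip"
    and p: "p \<in> index_pairs (Suc n) s k"
  shows "irreducible_rep fscale (Pin_fix (Suc n)) (H_action (Suc n))
    (ck_component n s k p :: ((nat \<Rightarrow> real) \<Rightarrow> 'a clifford) set)"
  unfolding irreducible_rep_def
proof (intro conjI allI impI invariant_ck_component[OF p] ck_component_nonzero[OF p])
  let ?W = "ck_component n s k p :: ((nat \<Rightarrow> real) \<Rightarrow> 'a clifford) set"
  fix U :: "((nat \<Rightarrow> real) \<Rightarrow> 'a clifford) set"
  assume U: "U \<subseteq> ?W" "invariant_subspace fscale (Pin_fix (Suc n)) (H_action (Suc n)) U"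
  then have sU: "fun_space.subspace U" by (simp add: invariant_subspace_def)
  interpret hermitian_space fscale "monogenics (Suc n) s k :: ((nat \<Rightarrow> real) \<Rightarrow> 'a clifford) set" ip
    using L2 by (intro hermitian_space_monogenics) (simp add: invariant_inner_product_def)
  obtain c where c: "\<And>f. f \<in> ?W \<Longrightarrow> fscale c f \<in> U" "\<And>f u. f \<in> ?W \<Longrightarrow> u \<in> U \<Longrightarrow> ip (f - fscale c f) u = 0"
    using projection_scalar[OF L2 p p U(2,1)] by auto
  show "U = {0} \<or> U = ?W"
  proof (cases "c = 0")
    case True
    have "u = 0" if u: "u \<in> U" for u
    proof (rule ip_eq_zero)
      show "u \<in> monogenics (Suc n) s k" using u U(1) ck_component_monogenics[OF p] by blast
      show "ip u u = 0" using c(2)[of u u] u U(1) True by auto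
    qed
    then show ?thesis using fun_space.subspace_0[OF sU] by blast
  next
    case False
    have "f \<in> U" if "f \<in> ?W" for f
      using fun_space.subspace_scale[OF sU c(1)[OF that], of "inverse c"] False by simp
    then show ?thesis using U(1) by blast
  qed
qed

text \<open>By Schur's lemma an equivalence between different components would be the zero map,
  while its image is a nonzero space.\<close>

lemma ck_component_inequivalent:
  assumes p: "p \<in> index_pairs (Suc n) s k" and p': "p' \<in> index_pairs (Suc n) s k" and ne: "p \<noteq> p'"
  shows "\<not> equivalent_reps fscale (Pin_fix (Suc n)) (H_action (Suc n))
    (ck_component n s k p :: ((nat \<Rightarrow> real) \<Rightarrow> 'a::real_or_complex clifford) set) (ck_component n s k p')"
proof
  let ?W = "ck_component n s k p :: ((nat \<Rightarrow> real) \<Rightarrow> 'a clifford) set"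
  let ?W' = "ck_component n s k p' :: ((nat \<Rightarrow> real) \<Rightarrow> 'a clifford) set"
  assume "equivalent_reps fscale (Pin_fix (Suc n)) (H_action (Suc n)) ?W ?W'"
  then obtain \<phi> where \<phi>: "bij_betw \<phi> ?W ?W'" "\<And>u v. u \<in> ?W \<Longrightarrow> v \<in> ?W \<Longrightarrow> \<phi> (u + v) = \<phi> u + \<phi> v"
      "\<And>c u. u \<in> ?W \<Longrightarrow> \<phi> (fscale c u) = fscale c (\<phi> u)"
      "\<And>r u. r \<in> Pin_fix (Suc n) \<Longrightarrow> u \<in> ?W \<Longrightarrow> \<phi> (H_action (Suc n) r u) = H_action (Suc n) r (\<phi> u)"
    unfolding equivalent_reps_def by blast
  have "\<exists>c. \<forall>f\<in>?W. \<phi> f = fscale (if p = p' then c else 0) f"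
    by (rule ck_component_schur[OF p p' _ \<phi>(2,3)])
      (use \<phi>(1) in \<open>auto intro: \<phi>(4) unit_vec_Pin_fix dest: bij_betwE\<close>)
  then have zero: "\<phi> f = 0" if "f \<in> ?W" for f using ne that by auto
  have "?W' = \<phi> ` ?W" using \<phi>(1) by (simp add: bij_betw_def)
  then have "?W' \<subseteq> {0}" using zero by auto
  moreover have "0 \<in> ?W'" by (rule fun_space.subspace_0[OF subspace_ck_component])
  ultimately show False using ck_component_nonzero[OF p', where 'a='a] by blast
qed

end

lemma Pin_fix_L2_invariant:
  "invariant_inner_product fscale (Pin_fix m) (H_action m)
    (monogenics m s k :: ((nat \<Rightarrow> real) \<Rightarrow> 'a::real_or_complex clifford) set) (L2_inner m)"
  unfolding invariant_inner_product_def
  using L2_inner_product_on L2_inner_H_action by (auto simp: Pin_fix_def)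

theorem theorem3:
  fixes m s k :: nat
  assumes "m \<ge> 3" and "s \<le> m"
  shows "let
      I = (if s \<in> {0, m} \<and> k > 0 then {} else index_pairs m s k);
      V = (monogenics m s k :: ((nat \<Rightarrow> real) \<Rightarrow> 'a::real_or_complex clifford) set);
      W = (\<lambda>(t, j). embedding m s t k j ` monogenics (m - 1) t j)
    in multiplicity_free_decomposition fscale (Pin_fix m) (H_action m) V I W \<and>
       (\<forall>ip. invariant_inner_product fscale (Pin_fix m) (H_action m) V ip \<longrightarrow>
          orthogonal_family ip I W) \<and>
       invariant_inner_product fscale (Pin_fix m) (H_action m) V (L2_inner m) \<and>
       orthogonal_family (L2_inner m) I W"
proof -
  obtain n where m: "m = Suc n" and n: "1 \<le> n" using assms(1) by (cases m) auto
  define I where "I = (if s \<in> {0, m} \<and> k > 0 then {} else index_pairs m s k)"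
  define W where "W = (\<lambda>(t, j). embedding m s t k j `
    (monogenics (m - 1) t j :: ((nat \<Rightarrow> real) \<Rightarrow> 'a clifford) set))"
  let ?V = "monogenics m s k :: ((nat \<Rightarrow> real) \<Rightarrow> 'a clifford) set"
  let ?inv = "invariant_inner_product fscale (Pin_fix m) (H_action m) ?V"
  have "multiplicity_free_decomposition fscale (Pin_fix m) (H_action m) ?V I W \<and>
    (\<forall>ip. ?inv ip \<longrightarrow> orthogonal_family ip I W)"
  proof (cases "nontrivial (Suc n) s k")
    case True
    have I: "I = index_pairs (Suc n) s k" using True by (auto simp: I_def m nontrivial_def)
    have W: "W p = ck_component n s k p" if "p \<in> I" for p
    proof (cases p)
      case (Pair t j)
      have "t \<le> m - 1" "s = t \<or> s = Suc t"
        using that by (auto simp: I Pair index_pairs_iff nontrivial_def m)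
      then show ?thesis
        using embedding_eq_ck_embedding[OF assms(1), of t s k j, where 'a='a]
        by (simp add: W_def Pair ck_component_def m image_def)
    qed
    have orth: "orthogonal_family ip I W" if "?inv ip" for ip
      using ck_component_orthogonal[OF n True that[unfolded m]] W unfolding orthogonal_family_def I by simp
    have "Pi\<^sub>E I W = Pi\<^sub>E I (ck_component n s k)" using W by (rule PiE_cong)
    then have "internal_direct_sum ?V I W"
      using ck_component_direct_sum[OF n True, where 'a='a] unfolding internal_direct_sum_def I m by simp
    then show ?thesis
      using orth ck_component_irreducible[OF n True Pin_fix_L2_invariant, where 'a='a]
        ck_component_inequivalent[OF n True, where 'a='a] W
      unfolding multiplicity_free_decomposition_def I m by auto
  next
    case False
    then have I: "I = {}" using assms(2) by (auto simp: I_def m nontrivial_def)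
    \<comment> \<open>The exceptional case: the space is zero and has to be the direct sum of the
      empty family, whose only choice function has sum \<open>0\<close>.\<close>
    have "f = 0" if "f \<in> ?V" for f using monogenics_trivial[of f m s k] that False by (auto simp: m fun_eq_iff)
    then have "?V = {0}" using fun_space.subspace_0[OF subspace_monogenics] by blast
    then show ?thesis
      by (simp add: multiplicity_free_decomposition_def orthogonal_family_def internal_direct_sum_def I bij_betw_def)
  qed
  then show ?thesis
    using Pin_fix_L2_invariant[of m s k, where 'a='a] unfolding I_def W_def Let_def by blast
qed

end
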